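(* Let $p$ be an odd prime. Given any object $T$ in any cluster $\mathcal{L}$ of $\mathcal{C}_\pi^{\mathbb{Z}/p}$, there is, up to isomorphism, exactly one (other) object $T^\ast$ so that $(\mathcal{L}\setminus T)\cup T^\ast$ is a cluster. Furthermore, the object $T^\ast$ can be obtained from $T$ by forming distinguished triangles $$T\to A\to T^\ast\to T[1],\qquad T[-1]\to T^\ast\to B\to T$$ where $T\to A$ and $B\to T$ are left and right $\operatorname{add}(\mathcal{L}\setminus T)$-approximations of $T$.
   Context: **The category.** $p$ is an odd prime, $\theta=2\pi/p$. $R$ is a discrete valuation ring with uniformizer $u$ and residue field $K=R/(u)$ of characteristic $\neq p$, containing all $p$-th roots of unity. Let $\tilde{\mathcal{X}}_\pi=\{(x,y,\epsilon)\in\mathbb{R}\times\mathbb{R}\times\{+,-\}: |x-y|\le \pi\}$, with $(x,y,\epsilon)\le(x',y',\epsilon')$ iff $x\le x'$ and $y\le y'$, and automorphism $\sigma(x,y,\epsilon)=(y+\pi,x+\pi,-\epsilon)$. Let $\mathcal{X}_\pi$ be the set of $\sigma$-orbits, $M(x,y)$ the orbit of $(x,y,+)$ (the orbit of $(x,y,-)$ is $M(y+\pi,x+\pi)$), and $E(x,y)=M(x,y-\pi)$ for $x\le y\le x+2\pi$; $E(x,y)\cong E(y,x+2\pi)$. For $X,Y,Z\in\mathcal{X}_\pi$ with representatives $\tilde X,\tilde Y,\tilde Z$ put $c(X,Y,Z)=i+j-k$ where $i,j,k$ are the minimal integers with $\tilde X\le\sigma^i\tilde Y$, $\tilde Y\le\sigma^j\tilde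 Z$, $\tilde X\le\sigma^k\tilde Z$. Let $\mathcal{F}_\pi$ be the additive $R$-category of finite direct sums of elements of $\mathcal{X}_\pi$, where $\mathrm{Hom}(X,Y)=Rf_{XY}$ is free of rank one for $X,Y\in\mathcal{X}_\pi$ ($f_{XY}$ basic morphism), $f_{XX}=\mathrm{id}$, $f_{YZ}f_{XY}=u^{c(X,Y,Z)}f_{XZ}$. It has a unique exact structure making it a Frobenius category with indecomposable projective-injectives the $M(x,y)$ with $|x-y|=\pi$. The generator $\gamma$ of $G=\mathbb{Z}/p$ acts $R$-linearly by rotation: $\gamma M(x,y)=M(x+\theta,y+\theta)$, $\gamma f_{XY}=f_{\gamma X,\gamma Y}$. $\mathcal{F}_\pi^{\mathbb{Z}/p}$ has objects $(X,\xi)$ with isomorphisms $\xi_g:gX\to X$ ($g\in G$), $\xi_{gh}=\xi_g\circ g\xi_h$; morphisms $f:X\to Y$ with $f\xi^X_g=\xi^Y_g\,gf$; exact sequences those exact in $\mathcal{F}_\pi$. It is a Frobenius category and $\mathcal{C}_\pi^{\mathbb{Z}/p}$ is its stable category, triangulated with shift $[1]$. For $X\in\mathcal{X}_\pi$, $SX=(\bigoplus_{g\in G}gX,\xi)$ with $\xi_h$ permuting summands by identity maps $h(gX)\to(hg)X$. All indecomposables are isomorphic to objects $SX$, $X\in\mathcal{X}_\pi$; write $SE(x,y)=S(E(x,y))$. **Clusters.** An indecomposable object of $\mathcal{C}_\pi^{\mathbb{Z}/p}$ is rigid if its endomorphism ring is $K$; equivalently, it is isomorphic to $SE(x,y)$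 with $x<y<x+\theta$. It is almost rigid if it is a limit of a sequence of rigid objects; equivalently, it is isomorphic to $SE(x,y)$ with $x<y\le x+\theta$. Convergence $Y_n\to Y$ means convergence of endpoints: $Y_n\cong SE(x_n,y_n)$, $Y\cong SE(x,y)$ with $x_n\to x$, $y_n\to y$. Almost rigid objects $X,Y$ are compatible if there is a sequence $Y_n\to Y$ with $\mathcal{C}_\pi^{\mathbb{Z}/p}(X,Y_n)=0$ for all $n$. A cluster is a discrete maximal set of pairwise compatible (nonisomorphic) almost rigid objects, where discreteness refers to the topology on isomorphism classes of almost rigid objects given by $\{(x,y): x<y\le x+\theta\}$ modulo $(x,y)\sim(x+\theta,y+\theta)$. *)

theory Defs
  imports
    "HOL-Analysis.Abstract_Topology"
    "HOL-Analysis.Product_Vector"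
    "HOL-Algebra.Elementary_Groups"
    "HOL-Algebra.Ring_Divisibility"
    "HOL-Algebra.QuotRing"
    "Jordan_Normal_Form.Matrix"
    "Jordan_Normal_Form.VS_Connect"
begin

section \<open>Preadditive categories\<close>

text \<open>
  Composition takes the three objects involved: a morphism does not record its source and target,
  so \<open>Cmp C X Y Z g f\<close> is the composite of \<open>f \<in> Hom C X Y\<close> and \<open>g \<in> Hom C Y Z\<close>.
\<close>

record ('o, 'm) precat =
  Obj :: "'o set"
  Hom :: "'o \<Rightarrow> 'o \<Rightarrow> 'm set"
  Cmp :: "'o \<Rightarrow> 'o \<Rightarrow> 'o \<Rightarrow> 'm \<Rightarrow> 'm \<Rightarrow> 'm"
  Idn :: "'o \<Rightarrow> 'm"
  Zer :: "'o \<Rightarrow> 'o \<Rightarrow> 'm"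
  Pls :: "'o \<Rightarrow> 'o \<Rightarrow> 'm \<Rightarrow> 'm \<Rightarrow> 'm"

definition iso_mor :: "('o, 'm) precat \<Rightarrow> 'o \<Rightarrow> 'o \<Rightarrow> 'm \<Rightarrow> bool" where
  "iso_mor C X Y f \<longleftrightarrow> f \<in> Hom C X Y \<and>
     (\<exists>g \<in> Hom C Y X. Cmp C X Y X g f = Idn C X \<and> Cmp C Y X Y f g = Idn C Y)"

definition iso_obj :: "('o, 'm) precat \<Rightarrow> 'o \<Rightarrow> 'o \<Rightarrow> bool" where
  "iso_obj C X Y \<longleftrightarrow> X \<in> Obj C \<and> Y \<in> Obj C \<and> (\<exists>f. iso_mor C X Y f)"

definition zero_obj :: "('o, 'm) precat \<Rightarrow> 'o \<Rightarrow> bool" where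
  "zero_obj C X \<longleftrightarrow> X \<in> Obj C \<and> Idn C X = Zer C X X"

definition biproduct :: "('o, 'm) precat \<Rightarrow> 'o \<Rightarrow> 'o \<Rightarrow> 'o \<Rightarrow> bool" where
  "biproduct C A B S \<longleftrightarrow> A \<in> Obj C \<and> B \<in> Obj C \<and> S \<in> Obj C \<and>
     (\<exists>i \<in> Hom C A S. \<exists>j \<in> Hom C B S. \<exists>q \<in> Hom C S A. \<exists>r \<in> Hom C S B.
        Cmp C A S A q i = Idn C A \<and> Cmp C B S B r j = Idn C B \<and>
        Cmp C B S A q j = Zer C B A \<and> Cmp C A S B r i = Zer C A B \<and>
        Pls C S S (Cmp C S A S i q) (Cmp C S B S j r) = Idn C S)"

definition indecomposable :: "('o, 'm) precat \<Rightarrow> 'o \<Rightarrow> bool" where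
  "indecomposable C X \<longleftrightarrow> X \<in> Obj C \<and> \<not> zero_obj C X \<and>
     (\<forall>A B. biproduct C A B X \<longrightarrow> zero_obj C A \<or> zero_obj C B)"

definition end_ring :: "('o, 'm) precat \<Rightarrow> 'o \<Rightarrow> 'm ring" where
  "end_ring C X = \<lparr>carrier = Hom C X X, monoid.mult = Cmp C X X X, one = Idn C X,
                    zero = Zer C X X, add = Pls C X X\<rparr>"

text \<open>
  Objects of \<open>add U\<close>: direct summands of finite direct sums of objects of \<open>U\<close>. The set is closed
  under isomorphism, as \<open>A \<cong> B\<close> makes \<open>B\<close> a biproduct of \<open>A\<close> and a zero object.
\<close>

inductive_set add_closure :: "('o, 'm) precat \<Rightarrow> 'o set \<Rightarrow> 'o set"
  for C :: "('o, 'm) precat" and U :: "'o set" where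
  zero: "zero_obj C X \<Longrightarrow> X \<in> add_closure C U"
| base: "X \<in> U \<Longrightarrow> X \<in> Obj C \<Longrightarrow> X \<in> add_closure C U"
| sum: "A \<in> add_closure C U \<Longrightarrow> B \<in> add_closure C U \<Longrightarrow> biproduct C A B X \<Longrightarrow> X \<in> add_closure C U"
| summand: "X \<in> add_closure C U \<Longrightarrow> biproduct C A B X \<Longrightarrow> A \<in> add_closure C U"

definition left_approximation :: "('o, 'm) precat \<Rightarrow> 'o set \<Rightarrow> 'o \<Rightarrow> 'o \<Rightarrow> 'm \<Rightarrow> bool" where
  "left_approximation C U T A f \<longleftrightarrow> A \<in> add_closure C U \<and> f \<in> Hom C T A \<and>
     (\<forall>A' \<in> add_closure C U. \<forall>f' \<in> Hom C T A'. \<exists>g \<in> Hom C A A'. Cmp C T A A' g f = f')"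

definition right_approximation :: "('o, 'm) precat \<Rightarrow> 'o set \<Rightarrow> 'o \<Rightarrow> 'o \<Rightarrow> 'm \<Rightarrow> bool" where
  "right_approximation C U T B f \<longleftrightarrow> B \<in> add_closure C U \<and> f \<in> Hom C B T \<and>
     (\<forall>B' \<in> add_closure C U. \<forall>f' \<in> Hom C B' T. \<exists>g \<in> Hom C B' B. Cmp C B' B T f g = f')"


section \<open>Exact and Frobenius categories\<close>

definition is_kernel :: "('o, 'm) precat \<Rightarrow> 'o \<Rightarrow> 'o \<Rightarrow> 'o \<Rightarrow> 'm \<Rightarrow> 'm \<Rightarrow> bool" where
  "is_kernel C X Y Z i d \<longleftrightarrow> i \<in> Hom C X Y \<and> d \<in> Hom C Y Z \<and> Cmp C X Y Z d i = Zer C X Z \<and>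
     (\<forall>W \<in> Obj C. \<forall>a \<in> Hom C W Y. Cmp C W Y Z d a = Zer C W Z \<longrightarrow>
        (\<exists>!b. b \<in> Hom C W X \<and> Cmp C W X Y i b = a))"

definition is_cokernel :: "('o, 'm) precat \<Rightarrow> 'o \<Rightarrow> 'o \<Rightarrow> 'o \<Rightarrow> 'm \<Rightarrow> 'm \<Rightarrow> bool" where
  "is_cokernel C X Y Z i d \<longleftrightarrow> i \<in> Hom C X Y \<and> d \<in> Hom C Y Z \<and> Cmp C X Y Z d i = Zer C X Z \<and>
     (\<forall>W \<in> Obj C. \<forall>a \<in> Hom C Y W. Cmp C X Y W a i = Zer C X W \<longrightarrow>
        (\<exists>!b. b \<in> Hom C Z W \<and> Cmp C Y Z W b d = a))"

text \<open>The square \<open>j i = g f\<close> with \<open>i : X \<rightarrow> A\<close>, \<open>f : X \<rightarrow> B\<close>, \<open>j : A \<rightarrow> S\<close>, \<open>g : B \<rightarrow> S\<close>.\<close>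

definition is_pushout ::
  "('o, 'm) precat \<Rightarrow> 'o \<Rightarrow> 'o \<Rightarrow> 'o \<Rightarrow> 'o \<Rightarrow> 'm \<Rightarrow> 'm \<Rightarrow> 'm \<Rightarrow> 'm \<Rightarrow> bool" where
  "is_pushout C X A B S i f j g \<longleftrightarrow>
     X \<in> Obj C \<and> A \<in> Obj C \<and> B \<in> Obj C \<and> S \<in> Obj C \<and>
     i \<in> Hom C X A \<and> f \<in> Hom C X B \<and> j \<in> Hom C A S \<and> g \<in> Hom C B S \<and>
     Cmp C X A S j i = Cmp C X B S g f \<and>
     (\<forall>W \<in> Obj C. \<forall>a \<in> Hom C A W. \<forall>b \<in> Hom C B W. Cmp C X A W a i = Cmp C X B W b f \<longrightarrow>
        (\<exists>!w. w \<in> Hom C S W \<and> Cmp C A S W w j = a \<and> Cmp C B S W w g = b))"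

text \<open>The square \<open>d j = f g\<close> with \<open>d : A \<rightarrow> X\<close>, \<open>f : B \<rightarrow> X\<close>, \<open>j : S \<rightarrow> A\<close>, \<open>g : S \<rightarrow> B\<close>.\<close>

definition is_pullback ::
  "('o, 'm) precat \<Rightarrow> 'o \<Rightarrow> 'o \<Rightarrow> 'o \<Rightarrow> 'o \<Rightarrow> 'm \<Rightarrow> 'm \<Rightarrow> 'm \<Rightarrow> 'm \<Rightarrow> bool" where
  "is_pullback C X A B S d f j g \<longleftrightarrow>
     X \<in> Obj C \<and> A \<in> Obj C \<and> B \<in> Obj C \<and> S \<in> Obj C \<and>
     d \<in> Hom C A X \<and> f \<in> Hom C B X \<and> j \<in> Hom C S A \<and> g \<in> Hom C S B \<and>
     Cmp C S A X d j = Cmp C S B X f g \<and>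
     (\<forall>W \<in> Obj C. \<forall>a \<in> Hom C W A. \<forall>b \<in> Hom C W B. Cmp C W A X d a = Cmp C W B X f b \<longrightarrow>
        (\<exists>!w. w \<in> Hom C W S \<and> Cmp C W S A j w = a \<and> Cmp C W S B g w = b))"

text \<open>\<open>(X, Y, Z, i, d)\<close> stands for the sequence \<open>X \<rightarrow> Y \<rightarrow> Z\<close> with maps \<open>i\<close> and \<open>d\<close>.\<close>

type_synonym ('o, 'm) conflation = "'o \<times> 'o \<times> 'o \<times> 'm \<times> 'm"

definition inflation :: "('o, 'm) conflation set \<Rightarrow> 'o \<Rightarrow> 'o \<Rightarrow> 'm \<Rightarrow> bool" where
  "inflation E X Y i \<longleftrightarrow> (\<exists>Z d. (X, Y, Z, i, d) \<in> E)"

definition deflation :: "('o, 'm) conflation set \<Rightarrow> 'o \<Rightarrow> 'o \<Rightarrow> 'm \<Rightarrow> bool" where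
  "deflation E Y Z d \<longleftrightarrow> (\<exists>X i. (X, Y, Z, i, d) \<in> E)"

text \<open>Quillen's axioms for the class \<open>E\<close> of exact sequences (conflations).\<close>

definition exact_structure :: "('o, 'm) precat \<Rightarrow> ('o, 'm) conflation set \<Rightarrow> bool" where
  "exact_structure C E \<longleftrightarrow>
     (\<forall>X Y Z i d. (X, Y, Z, i, d) \<in> E \<longrightarrow> X \<in> Obj C \<and> Y \<in> Obj C \<and> Z \<in> Obj C \<and>
        is_kernel C X Y Z i d \<and> is_cokernel C X Y Z i d) \<and>
     (\<forall>X Y Z i d X' Y' Z' i' d' a b c.
        (X, Y, Z, i, d) \<in> E \<and> X' \<in> Obj C \<and> Y' \<in> Obj C \<and> Z' \<in> Obj C \<and>
        i' \<in> Hom C X' Y' \<and> d' \<in> Hom C Y' Z' \<and>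
        iso_mor C X X' a \<and> iso_mor C Y Y' b \<and> iso_mor C Z Z' c \<and>
        Cmp C X Y Y' b i = Cmp C X X' Y' i' a \<and> Cmp C Y Z Z' c d = Cmp C Y Y' Z' d' b
        \<longrightarrow> (X', Y', Z', i', d') \<in> E) \<and>
     (\<forall>X \<in> Obj C. inflation E X X (Idn C X) \<and> deflation E X X (Idn C X)) \<and>
     (\<forall>X Y Z i j. inflation E X Y i \<and> inflation E Y Z j \<longrightarrow> inflation E X Z (Cmp C X Y Z j i)) \<and>
     (\<forall>X Y Z d e. deflation E X Y d \<and> deflation E Y Z e \<longrightarrow> deflation E X Z (Cmp C X Y Z e d)) \<and>
     (\<forall>X A i. inflation E X A i \<longrightarrow> (\<forall>B \<in> Obj C. \<forall>f \<in> Hom C X B.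
        \<exists>S j g. is_pushout C X A B S i f j g \<and> inflation E B S g)) \<and>
     (\<forall>A X d. deflation E A X d \<longrightarrow> (\<forall>B \<in> Obj C. \<forall>f \<in> Hom C B X.
        \<exists>S j g. is_pullback C X A B S d f j g \<and> deflation E S B g))"

definition injective_obj :: "('o, 'm) precat \<Rightarrow> ('o, 'm) conflation set \<Rightarrow> 'o \<Rightarrow> bool" where
  "injective_obj C E I \<longleftrightarrow> I \<in> Obj C \<and>
     (\<forall>X Y i. inflation E X Y i \<longrightarrow> (\<forall>f \<in> Hom C X I. \<exists>g \<in> Hom C Y I. Cmp C X Y I g i = f))"

definition projective_obj :: "('o, 'm) precat \<Rightarrow> ('o, 'm) conflation set \<Rightarrow> 'o \<Rightarrow> bool" where
  "projective_obj C E P \<longleftrightarrow> P \<in> Obj C \<and>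
     (\<forall>Y Z d. deflation E Y Z d \<longrightarrow> (\<forall>f \<in> Hom C P Z. \<exists>g \<in> Hom C P Y. Cmp C P Y Z d g = f))"

definition frobenius_category :: "('o, 'm) precat \<Rightarrow> ('o, 'm) conflation set \<Rightarrow> bool" where
  "frobenius_category C E \<longleftrightarrow> exact_structure C E \<and>
     (\<forall>X \<in> Obj C. \<exists>I W i d. injective_obj C E I \<and> (X, I, W, i, d) \<in> E) \<and>
     (\<forall>X \<in> Obj C. \<exists>V P i d. projective_obj C E P \<and> (V, P, X, i, d) \<in> E) \<and>
     (\<forall>X. projective_obj C E X \<longleftrightarrow> injective_obj C E X)"


section \<open>The stable category and its triangles\<close>

definition stably_null :: "('o, 'm) precat \<Rightarrow> ('o, 'm) conflation set \<Rightarrow> 'o \<Rightarrow> 'o \<Rightarrow> 'm set" where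
  "stably_null C E X Y = {Cmp C X P Y b a | P a b.
     projective_obj C E P \<and> injective_obj C E P \<and> a \<in> Hom C X P \<and> b \<in> Hom C P Y}"

text \<open>The residue class of \<open>f\<close> modulo the morphisms factoring through a projective-injective.\<close>

definition stable_class ::
  "('o, 'm) precat \<Rightarrow> ('o, 'm) conflation set \<Rightarrow> 'o \<Rightarrow> 'o \<Rightarrow> 'm \<Rightarrow> 'm set" where
  "stable_class C E X Y f = {Pls C X Y f h | h. h \<in> stably_null C E X Y}"

definition stable_category ::
  "('o, 'm) precat \<Rightarrow> ('o, 'm) conflation set \<Rightarrow> ('o, 'm set) precat" where
  "stable_category C E =
     \<lparr>Obj = Obj C,
      Hom = (\<lambda>X Y. stable_class C E X Y ` Hom C X Y),
      Cmp = (\<lambda>X Y Z G F. \<Union>g\<in>G. \<Union>f\<in>F. stable_class C E X Z (Cmp C X Y Z g f)),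
      Idn = (\<lambda>X. stable_class C E X X (Idn C X)),
      Zer = (\<lambda>X Y. stable_class C E X Y (Zer C X Y)),
      Pls = (\<lambda>X Y F G. \<Union>f\<in>F. \<Union>g\<in>G. stable_class C E X Y (Pls C X Y f g))\<rparr>"

text \<open>
  The shift is computed by a chosen conflation \<open>X \<rightarrow> I \<rightarrow> X[1]\<close> with \<open>I\<close> injective, returned as
  \<open>(I, X[1], i, d)\<close>. The inverse shift is computed by a chosen conflation \<open>X[-1] \<rightarrow> P \<rightarrow> X\<close> with
  \<open>P\<close> projective, returned as \<open>(X[-1], P, i, d)\<close>.
\<close>

definition shift_seq ::
  "('o, 'm) precat \<Rightarrow> ('o, 'm) conflation set \<Rightarrow> 'o \<Rightarrow> 'o \<times> 'o \<times> 'm \<times> 'm" where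
  "shift_seq C E X = (SOME (I, W, i, d). injective_obj C E I \<and> (X, I, W, i, d) \<in> E)"

definition unshift_seq ::
  "('o, 'm) precat \<Rightarrow> ('o, 'm) conflation set \<Rightarrow> 'o \<Rightarrow> 'o \<times> 'o \<times> 'm \<times> 'm" where
  "unshift_seq C E X = (SOME (V, P, i, d). projective_obj C E P \<and> (V, P, X, i, d) \<in> E)"

text \<open>
  Happel's standard triangle \<open>X \<rightarrow> Y \<rightarrow> Z \<rightarrow> W\<close> on \<open>f : X \<rightarrow> Y\<close>, where \<open>X \<rightarrow> I \<rightarrow> W\<close> is a
  conflation with \<open>I\<close> injective, exhibiting \<open>W\<close> as \<open>X[1]\<close>: \<open>Z\<close> is the pushout of \<open>f\<close> and
  \<open>i : X \<rightarrow> I\<close>, and \<open>h : Z \<rightarrow> W\<close> is induced by \<open>0 : Y \<rightarrow> W\<close> and \<open>d : I \<rightarrow> W\<close>.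
\<close>

definition standard_triangle ::
  "('o, 'm) precat \<Rightarrow> ('o, 'm) conflation set \<Rightarrow>
   'o \<Rightarrow> 'o \<Rightarrow> 'o \<Rightarrow> 'o \<times> 'o \<times> 'm \<times> 'm \<Rightarrow> 'm \<Rightarrow> 'm \<Rightarrow> 'm \<Rightarrow> bool" where
  "standard_triangle C E X Y Z s f g h \<longleftrightarrow> (case s of (I, W, i, d) \<Rightarrow>
     injective_obj C E I \<and> (X, I, W, i, d) \<in> E \<and>
     (\<exists>j. is_pushout C X I Y Z i f j g \<and>
          h \<in> Hom C Z W \<and> Cmp C Y Z W h g = Zer C Y W \<and> Cmp C I Z W h j = d))"

text \<open>
  Stable morphisms \<open>F : X \<rightarrow> Y\<close>, \<open>G : Y \<rightarrow> Z\<close>, \<open>H : Z \<rightarrow> W\<close> form a distinguished triangle, \<open>W\<close>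
  being \<open>X[1]\<close> by means of \<open>s = (I, W, i, d)\<close>, if they are isomorphic in the stable category to a
  standard triangle. Here \<open>e : W \<rightarrow> W'\<close> is \<open>a[1]\<close>: it completes \<open>a : X \<rightarrow> X'\<close> and some
  \<open>m : I \<rightarrow> I'\<close> to a morphism of conflations. For the triangles \<open>X \<rightarrow> Y \<rightarrow> Z \<rightarrow> X[1]\<close> one takes
  \<open>s = shift_seq C E X\<close>. For the triangles \<open>X[-1] \<rightarrow> Y \<rightarrow> Z \<rightarrow> X\<close> one takes
  the chosen conflation \<open>X[-1] \<rightarrow> P \<rightarrow> X\<close>, which identifies \<open>X[-1][1]\<close> with \<open>X\<close>.
\<close>

definition distinguished ::
  "('o, 'm) precat \<Rightarrow> ('o, 'm) conflation set \<Rightarrow>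
   'o \<Rightarrow> 'o \<Rightarrow> 'o \<Rightarrow> 'o \<times> 'o \<times> 'm \<times> 'm \<Rightarrow> 'm set \<Rightarrow> 'm set \<Rightarrow> 'm set \<Rightarrow> bool" where
  "distinguished C E X Y Z s F G H \<longleftrightarrow> (case s of (I, W, i, d) \<Rightarrow>
     (let D = stable_category C E; cl = stable_class C E in
      injective_obj C E I \<and> (X, I, W, i, d) \<in> E \<and>
      F \<in> Hom D X Y \<and> G \<in> Hom D Y Z \<and> H \<in> Hom D Z W \<and>
      (\<exists>X' Y' Z' I' W' i' d' f g h a m e B K.
         standard_triangle C E X' Y' Z' (I', W', i', d') f g h \<and>
         a \<in> Hom C X X' \<and> m \<in> Hom C I I' \<and> e \<in> Hom C W W' \<and>
         Cmp C X I I' m i = Cmp C X X' I' i' a \<and> Cmp C I W W' e d = Cmp C I I' W' d' m \<and>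
         iso_mor D X X' (cl X X' a) \<and> iso_mor D Y Y' B \<and> iso_mor D Z Z' K \<and>
         Cmp D X Y Y' B F = Cmp D X X' Y' (cl X' Y' f) (cl X X' a) \<and>
         Cmp D Y Z Z' K G = Cmp D Y Y' Z' (cl Y' Z' g) B \<and>
         Cmp D Z W W' (cl W W' e) H = Cmp D Z Z' W' (cl Z' W' h) K)))"


section \<open>The ground ring\<close>

definition discrete_valuation_ring :: "('r, 'b) ring_scheme \<Rightarrow> bool" where
  "discrete_valuation_ring R \<longleftrightarrow>
     principal_domain R \<and> \<not> field R \<and> (\<exists>!m. maximalideal m R)"

definition uniformizer :: "('r, 'b) ring_scheme \<Rightarrow> 'r \<Rightarrow> bool" where
  "uniformizer R u \<longleftrightarrow> u \<in> carrier R \<and> maximalideal (PIdl\<^bsub>R\<^esub> u) R"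

definition residue_field :: "'r::idom \<Rightarrow> 'r set ring" where
  "residue_field u = class_ring Quot (PIdl\<^bsub>class_ring\<^esub> u)"


section \<open>The category \<open>F\<^sub>\<pi>\<close>\<close>

text \<open>The sign \<open>\<epsilon>\<close> is \<open>True\<close> for \<open>+\<close> and \<open>False\<close> for \<open>-\<close>.\<close>

type_synonym pt = "real \<times> real \<times> bool"

definition Xpi_cover :: "pt set" where
  "Xpi_cover = {(x, y, e). \<bar>x - y\<bar> \<le> pi}"

definition pt_le :: "pt \<Rightarrow> pt \<Rightarrow> bool" where
  "pt_le s t \<longleftrightarrow> (case (s, t) of ((x, y, e), (x', y', e')) \<Rightarrow> x \<le> x' \<and> y \<le> y')"

definition sigma :: "pt \<Rightarrow> pt" where
  "sigma t = (case t of (x, y, e) \<Rightarrow> (y + pi, x + pi, \<not> e))"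

definition sigma_pow :: "int \<Rightarrow> pt \<Rightarrow> pt" where
  "sigma_pow k = (if k \<ge> 0 then sigma ^^ nat k else inv_into UNIV sigma ^^ nat (- k))"

definition orbit_of :: "pt \<Rightarrow> pt set" where
  "orbit_of t = range (\<lambda>k. sigma_pow k t)"

definition Xpi :: "pt set set" where
  "Xpi = orbit_of ` Xpi_cover"

definition M_obj :: "real \<Rightarrow> real \<Rightarrow> pt set" where
  "M_obj x y = orbit_of (x, y, True)"

definition E_obj :: "real \<Rightarrow> real \<Rightarrow> pt set" where
  "E_obj x y = M_obj x (y - pi)"

definition min_shift :: "pt \<Rightarrow> pt \<Rightarrow> int" where
  "min_shift s t = (LEAST i. pt_le s (sigma_pow i t))"

definition rep :: "pt set \<Rightarrow> pt" where
  "rep X = (SOME t. t \<in> X)"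

definition c_exp :: "pt set \<Rightarrow> pt set \<Rightarrow> pt set \<Rightarrow> int" where
  "c_exp X Y Z = min_shift (rep X) (rep Y) + min_shift (rep Y) (rep Z) - min_shift (rep X) (rep Z)"

text \<open>
  The list \<open>[X\<^sub>0, \<dots>, X\<^sub>m]\<close> is the formal direct sum of the \<open>X\<^sub>i \<in> Xpi\<close>. A morphism is the matrix
  of its coefficients: entry \<open>(j, i)\<close> is the coefficient of the basic morphism from the \<open>i\<close>-th
  summand of the source to the \<open>j\<close>-th summand of the target. The exponent \<open>c_exp\<close> is never negative
  on \<open>Xpi\<close>, so \<open>nat\<close> does not truncate.
\<close>

definition F_pi :: "'r::idom \<Rightarrow> (pt set list, 'r mat) precat" where
  "F_pi u =
     \<lparr>Obj = {Xs. set Xs \<subseteq> Xpi},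
      Hom = (\<lambda>Xs Ys. carrier_mat (length Ys) (length Xs)),
      Cmp = (\<lambda>Xs Ys Zs g f. mat (length Zs) (length Xs) (\<lambda>(k, i).
               \<Sum>j<length Ys. g $$ (k, j) * f $$ (j, i) * u ^ nat (c_exp (Xs ! i) (Ys ! j) (Zs ! k)))),
      Idn = (\<lambda>Xs. 1\<^sub>m (length Xs)),
      Zer = (\<lambda>Xs Ys. 0\<^sub>m (length Ys) (length Xs)),
      Pls = (\<lambda>Xs Ys f g. f + g)\<rparr>"

text \<open>
  The exact structure on \<open>F_pi u\<close>: it is determined uniquely by being Frobenius with the
  indecomposable projective-injectives \<open>M_obj x y\<close>, \<open>\<bar>x - y\<bar> = pi\<close>.
\<close>

definition F_pi_exact_structure :: "'r::idom \<Rightarrow> (pt set list, 'r mat) conflation set \<Rightarrow> bool" where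
  "F_pi_exact_structure u E \<longleftrightarrow> frobenius_category (F_pi u) E \<and>
     (\<forall>X. indecomposable (F_pi u) X \<longrightarrow>
        (projective_obj (F_pi u) E X \<and> injective_obj (F_pi u) E X \<longleftrightarrow>
         (\<exists>x y. \<bar>x - y\<bar> = pi \<and> iso_obj (F_pi u) X [M_obj x y])))"


section \<open>The equivariant category\<close>

definition theta :: "nat \<Rightarrow> real" where
  "theta p = 2 * pi / real p"

text \<open>
  The action of \<open>\<gamma>\<^sup>g\<close> on objects. As \<open>\<gamma>\<close> sends basic morphisms to basic morphisms, it does not
  change the coefficient matrix of a morphism: \<open>g f \<in> Hom (gX) (gY)\<close> is the same matrix as
  \<open>f \<in> Hom X Y\<close>.
\<close>

definition rot :: "nat \<Rightarrow> int \<Rightarrow> pt set \<Rightarrow> pt set" where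
  "rot p g X = (\<lambda>(x, y, e). (x + of_int g * theta p, y + of_int g * theta p, e)) ` X"

type_synonym 'r eqobj = "pt set list \<times> (int \<Rightarrow> 'r mat)"

definition F_pi_eq :: "nat \<Rightarrow> 'r::idom \<Rightarrow> ('r eqobj, 'r mat) precat" where
  "F_pi_eq p u = (let C = F_pi u; G = integer_mod_group p; act = (\<lambda>g. map (rot p g)) in
     \<lparr>Obj = {(X, \<xi>). X \<in> Obj C \<and> \<xi> \<in> extensional (carrier G) \<and>
              (\<forall>g \<in> carrier G. iso_mor C (act g X) X (\<xi> g)) \<and>
              (\<forall>g \<in> carrier G. \<forall>h \<in> carrier G.
                 \<xi> (g \<otimes>\<^bsub>G\<^esub> h) = Cmp C (act g (act h X)) (act g X) X (\<xi> g) (\<xi> h))},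
      Hom = (\<lambda>(X, \<xi>) (Y, \<eta>). {f \<in> Hom C X Y. \<forall>g \<in> carrier G.
               Cmp C (act g X) X Y f (\<xi> g) = Cmp C (act g X) (act g Y) Y (\<eta> g) f}),
      Cmp = (\<lambda>X Y Z. Cmp C (fst X) (fst Y) (fst Z)),
      Idn = (\<lambda>X. Idn C (fst X)),
      Zer = (\<lambda>X Y. Zer C (fst X) (fst Y)),
      Pls = (\<lambda>X Y. Pls C (fst X) (fst Y))\<rparr>)"

definition eq_exact ::
  "nat \<Rightarrow> 'r::idom \<Rightarrow> (pt set list, 'r mat) conflation set \<Rightarrow> ('r eqobj, 'r mat) conflation set" where
  "eq_exact p u E = {(X, Y, Z, i, d).
     X \<in> Obj (F_pi_eq p u) \<and> Y \<in> Obj (F_pi_eq p u) \<and> Z \<in> Obj (F_pi_eq p u) \<and>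
     i \<in> Hom (F_pi_eq p u) X Y \<and> d \<in> Hom (F_pi_eq p u) Y Z \<and>
     (fst X, fst Y, fst Z, i, d) \<in> E}"

definition C_pi_eq ::
  "nat \<Rightarrow> 'r::idom \<Rightarrow> (pt set list, 'r mat) conflation set \<Rightarrow> ('r eqobj, 'r mat set) precat" where
  "C_pi_eq p u E = stable_category (F_pi_eq p u) (eq_exact p u E)"

text \<open>
  \<open>SX\<close> is the direct sum of the \<open>gX\<close>, \<open>g = 0, \<dots>, p - 1\<close>; \<open>\<xi>\<^sub>h\<close> maps the summand \<open>h(gX)\<close>
  identically onto the summand \<open>(hg)X\<close>, whose index is \<open>(h + g) mod p\<close>.
\<close>

definition S_obj :: "nat \<Rightarrow> pt set \<Rightarrow> 'r::idom eqobj" where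
  "S_obj p X = (map (\<lambda>g. rot p (int g) X) [0..<p],
     \<lambda>h \<in> carrier (integer_mod_group p).
       mat p p (\<lambda>(k, g). if int k = h \<otimes>\<^bsub>integer_mod_group p\<^esub> int g then 1 else 0))"

definition SE :: "nat \<Rightarrow> real \<Rightarrow> real \<Rightarrow> 'r::idom eqobj" where
  "SE p x y = S_obj p (E_obj x y)"


section \<open>Clusters\<close>

definition rigid ::
  "nat \<Rightarrow> 'r::idom \<Rightarrow> (pt set list, 'r mat) conflation set \<Rightarrow> 'r eqobj \<Rightarrow> bool" where
  "rigid p u E X \<longleftrightarrow> indecomposable (C_pi_eq p u E) X \<and>
     is_ring_iso (end_ring (C_pi_eq p u E) X) (residue_field u)"

definition converges_to ::
  "nat \<Rightarrow> 'r::idom \<Rightarrow> (pt set list, 'r mat) conflation set \<Rightarrow> (nat \<Rightarrow> 'r eqobj) \<Rightarrow> 'r eqobj \<Rightarrow> bool" where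
  "converges_to p u E Ys Y \<longleftrightarrow> (\<exists>xs ys x y.
     (\<forall>n. xs n \<le> ys n \<and> ys n \<le> xs n + 2 * pi \<and> iso_obj (C_pi_eq p u E) (Ys n) (SE p (xs n) (ys n))) \<and>
     x \<le> y \<and> y \<le> x + 2 * pi \<and> iso_obj (C_pi_eq p u E) Y (SE p x y) \<and>
     xs \<longlonglongrightarrow> x \<and> ys \<longlonglongrightarrow> y)"

definition almost_rigid ::
  "nat \<Rightarrow> 'r::idom \<Rightarrow> (pt set list, 'r mat) conflation set \<Rightarrow> 'r eqobj \<Rightarrow> bool" where
  "almost_rigid p u E Y \<longleftrightarrow> indecomposable (C_pi_eq p u E) Y \<and>
     (\<exists>Ys. (\<forall>n. rigid p u E (Ys n)) \<and> converges_to p u E Ys Y)"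

definition compatible ::
  "nat \<Rightarrow> 'r::idom \<Rightarrow> (pt set list, 'r mat) conflation set \<Rightarrow> 'r eqobj \<Rightarrow> 'r eqobj \<Rightarrow> bool" where
  "compatible p u E X Y \<longleftrightarrow> (\<exists>Ys. converges_to p u E Ys Y \<and>
     (\<forall>n. Hom (C_pi_eq p u E) X (Ys n) = {Zer (C_pi_eq p u E) X (Ys n)}))"

definition compatible_set ::
  "nat \<Rightarrow> 'r::idom \<Rightarrow> (pt set list, 'r mat) conflation set \<Rightarrow> 'r eqobj set \<Rightarrow> bool" where
  "compatible_set p u E L \<longleftrightarrow> (\<forall>X \<in> L. almost_rigid p u E X) \<and>
     pairwise (\<lambda>X Y. \<not> iso_obj (C_pi_eq p u E) X Y \<and> compatible p u E X Y) L"

definition iso_class ::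
  "nat \<Rightarrow> 'r::idom \<Rightarrow> (pt set list, 'r mat) conflation set \<Rightarrow> 'r eqobj \<Rightarrow> 'r eqobj set" where
  "iso_class p u E X = {Y. iso_obj (C_pi_eq p u E) X Y}"

text \<open>
  The quotient topology along the surjection \<open>(x, y) \<mapsto> [SE(x, y)]\<close> from the strip
  \<open>x < y \<le> x + \<theta>\<close>, whose fibres are the orbits of the translation by \<open>(\<theta>, \<theta>)\<close>.
\<close>

definition almost_rigid_topology ::
  "nat \<Rightarrow> 'r::idom \<Rightarrow> (pt set list, 'r mat) conflation set \<Rightarrow> 'r eqobj set topology" where
  "almost_rigid_topology p u E =
     (let strip = {(x, y). x < y \<and> y \<le> x + theta p} in
      topology (\<lambda>U. U \<subseteq> iso_class p u E ` {X. almost_rigid p u E X} \<and>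
        openin (top_of_set strip) {(x, y) \<in> strip. iso_class p u E (SE p x y) \<in> U}))"

definition cluster ::
  "nat \<Rightarrow> 'r::idom \<Rightarrow> (pt set list, 'r mat) conflation set \<Rightarrow> 'r eqobj set \<Rightarrow> bool" where
  "cluster p u E L \<longleftrightarrow> compatible_set p u E L \<and>
     (\<forall>L'. compatible_set p u E L' \<and> L \<subseteq> L' \<longrightarrow> L' = L) \<and>
     subtopology (almost_rigid_topology p u E) (iso_class p u E ` L) =
       discrete_topology (iso_class p u E ` L)"

definition exchanges ::
  "nat \<Rightarrow> 'r::idom \<Rightarrow> (pt set list, 'r mat) conflation set \<Rightarrow>
   'r eqobj set \<Rightarrow> 'r eqobj \<Rightarrow> 'r eqobj \<Rightarrow> bool" where
  "exchanges p u E L T T' \<longleftrightarrow> \<not> iso_obj (C_pi_eq p u E) T' T \<and> cluster p u E ((L - {T}) \<union> {T'})"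

end

theory Submission
  imports Defs "HOL-Analysis.Elementary_Metric_Spaces"
begin

text \<open>
  The almost rigid objects are the \<open>SE(x, y)\<close> with \<open>x < y \<le> x + \<theta>\<close>; regard \<open>(x, y)\<close> as an arc, up
  to translation by \<open>\<theta>\<close>. There are nonzero morphisms between two such objects if
  translates of the arcs cross, and otherwise only if they share an endpoint or the arcs are long;
  as the endpoints may be perturbed, compatibility means that no translates cross. A cluster is therefore a maximal noncrossing periodic
  family of arcs without accumulation points: a triangulation, in which every arc \<open>(a, c)\<close> is the
  base of a triangle with apex \<open>b\<close> and, if \<open>c < a + \<theta>\<close>, the side of a second triangle with vertex
  \<open>d\<close>. For \<open>c = a + \<theta>\<close> a translate of the first triangle plays the role of the second. The object
  \<open>T\<^sup>*\<close> is given by the other diagonal of the quadrilateral.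

  The quadrilateral is an exact square in \<open>F\<^sub>\<pi>\<close>, that is, an exact sequence
  \<open>E(a, c) \<rightarrow> E(b, c) \<oplus> E(a, d) \<rightarrow> E(b, d)\<close>, and applying \<open>S\<close> yields a triangle. Its first map is a left
  approximation because a nonzero basic morphism from \<open>E(a, c)\<close> to an object of the cluster other
  than \<open>T\<close> factors through \<open>E(b, c)\<close> or \<open>E(a, d)\<close>, as otherwise two arcs of the cluster would cross.
  The other triangle is obtained in the same way. Exactness and the Frobenius property pass from
  \<open>F\<^sub>\<pi>\<close> to the equivariant category by averaging over the group, whose order is invertible.
\<close>

section \<open>Additive categories\<close>

text \<open>The exact structure \<open>E\<close> is known only through its projective-injectives, so
  no sequence is a conflation by definition. That the squares are conflations is forced: a deflation
  from a projective onto the last term lifts through the candidate, and the obscure axiom does the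
  rest. Computations are possible because \<open>u\<close> times any basic morphism factors through
  a projective point: a stable Hom space remembers coefficients modulo \<open>u\<close>, and only at
  those translates whose basic morphism is stably nonzero. Equivariant morphisms between objects SX
  are circulant matrices, so one column of coefficients, indexed by rotations, describes them. The
  conditions on \<open>p\<close> enter by the arithmetic of the circle: 2 pi = p \<theta>; 2
  \<theta> < 2 pi leaves room to perturb arcs; and for odd \<open>p\<close> no E(x, y) is isomorphic
  to a nontrivial rotation of itself. E(x, y) and E(y, x + 2 pi) are one object, so each arc has two
  families of lifts, and many case distinctions come from this flip.\<close>

definition is_biproduct ::
  "('o, 'm) precat \<Rightarrow> 'o \<Rightarrow> 'o \<Rightarrow> 'o \<Rightarrow> 'm \<Rightarrow> 'm \<Rightarrow> 'm \<Rightarrow> 'm \<Rightarrow> bool" where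
  "is_biproduct C A B S i j q r \<longleftrightarrow> A \<in> Obj C \<and> B \<in> Obj C \<and> S \<in> Obj C \<and>
     i \<in> Hom C A S \<and> j \<in> Hom C B S \<and> q \<in> Hom C S A \<and> r \<in> Hom C S B \<and>
     Cmp C A S A q i = Idn C A \<and> Cmp C B S B r j = Idn C B \<and>
     Cmp C B S A q j = Zer C B A \<and> Cmp C A S B r i = Zer C A B \<and>
     Pls C S S (Cmp C S A S i q) (Cmp C S B S j r) = Idn C S"

lemma biproduct_iff: "biproduct C A B S \<longleftrightarrow> (\<exists>i j q r. is_biproduct C A B S i j q r)"
  unfolding biproduct_def is_biproduct_def by blast

text \<open>The record \<open>precat\<close> has no axioms and no negation: morphisms obey the laws
  only inside their Hom sets, and inverses come from \<open>neg_ex\<close>, out of which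
  \<open>neg\<close> makes a choice.\<close>

locale addcat =
  fixes C :: "('o, 'm) precat"
  assumes cmp_in [simp]: "\<lbrakk>X \<in> Obj C; Y \<in> Obj C; Z \<in> Obj C; f \<in> Hom C X Y; g \<in> Hom C Y Z\<rbrakk>
      \<Longrightarrow> Cmp C X Y Z g f \<in> Hom C X Z"
    and cmp_assoc: "\<lbrakk>W \<in> Obj C; X \<in> Obj C; Y \<in> Obj C; Z \<in> Obj C;
        f \<in> Hom C W X; g \<in> Hom C X Y; h \<in> Hom C Y Z\<rbrakk>
      \<Longrightarrow> Cmp C W X Z (Cmp C X Y Z h g) f = Cmp C W Y Z h (Cmp C W X Y g f)"
    and idn_in [simp]: "X \<in> Obj C \<Longrightarrow> Idn C X \<in> Hom C X X"
    and cmp_idl [simp]: "\<lbrakk>X \<in> Obj C; Y \<in> Obj C; f \<in> Hom C X Y\<rbrakk> \<Longrightarrow> Cmp C X Y Y (Idn C Y) f = f"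
    and cmp_idr [simp]: "\<lbrakk>X \<in> Obj C; Y \<in> Obj C; f \<in> Hom C X Y\<rbrakk> \<Longrightarrow> Cmp C X X Y f (Idn C X) = f"
    and zer_in [simp]: "\<lbrakk>X \<in> Obj C; Y \<in> Obj C\<rbrakk> \<Longrightarrow> Zer C X Y \<in> Hom C X Y"
    and pls_in [simp]: "\<lbrakk>X \<in> Obj C; Y \<in> Obj C; f \<in> Hom C X Y; g \<in> Hom C X Y\<rbrakk>
      \<Longrightarrow> Pls C X Y f g \<in> Hom C X Y"
    and pls_assoc: "\<lbrakk>X \<in> Obj C; Y \<in> Obj C; f \<in> Hom C X Y; g \<in> Hom C X Y; h \<in> Hom C X Y\<rbrakk>
      \<Longrightarrow> Pls C X Y (Pls C X Y f g) h = Pls C X Y f (Pls C X Y g h)"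
    and pls_comm: "\<lbrakk>X \<in> Obj C; Y \<in> Obj C; f \<in> Hom C X Y; g \<in> Hom C X Y\<rbrakk>
      \<Longrightarrow> Pls C X Y f g = Pls C X Y g f"
    and pls_zer [simp]: "\<lbrakk>X \<in> Obj C; Y \<in> Obj C; f \<in> Hom C X Y\<rbrakk> \<Longrightarrow> Pls C X Y f (Zer C X Y) = f"
    and neg_ex: "\<lbrakk>X \<in> Obj C; Y \<in> Obj C; f \<in> Hom C X Y\<rbrakk>
      \<Longrightarrow> \<exists>g \<in> Hom C X Y. Pls C X Y f g = Zer C X Y"
    and cmp_plsl: "\<lbrakk>X \<in> Obj C; Y \<in> Obj C; Z \<in> Obj C; f \<in> Hom C X Y; g \<in> Hom C Y Z; h \<in> Hom C Y Z\<rbrakk>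
      \<Longrightarrow> Cmp C X Y Z (Pls C Y Z g h) f = Pls C X Z (Cmp C X Y Z g f) (Cmp C X Y Z h f)"
    and cmp_plsr: "\<lbrakk>X \<in> Obj C; Y \<in> Obj C; Z \<in> Obj C; f \<in> Hom C X Y; g \<in> Hom C X Y; h \<in> Hom C Y Z\<rbrakk>
      \<Longrightarrow> Cmp C X Y Z h (Pls C X Y f g) = Pls C X Z (Cmp C X Y Z h f) (Cmp C X Y Z h g)"
    and biproduct_ex: "\<lbrakk>X \<in> Obj C; Y \<in> Obj C\<rbrakk> \<Longrightarrow> \<exists>S. biproduct C X Y S"
begin

lemma pls_zerl [simp]:
  "\<lbrakk>X \<in> Obj C; Y \<in> Obj C; f \<in> Hom C X Y\<rbrakk> \<Longrightarrow> Pls C X Y (Zer C X Y) f = f"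
  using pls_comm[of X Y f "Zer C X Y"] by simp

definition neg :: "'o \<Rightarrow> 'o \<Rightarrow> 'm \<Rightarrow> 'm" where
  "neg X Y f = (SOME g. g \<in> Hom C X Y \<and> Pls C X Y f g = Zer C X Y)"

lemma
  assumes "X \<in> Obj C" "Y \<in> Obj C" "f \<in> Hom C X Y"
  shows neg_in [simp]: "neg X Y f \<in> Hom C X Y"
    and pls_neg [simp]: "Pls C X Y f (neg X Y f) = Zer C X Y"
    and pls_negl [simp]: "Pls C X Y (neg X Y f) f = Zer C X Y"
proof -
  have *: "neg X Y f \<in> Hom C X Y \<and> Pls C X Y f (neg X Y f) = Zer C X Y"
    unfolding neg_def by (rule someI_ex) (use neg_ex[OF assms] in blast)
  show "neg X Y f \<in> Hom C X Y" "Pls C X Y f (neg X Y f) = Zer C X Y" using * by auto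
  show "Pls C X Y (neg X Y f) f = Zer C X Y"
    using * pls_comm[OF assms(1,2), of f "neg X Y f"] assms by simp
qed

lemma pls_left_comm:
  "\<lbrakk>X \<in> Obj C; Y \<in> Obj C; f \<in> Hom C X Y; g \<in> Hom C X Y; h \<in> Hom C X Y\<rbrakk>
   \<Longrightarrow> Pls C X Y f (Pls C X Y g h) = Pls C X Y g (Pls C X Y f h)"
  by (metis pls_assoc pls_comm)

lemma pls_neg_left [simp]:
  "\<lbrakk>X \<in> Obj C; Y \<in> Obj C; f \<in> Hom C X Y; g \<in> Hom C X Y\<rbrakk> \<Longrightarrow> Pls C X Y f (Pls C X Y (neg X Y f) g) = g"
  by (simp add: pls_assoc[symmetric])

lemma neg_pls_left [simp]:
  "\<lbrakk>X \<in> Obj C; Y \<in> Obj C; f \<in> Hom C X Y; g \<in> Hom C X Y\<rbrakk> \<Longrightarrow> Pls C X Y (neg X Y f) (Pls C X Y f g) = g"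
  by (simp add: pls_assoc[symmetric])

lemmas pls_ac = pls_assoc pls_comm pls_left_comm

lemma pls_cancel:
  "\<lbrakk>X \<in> Obj C; Y \<in> Obj C; f \<in> Hom C X Y; g \<in> Hom C X Y; h \<in> Hom C X Y;
    Pls C X Y f g = Pls C X Y f h\<rbrakk> \<Longrightarrow> g = h"
  by (metis neg_pls_left)

lemma neg_unique:
  "\<lbrakk>X \<in> Obj C; Y \<in> Obj C; f \<in> Hom C X Y; g \<in> Hom C X Y; Pls C X Y f g = Zer C X Y\<rbrakk> \<Longrightarrow> g = neg X Y f"
  by (metis pls_cancel neg_in pls_neg)

lemma cmp_zerl [simp]:
  assumes "X \<in> Obj C" "Y \<in> Obj C" "Z \<in> Obj C" "f \<in> Hom C X Y"
  shows "Cmp C X Y Z (Zer C Y Z) f = Zer C X Z"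
proof -
  have "Pls C X Z (Cmp C X Y Z (Zer C Y Z) f) (Cmp C X Y Z (Zer C Y Z) f) =
        Pls C X Z (Cmp C X Y Z (Zer C Y Z) f) (Zer C X Z)"
    using assms cmp_plsl[of X Y Z f "Zer C Y Z" "Zer C Y Z"] by simp
  then show ?thesis using assms by (meson cmp_in pls_cancel zer_in)
qed

lemma cmp_zerr [simp]:
  assumes "X \<in> Obj C" "Y \<in> Obj C" "Z \<in> Obj C" "g \<in> Hom C Y Z"
  shows "Cmp C X Y Z g (Zer C X Y) = Zer C X Z"
proof -
  have "Pls C X Z (Cmp C X Y Z g (Zer C X Y)) (Cmp C X Y Z g (Zer C X Y)) =
        Pls C X Z (Cmp C X Y Z g (Zer C X Y)) (Zer C X Z)"
    using assms cmp_plsr[of X Y Z "Zer C X Y" "Zer C X Y" g] by simp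
  then show ?thesis using assms by (meson cmp_in pls_cancel zer_in)
qed

lemma cmp_negl:
  assumes "X \<in> Obj C" "Y \<in> Obj C" "Z \<in> Obj C" "f \<in> Hom C X Y" "g \<in> Hom C Y Z"
  shows "Cmp C X Y Z (neg Y Z g) f = neg X Z (Cmp C X Y Z g f)"
  by (rule neg_unique) (use assms cmp_plsl[of X Y Z f g "neg Y Z g"] in simp_all)

lemma cmp_negr:
  assumes "X \<in> Obj C" "Y \<in> Obj C" "Z \<in> Obj C" "f \<in> Hom C X Y" "g \<in> Hom C Y Z"
  shows "Cmp C X Y Z g (neg X Y f) = neg X Z (Cmp C X Y Z g f)"
  by (rule neg_unique) (use assms cmp_plsr[of X Y Z f "neg X Y f" g] in simp_all)

lemma neg_zer [simp]: "X \<in> Obj C \<Longrightarrow> Y \<in> Obj C \<Longrightarrow> neg X Y (Zer C X Y) = Zer C X Y"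
  by (metis neg_unique pls_zer zer_in)

text \<open>After \<open>cmp_assoc\<close> all composites are bracketed to the right, and an
  equation for \<open>g f\<close> no longer matches inside \<open>g (f t)\<close>; this is the form
  in which such equations are then used.\<close>

lemma cmp_ctx:
  "\<lbrakk>Cmp C X Y Z g f = k; W \<in> Obj C; X \<in> Obj C; Y \<in> Obj C; Z \<in> Obj C;
    f \<in> Hom C X Y; g \<in> Hom C Y Z; t \<in> Hom C W X\<rbrakk>
   \<Longrightarrow> Cmp C W Y Z g (Cmp C W X Y f t) = Cmp C W X Z k t"
  by (metis cmp_assoc)

lemma is_biproductD:
  assumes "is_biproduct C A B S i j q r"
  shows "A \<in> Obj C" "B \<in> Obj C" "S \<in> Obj C" "i \<in> Hom C A S" "j \<in> Hom C B S" "q \<in> Hom C S A"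
    "r \<in> Hom C S B" "Cmp C A S A q i = Idn C A" "Cmp C B S B r j = Idn C B"
    "Cmp C B S A q j = Zer C B A" "Cmp C A S B r i = Zer C A B"
    "Pls C S S (Cmp C S A S i q) (Cmp C S B S j r) = Idn C S"
  using assms unfolding is_biproduct_def by auto

lemma biproduct_ctx:
  assumes "is_biproduct C A B S i j q r" "W \<in> Obj C"
  shows "t \<in> Hom C W A \<Longrightarrow> Cmp C W S A q (Cmp C W A S i t) = t"
    and "t \<in> Hom C W A \<Longrightarrow> Cmp C W S B r (Cmp C W A S i t) = Zer C W B"
    and "s \<in> Hom C W B \<Longrightarrow> Cmp C W S B r (Cmp C W B S j s) = s"
    and "s \<in> Hom C W B \<Longrightarrow> Cmp C W S A q (Cmp C W B S j s) = Zer C W A"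
proof -
  note [simp] = is_biproductD[OF assms(1)] assms(2)
  show "t \<in> Hom C W A \<Longrightarrow> Cmp C W S A q (Cmp C W A S i t) = t"
    by (subst cmp_ctx[of A S A q i "Idn C A"]) auto
  show "t \<in> Hom C W A \<Longrightarrow> Cmp C W S B r (Cmp C W A S i t) = Zer C W B"
    by (subst cmp_ctx[of A S B r i "Zer C A B"]) auto
  show "s \<in> Hom C W B \<Longrightarrow> Cmp C W S B r (Cmp C W B S j s) = s"
    by (subst cmp_ctx[of B S B r j "Idn C B"]) auto
  show "s \<in> Hom C W B \<Longrightarrow> Cmp C W S A q (Cmp C W B S j s) = Zer C W A"
    by (subst cmp_ctx[of B S A q j "Zer C B A"]) auto
qed

lemma biproduct_decomp_in:
  assumes "is_biproduct C A B S i j q r" "W \<in> Obj C" "t \<in> Hom C W S"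
  shows "Pls C W S (Cmp C W A S i (Cmp C W S A q t)) (Cmp C W B S j (Cmp C W S B r t)) = t"
proof -
  note [simp] = is_biproductD[OF assms(1)] assms(2,3)
  show ?thesis
    using cmp_plsl[of W S S t "Cmp C S A S i q" "Cmp C S B S j r"] by (simp add: cmp_assoc)
qed

lemma biproduct_decomp_out:
  assumes "is_biproduct C A B S i j q r" "W \<in> Obj C" "t \<in> Hom C S W"
  shows "Pls C S W (Cmp C S A W (Cmp C A S W t i) q) (Cmp C S B W (Cmp C B S W t j) r) = t"
proof -
  note [simp] = is_biproductD[OF assms(1)] assms(2,3)
  show ?thesis
    using cmp_plsr[of S S W "Cmp C S A S i q" "Cmp C S B S j r" t] by (simp add: cmp_assoc)
qed

lemma biproduct_in_eqI:
  assumes "is_biproduct C A B S i j q r" "W \<in> Obj C" "t \<in> Hom C W S" "t' \<in> Hom C W S"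
    "Cmp C W S A q t = Cmp C W S A q t'" "Cmp C W S B r t = Cmp C W S B r t'"
  shows "t = t'"
  using biproduct_decomp_in[OF assms(1,2,3)] biproduct_decomp_in[OF assms(1,2,4)] assms(5,6) by metis

lemma biproduct_out_eqI:
  assumes "is_biproduct C A B S i j q r" "W \<in> Obj C" "t \<in> Hom C S W" "t' \<in> Hom C S W"
    "Cmp C A S W t i = Cmp C A S W t' i" "Cmp C B S W t j = Cmp C B S W t' j"
  shows "t = t'"
  using biproduct_decomp_out[OF assms(1,2,3)] biproduct_decomp_out[OF assms(1,2,4)] assms(5,6) by metis

lemma is_biproduct_commute:
  assumes "is_biproduct C A B S i j q r" shows "is_biproduct C B A S j i r q"
  using assms pls_comm[of S S "Cmp C S A S i q" "Cmp C S B S j r"] unfolding is_biproduct_def by auto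

section \<open>Isomorphisms and zero objects\<close>

lemma iso_mor_idn: "X \<in> Obj C \<Longrightarrow> iso_mor C X X (Idn C X)"
  unfolding iso_mor_def by (auto intro!: bexI[of _ "Idn C X"])

lemma iso_mor_cmp:
  assumes "X \<in> Obj C" "Y \<in> Obj C" "Z \<in> Obj C" "iso_mor C X Y f" "iso_mor C Y Z g"
  shows "iso_mor C X Z (Cmp C X Y Z g f)"
proof -
  obtain f' where f': "f \<in> Hom C X Y" "f' \<in> Hom C Y X" "Cmp C X Y X f' f = Idn C X" "Cmp C Y X Y f f' = Idn C Y"
    using assms(4) unfolding iso_mor_def by auto
  obtain g' where g': "g \<in> Hom C Y Z" "g' \<in> Hom C Z Y" "Cmp C Y Z Y g' g = Idn C Y" "Cmp C Z Y Z g g' = Idn C Z"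
    using assms(5) unfolding iso_mor_def by auto
  note [simp] = assms(1-3) f' g'
  have "Cmp C X Z X (Cmp C Z Y X f' g') (Cmp C X Y Z g f) = Idn C X"
    by (simp add: cmp_assoc cmp_ctx[OF g'(3)])
  moreover have "Cmp C Z X Z (Cmp C X Y Z g f) (Cmp C Z Y X f' g') = Idn C Z"
    by (simp add: cmp_assoc cmp_ctx[OF f'(4)])
  ultimately show ?thesis unfolding iso_mor_def by (auto intro!: bexI[of _ "Cmp C Z Y X f' g'"])
qed

lemma iso_obj_refl: "X \<in> Obj C \<Longrightarrow> iso_obj C X X"
  unfolding iso_obj_def using iso_mor_idn by blast

lemma iso_obj_sym: "iso_obj C X Y \<Longrightarrow> iso_obj C Y X"
  unfolding iso_obj_def iso_mor_def by blast

lemma iso_obj_trans: "iso_obj C X Y \<Longrightarrow> iso_obj C Y Z \<Longrightarrow> iso_obj C X Z"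
  unfolding iso_obj_def using iso_mor_cmp by blast

lemma iso_objE:
  assumes "iso_obj C X Y"
  obtains f g where "X \<in> Obj C" "Y \<in> Obj C" "f \<in> Hom C X Y" "g \<in> Hom C Y X"
    "Cmp C X Y X g f = Idn C X" "Cmp C Y X Y f g = Idn C Y"
  using assms unfolding iso_obj_def iso_mor_def by auto

lemma zero_obj_homs:
  assumes "zero_obj C Z" "X \<in> Obj C"
  shows "f \<in> Hom C X Z \<Longrightarrow> f = Zer C X Z" "g \<in> Hom C Z X \<Longrightarrow> g = Zer C Z X"
proof -
  have Z: "Z \<in> Obj C" "Idn C Z = Zer C Z Z" using assms unfolding zero_obj_def by auto
  show "f = Zer C X Z" if "f \<in> Hom C X Z" using cmp_idl[OF assms(2) Z(1) that] that Z assms by simp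
  show "g = Zer C Z X" if "g \<in> Hom C Z X" using cmp_idr[OF Z(1) assms(2) that] that Z assms by simp
qed

lemma iso_obj_hom_zero:
  assumes "iso_obj C X X'" "iso_obj C Y Y'" "Hom C X Y = {Zer C X Y}"
  shows "Hom C X' Y' = {Zer C X' Y'}"
proof -
  obtain f g where fg [simp]: "X \<in> Obj C" "X' \<in> Obj C" "f \<in> Hom C X X'" "g \<in> Hom C X' X"
    "Cmp C X X' X g f = Idn C X" "Cmp C X' X X' f g = Idn C X'" using iso_objE[OF assms(1)] .
  obtain f' g' where fg' [simp]: "Y \<in> Obj C" "Y' \<in> Obj C" "f' \<in> Hom C Y Y'" "g' \<in> Hom C Y' Y"
    "Cmp C Y Y' Y g' f' = Idn C Y" "Cmp C Y' Y Y' f' g' = Idn C Y'" using iso_objE[OF assms(2)] .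
  have "h = Zer C X' Y'" if [simp]: "h \<in> Hom C X' Y'" for h
  proof -
    have "Cmp C X Y' Y g' (Cmp C X X' Y' h f) \<in> Hom C X Y" by simp
    then have "Cmp C X Y' Y g' (Cmp C X X' Y' h f) = Zer C X Y" using assms(3) by blast
    then have "Cmp C X' X Y' (Cmp C X Y Y' f' (Cmp C X Y' Y g' (Cmp C X X' Y' h f))) g = Zer C X' Y'" by simp
    then show ?thesis by (simp add: cmp_assoc cmp_ctx[OF fg'(6)])
  qed
  then show ?thesis by auto
qed

lemma zero_obj_iso: "zero_obj C X \<Longrightarrow> iso_obj C X Y \<Longrightarrow> zero_obj C Y"
  unfolding zero_obj_def
  by (metis cmp_idr cmp_zerl cmp_zerr iso_objE)

text \<open>Serves to replace a summand by an isomorphic object, which is how members of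
  \<open>add_closure\<close> are recognised.\<close>

lemma is_biproduct_iso:
  assumes "is_biproduct C A B S i j q r" "iso_obj C A A'"
  shows "biproduct C A' B S"
proof -
  note [simp] = is_biproductD[OF assms(1)]
  obtain f g where fg [simp]: "A \<in> Obj C" "A' \<in> Obj C" "f \<in> Hom C A A'" "g \<in> Hom C A' A"
    "Cmp C A A' A g f = Idn C A" "Cmp C A' A A' f g = Idn C A'" using iso_objE[OF assms(2)] .
  have "is_biproduct C A' B S (Cmp C A' A S i g) j (Cmp C S A A' f q) r"
    unfolding is_biproduct_def
    by (simp add: cmp_assoc cmp_ctx[OF fg(5)] biproduct_ctx[OF assms(1)])
  then show ?thesis unfolding biproduct_iff by blast
qed

end

text \<open>Together with \<open>op_conf\<close>, the device that turns each result on inflations,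
  pushouts and cokernels into one on deflations, pullbacks and kernels.\<close>

definition op_cat :: "('o, 'm) precat \<Rightarrow> ('o, 'm) precat" where
  "op_cat C = \<lparr>Obj = Obj C, Hom = (\<lambda>X Y. Hom C Y X), Cmp = (\<lambda>X Y Z g f. Cmp C Z Y X f g),
     Idn = Idn C, Zer = (\<lambda>X Y. Zer C Y X), Pls = (\<lambda>X Y. Pls C Y X)\<rparr>"

definition op_conf :: "('o, 'm) conflation set \<Rightarrow> ('o, 'm) conflation set" where
  "op_conf E = {(X, Y, Z, i, d). (Z, Y, X, d, i) \<in> E}"

lemma op_sel [simp]:
  "Obj (op_cat C) = Obj C" "Hom (op_cat C) X Y = Hom C Y X"
  "Cmp (op_cat C) X Y Z g f = Cmp C Z Y X f g" "Idn (op_cat C) = Idn C"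
  "Zer (op_cat C) X Y = Zer C Y X" "Pls (op_cat C) X Y = Pls C Y X"
  by (simp_all add: op_cat_def)

lemma op_conf_iff [simp]: "(X, Y, Z, i, d) \<in> op_conf E \<longleftrightarrow> (Z, Y, X, d, i) \<in> E"
  by (simp add: op_conf_def)

lemma op_is_biproduct [simp]:
  "is_biproduct (op_cat C) A B S i j q r \<longleftrightarrow> is_biproduct C A B S q r i j"
  unfolding is_biproduct_def by auto

lemma op_kernel [simp]: "is_kernel (op_cat C) X Y Z i d \<longleftrightarrow> is_cokernel C Z Y X d i"
  and op_cokernel [simp]: "is_cokernel (op_cat C) X Y Z i d \<longleftrightarrow> is_kernel C Z Y X d i"
  unfolding is_kernel_def is_cokernel_def by auto

lemma op_inflation [simp]: "inflation (op_conf E) X Y i \<longleftrightarrow> deflation E Y X i"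
  and op_deflation [simp]: "deflation (op_conf E) X Y i \<longleftrightarrow> inflation E Y X i"
  unfolding inflation_def deflation_def by auto

lemma op_pushout [simp]: "is_pushout (op_cat C) X A B S i f j g \<longleftrightarrow> is_pullback C X A B S i f j g"
  and op_pullback [simp]: "is_pullback (op_cat C) X A B S i f j g \<longleftrightarrow> is_pushout C X A B S i f j g"
  unfolding is_pushout_def is_pullback_def by auto

lemma op_iso_mor: "iso_mor (op_cat C) X Y f \<longleftrightarrow> iso_mor C Y X f"
  unfolding iso_mor_def by auto

lemma (in addcat) op_addcat: "addcat (op_cat C)"
proof
  fix X Y assume "X \<in> Obj (op_cat C)" "Y \<in> Obj (op_cat C)"
  then obtain S i j q r where "is_biproduct C X Y S i j q r"
    using biproduct_ex[of X Y] unfolding biproduct_iff by auto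
  then have "is_biproduct (op_cat C) X Y S q r i j" by simp
  then show "\<exists>S. biproduct (op_cat C) X Y S" unfolding biproduct_iff by blast
qed (auto simp: cmp_assoc pls_assoc cmp_plsl cmp_plsr neg_ex intro: pls_comm)

section \<open>Exact categories\<close>

lemma iso_mor_inv:
  assumes "iso_mor C X Y f"
  obtains g where "f \<in> Hom C X Y" "g \<in> Hom C Y X" "Cmp C X Y X g f = Idn C X" "Cmp C Y X Y f g = Idn C Y"
    "iso_mor C Y X g"
  using assms unfolding iso_mor_def by auto

locale excat = addcat C for C :: "('o, 'm) precat" +
  fixes E :: "('o, 'm) conflation set"
  assumes exact: "exact_structure C E"
begin

lemma confD:
  assumes "(X, Y, Z, i, d) \<in> E"
  shows "X \<in> Obj C" "Y \<in> Obj C" "Z \<in> Obj C" "is_kernel C X Y Z i d" "is_cokernel C X Y Z i d"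
    "i \<in> Hom C X Y" "d \<in> Hom C Y Z" "Cmp C X Y Z d i = Zer C X Z"
proof -
  have "X \<in> Obj C \<and> Y \<in> Obj C \<and> Z \<in> Obj C \<and> is_kernel C X Y Z i d \<and> is_cokernel C X Y Z i d"
    using exact[unfolded exact_structure_def, THEN conjunct1] assms by blast
  then show "X \<in> Obj C" "Y \<in> Obj C" "Z \<in> Obj C" "is_kernel C X Y Z i d" "is_cokernel C X Y Z i d"
    "i \<in> Hom C X Y" "d \<in> Hom C Y Z" "Cmp C X Y Z d i = Zer C X Z"
    by (auto simp: is_kernel_def)
qed

lemma conf_iso:
  assumes "(X, Y, Z, i, d) \<in> E" "X' \<in> Obj C" "Y' \<in> Obj C" "Z' \<in> Obj C"
    "i' \<in> Hom C X' Y'" "d' \<in> Hom C Y' Z'" "iso_mor C X X' a" "iso_mor C Y Y' b" "iso_mor C Z Z' c"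
    "Cmp C X Y Y' b i = Cmp C X X' Y' i' a" "Cmp C Y Z Z' c d = Cmp C Y Y' Z' d' b"
  shows "(X', Y', Z', i', d') \<in> E"
proof -
  have "\<forall>X Y Z i d X' Y' Z' i' d' a b c.
        (X, Y, Z, i, d) \<in> E \<and> X' \<in> Obj C \<and> Y' \<in> Obj C \<and> Z' \<in> Obj C \<and>
        i' \<in> Hom C X' Y' \<and> d' \<in> Hom C Y' Z' \<and>
        iso_mor C X X' a \<and> iso_mor C Y Y' b \<and> iso_mor C Z Z' c \<and>
        Cmp C X Y Y' b i = Cmp C X X' Y' i' a \<and> Cmp C Y Z Z' c d = Cmp C Y Y' Z' d' b
        \<longrightarrow> (X', Y', Z', i', d') \<in> E"
    by (rule exact[unfolded exact_structure_def, THEN conjunct2, THEN conjunct1])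
  then show ?thesis using assms by blast
qed

lemmas exact_rest = exact[unfolded exact_structure_def, THEN conjunct2, THEN conjunct2]

lemma idn_infl: "X \<in> Obj C \<Longrightarrow> inflation E X X (Idn C X)"
  using exact_rest[THEN conjunct1] by blast

lemma idn_defl: "X \<in> Obj C \<Longrightarrow> deflation E X X (Idn C X)"
  using exact_rest[THEN conjunct1] by blast

lemma infl_cmp: "\<lbrakk>inflation E X Y i; inflation E Y Z j\<rbrakk> \<Longrightarrow> inflation E X Z (Cmp C X Y Z j i)"
  using exact_rest[THEN conjunct2, THEN conjunct1] by blast

lemma defl_cmp: "\<lbrakk>deflation E X Y i; deflation E Y Z j\<rbrakk> \<Longrightarrow> deflation E X Z (Cmp C X Y Z j i)"
  using exact_rest[THEN conjunct2, THEN conjunct2, THEN conjunct1] by blast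

lemma pushout_ex: "\<lbrakk>inflation E X A i; B \<in> Obj C; f \<in> Hom C X B\<rbrakk>
    \<Longrightarrow> \<exists>S j g. is_pushout C X A B S i f j g \<and> inflation E B S g"
  using exact_rest[THEN conjunct2, THEN conjunct2, THEN conjunct2, THEN conjunct1] by blast

lemma pullback_ex: "\<lbrakk>deflation E A X d; B \<in> Obj C; f \<in> Hom C B X\<rbrakk>
    \<Longrightarrow> \<exists>S j g. is_pullback C X A B S d f j g \<and> deflation E S B g"
  using exact_rest[THEN conjunct2, THEN conjunct2, THEN conjunct2, THEN conjunct2] by blast

lemma op_excat: "excat (op_cat C) (op_conf E)"
proof (intro excat.intro op_addcat excat_axioms.intro)
  show "exact_structure (op_cat C) (op_conf E)"
    unfolding exact_structure_def op_conf_iff op_sel op_kernel op_cokernel op_inflation op_deflation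
      op_pushout op_pullback op_iso_mor
  proof (intro conjI allI impI ballI)
    fix X Y Z i d X' Y' Z' i' d' a b c
    assume *: "(Z, Y, X, d, i) \<in> E \<and> X' \<in> Obj C \<and> Y' \<in> Obj C \<and> Z' \<in> Obj C \<and>
        i' \<in> Hom C Y' X' \<and> d' \<in> Hom C Z' Y' \<and>
        iso_mor C X' X a \<and> iso_mor C Y' Y b \<and> iso_mor C Z' Z c \<and>
        Cmp C Y' Y X i b = Cmp C Y' X' X a i' \<and> Cmp C Z' Z Y d c = Cmp C Z' Y' Y b d'"
    note [simp] = confD[OF conjunct1[OF *]]
    \<comment> \<open>Closure under isomorphism concerns arrows that now point the wrong way, so it
      is applied to the inverses of \<open>a\<close>, \<open>b\<close> and \<open>c\<close>.\<close>
    obtain a' where a' [simp]: "a \<in> Hom C X' X" "a' \<in> Hom C X X'" "Cmp C X' X X' a' a = Idn C X'"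
      "Cmp C X X' X a a' = Idn C X" "iso_mor C X X' a'" using * iso_mor_inv by metis
    obtain b' where b' [simp]: "b \<in> Hom C Y' Y" "b' \<in> Hom C Y Y'" "Cmp C Y' Y Y' b' b = Idn C Y'"
      "Cmp C Y Y' Y b b' = Idn C Y" "iso_mor C Y Y' b'" using * iso_mor_inv by metis
    obtain c' where c' [simp]: "c \<in> Hom C Z' Z" "c' \<in> Hom C Z Z'" "Cmp C Z' Z Z' c' c = Idn C Z'"
      "Cmp C Z Z' Z c c' = Idn C Z" "iso_mor C Z Z' c'" using * iso_mor_inv by metis
    have ob [simp]: "X' \<in> Obj C" "Y' \<in> Obj C" "Z' \<in> Obj C" "i' \<in> Hom C Y' X'" "d' \<in> Hom C Z' Y'"
      and s1: "Cmp C Y' Y X i b = Cmp C Y' X' X a i'" and s2: "Cmp C Z' Z Y d c = Cmp C Z' Y' Y b d'"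
      using * by auto
    have "Cmp C Y X X' a' i = Cmp C Y X X' a' (Cmp C Y Y' X (Cmp C Y' Y X i b) b')"
      by (simp add: cmp_assoc)
    then have e1: "Cmp C Y X X' a' i = Cmp C Y Y' X' i' b'"
      by (simp add: s1 cmp_assoc cmp_ctx[OF a'(3)])
    have "Cmp C Z Y Y' b' d = Cmp C Z Y Y' b' (Cmp C Z Z' Y (Cmp C Z' Z Y d c) c')"
      by (simp add: cmp_assoc)
    then have e2: "Cmp C Z Y Y' b' d = Cmp C Z Z' Y' d' c'"
      by (simp add: s2 cmp_assoc cmp_ctx[OF b'(3)])
    show "(Z', Y', X', d', i') \<in> E"
      by (rule conf_iso[of Z Y X d i _ _ _ _ _ c' b' a']) (use * e1 e2 in auto)
  qed ((erule confD) | (erule conjE, rule infl_cmp defl_cmp, assumption, assumption)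
      | (rule idn_infl idn_defl pushout_ex pullback_ex, assumption+))+
qed

end

section \<open>Universal properties of kernels, cokernels and pushouts\<close>

context addcat
begin

lemma kernelD:
  assumes "is_kernel C X Y Z i d" "W \<in> Obj C" "a \<in> Hom C W Y" "Cmp C W Y Z d a = Zer C W Z"
  obtains b where "b \<in> Hom C W X" "Cmp C W X Y i b = a"
  using assms unfolding is_kernel_def by blast

lemma kernel_mono:
  assumes "is_kernel C X Y Z i d" "X \<in> Obj C" "Y \<in> Obj C" "Z \<in> Obj C" "W \<in> Obj C"
    "b \<in> Hom C W X" "b' \<in> Hom C W X" "Cmp C W X Y i b = Cmp C W X Y i b'"
  shows "b = b'"
proof -
  have i: "i \<in> Hom C X Y" "d \<in> Hom C Y Z" "Cmp C X Y Z d i = Zer C X Z"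
    using assms(1) unfolding is_kernel_def by auto
  have a: "Cmp C W X Y i b \<in> Hom C W Y" "Cmp C W Y Z d (Cmp C W X Y i b) = Zer C W Z"
    using assms i cmp_ctx[OF i(3), of W b] by auto
  have "\<forall>W \<in> Obj C. \<forall>a \<in> Hom C W Y. Cmp C W Y Z d a = Zer C W Z \<longrightarrow>
        (\<exists>!b. b \<in> Hom C W X \<and> Cmp C W X Y i b = a)"
    using assms(1) unfolding is_kernel_def by blast
  then show ?thesis using a assms(5-8) by metis
qed

lemma cokernelD:
  assumes "is_cokernel C X Y Z i d" "W \<in> Obj C" "a \<in> Hom C Y W" "Cmp C X Y W a i = Zer C X W"
  obtains b where "b \<in> Hom C Z W" "Cmp C Y Z W b d = a"
  using assms unfolding is_cokernel_def by blast

lemma cokernel_epi: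
  assumes "is_cokernel C X Y Z i d" "X \<in> Obj C" "Y \<in> Obj C" "Z \<in> Obj C" "W \<in> Obj C"
    "b \<in> Hom C Z W" "b' \<in> Hom C Z W" "Cmp C Y Z W b d = Cmp C Y Z W b' d"
  shows "b = b'"
proof -
  have i: "i \<in> Hom C X Y" "d \<in> Hom C Y Z" "Cmp C X Y Z d i = Zer C X Z"
    using assms(1) unfolding is_cokernel_def by auto
  have a: "Cmp C Y Z W b d \<in> Hom C Y W" "Cmp C X Y W (Cmp C Y Z W b d) i = Zer C X W"
    using assms i by (auto simp: cmp_assoc)
  have "\<forall>W \<in> Obj C. \<forall>a \<in> Hom C Y W. Cmp C X Y W a i = Zer C X W \<longrightarrow>
        (\<exists>!b. b \<in> Hom C Z W \<and> Cmp C Y Z W b d = a)"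
    using assms(1) unfolding is_cokernel_def by blast
  then show ?thesis using a assms(5-8) by metis
qed

lemma pushout_unique:
  assumes "is_pushout C X A B S i f j g" "W \<in> Obj C" "w \<in> Hom C S W" "w' \<in> Hom C S W"
    "Cmp C A S W w j = Cmp C A S W w' j" "Cmp C B S W w g = Cmp C B S W w' g"
  shows "w = w'"
proof -
  have p [simp]: "X \<in> Obj C" "A \<in> Obj C" "B \<in> Obj C" "S \<in> Obj C"
     "i \<in> Hom C X A" "f \<in> Hom C X B" "j \<in> Hom C A S" "g \<in> Hom C B S" "W \<in> Obj C" "w \<in> Hom C S W"
    and c: "Cmp C X A S j i = Cmp C X B S g f"
    using assms unfolding is_pushout_def by auto
  have "Cmp C X A W (Cmp C A S W w j) i = Cmp C X B W (Cmp C B S W w g) f" by (simp add: cmp_assoc c)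
  moreover have "\<forall>W \<in> Obj C. \<forall>a \<in> Hom C A W. \<forall>b \<in> Hom C B W. Cmp C X A W a i = Cmp C X B W b f \<longrightarrow>
        (\<exists>!w. w \<in> Hom C S W \<and> Cmp C A S W w j = a \<and> Cmp C B S W w g = b)"
    using assms(1) unfolding is_pushout_def by blast
  moreover have "Cmp C A S W w j \<in> Hom C A W" "Cmp C B S W w g \<in> Hom C B W" by simp_all
  ultimately show ?thesis using assms(2-6) by metis
qed

lemma pushoutD:
  assumes "is_pushout C X A B S i f j g" "W \<in> Obj C" "a \<in> Hom C A W" "b \<in> Hom C B W"
    "Cmp C X A W a i = Cmp C X B W b f"
  obtains w where "w \<in> Hom C S W" "Cmp C A S W w j = a" "Cmp C B S W w g = b"
proof -
  have "\<forall>W \<in> Obj C. \<forall>a \<in> Hom C A W. \<forall>b \<in> Hom C B W. Cmp C X A W a i = Cmp C X B W b f \<longrightarrow>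
        (\<exists>!w. w \<in> Hom C S W \<and> Cmp C A S W w j = a \<and> Cmp C B S W w g = b)"
    using assms(1) unfolding is_pushout_def by blast
  then show ?thesis using assms(2-5) that by blast
qed

lemma pushout_iso:
  assumes "is_pushout C X A B S i f j g" "is_pushout C X A B S' i f j' g'"
  obtains w w' where "w \<in> Hom C S S'" "w' \<in> Hom C S' S" "Cmp C S S' S w' w = Idn C S"
    "Cmp C S' S S' w w' = Idn C S'" "Cmp C B S S' w g = g'" "Cmp C B S' S w' g' = g"
proof -
  have p [simp]: "X \<in> Obj C" "A \<in> Obj C" "B \<in> Obj C" "S \<in> Obj C" "S' \<in> Obj C"
     "i \<in> Hom C X A" "f \<in> Hom C X B" "j \<in> Hom C A S" "g \<in> Hom C B S" "j' \<in> Hom C A S'" "g' \<in> Hom C B S'"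
    and c: "Cmp C X A S j i = Cmp C X B S g f" "Cmp C X A S' j' i = Cmp C X B S' g' f"
    using assms unfolding is_pushout_def by auto
  obtain w where w [simp]: "w \<in> Hom C S S'" "Cmp C A S S' w j = j'" "Cmp C B S S' w g = g'"
    using pushoutD[OF assms(1), of S' j' g'] c by auto
  obtain w' where w' [simp]: "w' \<in> Hom C S' S" "Cmp C A S' S w' j' = j" "Cmp C B S' S w' g' = g"
    using pushoutD[OF assms(2), of S j g] c by auto
  have "Cmp C S S' S w' w = Idn C S"
    by (rule pushout_unique[OF assms(1), of S]) (auto simp: cmp_assoc)
  moreover have "Cmp C S' S S' w w' = Idn C S'"
    by (rule pushout_unique[OF assms(2), of S']) (auto simp: cmp_assoc)
  ultimately show ?thesis using that w w' by blast
qed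

end

context excat
begin

lemma infl_iso:
  assumes "inflation E X Y i" "iso_mor C Y Y' b" "Y' \<in> Obj C"
  shows "inflation E X Y' (Cmp C X Y Y' b i)"
proof -
  obtain Z d where E: "(X, Y, Z, i, d) \<in> E" using assms(1) unfolding inflation_def by auto
  note [simp] = confD[OF E] assms(3)
  obtain b' where b' [simp]: "b \<in> Hom C Y Y'" "b' \<in> Hom C Y' Y" "Cmp C Y Y' Y b' b = Idn C Y"
     "Cmp C Y' Y Y' b b' = Idn C Y'" using iso_mor_inv[OF assms(2)] by metis
  have "(X, Y', Z, Cmp C X Y Y' b i, Cmp C Y' Y Z d b') \<in> E"
    by (rule conf_iso[OF E, where a = "Idn C X" and b = b and c = "Idn C Z"])
      (use assms(2) iso_mor_idn in \<open>auto simp: cmp_assoc\<close>)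
  then show ?thesis unfolding inflation_def by blast
qed

text \<open>The axiom provides one pushout along \<open>f\<close> whose leg is an inflation; any
  other pushout differs from it by an isomorphism.\<close>

lemma infl_pushout:
  assumes "is_pushout C X A B S i f j g" "inflation E X A i"
  shows "inflation E B S g"
proof -
  have p [simp]: "X \<in> Obj C" "A \<in> Obj C" "B \<in> Obj C" "S \<in> Obj C" "f \<in> Hom C X B"
    using assms unfolding is_pushout_def by auto
  obtain S' j' g' where S': "is_pushout C X A B S' i f j' g'" "inflation E B S' g'"
    using pushout_ex[OF assms(2), of B f] by auto
  obtain w w' where w: "w \<in> Hom C S' S" "w' \<in> Hom C S S'" "Cmp C S' S S' w' w = Idn C S'"
    "Cmp C S S' S w w' = Idn C S" "Cmp C B S' S w g' = g"
    using pushout_iso[OF S'(1) assms(1)] by metis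
  then have "iso_mor C S' S w" unfolding iso_mor_def by blast
  then show ?thesis using infl_iso[OF S'(2)] w by force
qed

text \<open>No zero object is assumed: one arises as the kernel of an identity, which is a
  deflation.\<close>

lemma zero_infl:
  assumes "B \<in> Obj C"
  obtains N where "zero_obj C N" "inflation E N B (Zer C N B)"
proof -
  obtain N i where N: "(N, B, B, i, Idn C B) \<in> E" using idn_defl[OF assms] unfolding deflation_def by auto
  note [simp] = confD[OF N]
  have i: "i = Zer C N B" using confD(8)[OF N] cmp_idl[of N B i] confD(1,2,6)[OF N] by metis
  have "Idn C N = Zer C N N"
    by (rule kernel_mono[OF confD(4)[OF N], of N]) (use i in auto)
  then have "zero_obj C N" unfolding zero_obj_def by simp
  then show ?thesis using that N i unfolding inflation_def by blast
qed

text \<open>The biproduct is the pushout of 0 -> B along 0 -> A, and 0 -> B is an inflation.\<close>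

lemma coproj_infl:
  assumes "is_biproduct C A B S i j q r"
  shows "inflation E A S i"
proof -
  note [simp] = is_biproductD[OF assms]
  obtain N where N: "zero_obj C N" "inflation E N B (Zer C N B)" using zero_infl[of B] by auto
  have [simp]: "N \<in> Obj C" using N unfolding zero_obj_def by auto
  have "is_pushout C N B A S (Zer C N B) (Zer C N A) j i"
    unfolding is_pushout_def
  proof (intro conjI ballI impI)
    fix W a b assume [simp]: "W \<in> Obj C" "a \<in> Hom C B W" "b \<in> Hom C A W"
    show "\<exists>!w. w \<in> Hom C S W \<and> Cmp C B S W w j = a \<and> Cmp C A S W w i = b"
    proof (rule ex1I[of _ "Pls C S W (Cmp C S A W b q) (Cmp C S B W a r)"])
      fix w assume w: "w \<in> Hom C S W \<and> Cmp C B S W w j = a \<and> Cmp C A S W w i = b"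
      show "w = Pls C S W (Cmp C S A W b q) (Cmp C S B W a r)"
        using biproduct_decomp_out[OF assms, of W w] w by auto
    qed (auto simp: cmp_plsl cmp_assoc)
  qed (use N in auto)
  then show ?thesis using infl_pushout N(2) by blast
qed

text \<open>A morphism into a biproduct with a component that is an inflation: it is the composite of
  the graph of the other component, a split inflation, with a pushout of the inflation.\<close>

lemma infl_component:
  assumes b: "is_biproduct C A B S i j q r" and m: "m \<in> Hom C X S"
    and f: "inflation E X A (Cmp C X S A q m)"
  shows "inflation E X S m"
proof -
  note [simp] = is_biproductD[OF b]
  define k where "k = Cmp C X S A q m"
  define f where "f = Cmp C X S B r m"
  have X [simp]: "X \<in> Obj C" using f unfolding inflation_def using confD by blast
  note [simp] = m
  have [simp]: "k \<in> Hom C X A" "f \<in> Hom C X B" unfolding k_def f_def by simp_all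
  obtain U i' j' q' r' where U: "is_biproduct C X B U i' j' q' r'"
    using biproduct_ex[of X B] unfolding biproduct_iff by auto
  note [simp] = is_biproductD[OF U]
  \<comment> \<open>\<open>\<gamma>\<close> = (1, f) is the graph of \<open>f\<close>, and
    \<open>v\<close> is k (+) 1 on X (+) B.\<close>
  define \<gamma> where "\<gamma> = Pls C X U i' (Cmp C X B U j' f)"
  define v where "v = Pls C U S (Cmp C U A S i (Cmp C U X A k q')) (Cmp C U B S j r')"
  have [simp]: "\<gamma> \<in> Hom C X U" "v \<in> Hom C U S" unfolding \<gamma>_def v_def by auto
  \<comment> \<open>The graph is a coprojection for new coordinates on X (+) B, in which the
    projection onto \<open>B\<close> is r' - f q'.\<close>
  have "is_biproduct C X B U \<gamma> j' q' (Pls C U B r' (neg U B (Cmp C U X B f q')))"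
    unfolding is_biproduct_def \<gamma>_def
    apply (simp add: cmp_plsl cmp_plsr cmp_assoc cmp_negl cmp_negr biproduct_ctx[OF U])
    apply (subst pls_left_comm, simp_all)
    apply (simp add: pls_assoc is_biproductD(12)[OF is_biproduct_commute[OF U]])
    done
  then have \<gamma>: "inflation E X U \<gamma>" by (rule coproj_infl)
  have "is_pushout C X A U S k i' i v"
    unfolding is_pushout_def
  proof (intro conjI ballI impI)
    show "Cmp C X A S i k = Cmp C X U S v i'"
      unfolding v_def by (simp add: cmp_plsl cmp_assoc)
    fix W a b' assume [simp]: "W \<in> Obj C" "a \<in> Hom C A W" "b' \<in> Hom C U W"
      and e: "Cmp C X A W a k = Cmp C X U W b' i'"
    have v1: "Cmp C B U S v j' = j" unfolding v_def by (simp add: cmp_plsl cmp_assoc)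
    have v2: "Cmp C X U S v i' = Cmp C X A S i k" unfolding v_def by (simp add: cmp_plsl cmp_assoc)
    show "\<exists>!w. w \<in> Hom C S W \<and> Cmp C A S W w i = a \<and> Cmp C U S W w v = b'"
    proof (rule ex1I[of _ "Pls C S W (Cmp C S A W a q) (Cmp C S B W (Cmp C B U W b' j') r)"], intro conjI)
      let ?w = "Pls C S W (Cmp C S A W a q) (Cmp C S B W (Cmp C B U W b' j') r)"
      show "Cmp C U S W ?w v = b'"
        by (rule biproduct_out_eqI[OF U, of W])
          (auto simp: cmp_plsl cmp_assoc v1 v2 e biproduct_ctx[OF b])
      fix w assume w: "w \<in> Hom C S W \<and> Cmp C A S W w i = a \<and> Cmp C U S W w v = b'"
      then have w' [simp]: "w \<in> Hom C S W" by simp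
      have "Cmp C B S W w j = Cmp C B U W b' j'"
        using w by (auto simp: cmp_assoc v1)
      then show "w = ?w"
        using biproduct_decomp_out[OF b, of W w] w by auto
    qed (auto simp: cmp_plsl cmp_assoc)
  qed auto
  then have "inflation E U S v" using infl_pushout f unfolding k_def by blast
  from infl_cmp[OF \<gamma> this] have "inflation E X S (Cmp C X U S v \<gamma>)" .
  moreover have "Cmp C X U S v \<gamma> = m"
    by (rule biproduct_in_eqI[OF b, of X])
     (auto simp: v_def \<gamma>_def cmp_plsl cmp_plsr cmp_assoc biproduct_ctx[OF U] biproduct_ctx[OF b] k_def f_def)
  ultimately show ?thesis by simp
qed

end

context excat
begin

lemma defl_pullback:
  assumes "is_pullback C X A B S d f j g" "deflation E A X d"
  shows "deflation E S B g"
  using excat.infl_pushout[OF op_excat, of X A B S d f j g] assms by simp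

lemma defl_component:
  assumes "is_biproduct C A B S i j q r" "m \<in> Hom C S X" "deflation E A X (Cmp C A S X m i)"
  shows "deflation E S X m"
  using excat.infl_component[OF op_excat, of A B S q r i j m X] assms by simp

text \<open>An inflation comes with one cokernel by definition; uniqueness of cokernels lets every
  other one take its place.\<close>

lemma conf_of_cokernel:
  assumes "inflation E X Y i" "is_cokernel C X Y Z i d" "Z \<in> Obj C"
  shows "(X, Y, Z, i, d) \<in> E"
proof -
  obtain Z' d' where E: "(X, Y, Z', i, d') \<in> E" using assms(1) unfolding inflation_def by auto
  note [simp] = confD[OF E] assms(3)
  have [simp]: "d \<in> Hom C Y Z" "Cmp C X Y Z d i = Zer C X Z" using assms(2) unfolding is_cokernel_def by auto
  obtain w where w [simp]: "w \<in> Hom C Z' Z" "Cmp C Y Z' Z w d' = d"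
    using cokernelD[OF confD(5)[OF E], of Z d] by auto
  obtain w' where w' [simp]: "w' \<in> Hom C Z Z'" "Cmp C Y Z Z' w' d = d'"
    using cokernelD[OF assms(2), of Z' d'] by auto
  have "Cmp C Z' Z Z' w' w = Idn C Z'"
    by (rule cokernel_epi[OF confD(5)[OF E], of Z']) (auto simp: cmp_assoc)
  moreover have "Cmp C Z Z' Z w w' = Idn C Z"
    by (rule cokernel_epi[OF assms(2), of Z]) (auto simp: cmp_assoc)
  ultimately have "iso_mor C Z' Z w" unfolding iso_mor_def by auto
  then show ?thesis
    by (intro conf_iso[OF E, where a = "Idn C X" and b = "Idn C Y" and c = w]) (auto simp: iso_mor_idn)
qed

end

context excat
begin

lemma conf_of_kernel:
  assumes "deflation E Y Z d" "is_kernel C X Y Z i d" "X \<in> Obj C"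
  shows "(X, Y, Z, i, d) \<in> E"
  using excat.conf_of_cokernel[OF op_excat, of Z Y d X i] assms by simp

text \<open>The obscure axiom, for a morphism that already has a kernel and is its cokernel.\<close>

lemma conf_of_factor_infl:
  assumes k: "is_kernel C X Y Z f d" and c: "is_cokernel C X Y Z f d"
    and ob [simp]: "X \<in> Obj C" "Y \<in> Obj C" "Z \<in> Obj C" "I \<in> Obj C"
    and t [simp]: "t \<in> Hom C Y I" and tf: "inflation E X I (Cmp C X Y I t f)"
  shows "(X, Y, Z, f, d) \<in> E"
proof -
  have [simp]: "f \<in> Hom C X Y" "d \<in> Hom C Y Z" "Cmp C X Y Z d f = Zer C X Z"
    using k unfolding is_kernel_def by auto
  obtain S y i qy qi where S: "is_biproduct C Y I S y i qy qi"
    using biproduct_ex[of Y I] unfolding biproduct_iff by auto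
  note [simp] = is_biproductD[OF S]
  \<comment> \<open>A shear of Y (+) I: in the new coordinates the \<open>I\<close>-component of the
    morphism (f, 0) is \<open>t f\<close>, which is an inflation.\<close>
  have S': "is_biproduct C I Y S i (Pls C Y S y (neg Y S (Cmp C Y I S i t)))
      (Pls C S I qi (Cmp C S Y I t qy)) qy"
    unfolding is_biproduct_def
    apply (simp add: cmp_plsl cmp_plsr cmp_assoc cmp_negl cmp_negr biproduct_ctx[OF S])
    using is_biproductD(12)[OF S] is_biproductD(12)[OF is_biproduct_commute[OF S]]
    apply (simp add: pls_assoc)
    apply (subst pls_comm[of S S "Cmp C S Y S y qy"], simp_all)
    done
  define m where "m = Cmp C X Y S y f"
  have [simp]: "m \<in> Hom C X S" unfolding m_def by simp
  have "Cmp C X S I (Pls C S I qi (Cmp C S Y I t qy)) m = Cmp C X Y I t f"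
    unfolding m_def by (simp add: cmp_plsl cmp_assoc biproduct_ctx[OF S])
  then have "inflation E X S m" using infl_component[OF S', of m X] tf by simp
  then obtain W e where W: "(X, S, W, m, e) \<in> E" unfolding inflation_def by auto
  note [simp] = confD[OF W]
  have "Cmp C X Y W (Cmp C Y S W e y) f = Zer C X W"
    using confD(8)[OF W] unfolding m_def by (simp add: cmp_assoc)
  then obtain z where z [simp]: "z \<in> Hom C Z W" "Cmp C Y Z W z d = Cmp C Y S W e y"
    using cokernelD[OF c, of W "Cmp C Y S W e y"] by auto
  \<comment> \<open>The cokernel \<open>W\<close> of (f, 0) behaves like Z (+) I: \<open>z\<close>
    embeds \<open>Z\<close>, and \<open>z'\<close> and \<open>w\<close> are the projections.\<close>
  have "Cmp C X S I qi m = Zer C X I" unfolding m_def by (simp add: biproduct_ctx[OF S])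
  then obtain w where w [simp]: "w \<in> Hom C W I" "Cmp C S W I w e = qi"
    using cokernelD[OF confD(5)[OF W], of I qi] by auto
  have "Cmp C X S Z (Cmp C S Y Z d qy) m = Zer C X Z"
    unfolding m_def by (simp add: cmp_assoc biproduct_ctx[OF S])
  then obtain z' where z' [simp]: "z' \<in> Hom C W Z" "Cmp C S W Z z' e = Cmp C S Y Z d qy"
    using cokernelD[OF confD(5)[OF W], of Z "Cmp C S Y Z d qy"] by auto
  have wz: "Cmp C Z W I w z = Zer C Z I"
    by (rule cokernel_epi[OF c, of I]) (auto simp: cmp_assoc cmp_ctx[OF w(2)])
  have zz: "Cmp C Z W Z z' z = Idn C Z"
    by (rule cokernel_epi[OF c, of Z]) (auto simp: cmp_assoc cmp_ctx[OF z'(2)])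
  \<comment> \<open>Over the image of \<open>z\<close> the \<open>I\<close>-component vanishes, so
    the fibre product is \<open>Y\<close> with \<open>d\<close>; deflations are stable under
    pullback.\<close>
  have "is_pullback C W S Z Y e z y d"
    unfolding is_pullback_def
  proof (intro conjI ballI impI)
    fix V a b assume [simp]: "V \<in> Obj C" "a \<in> Hom C V S" "b \<in> Hom C V Z"
      and e: "Cmp C V S W e a = Cmp C V Z W z b"
    have "Cmp C V S I qi a = Cmp C V W I w (Cmp C V S W e a)"
      by (subst cmp_ctx[OF w(2)]) simp_all
    also have "\<dots> = Zer C V I"
      unfolding e by (subst cmp_ctx[OF wz]) simp_all
    finally have a: "Cmp C V Y S y (Cmp C V S Y qy a) = a"
      using biproduct_decomp_in[OF S, of V a] by simp
    have "Cmp C V W Z z' (Cmp C V S W e a) = b"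
      unfolding e by (subst cmp_ctx[OF zz]) simp_all
    then have b: "Cmp C V Y Z d (Cmp C V S Y qy a) = b"
      using cmp_ctx[OF z'(2), of V a] by (simp add: cmp_assoc)
    show "\<exists>!x. x \<in> Hom C V Y \<and> Cmp C V Y S y x = a \<and> Cmp C V Y Z d x = b"
    proof (rule ex1I[of _ "Cmp C V S Y qy a"])
      fix x assume "x \<in> Hom C V Y \<and> Cmp C V Y S y x = a \<and> Cmp C V Y Z d x = b"
      then show "x = Cmp C V S Y qy a" using biproduct_ctx(1)[OF S, of V x] by auto
    qed (use a b in auto)
  qed auto
  moreover have "deflation E S W e" using W unfolding deflation_def by blast
  ultimately have "deflation E Y Z d" by (rule defl_pullback)
  then show ?thesis using k by (rule conf_of_kernel) simp
qed

end

context excat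
begin

lemma conf_of_factor_defl:
  assumes "is_kernel C X Y Z f d" "is_cokernel C X Y Z f d"
    "X \<in> Obj C" "Y \<in> Obj C" "Z \<in> Obj C" "P \<in> Obj C"
    "t \<in> Hom C P Y" "deflation E P Z (Cmp C P Y Z d t)"
  shows "(X, Y, Z, f, d) \<in> E"
  using excat.conf_of_factor_infl[OF op_excat, of Z Y X d f P t] assms by simp

text \<open>A morphism of conflations that is the identity on the right has a pushout square on the left.
  Here the middle term \<open>P\<close> is such that \<open>P \<oplus> Y\<close> is the pullback of the two deflations.\<close>

lemma pushout_of_conf_mor:
  assumes E1: "(V, P, T, i, d) \<in> E" and E2: "(Y, B, T, g, h) \<in> E"
    and j: "j \<in> Hom C P B" "Cmp C P B T h j = d" and f: "f \<in> Hom C V Y" "Cmp C V Y B g f = Cmp C V P B j i"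
  shows "is_pushout C V P Y B i f j g"
proof -
  note [simp] = confD[OF E1] confD[OF E2] j f
  have fc: "Cmp C W Y B g (Cmp C W V Y f t) = Cmp C W P B j (Cmp C W V P i t)"
    if "W \<in> Obj C" "t \<in> Hom C W V" for W t
    using that by (simp add: cmp_ctx[OF f(2)] cmp_assoc)
  obtain Q p y qp qy where Q: "is_biproduct C P Y Q p y qp qy"
    using biproduct_ex[of P Y] unfolding biproduct_iff by auto
  note [simp] = is_biproductD[OF Q]
  \<comment> \<open>\<open>s\<close> = (j, g). It turns out to be a deflation whose kernel factors
    through (i, -f).\<close>
  define s where "s = Pls C Q B (Cmp C Q P B j qp) (Cmp C Q Y B g qy)"
  have s [simp]: "s \<in> Hom C Q B" unfolding s_def by simp
  have sp: "Cmp C P Q B s p = j" and sy: "Cmp C Y Q B s y = g"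
    unfolding s_def by (simp_all add: cmp_plsl cmp_assoc)
  have hs: "Cmp C Q B T h s = Cmp C Q P T d qp"
    unfolding s_def by (simp add: cmp_plsr cmp_ctx[OF j(2)] cmp_ctx[OF confD(8)[OF E2]])
  have "is_pullback C T P B Q d h qp s"
    unfolding is_pullback_def
  proof (intro conjI ballI impI)
    fix W a b assume [simp]: "W \<in> Obj C" "a \<in> Hom C W P" "b \<in> Hom C W B"
      and e: "Cmp C W P T d a = Cmp C W B T h b"
    have "Cmp C W B T h (Pls C W B (neg W B (Cmp C W P B j a)) b) = Zer C W T"
      by (simp add: cmp_plsr cmp_negr cmp_ctx[OF j(2)] e)
    then obtain c where c [simp]: "c \<in> Hom C W Y" "Cmp C W Y B g c = Pls C W B (neg W B (Cmp C W P B j a)) b"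
      using kernelD[OF confD(4)[OF E2], of W "Pls C W B (neg W B (Cmp C W P B j a)) b"] by auto
    show "\<exists>!w. w \<in> Hom C W Q \<and> Cmp C W Q P qp w = a \<and> Cmp C W Q B s w = b"
    proof (rule ex1I[of _ "Pls C W Q (Cmp C W P Q p a) (Cmp C W Y Q y c)"])
      show "Pls C W Q (Cmp C W P Q p a) (Cmp C W Y Q y c) \<in> Hom C W Q \<and>
        Cmp C W Q P qp (Pls C W Q (Cmp C W P Q p a) (Cmp C W Y Q y c)) = a \<and>
        Cmp C W Q B s (Pls C W Q (Cmp C W P Q p a) (Cmp C W Y Q y c)) = b"
        by (simp add: cmp_plsr biproduct_ctx[OF Q] cmp_ctx[OF sp] cmp_ctx[OF sy])
      fix w assume w: "w \<in> Hom C W Q \<and> Cmp C W Q P qp w = a \<and> Cmp C W Q B s w = b"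
      then have [simp]: "w \<in> Hom C W Q" by simp
      have "b = Pls C W B (Cmp C W P B j a) (Cmp C W Y B g (Cmp C W Q Y qy w))"
        using w unfolding s_def by (auto simp: cmp_plsl cmp_assoc)
      then have "Cmp C W Y B g (Cmp C W Q Y qy w) = Cmp C W Y B g c" by simp
      then have "Cmp C W Q Y qy w = c"
        by - (rule kernel_mono[OF confD(4)[OF E2], of W], auto)
      then show "w = Pls C W Q (Cmp C W P Q p a) (Cmp C W Y Q y c)"
        using w by - (rule biproduct_in_eqI[OF Q, of W], auto simp: cmp_plsr biproduct_ctx[OF Q])
    qed
  qed (auto simp: hs)
  moreover have "deflation E P T d" using E1 unfolding deflation_def by blast
  ultimately have "deflation E Q B s" by (rule defl_pullback)
  then obtain K k where K: "(K, Q, B, k, s) \<in> E" unfolding deflation_def by auto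
  note [simp] = confD[OF K]
  have "Cmp C K P T d (Cmp C K Q P qp k) = Cmp C K B T h (Cmp C K Q B s k)"
    by (subst cmp_ctx[OF hs]) (auto simp: cmp_assoc)
  then obtain v where v [simp]: "v \<in> Hom C K V" "Cmp C K V P i v = Cmp C K Q P qp k"
    using kernelD[OF confD(4)[OF E1], of K "Cmp C K Q P qp k"] by auto
  have "Pls C K B (Cmp C K P B j (Cmp C K Q P qp k)) (Cmp C K Y B g (Cmp C K Q Y qy k)) = Zer C K B"
    using confD(8)[OF K] unfolding s_def by (simp add: cmp_plsl cmp_assoc)
  then have "Cmp C K Y B g (Cmp C K Q Y qy k) = neg K B (Cmp C K P B j (Cmp C K Q P qp k))"
    by (intro neg_unique) simp_all
  also have "\<dots> = Cmp C K Y B g (neg K Y (Cmp C K V Y f v))"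
    by (simp add: cmp_negr fc)
  finally have qyk: "Cmp C K Q Y qy k = neg K Y (Cmp C K V Y f v)"
    by - (rule kernel_mono[OF confD(4)[OF E2], of K], auto)
  \<comment> \<open>A pair (a, b) that agrees on \<open>V\<close> vanishes on the kernel of
    \<open>s\<close>, as \<open>qp k = i v\<close> and \<open>qy k = - f v\<close>, and therefore
    descends to \<open>B\<close>.\<close>
  show ?thesis
    unfolding is_pushout_def
  proof (intro conjI ballI impI)
    fix W a b assume [simp]: "W \<in> Obj C" "a \<in> Hom C P W" "b \<in> Hom C Y W"
      and e: "Cmp C V P W a i = Cmp C V Y W b f"
    define c where "c = Pls C Q W (Cmp C Q P W a qp) (Cmp C Q Y W b qy)"
    have [simp]: "c \<in> Hom C Q W" unfolding c_def by simp
    have cp: "Cmp C P Q W c p = a" and cy: "Cmp C Y Q W c y = b"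
      unfolding c_def by (simp_all add: cmp_plsl cmp_assoc)
    have "Cmp C K Q W c k = Pls C K W (Cmp C K P W a (Cmp C K V P i v)) (Cmp C K Y W b (Cmp C K Q Y qy k))"
      unfolding c_def by (simp add: cmp_plsl cmp_assoc)
    also have "\<dots> = Zer C K W"
      using cmp_ctx[OF e, of K v] unfolding qyk by (simp add: cmp_negr cmp_assoc)
    finally obtain w where w [simp]: "w \<in> Hom C B W" "Cmp C Q B W w s = c"
      using cokernelD[OF confD(5)[OF K], of W c] by auto
    show "\<exists>!w. w \<in> Hom C B W \<and> Cmp C P B W w j = a \<and> Cmp C Y B W w g = b"
    proof (rule ex1I[of _ w], intro conjI)
      show "Cmp C P B W w j = a"
        by (subst sp[symmetric], subst cmp_assoc[symmetric]) (simp_all add: cp)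
      show "Cmp C Y B W w g = b"
        by (subst sy[symmetric], subst cmp_assoc[symmetric]) (simp_all add: cy)
      fix w' assume w': "w' \<in> Hom C B W \<and> Cmp C P B W w' j = a \<and> Cmp C Y B W w' g = b"
      then have [simp]: "w' \<in> Hom C B W" by simp
      have "Cmp C Q B W w' s = c"
        by (rule biproduct_out_eqI[OF Q, of W]) (use w' in \<open>auto simp: cmp_assoc sp sy cp cy\<close>)
      then show "w' = w" by - (rule cokernel_epi[OF confD(5)[OF K], of W], auto)
    qed simp
  qed auto
qed

end

context addcat
begin

text \<open>A biproduct decomposition yields the idempotent \<open>i q\<close>; if it is zero the
  first summand vanishes, and if it is the identity the second does.\<close>

lemma indecomposableI:
  assumes "X \<in> Obj C" "\<not> zero_obj C X"
    and idem: "\<And>e. \<lbrakk>e \<in> Hom C X X; Cmp C X X X e e = e\<rbrakk> \<Longrightarrow> e = Zer C X X \<or> e = Idn C X"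
  shows "indecomposable C X"
  unfolding indecomposable_def
proof (intro conjI assms allI impI)
  fix A B assume "biproduct C A B X"
  then obtain i j q r where b: "is_biproduct C A B X i j q r" unfolding biproduct_iff by auto
  note [simp] = is_biproductD[OF b]
  have zero: "zero_obj C A'" if b': "is_biproduct C A' B' X i' j' q' r'" and e: "Cmp C X A' X i' q' = Zer C X X" for A' B' i' j' q' r'
  proof -
    note [simp] = is_biproductD[OF b']
    have "Idn C A' = Cmp C A' X A' q' (Cmp C A' X X (Cmp C X A' X i' q') i')"
      by (simp add: cmp_assoc biproduct_ctx[OF b'])
    then show ?thesis unfolding e zero_obj_def by simp
  qed
  have "Cmp C X X X (Cmp C X A X i q) (Cmp C X A X i q) = Cmp C X A X i q"
    by (simp add: cmp_assoc biproduct_ctx[OF b])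
  then consider "Cmp C X A X i q = Zer C X X" | "Cmp C X A X i q = Idn C X"
    using idem[of "Cmp C X A X i q"] by auto
  then show "zero_obj C A \<or> zero_obj C B"
  proof cases
    case 1 then show ?thesis using zero[OF b] by blast
  next
    case 2
    have "Pls C X X (Idn C X) (Cmp C X B X j r) = Pls C X X (Idn C X) (Zer C X X)"
      using is_biproductD(12)[OF b] unfolding 2 by simp
    then have "Cmp C X B X j r = Zer C X X" by - (rule pls_cancel[of X X "Idn C X"], auto)
    then show ?thesis using zero[OF is_biproduct_commute[OF b]] by blast
  qed
qed

end

section \<open>Closure properties of projective objects\<close>

context excat
begin

lemma projective_retract:
  assumes P: "projective_obj C E P" and [simp]: "A \<in> Obj C" "i \<in> Hom C A P" "q \<in> Hom C P A" and qi: "Cmp C A P A q i = Idn C A"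
  shows "projective_obj C E A"
  unfolding projective_obj_def
proof (intro conjI allI impI ballI)
  fix Y Z d f assume d: "deflation E Y Z d" and [simp]: "f \<in> Hom C A Z"
  obtain V k where V: "(V, Y, Z, k, d) \<in> E" using d unfolding deflation_def by auto
  note [simp] = confD[OF V]
  have [simp]: "P \<in> Obj C" using P unfolding projective_obj_def by auto
  have "Cmp C P A Z f q \<in> Hom C P Z" by simp
  then obtain g where g [simp]: "g \<in> Hom C P Y" "Cmp C P Y Z d g = Cmp C P A Z f q"
    using P d unfolding projective_obj_def by blast
  have "Cmp C A Y Z d (Cmp C A P Y g i) = f"
    by (subst cmp_ctx[OF g(2)]) (simp_all add: cmp_assoc qi)
  then show "\<exists>g \<in> Hom C A Y. Cmp C A Y Z d g = f" by (intro bexI[of _ "Cmp C A P Y g i"]) auto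
qed simp

lemma projective_biproduct:
  assumes b: "is_biproduct C A B S i j q r" and A: "projective_obj C E A" and B: "projective_obj C E B"
  shows "projective_obj C E S"
  unfolding projective_obj_def
proof (intro conjI allI impI ballI)
  note [simp] = is_biproductD[OF b]
  show "S \<in> Obj C" by simp
  fix Y Z d f assume d: "deflation E Y Z d" and [simp]: "f \<in> Hom C S Z"
  obtain V k where V: "(V, Y, Z, k, d) \<in> E" using d unfolding deflation_def by auto
  note [simp] = confD[OF V]
  have "Cmp C A S Z f i \<in> Hom C A Z" "Cmp C B S Z f j \<in> Hom C B Z" by simp_all
  then obtain g h where g [simp]: "g \<in> Hom C A Y" "Cmp C A Y Z d g = Cmp C A S Z f i"
    and h [simp]: "h \<in> Hom C B Y" "Cmp C B Y Z d h = Cmp C B S Z f j"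
    using A B d unfolding projective_obj_def by meson
  have "Cmp C S Y Z d (Pls C S Y (Cmp C S A Y g q) (Cmp C S B Y h r)) = f"
    by (simp add: cmp_plsr cmp_ctx[OF g(2)] cmp_ctx[OF h(2)] biproduct_decomp_out[OF b])
  then show "\<exists>g \<in> Hom C S Y. Cmp C S Y Z d g = f"
    by (intro bexI[of _ "Pls C S Y (Cmp C S A Y g q) (Cmp C S B Y h r)"]) auto
qed

end

section \<open>The stable category\<close>

text \<open>The properties on which the stable category and its triangles are built.
  \<open>conf_mor_pushout\<close> stands for the axioms on pushouts; like the others, it passes to
  equivariant objects by averaging.\<close>

locale frobcat = addcat C for C :: "('o, 'm) precat" +
  fixes E :: "('o, 'm) conflation set"
  assumes conf: "(X, Y, Z, i, d) \<in> E \<Longrightarrow> X \<in> Obj C \<and> Y \<in> Obj C \<and> Z \<in> Obj C \<and>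
        is_kernel C X Y Z i d \<and> is_cokernel C X Y Z i d"
    and proj_inj: "projective_obj C E X \<longleftrightarrow> injective_obj C E X"
    and enough_inj: "X \<in> Obj C \<Longrightarrow> \<exists>I W i d. injective_obj C E I \<and> (X, I, W, i, d) \<in> E"
    and enough_proj: "X \<in> Obj C \<Longrightarrow> \<exists>V P i d. projective_obj C E P \<and> (V, P, X, i, d) \<in> E"
    and conf_mor_pushout: "\<lbrakk>(V, P, T, i, d) \<in> E; (Y, B, T, g, h) \<in> E; j \<in> Hom C P B; Cmp C P B T h j = d;
        f \<in> Hom C V Y; Cmp C V Y B g f = Cmp C V P B j i\<rbrakk> \<Longrightarrow> is_pushout C V P Y B i f j g"
begin

lemma confD:
  assumes "(X, Y, Z, i, d) \<in> E"
  shows "X \<in> Obj C" "Y \<in> Obj C" "Z \<in> Obj C" "is_kernel C X Y Z i d" "is_cokernel C X Y Z i d"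
    "i \<in> Hom C X Y" "d \<in> Hom C Y Z" "Cmp C X Y Z d i = Zer C X Z"
  using conf[OF assms] by (auto simp: is_kernel_def)

abbreviation "N \<equiv> stably_null C E"
abbreviation "cl \<equiv> stable_class C E"
abbreviation "D \<equiv> stable_category C E"

section \<open>The ideal of stably null morphisms\<close>

lemma inj_Obj: "injective_obj C E I \<Longrightarrow> I \<in> Obj C"
  unfolding injective_obj_def by auto

lemma nullI:
  "\<lbrakk>injective_obj C E P; a \<in> Hom C X P; b \<in> Hom C P Y\<rbrakk> \<Longrightarrow> Cmp C X P Y b a \<in> N X Y"
  unfolding stably_null_def using proj_inj by blast

lemma nullE:
  assumes "f \<in> N X Y"
  obtains P a b where "injective_obj C E P" "projective_obj C E P" "P \<in> Obj C" "a \<in> Hom C X P" "b \<in> Hom C P Y"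
    "f = Cmp C X P Y b a"
  using assms unfolding stably_null_def using inj_Obj by blast

lemma inj_biproduct:
  assumes b: "is_biproduct C A B S i j q r" and "injective_obj C E A" "injective_obj C E B"
  shows "injective_obj C E S"
  unfolding injective_obj_def
proof (intro conjI allI impI ballI)
  note [simp] = is_biproductD[OF b]
  show "S \<in> Obj C" by simp
  fix X Y k f assume k: "inflation E X Y k" and f [simp]: "f \<in> Hom C X S"
  obtain Z d where "(X, Y, Z, k, d) \<in> E" using k unfolding inflation_def by auto
  note [simp] = confD[OF this]
  obtain g where g [simp]: "g \<in> Hom C Y A" "Cmp C X Y A g k = Cmp C X S A q f"
    using assms(2) k unfolding injective_obj_def by (metis b cmp_in f is_biproductD(1,3,6) \<open>X \<in> Obj C\<close>)
  obtain h where h [simp]: "h \<in> Hom C Y B" "Cmp C X Y B h k = Cmp C X S B r f"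
    using assms(3) k unfolding injective_obj_def by (metis b cmp_in f is_biproductD(2,3,7) \<open>X \<in> Obj C\<close>)
  have "Cmp C X Y S (Pls C Y S (Cmp C Y A S i g) (Cmp C Y B S j h)) k = f"
    by (simp add: cmp_plsl cmp_assoc biproduct_decomp_in[OF b])
  then show "\<exists>g \<in> Hom C Y S. Cmp C X Y S g k = f"
    by (intro bexI[of _ "Pls C Y S (Cmp C Y A S i g) (Cmp C Y B S j h)"]) auto
qed

lemma null_in [simp]: "f \<in> N X Y \<Longrightarrow> X \<in> Obj C \<Longrightarrow> Y \<in> Obj C \<Longrightarrow> f \<in> Hom C X Y"
  by (auto elim!: nullE)

lemma null_zer [simp]: "X \<in> Obj C \<Longrightarrow> Y \<in> Obj C \<Longrightarrow> Zer C X Y \<in> N X Y"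
proof -
  assume [simp]: "X \<in> Obj C" "Y \<in> Obj C"
  obtain I where I: "injective_obj C E I" using enough_inj[of X] by auto
  then have [simp]: "I \<in> Obj C" by (rule inj_Obj)
  show ?thesis using nullI[OF I, of "Zer C X I" X "Zer C I Y" Y] by simp
qed

lemma null_cmpl:
  assumes "f \<in> N X Y" "g \<in> Hom C Y Z" and [simp]: "X \<in> Obj C" "Y \<in> Obj C" "Z \<in> Obj C"
  shows "Cmp C X Y Z g f \<in> N X Z"
proof -
  obtain P a b where P: "injective_obj C E P" and [simp]: "P \<in> Obj C" "a \<in> Hom C X P" "b \<in> Hom C P Y"
    "f = Cmp C X P Y b a" using assms(1) by (rule nullE)
  show ?thesis using nullI[OF P, of a X "Cmp C P Y Z g b" Z] assms by (simp add: cmp_assoc)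
qed

lemma null_cmpr:
  assumes "f \<in> N Y Z" "g \<in> Hom C X Y" and [simp]: "X \<in> Obj C" "Y \<in> Obj C" "Z \<in> Obj C"
  shows "Cmp C X Y Z f g \<in> N X Z"
proof -
  obtain P a b where P: "injective_obj C E P" and [simp]: "P \<in> Obj C" "a \<in> Hom C Y P" "b \<in> Hom C P Z"
    "f = Cmp C Y P Z b a" using assms(1) by (rule nullE)
  show ?thesis using nullI[OF P, of "Cmp C X Y P a g" X b Z] assms by (simp add: cmp_assoc)
qed

lemma null_neg [simp]:
  assumes "f \<in> N X Y" and [simp]: "X \<in> Obj C" "Y \<in> Obj C"
  shows "neg X Y f \<in> N X Y"
  using null_cmpl[OF assms(1), of "neg Y Y (Idn C Y)" Y] assms by (simp add: cmp_negl)

text \<open>Two factorisations combine into one through the biproduct of the middle terms, which is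
  again injective.\<close>

lemma null_pls [simp]:
  assumes "f \<in> N X Y" "g \<in> N X Y" and [simp]: "X \<in> Obj C" "Y \<in> Obj C"
  shows "Pls C X Y f g \<in> N X Y"
proof -
  obtain P a b where P: "injective_obj C E P" and [simp]: "P \<in> Obj C" "a \<in> Hom C X P" "b \<in> Hom C P Y"
    "f = Cmp C X P Y b a" using assms(1) by (rule nullE)
  obtain P' a' b' where P': "injective_obj C E P'" and [simp]: "P' \<in> Obj C" "a' \<in> Hom C X P'" "b' \<in> Hom C P' Y"
    "g = Cmp C X P' Y b' a'" using assms(2) by (rule nullE)
  obtain S i j q r where S: "is_biproduct C P P' S i j q r"
    using biproduct_ex[of P P'] unfolding biproduct_iff by auto
  note [simp] = is_biproductD[OF S]
  have "Pls C X Y f g = Cmp C X S Y (Pls C S Y (Cmp C S P Y b q) (Cmp C S P' Y b' r))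
      (Pls C X S (Cmp C X P S i a) (Cmp C X P' S j a'))"
    by (simp add: cmp_plsl cmp_plsr cmp_assoc biproduct_ctx[OF S])
  then show ?thesis using nullI[OF inj_biproduct[OF S P P']] by simp
qed

section \<open>Residue classes and the additive structure of the stable category\<close>

lemma cl_self: "X \<in> Obj C \<Longrightarrow> Y \<in> Obj C \<Longrightarrow> f \<in> Hom C X Y \<Longrightarrow> f \<in> cl X Y f"
  unfolding stable_class_def by (auto intro!: exI[of _ "Zer C X Y"])

lemma cl_eq_iff:
  assumes [simp]: "X \<in> Obj C" "Y \<in> Obj C" "f \<in> Hom C X Y" "g \<in> Hom C X Y"
  shows "cl X Y f = cl X Y g \<longleftrightarrow> Pls C X Y f (neg X Y g) \<in> N X Y"
proof
  assume "cl X Y f = cl X Y g"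
  moreover have "f \<in> cl X Y f" by (rule cl_self) simp_all
  ultimately have "f \<in> cl X Y g" by simp
  then obtain h where [simp]: "h \<in> N X Y" and f: "f = Pls C X Y g h" unfolding stable_class_def by auto
  have "Pls C X Y f (neg X Y g) = h" unfolding f by (simp add: pls_comm[of X Y g h] pls_assoc)
  then show "Pls C X Y f (neg X Y g) \<in> N X Y" by simp
next
  assume *: "Pls C X Y f (neg X Y g) \<in> N X Y"
  have sub: "cl X Y f \<subseteq> cl X Y g" if [simp]: "f \<in> Hom C X Y" "g \<in> Hom C X Y" and *: "Pls C X Y f (neg X Y g) \<in> N X Y" for f g
  proof
    fix x assume "x \<in> cl X Y f"
    then obtain h where [simp]: "h \<in> N X Y" and x: "x = Pls C X Y f h" unfolding stable_class_def by auto
    have "Pls C X Y f h = Pls C X Y g (Pls C X Y (Pls C X Y f (neg X Y g)) h)"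
      by (simp add: pls_assoc pls_left_comm[of X Y g f])
    moreover have "Pls C X Y (Pls C X Y f (neg X Y g)) h \<in> N X Y" using * by simp
    ultimately show "x \<in> cl X Y g" unfolding x stable_class_def by blast
  qed
  have "Pls C X Y g (neg X Y f) = neg X Y (Pls C X Y f (neg X Y g))"
    by (rule neg_unique) (simp_all add: pls_assoc)
  then have "Pls C X Y g (neg X Y f) \<in> N X Y" using * by simp
  then show "cl X Y f = cl X Y g" using sub[of f g] sub[of g f] * by auto
qed

lemma cl_plus_null:
  assumes [simp]: "X \<in> Obj C" "Y \<in> Obj C" "f \<in> Hom C X Y" "h \<in> N X Y"
  shows "cl X Y (Pls C X Y f h) = cl X Y f"
proof -
  have "Pls C X Y (Pls C X Y f h) (neg X Y f) = h"
    by (simp add: pls_comm[of X Y f h] pls_assoc)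
  then show ?thesis by (subst cl_eq_iff) auto
qed

lemma D_sel [simp]:
  "Obj D = Obj C" "Hom D X Y = cl X Y ` Hom C X Y" "Idn D X = cl X X (Idn C X)" "Zer D X Y = cl X Y (Zer C X Y)"
  by (simp_all add: stable_category_def)

text \<open>Composition of classes is defined as a union over representatives. Each pair contributes
  the same class, since the error terms \<open>h f\<close>, \<open>g k\<close> and
  \<open>h k\<close> are null.\<close>

lemma D_cmp [simp]:
  assumes [simp]: "X \<in> Obj C" "Y \<in> Obj C" "Z \<in> Obj C" "f \<in> Hom C X Y" "g \<in> Hom C Y Z"
  shows "Cmp D X Y Z (cl Y Z g) (cl X Y f) = cl X Z (Cmp C X Y Z g f)"
proof -
  have *: "cl X Z (Cmp C X Y Z g' f') = cl X Z (Cmp C X Y Z g f)" if g': "g' \<in> cl Y Z g" and f': "f' \<in> cl X Y f" for g' f'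
  proof -
    obtain h k where [simp]: "h \<in> N Y Z" "k \<in> N X Y" and e: "g' = Pls C Y Z g h" "f' = Pls C X Y f k"
      using f' g' unfolding stable_class_def by blast
    have "Cmp C X Y Z g' f' = Pls C X Z (Cmp C X Y Z g f)
      (Pls C X Z (Cmp C X Y Z h f) (Pls C X Z (Cmp C X Y Z g k) (Cmp C X Y Z h k)))"
      unfolding e by (simp add: cmp_plsl cmp_plsr pls_assoc)
    moreover have "Pls C X Z (Cmp C X Y Z h f) (Pls C X Z (Cmp C X Y Z g k) (Cmp C X Y Z h k)) \<in> N X Z"
      by (intro null_pls null_cmpl null_cmpr) simp_all
    ultimately show ?thesis by (simp add: cl_plus_null)
  qed
  have "f \<in> cl X Y f" "g \<in> cl Y Z g" by (rule cl_self; simp)+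
  then have ne: "cl X Y f \<noteq> {}" "cl Y Z g \<noteq> {}" by auto
  have "Cmp D X Y Z (cl Y Z g) (cl X Y f) = (\<Union>g'\<in>cl Y Z g. \<Union>f'\<in>cl X Y f. cl X Z (Cmp C X Y Z g' f'))"
    by (simp add: stable_category_def)
  also have "\<dots> = (\<Union>g'\<in>cl Y Z g. \<Union>f'\<in>cl X Y f. cl X Z (Cmp C X Y Z g f))"
    by (intro SUP_cong refl *)
  finally show ?thesis by (simp add: ne)
qed

lemma D_pls [simp]:
  assumes [simp]: "X \<in> Obj C" "Y \<in> Obj C" "f \<in> Hom C X Y" "g \<in> Hom C X Y"
  shows "Pls D X Y (cl X Y f) (cl X Y g) = cl X Y (Pls C X Y f g)"
proof -
  have *: "cl X Y (Pls C X Y f' g') = cl X Y (Pls C X Y f g)" if f': "f' \<in> cl X Y f" and g': "g' \<in> cl X Y g" for g' f'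
  proof -
    obtain h k where [simp]: "h \<in> N X Y" "k \<in> N X Y" and e: "f' = Pls C X Y f h" "g' = Pls C X Y g k"
      using f' g' unfolding stable_class_def by blast
    have "Pls C X Y f' g' = Pls C X Y (Pls C X Y f g) (Pls C X Y h k)"
      unfolding e by (simp add: pls_assoc pls_left_comm[of X Y h g])
    then show ?thesis by (simp add: cl_plus_null)
  qed
  have "f \<in> cl X Y f" "g \<in> cl X Y g" by (rule cl_self; simp)+
  then have ne: "cl X Y f \<noteq> {}" "cl X Y g \<noteq> {}" by auto
  have "Pls D X Y (cl X Y f) (cl X Y g) = (\<Union>f'\<in>cl X Y f. \<Union>g'\<in>cl X Y g. cl X Y (Pls C X Y f' g'))"
    by (simp add: stable_category_def)
  also have "\<dots> = (\<Union>f'\<in>cl X Y f. \<Union>g'\<in>cl X Y g. cl X Y (Pls C X Y f g))"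
    by (intro SUP_cong refl *)
  finally show ?thesis by (simp add: ne)
qed

lemma is_biproduct_D:
  assumes "is_biproduct C A B S i j q r"
  shows "is_biproduct D A B S (cl A S i) (cl B S j) (cl S A q) (cl S B r)"
  using is_biproductD[OF assms] unfolding is_biproduct_def by simp

sublocale D: addcat D
proof
  fix X Y assume "X \<in> Obj D" "Y \<in> Obj D"
  then show "\<exists>S. biproduct D X Y S"
    using biproduct_ex[of X Y] is_biproduct_D unfolding biproduct_iff by auto blast
next
  fix X Y F assume "X \<in> Obj D" "Y \<in> Obj D" "F \<in> Hom D X Y"
  then obtain f where [simp]: "X \<in> Obj C" "Y \<in> Obj C" "f \<in> Hom C X Y" and "F = cl X Y f" by auto
  then show "\<exists>g\<in>Hom D X Y. Pls D X Y F g = Zer D X Y"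
    by (intro bexI[of _ "cl X Y (neg X Y f)"]) auto
qed (auto simp: cmp_assoc pls_assoc cmp_plsl cmp_plsr pls_ac)

lemma D_homE:
  assumes "F \<in> Hom D X Y" obtains f where "f \<in> Hom C X Y" "F = cl X Y f"
  using assms by auto

text \<open>If \<open>a = b k\<close> through an injective \<open>P\<close>, then \<open>k\<close>
  extends over \<open>i\<close>; with \<open>t\<close> the resulting endomorphism of
  \<open>I\<close>, \<open>m\<close> minus \<open>t\<close> kills \<open>i\<close> and hence factors
  as \<open>v d\<close>. As \<open>d t = 0\<close>, this gives \<open>e = d v\<close>, a
  factorisation through \<open>I\<close>.\<close>

lemma null_shift:
  assumes c: "(X, I, W, i, d) \<in> E" and I: "injective_obj C E I"
    and h: "a \<in> Hom C X X" "m \<in> Hom C I I" "e \<in> Hom C W W"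
    and s: "Cmp C X I I m i = Cmp C X X I i a" "Cmp C I W W e d = Cmp C I I W d m"
    and a: "a \<in> N X X"
  shows "e \<in> N W W"
proof -
  note [simp] = confD[OF c] h
  obtain P k b where P: "injective_obj C E P" and [simp]: "P \<in> Obj C" "k \<in> Hom C X P" "b \<in> Hom C P X"
    and a: "a = Cmp C X P X b k" using a by (rule nullE)
  have "inflation E X I i" using c unfolding inflation_def by blast
  then obtain k' where k' [simp]: "k' \<in> Hom C I P" "Cmp C X I P k' i = k"
    using P unfolding injective_obj_def by (metis \<open>k \<in> Hom C X P\<close>)
  define t where "t = Cmp C I X I i (Cmp C I P X b k')"
  have t [simp]: "t \<in> Hom C I I" unfolding t_def by simp
  have ti: "Cmp C X I I t i = Cmp C X X I i a" unfolding t_def a by (simp add: cmp_assoc)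
  have dt: "Cmp C I I W d t = Zer C I W"
    unfolding t_def by (subst cmp_ctx[OF confD(8)[OF c]]) simp_all
  have "Cmp C X I I (Pls C I I m (neg I I t)) i = Zer C X I"
    by (simp add: cmp_plsl cmp_negl s ti)
  then obtain v where v [simp]: "v \<in> Hom C W I" "Cmp C I W I v d = Pls C I I m (neg I I t)"
    using cokernelD[OF confD(5)[OF c], of I "Pls C I I m (neg I I t)"] by auto
  have "Cmp C I W W e d = Cmp C I W W (Cmp C W I W d v) d"
    by (simp add: cmp_assoc cmp_plsr cmp_negr dt s)
  then have "e = Cmp C W I W d v"
    by - (rule cokernel_epi[OF confD(5)[OF c], of W], auto)
  then show ?thesis using nullI[OF I, of v W d W] by simp
qed

text \<open>Dual argument: the factor \<open>b\<close> of \<open>e\<close> lifts through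
  \<open>d\<close>, and \<open>m\<close> minus the resulting \<open>t\<close> factors through the
  kernel \<open>i\<close>.\<close>

lemma null_unshift:
  assumes c: "(X, I, W, i, d) \<in> E" and I: "injective_obj C E I"
    and h: "a \<in> Hom C X X" "m \<in> Hom C I I" "e \<in> Hom C W W"
    and s: "Cmp C X I I m i = Cmp C X X I i a" "Cmp C I W W e d = Cmp C I I W d m"
    and e: "e \<in> N W W"
  shows "a \<in> N X X"
proof -
  note [simp] = confD[OF c] h
  obtain P k b where P: "projective_obj C E P" and [simp]: "P \<in> Obj C" "k \<in> Hom C W P" "b \<in> Hom C P W"
    and e: "e = Cmp C W P W b k" using e by (rule nullE)
  have "deflation E I W d" using c unfolding deflation_def by blast
  then obtain b' where b' [simp]: "b' \<in> Hom C P I" "Cmp C P I W d b' = b"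
    using P unfolding projective_obj_def by (metis \<open>b \<in> Hom C P W\<close>)
  define t where "t = Cmp C I W I (Cmp C W P I b' k) d"
  have t [simp]: "t \<in> Hom C I I" unfolding t_def by simp
  have dt: "Cmp C I I W d t = Cmp C I W W e d"
    unfolding t_def e by (simp add: cmp_assoc cmp_ctx[OF b'(2)])
  have ti: "Cmp C X I I t i = Zer C X I"
    unfolding t_def by (simp add: cmp_assoc)
  have "Cmp C I I W d (Pls C I I m (neg I I t)) = Zer C I W"
    by (simp add: cmp_plsr cmp_negr s dt)
  then obtain v where v [simp]: "v \<in> Hom C I X" "Cmp C I X I i v = Pls C I I m (neg I I t)"
    using kernelD[OF confD(4)[OF c], of I "Pls C I I m (neg I I t)"] by auto
  have "Cmp C X X I i a = Cmp C X X I i (Cmp C X I X v i)"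
    by (subst cmp_ctx[OF v(2)]) (simp_all add: cmp_plsl cmp_negl ti s)
  then have "a = Cmp C X I X v i"
    by - (rule kernel_mono[OF confD(4)[OF c], of X], auto)
  then show ?thesis using nullI[OF I, of i X v X] by simp
qed

section \<open>Morphisms of conflations and the shift\<close>

definition conf_mor :: "'o \<Rightarrow> 'o \<Rightarrow> 'o \<Rightarrow> 'm \<Rightarrow> 'm \<Rightarrow> 'o \<Rightarrow> 'o \<Rightarrow> 'o \<Rightarrow> 'm \<Rightarrow> 'm \<Rightarrow> 'm \<Rightarrow> 'm \<Rightarrow> 'm \<Rightarrow> bool" where
  "conf_mor X I W i d X' I' W' i' d' a m e \<longleftrightarrow>
     a \<in> Hom C X X' \<and> m \<in> Hom C I I' \<and> e \<in> Hom C W W' \<and>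
     Cmp C X I I' m i = Cmp C X X' I' i' a \<and> Cmp C I W W' e d = Cmp C I I' W' d' m"

lemma conf_mor_from_left:
  assumes c: "(X, I, W, i, d) \<in> E" and c': "(X', I', W', i', d') \<in> E" and I': "injective_obj C E I'"
    and a: "a \<in> Hom C X X'"
  obtains m e where "conf_mor X I W i d X' I' W' i' d' a m e"
proof -
  note [simp] = confD[OF c] confD[OF c'] a
  have "inflation E X I i" using c unfolding inflation_def by blast
  moreover have "Cmp C X X' I' i' a \<in> Hom C X I'" by simp
  ultimately obtain m where m [simp]: "m \<in> Hom C I I'" "Cmp C X I I' m i = Cmp C X X' I' i' a"
    using I' unfolding injective_obj_def by blast
  have "Cmp C X I W' (Cmp C I I' W' d' m) i = Zer C X W'"
    by (simp add: cmp_assoc cmp_ctx[OF confD(8)[OF c']])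
  then obtain e where "e \<in> Hom C W W'" "Cmp C I W W' e d = Cmp C I I' W' d' m"
    using cokernelD[OF confD(5)[OF c], of W' "Cmp C I I' W' d' m"] by auto
  then show ?thesis using that[unfolded conf_mor_def] m a by blast
qed

lemma conf_mor_from_right:
  assumes c: "(X, I, W, i, d) \<in> E" and c': "(X', I', W', i', d') \<in> E" and I: "projective_obj C E I"
    and e: "e \<in> Hom C W W'"
  obtains a m where "conf_mor X I W i d X' I' W' i' d' a m e"
proof -
  note [simp] = confD[OF c] confD[OF c'] e
  have "deflation E I' W' d'" using c' unfolding deflation_def by blast
  moreover have "Cmp C I W W' e d \<in> Hom C I W'" by simp
  ultimately obtain m where m [simp]: "m \<in> Hom C I I'" "Cmp C I I' W' d' m = Cmp C I W W' e d"
    using I unfolding projective_obj_def by blast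
  have "Cmp C X I' W' d' (Cmp C X I I' m i) = Zer C X W'"
    by (subst cmp_ctx[OF m(2)]) (simp_all add: cmp_assoc)
  then obtain a where "a \<in> Hom C X X'" "Cmp C X X' I' i' a = Cmp C X I I' m i"
    using kernelD[OF confD(4)[OF c'], of X "Cmp C X I I' m i"] by auto
  then show ?thesis using that[unfolded conf_mor_def] m e by metis
qed

text \<open>The composite minus the identity is an endomorphism of the first conflation; by
  \<open>null_shift\<close> and \<open>null_unshift\<close> it is null at one end exactly if it is
  null at the other.\<close>

lemma conf_mor_comp_minus_idn:
  assumes c: "(X, I, W, i, d) \<in> E" and c': "(X', I', W', i', d') \<in> E"
    and m: "conf_mor X I W i d X' I' W' i' d' a m e" and m': "conf_mor X' I' W' i' d' X I W i d a' m' e'"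
    and I: "injective_obj C E I"
  shows "cl X X (Cmp C X X' X a' a) = cl X X (Idn C X) \<longleftrightarrow> cl W W (Cmp C W W' W e' e) = cl W W (Idn C W)"
proof -
  note [simp] = confD[OF c] confD[OF c']
  have h [simp]: "a \<in> Hom C X X'" "m \<in> Hom C I I'" "e \<in> Hom C W W'"
    "a' \<in> Hom C X' X" "m' \<in> Hom C I' I" "e' \<in> Hom C W' W"
    and s: "Cmp C X I I' m i = Cmp C X X' I' i' a" "Cmp C I W W' e d = Cmp C I I' W' d' m"
    "Cmp C X' I' I m' i' = Cmp C X' X I i a'" "Cmp C I' W' W e' d' = Cmp C I' I W d m'"
    using m m' unfolding conf_mor_def by auto
  define A where "A = Pls C X X (Cmp C X X' X a' a) (neg X X (Idn C X))"
  define M where "M = Pls C I I (Cmp C I I' I m' m) (neg I I (Idn C I))"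
  define B where "B = Pls C W W (Cmp C W W' W e' e) (neg W W (Idn C W))"
  have [simp]: "A \<in> Hom C X X" "M \<in> Hom C I I" "B \<in> Hom C W W" unfolding A_def M_def B_def by simp_all
  have 1: "Cmp C X I I M i = Cmp C X X I i A"
    unfolding M_def A_def by (simp add: cmp_plsl cmp_plsr cmp_negl cmp_negr cmp_assoc s cmp_ctx[OF s(3)])
  have 2: "Cmp C I W W B d = Cmp C I I W d M"
    unfolding M_def B_def by (simp add: cmp_plsl cmp_plsr cmp_negl cmp_negr cmp_assoc s cmp_ctx[OF s(4)])
  have "A \<in> N X X \<longleftrightarrow> B \<in> N W W"
    using null_shift[OF c I _ _ _ 1 2] null_unshift[OF c I _ _ _ 1 2] by auto
  then show ?thesis unfolding A_def B_def by (simp add: cl_eq_iff)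
qed

lemma D_iso_inv:
  assumes "iso_mor D X Y (cl X Y f)" "X \<in> Obj C" "Y \<in> Obj C"
  obtains g where "g \<in> Hom C Y X" "Cmp D X Y X (cl Y X g) (cl X Y f) = cl X X (Idn C X)"
    "Cmp D Y X Y (cl X Y f) (cl Y X g) = cl Y Y (Idn C Y)"
  using assms unfolding iso_mor_def by auto

lemma D_iso_rep:
  assumes "iso_obj D X Y"
  obtains f where "X \<in> Obj C" "Y \<in> Obj C" "f \<in> Hom C X Y" "iso_mor D X Y (cl X Y f)"
proof -
  obtain F where F: "iso_mor D X Y F" "X \<in> Obj C" "Y \<in> Obj C" using assms unfolding iso_obj_def by auto
  then obtain f where "f \<in> Hom C X Y" "F = cl X Y f" unfolding iso_mor_def by auto
  then show ?thesis using that F by blast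
qed

lemma D_iso_morI:
  assumes "X \<in> Obj C" "Y \<in> Obj C" "f \<in> Hom C X Y" "g \<in> Hom C Y X" "cl X X (Cmp C X Y X g f) = cl X X (Idn C X)"
    "cl Y Y (Cmp C Y X Y f g) = cl Y Y (Idn C Y)"
  shows "iso_mor D X Y (cl X Y f)"
  unfolding iso_mor_def using assms by (auto intro!: bexI[of _ "cl Y X g"])

text \<open>A stable inverse at one end is completed to a morphism of conflations in the opposite
  direction. One implication serves triangles that begin at \<open>T\<close>, the other those that
  begin at T[-1], where the isomorphism is given on the right.\<close>

lemma shift_iso:
  assumes c: "(X, I, W, i, d) \<in> E" and c': "(X', I', W', i', d') \<in> E"
    and I: "injective_obj C E I" "injective_obj C E I'"
    and m: "conf_mor X I W i d X' I' W' i' d' a m e"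
  shows "iso_mor D X X' (cl X X' a) \<longleftrightarrow> iso_mor D W W' (cl W W' e)"
proof -
  note [simp] = confD[OF c] confD[OF c']
  have h [simp]: "a \<in> Hom C X X'" "m \<in> Hom C I I'" "e \<in> Hom C W W'" using m unfolding conf_mor_def by auto
  show ?thesis
  proof
    assume "iso_mor D X X' (cl X X' a)"
    then obtain a' where [simp]: "a' \<in> Hom C X' X" and a': "cl X X (Cmp C X X' X a' a) = cl X X (Idn C X)"
      "cl X' X' (Cmp C X' X X' a a') = cl X' X' (Idn C X')"
      by (rule D_iso_inv) auto
    obtain m' e' where m': "conf_mor X' I' W' i' d' X I W i d a' m' e'"
      using conf_mor_from_left[OF c' c I(1), of a'] by auto
    then have [simp]: "e' \<in> Hom C W' W" unfolding conf_mor_def by auto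
    show "iso_mor D W W' (cl W W' e)"
      by (rule D_iso_morI[where g = e'])
        (use a' conf_mor_comp_minus_idn[OF c c' m m' I(1)] conf_mor_comp_minus_idn[OF c' c m' m I(2)] in auto)
  next
    assume "iso_mor D W W' (cl W W' e)"
    then obtain e' where [simp]: "e' \<in> Hom C W' W" and e': "cl W W (Cmp C W W' W e' e) = cl W W (Idn C W)"
      "cl W' W' (Cmp C W' W W' e e') = cl W' W' (Idn C W')"
      by (rule D_iso_inv) auto
    obtain a' m' where m': "conf_mor X' I' W' i' d' X I W i d a' m' e'"
      using conf_mor_from_right[OF c' c, of e'] proj_inj I by auto
    then have [simp]: "a' \<in> Hom C X' X" unfolding conf_mor_def by auto
    show "iso_mor D X X' (cl X X' a)"
      by (rule D_iso_morI[where g = a'])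
        (use e' conf_mor_comp_minus_idn[OF c c' m m' I(1)] conf_mor_comp_minus_idn[OF c' c m' m I(2)] in auto)
  qed
qed

lemma shift_seq_conf:
  assumes "X \<in> Obj C"
  obtains I W i d where "shift_seq C E X = (I, W, i, d)" "injective_obj C E I" "(X, I, W, i, d) \<in> E"
proof -
  obtain I W i d where "injective_obj C E I \<and> (X, I, W, i, d) \<in> E" using enough_inj[OF assms] by auto
  moreover define Q where "Q = (\<lambda>(I, W, i, d). injective_obj C E I \<and> (X, I, W, i, d) \<in> E)"
  ultimately have "Q (I, W, i, d)" by simp
  then have "Q (shift_seq C E X)" unfolding shift_seq_def Q_def[symmetric] by (rule someI)
  then show ?thesis using that unfolding Q_def by (auto split: prod.splits)
qed

lemma unshift_seq_conf:
  assumes "X \<in> Obj C"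
  obtains V P i d where "unshift_seq C E X = (V, P, i, d)" "projective_obj C E P" "(V, P, X, i, d) \<in> E"
proof -
  obtain V P i d where "projective_obj C E P \<and> (V, P, X, i, d) \<in> E" using enough_proj[OF assms] by auto
  moreover define Q where "Q = (\<lambda>(V, P, i, d). projective_obj C E P \<and> (V, P, X, i, d) \<in> E)"
  ultimately have "Q (V, P, i, d)" by simp
  then have "Q (unshift_seq C E X)" unfolding unshift_seq_def Q_def[symmetric] by (rule someI)
  then show ?thesis using that unfolding Q_def by (auto split: prod.splits)
qed

section \<open>Distinguished triangles from conflations\<close>

lemma distinguishedI:
  assumes "injective_obj C E I" "(X, I, W, i, d) \<in> E" "F \<in> Hom D X Y" "G \<in> Hom D Y Z" "H \<in> Hom D Z W"
    "standard_triangle C E X' Y' Z' (I', W', i', d') f g h" "conf_mor X I W i d X' I' W' i' d' a m e"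
    "iso_mor D X X' (cl X X' a)" "iso_mor D Y Y' B" "iso_mor D Z Z' K"
    "Cmp D X Y Y' B F = Cmp D X X' Y' (cl X' Y' f) (cl X X' a)"
    "Cmp D Y Z Z' K G = Cmp D Y Y' Z' (cl Y' Z' g) B"
    "Cmp D Z W W' (cl W W' e) H = Cmp D Z Z' W' (cl Z' W' h) K"
  shows "distinguished C E X Y Z (I, W, i, d) F G H"
  using assms unfolding distinguished_def Let_def prod.case conf_mor_def by blast

text \<open>The cone of an inflation \<open>f : X \<rightarrow> Y\<close> with cokernel \<open>Z\<close> is \<open>Z \<oplus> I\<close>.\<close>

lemma triangle_of_conflation:
  assumes c: "(X', Y', Z', f, g) \<in> E"
    and T [simp]: "\<alpha> \<in> Hom C T X'" and \<alpha>: "iso_mor D T X' (cl T X' \<alpha>)" and ob [simp]: "T \<in> Obj C"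
    and T': "iso_obj D T' Z'"
  shows "\<exists>G H. distinguished C E T Y' T' (shift_seq C E T) (cl T Y' (Cmp C T X' Y' f \<alpha>)) G H"
proof -
  note [simp] = confD[OF c]
  obtain \<kappa> where \<kappa> [simp]: "T' \<in> Obj C" "\<kappa> \<in> Hom C T' Z'" and \<kappa>_iso: "iso_mor D T' Z' (cl T' Z' \<kappa>)"
    using T' by (rule D_iso_rep)
  obtain I W i d where s: "shift_seq C E T = (I, W, i, d)" and I: "injective_obj C E I" and cs: "(T, I, W, i, d) \<in> E"
    using shift_seq_conf[OF ob] by metis
  obtain I' W' i' d' where I': "injective_obj C E I'" and cs': "(X', I', W', i', d') \<in> E"
    using enough_inj[of X'] by auto
  note [simp] = confD[OF cs] confD[OF cs']
  obtain m e where m: "conf_mor T I W i d X' I' W' i' d' \<alpha> m e"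
    using conf_mor_from_left[OF cs cs' I', of \<alpha>] by auto
  then have [simp]: "m \<in> Hom C I I'" "e \<in> Hom C W W'" unfolding conf_mor_def by auto
  have e_iso: "iso_mor D W W' (cl W W' e)" using shift_iso[OF cs cs' I I' m] \<alpha> by simp
  obtain e' where [simp]: "e' \<in> Hom C W' W" and e': "cl W' W' (Cmp C W' W W' e e') = cl W' W' (Idn C W')"
    using e_iso by (rule D_iso_inv) auto
  have "inflation E X' Y' f" using c unfolding inflation_def by blast
  then obtain t where t [simp]: "t \<in> Hom C Y' I'" "Cmp C X' Y' I' t f = i'"
    using I' unfolding injective_obj_def by (metis confD(6) cs')
  obtain S z k qz qk where S: "is_biproduct C Z' I' S z k qz qk"
    using biproduct_ex[of Z' I'] unfolding biproduct_iff by auto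
  note [simp] = is_biproductD[OF S]
  \<comment> \<open>\<open>g'\<close> = (g, t), where \<open>t\<close> extends \<open>i'\<close>
    over \<open>f\<close>; this exhibits Z (+) I as the pushout.\<close>
  define g' where "g' = Pls C Y' S (Cmp C Y' Z' S z g) (Cmp C Y' I' S k t)"
  have [simp]: "g' \<in> Hom C Y' S" unfolding g'_def by simp
  have sq: "Cmp C X' I' S k i' = Cmp C X' Y' S g' f"
    unfolding g'_def by (simp add: cmp_plsl cmp_assoc)
  have po: "is_pushout C X' I' Y' S i' f k g'"
    unfolding is_pushout_def
  proof (intro conjI ballI impI)
    show "Cmp C X' I' S k i' = Cmp C X' Y' S g' f" by (rule sq)
    fix V a b assume [simp]: "V \<in> Obj C" "a \<in> Hom C I' V" "b \<in> Hom C Y' V"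
      and ab: "Cmp C X' I' V a i' = Cmp C X' Y' V b f"
    have "Cmp C X' Y' V (Pls C Y' V b (neg Y' V (Cmp C Y' I' V a t))) f = Zer C X' V"
      by (simp add: cmp_plsl cmp_negl cmp_assoc ab)
    then obtain w where w [simp]: "w \<in> Hom C Z' V" "Cmp C Y' Z' V w g = Pls C Y' V b (neg Y' V (Cmp C Y' I' V a t))"
      using cokernelD[OF confD(5)[OF c], of V "Pls C Y' V b (neg Y' V (Cmp C Y' I' V a t))"] by auto
    show "\<exists>!w. w \<in> Hom C S V \<and> Cmp C I' S V w k = a \<and> Cmp C Y' S V w g' = b"
    proof (rule ex1I[of _ "Pls C S V (Cmp C S Z' V w qz) (Cmp C S I' V a qk)"], intro conjI)
      have "Pls C Y' V (Pls C Y' V b (neg Y' V (Cmp C Y' I' V a t))) (Cmp C Y' I' V a t) = b"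
        by (simp add: pls_assoc)
      then show "Cmp C Y' S V (Pls C S V (Cmp C S Z' V w qz) (Cmp C S I' V a qk)) g' = b"
        unfolding g'_def by (simp add: cmp_plsl cmp_plsr cmp_assoc biproduct_ctx[OF S])
      fix x assume x: "x \<in> Hom C S V \<and> Cmp C I' S V x k = a \<and> Cmp C Y' S V x g' = b"
      then have [simp]: "x \<in> Hom C S V" by simp
      have "b = Pls C Y' V (Cmp C Y' Z' V (Cmp C Z' S V x z) g) (Cmp C Y' I' V a t)"
        using x unfolding g'_def by (auto simp: cmp_plsr cmp_assoc)
      then have "Cmp C Y' Z' V (Cmp C Z' S V x z) g = Cmp C Y' Z' V w g"
        by (simp add: pls_assoc)
      then have "Cmp C Z' S V x z = w"
        by - (rule cokernel_epi[OF confD(5)[OF c], of V], auto)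
      then show "x = Pls C S V (Cmp C S Z' V w qz) (Cmp C S I' V a qk)"
        using x by - (rule biproduct_out_eqI[OF S, of V], auto simp: cmp_plsl cmp_assoc)
    qed (auto simp: cmp_plsl cmp_assoc)
  qed auto
  have "Cmp C X' Y' W' (neg Y' W' (Cmp C Y' I' W' d' t)) f = Zer C X' W'"
    by (simp add: cmp_negl cmp_assoc)
  \<comment> \<open>The minus sign makes the two contributions to \<open>h g'\<close>
    cancel.\<close>
  then obtain hz where hz [simp]: "hz \<in> Hom C Z' W'" "Cmp C Y' Z' W' hz g = neg Y' W' (Cmp C Y' I' W' d' t)"
    using cokernelD[OF confD(5)[OF c], of W' "neg Y' W' (Cmp C Y' I' W' d' t)"] by auto
  define h where "h = Pls C S W' (Cmp C S Z' W' hz qz) (Cmp C S I' W' d' qk)"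
  have [simp]: "h \<in> Hom C S W'" unfolding h_def by simp
  have "Cmp C Y' S W' h g' = Zer C Y' W'" "Cmp C I' S W' h k = d'"
    unfolding h_def g'_def by (simp_all add: cmp_plsl cmp_plsr cmp_assoc biproduct_ctx[OF S])
  then have st: "standard_triangle C E X' Y' S (I', W', i', d') f g' h"
    unfolding standard_triangle_def using I' cs' po by auto
  \<comment> \<open>The complement of \<open>z\<close> is the injective \<open>I'\<close>, which
    vanishes stably.\<close>
  have "iso_mor D Z' S (cl Z' S z)"
  proof (rule D_iso_morI[where g = qz])
    have "Pls C S S (Cmp C S Z' S z qz) (Cmp C S I' S k qk) = Idn C S" by simp
    then show "cl S S (Cmp C S Z' S z qz) = cl S S (Idn C S)"
      using cl_plus_null[of S S "Cmp C S Z' S z qz" "Cmp C S I' S k qk"] nullI[OF I', of qk S k S] by simp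
  qed auto
  then have K: "iso_mor D T' S (Cmp D T' Z' S (cl Z' S z) (cl T' Z' \<kappa>))"
    by (intro D.iso_mor_cmp) (use \<kappa>_iso in auto)
  then have K: "iso_mor D T' S (cl T' S (Cmp C T' Z' S z \<kappa>))" by simp
  obtain \<kappa>' where [simp]: "\<kappa>' \<in> Hom C S T'" and
    \<kappa>': "Cmp D S T' S (cl T' S (Cmp C T' Z' S z \<kappa>)) (cl S T' \<kappa>') = cl S S (Idn C S)"
    using K by (rule D_iso_inv) auto
  define G where "G = cl Y' T' (Cmp C Y' S T' \<kappa>' g')"
  define H where "H = cl T' W (Cmp C T' W' W e' (Cmp C T' S W' h (Cmp C T' Z' S z \<kappa>)))"
  have "Cmp D Y' T' S (cl T' S (Cmp C T' Z' S z \<kappa>)) G =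
      Cmp D Y' S S (Cmp D S T' S (cl T' S (Cmp C T' Z' S z \<kappa>)) (cl S T' \<kappa>')) (cl Y' S g')"
    unfolding G_def by (simp add: cmp_assoc)
  then have 1: "Cmp D Y' T' S (cl T' S (Cmp C T' Z' S z \<kappa>)) G = Cmp D Y' Y' S (cl Y' S g') (cl Y' Y' (Idn C Y'))"
    unfolding \<kappa>' by simp
  have "Cmp D T' W W' (cl W W' e) H = Cmp D T' W' W' (cl W' W' (Cmp C W' W W' e e')) (cl T' W' (Cmp C T' S W' h (Cmp C T' Z' S z \<kappa>)))"
    unfolding H_def by (simp add: cmp_assoc)
  then have 2: "Cmp D T' W W' (cl W W' e) H = Cmp D T' S W' (cl S W' h) (cl T' S (Cmp C T' Z' S z \<kappa>))"
    unfolding e' by simp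
  have "distinguished C E T Y' T' (I, W, i, d) (cl T Y' (Cmp C T X' Y' f \<alpha>)) G H"
    by (rule distinguishedI[OF I cs _ _ _ st m \<alpha> _ K _ 1 2])
      (auto simp: G_def H_def D.iso_mor_idn[of Y', simplified])
  then show ?thesis using s by auto
qed

text \<open>A lift \<open>j\<close> of \<open>d'\<close> through the deflation \<open>h\<close>
  induces \<open>f\<close> on kernels, and the square of \<open>i'\<close>, \<open>j\<close>,
  \<open>f\<close>, \<open>g\<close> is a pushout. So the conflation completes to a standard
  triangle on \<open>f\<close> without any extra summand, and what remains is transport along
  isomorphisms at \<open>T\<close>, T[-1] and \<open>T'\<close>.\<close>

lemma triangle_of_conflation_unshift:
  assumes c: "(Y', Z', W', g, h) \<in> E"
    and T [simp]: "\<epsilon> \<in> Hom C T W'" and \<epsilon>: "iso_mor D T W' (cl T W' \<epsilon>)" and ob [simp]: "T \<in> Obj C"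
    and T': "iso_obj D T' Y'"
    and H: "H \<in> Hom D Z' T" "Cmp D Z' T W' (cl T W' \<epsilon>) H = cl Z' W' h"
  shows "\<exists>F G V P i d. unshift_seq C E T = (V, P, i, d) \<and> distinguished C E V T' Z' (P, T, i, d) F G H"
proof -
  note [simp] = confD[OF c]
  obtain \<beta> where \<beta> [simp]: "T' \<in> Obj C" "\<beta> \<in> Hom C T' Y'" and \<beta>_iso: "iso_mor D T' Y' (cl T' Y' \<beta>)"
    using T' by (rule D_iso_rep)
  obtain V P i d where s: "unshift_seq C E T = (V, P, i, d)" and P: "projective_obj C E P" and cs: "(V, P, T, i, d) \<in> E"
    using unshift_seq_conf[OF ob] by metis
  obtain V' P' i' d' where P': "projective_obj C E P'" and cs': "(V', P', W', i', d') \<in> E"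
    using enough_proj[of W'] by auto
  note [simp] = confD[OF cs] confD[OF cs']
  have inj: "injective_obj C E P" "injective_obj C E P'" using P P' proj_inj by auto
  obtain a m where m: "conf_mor V P T i d V' P' W' i' d' a m \<epsilon>"
    using conf_mor_from_right[OF cs cs' P, of \<epsilon>] by auto
  then have [simp]: "a \<in> Hom C V V'" "m \<in> Hom C P P'" unfolding conf_mor_def by auto
  have a_iso: "iso_mor D V V' (cl V V' a)" using shift_iso[OF cs cs' inj m] \<epsilon> by simp
  have "deflation E Z' W' h" using c unfolding deflation_def by blast
  then obtain j where j [simp]: "j \<in> Hom C P' Z'" "Cmp C P' Z' W' h j = d'"
    using P' unfolding projective_obj_def by (metis confD(7) cs')
  have "Cmp C V' Z' W' h (Cmp C V' P' Z' j i') = Zer C V' W'"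
    by (simp add: cmp_ctx[OF j(2)])
  then obtain f where f [simp]: "f \<in> Hom C V' Y'" "Cmp C V' Y' Z' g f = Cmp C V' P' Z' j i'"
    using kernelD[OF confD(4)[OF c], of V' "Cmp C V' P' Z' j i'"] by auto
  have st: "standard_triangle C E V' Y' Z' (P', W', i', d') f g h"
    unfolding standard_triangle_def using conf_mor_pushout[OF cs' c j f] inj cs' j by auto
  obtain \<beta>' where [simp]: "\<beta>' \<in> Hom C Y' T'" and \<beta>': "cl Y' Y' (Cmp C Y' T' Y' \<beta> \<beta>') = cl Y' Y' (Idn C Y')"
    using \<beta>_iso by (rule D_iso_inv) auto
  define F where "F = cl V T' (Cmp C V Y' T' \<beta>' (Cmp C V V' Y' f a))"
  define G where "G = cl T' Z' (Cmp C T' Y' Z' g \<beta>)"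
  have "Cmp D V T' Y' (cl T' Y' \<beta>) F = Cmp D V Y' Y' (cl Y' Y' (Cmp C Y' T' Y' \<beta> \<beta>')) (cl V Y' (Cmp C V V' Y' f a))"
    unfolding F_def by (simp add: cmp_assoc)
  then have 1: "Cmp D V T' Y' (cl T' Y' \<beta>) F = Cmp D V V' Y' (cl V' Y' f) (cl V V' a)"
    unfolding \<beta>' by simp
  have 2: "Cmp D T' Z' Z' (cl Z' Z' (Idn C Z')) G = Cmp D T' Y' Z' (cl Y' Z' g) (cl T' Y' \<beta>)"
    unfolding G_def by simp
  have "distinguished C E V T' Z' (P, T, i, d) F G H"
    by (rule distinguishedI[OF inj(1) cs _ _ H(1) st m a_iso \<beta>_iso _ 1 2])
      (use H(2) in \<open>auto simp: F_def G_def D.iso_mor_idn[of Z', simplified]\<close>)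
  then show ?thesis using s by blast
qed

end

section \<open>The cyclic poset\<close>

lemma sigma_inv: "inv_into UNIV sigma (x, y, e) = (y - pi, x - pi, \<not> e)"
  by (rule inv_into_f_eq) (auto simp: inj_on_def sigma_def)

lemma sigma_pow_eq:
  "sigma_pow k (x, y, e) =
     (if even k then (x + of_int k * pi, y + of_int k * pi, e) else (y + of_int k * pi, x + of_int k * pi, \<not> e))"
proof -
  have 1: "(sigma ^^ n) (x, y, e) =
     (if even n then (x + of_nat n * pi, y + of_nat n * pi, e) else (y + of_nat n * pi, x + of_nat n * pi, \<not> e))" for n
    by (induction n) (auto simp: sigma_def algebra_simps)
  have 2: "(inv_into UNIV sigma ^^ n) (x, y, e) =
     (if even n then (x - of_nat n * pi, y - of_nat n * pi, e) else (y - of_nat n * pi, x - of_nat n * pi, \<not> e))" for n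
    by (induction n) (auto simp: sigma_inv algebra_simps)
  show ?thesis unfolding sigma_pow_def by (cases "k \<ge> 0") (auto simp: 1 2 even_nat_iff)
qed

lemma sigma_pow_add: "sigma_pow i (sigma_pow j s) = sigma_pow (i + j) s"
  by (cases s) (auto simp: sigma_pow_eq algebra_simps)

lemma sigma_pow_0 [simp]: "sigma_pow 0 s = s"
  by (cases s) (simp add: sigma_pow_eq)

lemma sigma_pow_cover [simp]: "sigma_pow k s \<in> Xpi_cover \<longleftrightarrow> s \<in> Xpi_cover"
  by (cases s) (auto simp: sigma_pow_eq Xpi_cover_def)

lemma pt_le_refl [simp]: "pt_le s s"
  by (auto simp: pt_le_def)

lemma pt_le_trans: "pt_le s t \<Longrightarrow> pt_le t r \<Longrightarrow> pt_le s r"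
  by (auto simp: pt_le_def)

lemma pt_le_sigma_pow [simp]: "pt_le (sigma_pow k s) (sigma_pow k t) \<longleftrightarrow> pt_le s t"
  by (cases s; cases t) (auto simp: sigma_pow_eq pt_le_def)

lemma pt_le_sigma_pow_shift: "pt_le (sigma_pow i s) (sigma_pow j t) \<longleftrightarrow> pt_le s (sigma_pow (j - i) t)"
  using pt_le_sigma_pow[of i s "sigma_pow (j - i) t"] by (simp add: sigma_pow_add)

text \<open>The width of the strip enters here: as |x - y| <= pi, \<sigma> moves a point up. Hence
  the shifts that work form an upward closed set of integers.\<close>

lemma pt_le_sigma_pow_mono:
  assumes "s \<in> Xpi_cover" "0 \<le> k"
  shows "pt_le s (sigma_pow k s)"
proof (cases "k = 0")
  case False
  define r where "r = of_int k * pi"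
  have "1 * pi \<le> r" using False assms unfolding r_def by (intro mult_right_mono) auto
  then show ?thesis using assms pi_ge_two
    by (cases s) (auto simp: sigma_pow_eq pt_le_def Xpi_cover_def r_def[symmetric])
qed simp

lemma pt_le_up:
  assumes "t \<in> Xpi_cover" "pt_le s (sigma_pow i t)" "i \<le> j"
  shows "pt_le s (sigma_pow j t)"
  using pt_le_trans[OF assms(2)] pt_le_sigma_pow_mono[OF assms(1), of "j - i"] assms(3)
  by (simp add: pt_le_sigma_pow_shift)

text \<open>\<open>LEAST\<close> over the integers is meaningful only for sets that are bounded
  below; the bound \<open>b\<close> reduces the matter to natural numbers.\<close>

lemma int_Least:
  assumes "P (i::int)" "\<And>j. P j \<Longrightarrow> b \<le> j"
  shows "P (LEAST i. P i)" "\<And>j. P j \<Longrightarrow> (LEAST i. P i) \<le> j"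
proof -
  define Q where "Q n = P (b + int n)" for n
  have "Q (nat (i - b))" using assms(2)[OF assms(1)] assms(1) by (simp add: Q_def)
  then have Q: "Q (LEAST n. Q n)" by (rule LeastI)
  have "b + int (LEAST n. Q n) \<le> j" if "P j" for j
  proof -
    have "b \<le> j" using assms(2) that by simp
    then have "Q (nat (j - b))" using that by (simp add: Q_def)
    then have "(LEAST n. Q n) \<le> nat (j - b)" by (rule Least_le)
    then show ?thesis using \<open>b \<le> j\<close> by linarith
  qed
  then have "(LEAST i. P i) = b + int (LEAST n. Q n)" "\<And>j. P j \<Longrightarrow> b + int (LEAST n. Q n) \<le> j"
    using Q unfolding Q_def by (auto intro!: Least_equality)
  then show "P (LEAST i. P i)" "\<And>j. P j \<Longrightarrow> (LEAST i. P i) \<le> j" using Q unfolding Q_def by auto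
qed

text \<open>Every exponent is later computed through this equivalence. Admissible shifts exist and
  are bounded below because \<sigma>^n adds n pi to both coordinates, up to exchanging them.\<close>

lemma min_shift_le_iff:
  assumes s: "s \<in> Xpi_cover" and t: "t \<in> Xpi_cover"
  shows "min_shift s t \<le> i \<longleftrightarrow> pt_le s (sigma_pow i t)"
proof -
  obtain x y e where s': "s = (x, y, e)" by (cases s)
  obtain a b e' where t': "t = (a, b, e')" by (cases t)
  define M where "M = \<bar>x\<bar> + \<bar>y\<bar> + \<bar>a\<bar> + \<bar>b\<bar>"
  define n where "n = \<lceil>M / pi\<rceil>"
  have n: "M \<le> of_int n * pi" unfolding n_def by (metis le_of_int_ceiling pi_gt_zero pos_divide_le_eq)
  have 1: "pt_le s (sigma_pow n t)"
    using n unfolding s' t' M_def by (auto simp: pt_le_def sigma_pow_eq)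
  have 2: "- n \<le> j" if "pt_le s (sigma_pow j t)" for j
  proof -
    have "- M \<le> of_int j * pi" using that unfolding s' t' M_def by (auto simp: pt_le_def sigma_pow_eq split: if_splits)
    then have "(- of_int j) * pi \<le> M" by simp
    then have "- of_int j \<le> M / pi" by (simp add: pos_le_divide_eq)
    then show ?thesis unfolding n_def by linarith
  qed
  show ?thesis
    using int_Least[where P = "\<lambda>i. pt_le s (sigma_pow i t)", OF 1 2] pt_le_up[OF t]
    unfolding min_shift_def by blast
qed

text \<open>A change of representatives alters \<open>min_shift\<close> by a coboundary, which
  cancels in \<open>c_exp\<close>.\<close>

lemma min_shift_sigma_pow:
  assumes "s \<in> Xpi_cover" "t \<in> Xpi_cover"
  shows "min_shift (sigma_pow i s) (sigma_pow j t) = min_shift s t + i - j"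
proof -
  have "min_shift (sigma_pow i s) (sigma_pow j t) \<le> k \<longleftrightarrow> min_shift s t + i - j \<le> k" for k
    using assms min_shift_le_iff[of s t "k + j - i"]
    by (subst min_shift_le_iff) (auto simp: sigma_pow_add pt_le_sigma_pow_shift algebra_simps)
  then show ?thesis by (meson order_antisym order_refl)
qed

lemma min_shift_self [simp]:
  assumes "s \<in> Xpi_cover" shows "min_shift s s = 0"
proof -
  have "\<not> min_shift s s \<le> -1"
    using assms pi_ge_two by (cases s) (auto simp: min_shift_le_iff pt_le_def sigma_pow_eq Xpi_cover_def)
  moreover have "min_shift s s \<le> 0" using assms by (simp add: min_shift_le_iff)
  ultimately show ?thesis by simp
qed

text \<open>Shifts add along a chain of inequalities. This is why the exponents are
  nonnegative.\<close>

lemma min_shift_triangle: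
  assumes "s \<in> Xpi_cover" "t \<in> Xpi_cover" "r \<in> Xpi_cover"
  shows "min_shift s r \<le> min_shift s t + min_shift t r"
proof -
  have "pt_le s (sigma_pow (min_shift s t) t)" "pt_le t (sigma_pow (min_shift t r) r)"
    using assms by (simp_all add: min_shift_le_iff[symmetric])
  then have "pt_le s (sigma_pow (min_shift s t) (sigma_pow (min_shift t r) r))"
    by (metis pt_le_sigma_pow pt_le_trans)
  then show ?thesis using assms by (simp add: min_shift_le_iff sigma_pow_add)
qed

lemma rep_orbit:
  obtains k where "rep (orbit_of s) = sigma_pow k s"
proof -
  have "s \<in> orbit_of s" unfolding orbit_of_def by (rule range_eqI[of _ _ 0]) simp
  then have "rep (orbit_of s) \<in> orbit_of s" unfolding rep_def by (rule someI)
  then show ?thesis using that unfolding orbit_of_def by auto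
qed

lemma orbit_of_sigma_pow [simp]: "orbit_of (sigma_pow k s) = orbit_of s"
proof -
  have "sigma_pow i s \<in> range (\<lambda>j. sigma_pow j (sigma_pow k s))" for i
    by (rule range_eqI[of _ _ "i - k"]) (simp add: sigma_pow_add)
  moreover have "sigma_pow i (sigma_pow k s) \<in> range (\<lambda>j. sigma_pow j s)" for i
    by (simp add: sigma_pow_add)
  ultimately show ?thesis unfolding orbit_of_def by auto
qed

lemma c_exp_orbit:
  assumes "s \<in> Xpi_cover" "t \<in> Xpi_cover" "r \<in> Xpi_cover"
  shows "c_exp (orbit_of s) (orbit_of t) (orbit_of r) = min_shift s t + min_shift t r - min_shift s r"
proof -
  obtain i j k where "rep (orbit_of s) = sigma_pow i s" "rep (orbit_of t) = sigma_pow j t"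
    "rep (orbit_of r) = sigma_pow k r" using rep_orbit by metis
  then show ?thesis unfolding c_exp_def using assms by (simp add: min_shift_sigma_pow)
qed

lemma XpiE:
  assumes "X \<in> Xpi" obtains s where "s \<in> Xpi_cover" "X = orbit_of s"
  using assms unfolding Xpi_def by auto

lemma c_exp_nonneg: "\<lbrakk>X \<in> Xpi; Y \<in> Xpi; Z \<in> Xpi\<rbrakk> \<Longrightarrow> 0 \<le> c_exp X Y Z"
  by (elim XpiE) (use min_shift_triangle in \<open>fastforce simp: c_exp_orbit\<close>)

text \<open>The exponent is the coboundary of \<open>min_shift\<close>, so all terms cancel. The
  identity is the associativity of composition in \<open>F_pi\<close>.\<close>

lemma c_exp_cocycle: "c_exp X Y Z + c_exp W X Z = c_exp W X Y + c_exp W Y Z"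
  unfolding c_exp_def by simp

lemma c_exp_refl [simp]: "X \<in> Xpi \<Longrightarrow> Y \<in> Xpi \<Longrightarrow> c_exp X X Y = 0" "X \<in> Xpi \<Longrightarrow> Y \<in> Xpi \<Longrightarrow> c_exp X Y Y = 0"
  by (auto elim!: XpiE simp: c_exp_orbit)

section \<open>Rotations of points\<close>

definition rot_pt :: "real \<Rightarrow> pt \<Rightarrow> pt" where
  "rot_pt w = (\<lambda>(x, y, e). (x + w, y + w, e))"

lemma rot_pt_sigma_pow: "rot_pt w (sigma_pow k s) = sigma_pow k (rot_pt w s)"
  by (cases s) (auto simp: rot_pt_def sigma_pow_eq)

lemma rot_pt_cover [simp]: "rot_pt w s \<in> Xpi_cover \<longleftrightarrow> s \<in> Xpi_cover"
  by (cases s) (auto simp: rot_pt_def Xpi_cover_def)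

lemma pt_le_rot_pt [simp]: "pt_le (rot_pt w s) (rot_pt w t) \<longleftrightarrow> pt_le s t"
  by (cases s; cases t) (auto simp: rot_pt_def pt_le_def)

lemma rot_orbit: "rot p g (orbit_of s) = orbit_of (rot_pt (of_int g * theta p) s)"
proof -
  have "rot p g (orbit_of s) = rot_pt (of_int g * theta p) ` orbit_of s"
    unfolding rot_def rot_pt_def by simp
  then show ?thesis unfolding orbit_of_def by (simp add: image_image rot_pt_sigma_pow)
qed

lemma rot_Xpi [simp]: "X \<in> Xpi \<Longrightarrow> rot p g X \<in> Xpi"
  by (auto elim!: XpiE simp: rot_orbit Xpi_def)

lemma min_shift_rot_pt:
  assumes "s \<in> Xpi_cover" "t \<in> Xpi_cover"
  shows "min_shift (rot_pt w s) (rot_pt w t) = min_shift s t"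
proof -
  have "min_shift (rot_pt w s) (rot_pt w t) \<le> k \<longleftrightarrow> min_shift s t \<le> k" for k
    using assms by (simp add: min_shift_le_iff rot_pt_sigma_pow[symmetric])
  then show ?thesis by (meson order_antisym order_refl)
qed

lemma c_exp_rot [simp]:
  "\<lbrakk>X \<in> Xpi; Y \<in> Xpi; Z \<in> Xpi\<rbrakk> \<Longrightarrow> c_exp (rot p g X) (rot p g Y) (rot p g Z) = c_exp X Y Z"
  by (elim XpiE) (simp add: rot_orbit c_exp_orbit min_shift_rot_pt)

lemma rot_rot: "X \<in> Xpi \<Longrightarrow> rot p g (rot p h X) = rot p (g + h) X"
  by (elim XpiE, simp add: rot_orbit)
    (rule arg_cong[of _ _ orbit_of], auto simp: rot_pt_def algebra_simps)

lemma rot_0 [simp]: "X \<in> Xpi \<Longrightarrow> rot p 0 X = X"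
  by (auto elim!: XpiE simp: rot_orbit rot_pt_def)

text \<open>p \<theta> = 2 pi, and the translation by 2 pi is \<sigma>^2.\<close>

lemma rot_add_period:
  assumes "X \<in> Xpi" "p > 0" shows "rot p (g + int p * k) X = rot p g X"
proof -
  obtain x y e where s: "(x, y, e) \<in> Xpi_cover" "X = orbit_of (x, y, e)" using assms(1) by (metis XpiE prod_cases3)
  have "rot_pt (of_int (g + int p * k) * theta p) (x, y, e) = sigma_pow (2 * k) (rot_pt (of_int g * theta p) (x, y, e))"
    using assms(2) by (auto simp: rot_pt_def sigma_pow_eq theta_def field_simps)
  then show ?thesis unfolding s rot_orbit by simp
qed

lemma rot_mod: assumes "X \<in> Xpi" "p > 0" shows "rot p (g mod int p) X = rot p g X"
  using rot_add_period[OF assms, of "g mod int p" "g div int p"] by (simp add: mult.commute)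

text \<open>The representative of E(x, y) with sign +. In its coordinates the strip reads x <= y <=
  x + 2 pi.\<close>

definition epoint :: "real \<Rightarrow> real \<Rightarrow> pt" where
  "epoint x y = (x, y - pi, True)"

lemma E_obj_epoint: "E_obj x y = orbit_of (epoint x y)"
  unfolding E_obj_def M_obj_def epoint_def by simp

lemma epoint_cover [simp]: "epoint x y \<in> Xpi_cover \<longleftrightarrow> x \<le> y \<and> y \<le> x + 2 * pi"
  unfolding epoint_def Xpi_cover_def by auto

lemma E_obj_Xpi [simp]: "x \<le> y \<Longrightarrow> y \<le> x + 2 * pi \<Longrightarrow> E_obj x y \<in> Xpi"
  unfolding E_obj_epoint Xpi_def by auto

lemma Xpi_E_obj:
  assumes "X \<in> Xpi" obtains x y where "x \<le> y" "y \<le> x + 2 * pi" "X = E_obj x y"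
proof -
  obtain x y e where s: "(x, y, e) \<in> Xpi_cover" "X = orbit_of (x, y, e)" using assms by (metis XpiE prod_cases3)
  show ?thesis
  proof (cases e)
    case True
    then show ?thesis using s that[of x "y + pi"] by (auto simp: E_obj_epoint epoint_def Xpi_cover_def)
  next
    case False
    \<comment> \<open>A point with sign - turns into one with sign + after one application of
      \<sigma>.\<close>
    have "X = orbit_of (sigma_pow 1 (x, y, e))" using s by simp
    also have "sigma_pow 1 (x, y, e) = epoint (y + pi) (x + 2 * pi)" using False by (simp add: sigma_pow_eq epoint_def)
    finally show ?thesis using s that[of "y + pi" "x + 2 * pi"] by (auto simp: E_obj_epoint Xpi_cover_def)
  qed
qed

lemma rot_E_obj: "rot p g (E_obj x y) = E_obj (x + of_int g * theta p) (y + of_int g * theta p)"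
  unfolding E_obj_epoint rot_orbit by (simp add: rot_pt_def epoint_def algebra_simps)

text \<open>\<open>elift k a b\<close> is \<open>\<sigma>\<^sup>k(a, b)\<close> in the coordinates of \<open>E(a, b)\<close>, where \<open>\<sigma>(a, b) = (b, a + 2\<pi>)\<close>.\<close>

definition elift :: "int \<Rightarrow> real \<Rightarrow> real \<Rightarrow> real \<times> real" where
  "elift k a b = (if even k then (a + of_int k * pi, b + of_int k * pi)
                  else (b + (of_int k - 1) * pi, a + (of_int k + 1) * pi))"

lemma elift_0 [simp]: "elift 0 a b = (a, b)"
  by (simp add: elift_def)

lemma pt_le_epoint:
  "pt_le (epoint x y) (sigma_pow k (epoint a b)) \<longleftrightarrow> x \<le> fst (elift k a b) \<and> y \<le> snd (elift k a b)"
  by (auto simp: pt_le_def epoint_def elift_def sigma_pow_eq algebra_simps)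

lemma elift_range: "a \<le> b \<Longrightarrow> b \<le> a + 2 * pi \<Longrightarrow>
    fst (elift k a b) \<le> snd (elift k a b) \<and> snd (elift k a b) \<le> fst (elift k a b) + 2 * pi"
  by (auto simp: elift_def algebra_simps)

lemma elift_elift: "elift i (fst (elift j a b)) (snd (elift j a b)) = elift (i + j) a b"
  by (auto simp: elift_def algebra_simps)

lemma min_shift_epoint_le:
  assumes "x \<le> y" "y \<le> x + 2 * pi" "a \<le> b" "b \<le> a + 2 * pi"
  shows "min_shift (epoint x y) (epoint a b) \<le> k \<longleftrightarrow> x \<le> fst (elift k a b) \<and> y \<le> snd (elift k a b)"
  using assms by (simp add: min_shift_le_iff pt_le_epoint)

lemma min_shift_epoint_elift:
  assumes "x \<le> y" "y \<le> x + 2 * pi" "a \<le> b" "b \<le> a + 2 * pi"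
  shows "min_shift (epoint x y) (epoint (fst (elift j a b)) (snd (elift j a b))) = min_shift (epoint x y) (epoint a b) - j"
    and "min_shift (epoint (fst (elift j a b)) (snd (elift j a b))) (epoint x y) = min_shift (epoint a b) (epoint x y) + j"
proof -
  have r: "fst (elift j a b) \<le> snd (elift j a b)" "snd (elift j a b) \<le> fst (elift j a b) + 2 * pi"
    using elift_range assms(3,4) by auto
  have "min_shift (epoint x y) (epoint (fst (elift j a b)) (snd (elift j a b))) \<le> k \<longleftrightarrow>
      min_shift (epoint x y) (epoint a b) - j \<le> k" for k
    using assms r min_shift_epoint_le[of x y a b "k + j"]
    by (subst min_shift_epoint_le) (auto simp: elift_elift algebra_simps)
  then show "min_shift (epoint x y) (epoint (fst (elift j a b)) (snd (elift j a b))) = min_shift (epoint x y) (epoint a b) - j"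
    by (meson order_antisym order_refl)
  have "fst (elift j a b) \<le> fst (elift k x y) \<and> snd (elift j a b) \<le> snd (elift k x y) \<longleftrightarrow>
      a \<le> fst (elift (k - j) x y) \<and> b \<le> snd (elift (k - j) x y)" for k
    by (auto simp: elift_def algebra_simps)
  then have "min_shift (epoint (fst (elift j a b)) (snd (elift j a b))) (epoint x y) \<le> k \<longleftrightarrow>
      min_shift (epoint a b) (epoint x y) + j \<le> k" for k
    using assms r min_shift_epoint_le[of a b x y "k - j"]
    by (subst min_shift_epoint_le) (auto simp: algebra_simps)
  then show "min_shift (epoint (fst (elift j a b)) (snd (elift j a b))) (epoint x y) = min_shift (epoint a b) (epoint x y) + j"
    by (meson order_antisym order_refl)
qed

lemma c_exp_E:
  assumes "x \<le> y" "y \<le> x + 2 * pi" "a \<le> b" "b \<le> a + 2 * pi" "v \<le> w" "w \<le> v + 2 * pi"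
  shows "c_exp (E_obj x y) (E_obj a b) (E_obj v w) = min_shift (epoint x y) (epoint a b)
    + min_shift (epoint a b) (epoint v w) - min_shift (epoint x y) (epoint v w)"
  using assms by (simp add: E_obj_epoint c_exp_orbit)

section \<open>Projective points and stably nonzero basic morphisms\<close>

definition proj_pts :: "pt set set" where
  "proj_pts = {M_obj x y | x y. \<bar>x - y\<bar> = pi}"

lemma proj_pts_E: "P \<in> proj_pts \<longleftrightarrow> (\<exists>z. P = E_obj z z \<or> P = E_obj z (z + 2 * pi))"
proof -
  have *: "\<bar>x - y\<bar> = pi \<longleftrightarrow> y = x - pi \<or> y = x + 2 * pi - pi" for x y :: real
    using pi_ge_two by (auto simp: abs_if split: if_splits)
  show ?thesis unfolding proj_pts_def E_obj_def * by blast
qed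

lemma proj_pts_Xpi [simp]: "P \<in> proj_pts \<Longrightarrow> P \<in> Xpi"
  unfolding proj_pts_E by auto

lemma proj_pts_rot [simp]: "P \<in> proj_pts \<Longrightarrow> rot p g P \<in> proj_pts"
  unfolding proj_pts_E rot_E_obj
  by (elim exE, intro exI[of _ "_ + of_int g * theta p"]) (auto simp: rot_E_obj add.commute add.left_commute)

text \<open>The basic morphism X -> Y is nonzero in the stable category: every factorisation through
  a projective point costs a power of \<open>u\<close>.\<close>

definition nonnull :: "pt set \<Rightarrow> pt set \<Rightarrow> bool" where
  "nonnull X Y \<longleftrightarrow> (\<forall>P \<in> proj_pts. 1 \<le> c_exp X P Y)"

text \<open>Lift the target to the least point above (x, y). The morphism dies as soon as a
  projective point lies between, and the decisive ones are the corners E(y, y) and E(x, x + 2 pi):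
  avoiding them leaves a rectangle.\<close>

lemma nonnull_E_iff:
  assumes xy: "x \<le> y" "y \<le> x + 2 * pi" and ab: "a \<le> b" "b \<le> a + 2 * pi"
  shows "nonnull (E_obj x y) (E_obj a b) \<longleftrightarrow>
    (\<exists>k. x \<le> fst (elift k a b) \<and> fst (elift k a b) < y \<and> y \<le> snd (elift k a b) \<and> snd (elift k a b) < x + 2 * pi)"
    (is "?L \<longleftrightarrow> ?R")
proof
  assume ?L
  define k where "k = min_shift (epoint x y) (epoint a b)"
  define a' b' where "a' = fst (elift k a b)" "b' = snd (elift k a b)"
  have r: "a' \<le> b'" "b' \<le> a' + 2 * pi" using elift_range[OF ab] unfolding a'_b'_def by auto
  have le: "x \<le> a'" "y \<le> b'" using min_shift_epoint_le[OF xy ab, of k] unfolding a'_b'_def k_def by auto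
  have *: "a' < v \<or> b' < w \<or> v < x \<or> w < y" if "E_obj v w \<in> proj_pts" "v \<le> w" "w \<le> v + 2 * pi" for v w
  proof (rule ccontr)
    assume "\<not> ?thesis"
    then have "min_shift (epoint x y) (epoint v w) \<le> 0" "min_shift (epoint v w) (epoint a b) \<le> k"
      using that(2,3) xy ab by (auto simp: min_shift_epoint_le a'_b'_def)
    then have "c_exp (E_obj x y) (E_obj v w) (E_obj a b) \<le> 0"
      using xy ab that by (simp add: c_exp_E k_def)
    then show False using \<open>?L\<close> that(1) unfolding nonnull_def by force
  qed
  have "a' < y" using *[of y y] le xy unfolding proj_pts_E by force
  moreover have "b' < x + 2 * pi" using *[of x "x + 2 * pi"] le xy unfolding proj_pts_E by force
  ultimately show ?R using le unfolding a'_b'_def by auto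
next
  assume ?R
  then obtain k where le: "x \<le> fst (elift k a b)" "fst (elift k a b) < y" "y \<le> snd (elift k a b)" "snd (elift k a b) < x + 2 * pi"
    by auto
  \<comment> \<open>The lift preceding (a', b') is (b' - 2 pi, a'), which is not above (x, y); so
    \<open>k\<close> is the minimal shift.\<close>
  have "elift (k - 1) a b = elift (- 1) (fst (elift k a b)) (snd (elift k a b))" by (simp add: elift_elift)
  then have "elift (k - 1) a b = (snd (elift k a b) - 2 * pi, fst (elift k a b))" by (simp add: elift_def)
  then have "\<not> min_shift (epoint x y) (epoint a b) \<le> k - 1" using le xy ab by (subst min_shift_epoint_le) auto
  then have k: "k \<le> min_shift (epoint x y) (epoint a b)" by simp
  show ?L unfolding nonnull_def
  proof (rule ballI, rule ccontr)
    fix P assume P: "P \<in> proj_pts" "\<not> 1 \<le> c_exp (E_obj x y) P (E_obj a b)"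
    obtain z w where P': "P = E_obj z w" "z = w \<or> w = z + 2 * pi" using P(1) unfolding proj_pts_E by metis
    then have zw: "z \<le> w" "w \<le> z + 2 * pi" by auto
    define i where "i = min_shift (epoint x y) (epoint z w)"
    have "i + min_shift (epoint z w) (epoint a b) \<le> min_shift (epoint x y) (epoint a b)"
      using P(2) xy ab zw unfolding P' by (simp add: c_exp_E i_def)
    moreover have "min_shift (epoint x y) (epoint a b) \<le> k" using le xy ab by (simp add: min_shift_epoint_le)
    ultimately have "min_shift (epoint (fst (elift i z w)) (snd (elift i z w))) (epoint a b) \<le> k"
      using min_shift_epoint_elift(2)[OF ab zw, of i] by simp
    then have "fst (elift i z w) \<le> fst (elift k a b)" "snd (elift i z w) \<le> snd (elift k a b)"
      using ab elift_range[OF zw, of i] by (auto simp: min_shift_epoint_le)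
    moreover have "x \<le> fst (elift i z w)" "y \<le> snd (elift i z w)"
      using min_shift_epoint_le[OF xy zw, of i] unfolding i_def by auto
    moreover have "fst (elift i z w) = snd (elift i z w) \<or> snd (elift i z w) = fst (elift i z w) + 2 * pi"
      using P'(2) by (auto simp: elift_def algebra_simps)
    ultimately show False using le by auto
  qed
qed

text \<open>For the least lift (a', b') of \<open>Y\<close> above \<open>X\<close>, the next one is
  (b', a' + 2 pi), and (b', b') lies between \<open>X\<close> and it. So \<open>u\<close> times a
  basic morphism always factors through a projective point.\<close>

lemma c_exp_proj_le_1:
  assumes "X \<in> Xpi" "Y \<in> Xpi"
  obtains P where "P \<in> proj_pts" "c_exp X P Y \<le> 1"
proof -
  obtain x y where X: "x \<le> y" "y \<le> x + 2 * pi" "X = E_obj x y" using assms(1) by (rule Xpi_E_obj)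
  obtain a b where Y: "a \<le> b" "b \<le> a + 2 * pi" "Y = E_obj a b" using assms(2) by (rule Xpi_E_obj)
  define k where "k = min_shift (epoint x y) (epoint a b)"
  define a' b' where ab': "a' = fst (elift k a b)" "b' = snd (elift k a b)"
  have r: "a' \<le> b'" "b' \<le> a' + 2 * pi" using elift_range[OF Y(1,2)] unfolding ab' by auto
  have le: "x \<le> a'" "y \<le> b'" using min_shift_epoint_le[OF X(1,2) Y(1,2), of k] unfolding ab' k_def by auto
  have "elift (k + 1) a b = elift 1 a' b'" by (simp add: elift_elift ab' add.commute)
  then have "elift (k + 1) a b = (b', a' + 2 * pi)" by (simp add: elift_def)
  then have "min_shift (epoint b' b') (epoint a b) \<le> k + 1" using Y r by (simp add: min_shift_epoint_le)
  moreover have "min_shift (epoint x y) (epoint b' b') \<le> 0" using X r le by (simp add: min_shift_epoint_le)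
  ultimately have "c_exp X (E_obj b' b') Y \<le> 1" using X Y by (simp add: c_exp_E k_def)
  then show ?thesis using that proj_pts_E by blast
qed

lemma nonnull_rot [simp]:
  assumes "X \<in> Xpi" "Y \<in> Xpi" shows "nonnull (rot p g X) (rot p g Y) \<longleftrightarrow> nonnull X Y"
proof -
  have *: "nonnull X Y" if "nonnull (rot p g X) (rot p g Y)" "X \<in> Xpi" "Y \<in> Xpi" for X Y g
    using that unfolding nonnull_def by (metis c_exp_rot proj_pts_Xpi proj_pts_rot)
  show ?thesis using *[of g X Y] *[of "-g" "rot p g X" "rot p g Y"] assms by (auto simp: rot_rot)
qed

text \<open>Three comparable lifts compose without loss if the last is the least lift above (x, y).
  The final hypothesis ensures this: it excludes the preceding lift, which is (second - 2 pi,
  first).\<close>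

lemma c_exp_E_eq_0I:
  assumes "x \<le> y" "y \<le> x + 2 * pi" "a \<le> b" "b \<le> a + 2 * pi" "v \<le> w" "w \<le> v + 2 * pi"
    and le: "x \<le> fst (elift i a b)" "y \<le> snd (elift i a b)"
      "fst (elift i a b) \<le> fst (elift k v w)" "snd (elift i a b) \<le> snd (elift k v w)"
    and "fst (elift k v w) < y \<or> snd (elift k v w) < x + 2 * pi"
  shows "c_exp (E_obj x y) (E_obj a b) (E_obj v w) = 0"
proof -
  have "elift (k - 1) v w = elift (- 1) (fst (elift k v w)) (snd (elift k v w))" by (simp add: elift_elift)
  then have "elift (k - 1) v w = (snd (elift k v w) - 2 * pi, fst (elift k v w))" by (simp add: elift_def)
  then have "\<not> min_shift (epoint x y) (epoint v w) \<le> k - 1" using assms by (subst min_shift_epoint_le) auto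
  moreover have "min_shift (epoint x y) (epoint a b) \<le> i" using assms by (simp add: min_shift_epoint_le)
  moreover have "min_shift (epoint (fst (elift i a b)) (snd (elift i a b))) (epoint v w) \<le> k"
    using assms elift_range[OF assms(3,4), of i] by (simp add: min_shift_epoint_le)
  then have "min_shift (epoint a b) (epoint v w) + i \<le> k" using assms by (simp add: min_shift_epoint_elift)
  ultimately have "c_exp (E_obj x y) (E_obj a b) (E_obj v w) \<le> 0" using assms by (simp add: c_exp_E)
  moreover have "0 \<le> c_exp (E_obj x y) (E_obj a b) (E_obj v w)" using assms by (intro c_exp_nonneg) auto
  ultimately show ?thesis by simp
qed

text \<open>Exponent 0 makes suitable lifts of the two points lie below each other, so that they
  coincide.\<close>

lemma c_exp_E_round_trip:
  assumes xy: "x \<le> y" "y \<le> x + 2 * pi" and ab: "a \<le> b" "b \<le> a + 2 * pi"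
  shows "c_exp (E_obj x y) (E_obj a b) (E_obj x y) = 0 \<longleftrightarrow> (\<exists>k. (x, y) = elift k a b)"
proof
  assume *: "c_exp (E_obj x y) (E_obj a b) (E_obj x y) = 0"
  define k where "k = min_shift (epoint x y) (epoint a b)"
  have "min_shift (epoint a b) (epoint x y) + k \<le> 0" using * xy ab by (simp add: c_exp_E k_def)
  then have "min_shift (epoint (fst (elift k a b)) (snd (elift k a b))) (epoint x y) \<le> 0"
    using min_shift_epoint_elift(2)[OF xy ab, of k] by simp
  then have "fst (elift k a b) \<le> x" "snd (elift k a b) \<le> y" using xy elift_range[OF ab, of k]
    by (auto simp: min_shift_epoint_le)
  moreover have "x \<le> fst (elift k a b)" "y \<le> snd (elift k a b)"
    using min_shift_epoint_le[OF xy ab, of k] unfolding k_def by auto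
  ultimately show "\<exists>k. (x, y) = elift k a b" by (intro exI[of _ k]) (auto intro!: prod_eqI)
next
  assume "\<exists>k. (x, y) = elift k a b"
  then obtain k where k: "x = fst (elift k a b)" "y = snd (elift k a b)" by (metis fst_conv snd_conv)
  have e: "epoint x y \<in> Xpi_cover" using xy by simp
  have "min_shift (epoint x y) (epoint x y) = min_shift (epoint x y) (epoint a b) - k"
    using min_shift_epoint_elift(1)[OF xy ab, of k] k by simp
  moreover have "min_shift (epoint x y) (epoint x y) = min_shift (epoint a b) (epoint x y) + k"
    using min_shift_epoint_elift(2)[OF xy ab, of k] k by simp
  ultimately show "c_exp (E_obj x y) (E_obj a b) (E_obj x y) = 0"
    using min_shift_self[OF e] xy ab by (simp add: c_exp_E)
qed

text \<open>The combinatorial content of the exactness of \<open>X \<rightarrow> Y\<^sub>1 \<oplus> Y\<^sub>2 \<rightarrow> Z\<close>.\<close>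

definition exact_square :: "pt set \<Rightarrow> pt set \<Rightarrow> pt set \<Rightarrow> pt set \<Rightarrow> bool" where
  "exact_square X Y1 Y2 Z \<longleftrightarrow> X \<in> Xpi \<and> Y1 \<in> Xpi \<and> Y2 \<in> Xpi \<and> Z \<in> Xpi \<and>
     c_exp X Y1 Z = c_exp X Y2 Z \<and>
     (\<forall>W \<in> Xpi. c_exp W X Y1 = 0 \<or> c_exp W X Y2 = 0) \<and>
     (\<forall>W \<in> Xpi. c_exp Y1 Z W = 0 \<or> c_exp Y2 Z W = 0) \<and>
     (\<forall>P \<in> proj_pts. c_exp P Y1 Z = 0 \<or> c_exp P Y2 Z = 0)"

text \<open>E(a, c) and E(b, d) are the componentwise minimum and maximum of the middle terms E(b,
  c) and E(a, d). The least shift needed to get below the minimum is already needed for one of the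
  two, and dually for the maximum.\<close>

lemma exact_square_E:
  assumes o: "a \<le> b" "b \<le> c" "c \<le> d" "d \<le> a + 2 * pi" "a < c" "c < a + 2 * pi" "b < d" "d < b + 2 * pi"
  shows "exact_square (E_obj a c) (E_obj b c) (E_obj a d) (E_obj b d)"
  unfolding exact_square_def
proof (intro conjI ballI)
  have m: "min_shift (epoint a c) (epoint b c) = 0" "min_shift (epoint a c) (epoint a d) = 0"
    "min_shift (epoint b c) (epoint b d) = 0" "min_shift (epoint a d) (epoint b d) = 0"
  proof -
    have *: "min_shift s t = 0" if "min_shift s t \<le> 0" "\<not> min_shift s t \<le> -1" for s t using that by simp
    show "min_shift (epoint a c) (epoint b c) = 0" "min_shift (epoint a c) (epoint a d) = 0"
      "min_shift (epoint b c) (epoint b d) = 0" "min_shift (epoint a d) (epoint b d) = 0"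
      using o by (auto intro!: * simp: min_shift_epoint_le elift_def)
  qed
  show "c_exp (E_obj a c) (E_obj b c) (E_obj b d) = c_exp (E_obj a c) (E_obj a d) (E_obj b d)"
    using o by (simp add: c_exp_E m)
  {
    fix W assume W: "W \<in> Xpi"
    obtain x y where X: "x \<le> y" "y \<le> x + 2 * pi" "W = E_obj x y" using W by (rule Xpi_E_obj)
    have meet: "x \<le> fst (elift k a c) \<and> y \<le> snd (elift k a c)"
      if "x \<le> fst (elift k b c) \<and> y \<le> snd (elift k b c)" "x \<le> fst (elift k a d) \<and> y \<le> snd (elift k a d)" for k
      using that o by (auto simp: elift_def split: if_splits)
    define m where "m = min_shift (epoint x y) (epoint a c)"
    have "\<not> min_shift (epoint x y) (epoint a c) \<le> m - 1" unfolding m_def by simp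
    then have "\<not> (min_shift (epoint x y) (epoint b c) \<le> m - 1 \<and> min_shift (epoint x y) (epoint a d) \<le> m - 1)"
      using meet[of "m - 1"] X o min_shift_epoint_le[of x y b c "m - 1"] min_shift_epoint_le[of x y a d "m - 1"]
        min_shift_epoint_le[of x y a c "m - 1"] by auto
    moreover have "0 \<le> c_exp W (E_obj a c) (E_obj b c)" "0 \<le> c_exp W (E_obj a c) (E_obj a d)"
      using W o by (auto intro!: c_exp_nonneg)
    ultimately show "c_exp W (E_obj a c) (E_obj b c) = 0 \<or> c_exp W (E_obj a c) (E_obj a d) = 0"
      using X o by (auto simp: c_exp_E m m_def)
    have join: "b \<le> fst (elift k x y) \<and> d \<le> snd (elift k x y)"
      if "b \<le> fst (elift k x y) \<and> c \<le> snd (elift k x y)" "a \<le> fst (elift k x y) \<and> d \<le> snd (elift k x y)" for k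
      using that by auto
    define n where "n = min_shift (epoint b d) (epoint x y)"
    have "\<not> min_shift (epoint b d) (epoint x y) \<le> n - 1" unfolding n_def by simp
    then have "\<not> (min_shift (epoint b c) (epoint x y) \<le> n - 1 \<and> min_shift (epoint a d) (epoint x y) \<le> n - 1)"
      using join[of "n - 1"] X o min_shift_epoint_le[of b c x y "n - 1"] min_shift_epoint_le[of a d x y "n - 1"]
        min_shift_epoint_le[of b d x y "n - 1"] by auto
    moreover have "0 \<le> c_exp (E_obj b c) (E_obj b d) W" "0 \<le> c_exp (E_obj a d) (E_obj b d) W"
      using W o by (auto intro!: c_exp_nonneg)
    ultimately show "c_exp (E_obj b c) (E_obj b d) W = 0 \<or> c_exp (E_obj a d) (E_obj b d) W = 0"
      using X o by (auto simp: c_exp_E m n_def)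
  }
  fix P assume "P \<in> proj_pts"
  then obtain z w where P: "P = E_obj z w" "w = z \<or> w = z + 2 * pi" unfolding proj_pts_E by blast
  then have zw: "z \<le> w" "w \<le> z + 2 * pi" by auto
  define n where "n = min_shift (epoint z w) (epoint b d)"
  have "z \<le> fst (elift n b d) \<and> w \<le> snd (elift n b d)"
    using min_shift_epoint_le[OF zw, of b d n] o unfolding n_def by auto
  \<comment> \<open>On the boundary one coordinate determines the other, and b <= c or d <= a + 2 pi
    yields the missing inequality.\<close>
  then have "z \<le> fst (elift n b c) \<and> w \<le> snd (elift n b c) \<or> z \<le> fst (elift n a d) \<and> w \<le> snd (elift n a d)"
    using P(2) o by (auto simp: elift_def algebra_simps split: if_splits)
  then have "min_shift (epoint z w) (epoint b c) \<le> n \<or> min_shift (epoint z w) (epoint a d) \<le> n"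
    using zw o by (auto simp: min_shift_epoint_le)
  moreover have "0 \<le> c_exp P (E_obj b c) (E_obj b d)" "0 \<le> c_exp P (E_obj a d) (E_obj b d)"
    using zw o P by (auto intro!: c_exp_nonneg)
  ultimately show "c_exp P (E_obj b c) (E_obj b d) = 0 \<or> c_exp P (E_obj a d) (E_obj b d) = 0"
    using zw o unfolding P by (auto simp: c_exp_E m n_def)
qed (use o in auto)

text \<open>The test objects range over all points, or over all projective points, so the rotation
  can be moved onto them.\<close>

lemma exact_square_rot:
  assumes "exact_square X Y1 Y2 Z"
  shows "exact_square (rot p g X) (rot p g Y1) (rot p g Y2) (rot p g Z)"
proof -
  have Xpi: "X \<in> Xpi" "Y1 \<in> Xpi" "Y2 \<in> Xpi" "Z \<in> Xpi" using assms unfolding exact_square_def by auto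
  have W: "c_exp W (rot p g A) (rot p g B) = c_exp (rot p (- g) W) A B"
    "c_exp (rot p g A) (rot p g B) W = c_exp A B (rot p (- g) W)" if "W \<in> Xpi" "A \<in> Xpi" "B \<in> Xpi" for W A B
    using c_exp_rot[of "rot p (- g) W" A B p g] c_exp_rot[of A B "rot p (- g) W" p g] that by (simp_all add: rot_rot)
  show ?thesis using assms unfolding exact_square_def by (simp add: W Xpi rot_rot)
qed

section \<open>The category \<open>F\<^sub>\<pi>\<close>\<close>

text \<open>A local domain whose maximal ideal is generated by \<open>u\<close>: the form in which
  the valuation ring enters the matrix computations.\<close>

locale ground =
  fixes u :: "'r::idom"
  assumes u_nonzero: "u \<noteq> 0" and u_nonunit: "\<not> u dvd 1" and u_local: "\<And>x. \<not> u dvd x \<Longrightarrow> x dvd 1"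

lemma sum_lessThan_add:
  "sum g {..<n + m} = sum g {..<n} + (\<Sum>j<m. g (n + j))" for g :: "nat \<Rightarrow> 'b::comm_monoid_add"
  by (induction m) (auto simp: add.assoc)

lemma mult_delta:
  "(if b then x else 0) * z = (if b then x * z else 0)"
  "z * (if b then x else 0) = (if b then z * x else 0)" for x y z :: "'b::mult_zero"
  by auto

context
  fixes u :: "'r::idom"
begin

abbreviation "F \<equiv> F_pi u"

definition wt :: "pt set \<Rightarrow> pt set \<Rightarrow> pt set \<Rightarrow> 'r" where
  "wt X Y Z = u ^ nat (c_exp X Y Z)"

lemma F_sel:
  "Obj F = {Xs. set Xs \<subseteq> Xpi}" "Hom F Xs Ys = carrier_mat (length Ys) (length Xs)"
  "Idn F Xs = 1\<^sub>m (length Xs)" "Zer F Xs Ys = 0\<^sub>m (length Ys) (length Xs)" "Pls F Xs Ys f g = f + g"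
  by (simp_all add: F_pi_def)

lemma F_nth: "Xs \<in> Obj F \<Longrightarrow> i < length Xs \<Longrightarrow> Xs ! i \<in> Xpi"
  by (auto simp: F_sel)

lemma F_cmp_index [simp]:
  "k < length Zs \<Longrightarrow> i < length Xs \<Longrightarrow>
   Cmp F Xs Ys Zs g f $$ (k, i) = (\<Sum>j<length Ys. g $$ (k, j) * f $$ (j, i) * wt (Xs ! i) (Ys ! j) (Zs ! k))"
  by (simp add: F_pi_def wt_def)

lemma F_cmp_carrier [simp]: "Cmp F Xs Ys Zs g f \<in> carrier_mat (length Zs) (length Xs)"
  by (simp add: F_pi_def)

lemma F_cmp_dim [simp]: "dim_row (Cmp F Xs Ys Zs g f) = length Zs" "dim_col (Cmp F Xs Ys Zs g f) = length Xs"
  by (simp_all add: F_pi_def)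

lemma F_eqI:
  assumes "f \<in> carrier_mat m n" "g \<in> carrier_mat m n" "\<And>j i. j < m \<Longrightarrow> i < n \<Longrightarrow> f $$ (j, i) = g $$ (j, i)"
  shows "f = g"
  by (rule eq_matI) (use assms in auto)

lemma wt_cocycle:
  assumes "W \<in> Xpi" "X \<in> Xpi" "Y \<in> Xpi" "Z \<in> Xpi"
  shows "wt X Y Z * wt W X Z = wt W X Y * wt W Y Z"
proof -
  have "nat (c_exp X Y Z) + nat (c_exp W X Z) = nat (c_exp W X Y) + nat (c_exp W Y Z)"
    using c_exp_cocycle[of X Y Z W] assms by (simp add: nat_add_distrib[symmetric] c_exp_nonneg)
  then show ?thesis unfolding wt_def by (simp add: power_add[symmetric])
qed

lemma wt_refl [simp]: "X \<in> Xpi \<Longrightarrow> Y \<in> Xpi \<Longrightarrow> wt X X Y = 1" "X \<in> Xpi \<Longrightarrow> Y \<in> Xpi \<Longrightarrow> wt X Y Y = 1"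
  by (simp_all add: wt_def)

lemma is_biproduct_append:
  assumes X: "X \<in> Obj F" and Y: "Y \<in> Obj F"
  shows "is_biproduct F X Y (X @ Y)
    (mat (length X + length Y) (length X) (\<lambda>(j, l). if j = l then 1 else 0))
    (mat (length X + length Y) (length Y) (\<lambda>(j, l). if j = length X + l then 1 else 0))
    (mat (length X) (length X + length Y) (\<lambda>(l, j). if j = l then 1 else 0))
    (mat (length Y) (length X + length Y) (\<lambda>(l, j). if j = length X + l then 1 else 0))"
    (is "is_biproduct F X Y ?S ?i ?j ?q ?r")
  unfolding is_biproduct_def
proof (intro conjI)
  let ?n = "length X" and ?m = "length Y"
  show "Cmp F X ?S X ?q ?i = Idn F X"
    by (rule F_eqI[where m = ?n and n = ?n]) (use X in \<open>auto simp: F_sel(3) F_nth mult_delta sum_lessThan_add nth_append\<close>)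
  show "Cmp F Y ?S Y ?r ?j = Idn F Y"
    by (rule F_eqI[where m = ?m and n = ?m]) (use Y in \<open>auto simp: F_sel(3) F_nth mult_delta sum_lessThan_add nth_append\<close>)
  show "Cmp F Y ?S X ?q ?j = Zer F Y X"
    by (rule F_eqI[where m = ?n and n = ?m]) (auto simp: F_sel(4) sum_lessThan_add intro!: sum.neutral)
  show "Cmp F X ?S Y ?r ?i = Zer F X Y"
    by (rule F_eqI[where m = ?m and n = ?n]) (auto simp: F_sel(4) sum_lessThan_add intro!: sum.neutral)
  show "Pls F ?S ?S (Cmp F ?S X ?S ?i ?q) (Cmp F ?S Y ?S ?j ?r) = Idn F ?S"
  proof (rule F_eqI[where m = "?n + ?m" and n = "?n + ?m"])
    fix k i assume ki: "k < ?n + ?m" "i < ?n + ?m"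
    have 1: "Cmp F ?S X ?S ?i ?q $$ (k, i) = (if k = i \<and> k < ?n then 1 else 0)"
    proof -
      have "Cmp F ?S X ?S ?i ?q $$ (k, i) = (\<Sum>j<?n. if j = k then (if i = j then wt (?S ! i) (X ! j) (?S ! k) else 0) else 0)"
        using ki by (auto simp del: sum.delta sum.delta' intro!: sum.cong)
      then show ?thesis using X by (auto simp: F_nth nth_append)
    qed
    have 2: "Cmp F ?S Y ?S ?j ?r $$ (k, i) = (if k = i \<and> \<not> k < ?n then 1 else 0)"
    proof -
      have e: "Cmp F ?S Y ?S ?j ?r $$ (k, i) =
          (\<Sum>j<?m. (if k = ?n + j then 1 else 0) * (if i = ?n + j then 1 else 0) * wt (?S ! i) (Y ! j) (?S ! k))"
        using ki by simp
      show ?thesis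
      proof (cases "k < ?n")
        case True
        then show ?thesis unfolding e by (auto intro!: sum.neutral)
      next
        case False
        then obtain k' where k': "k = ?n + k'" "k' < ?m" using ki by (metis add_less_cancel_left le_Suc_ex not_le)
        have "(\<Sum>j<?m. (if k = ?n + j then 1 else 0) * (if i = ?n + j then 1 else 0) * wt (?S ! i) (Y ! j) (?S ! k)) =
            (\<Sum>j<?m. if j = k' then (if i = ?n + j then wt (?S ! i) (Y ! j) (?S ! k) else 0) else 0)"
          unfolding k' by (rule sum.cong) auto
        then show ?thesis unfolding e using k' Y by (auto simp: F_nth nth_append)
      qed
    qed
    show "Pls F ?S ?S (Cmp F ?S X ?S ?i ?q) (Cmp F ?S Y ?S ?j ?r) $$ (k, i) = Idn F ?S $$ (k, i)"
      using ki 1 2 by (auto simp: F_sel(3,5) simp del: F_cmp_index)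
  qed (auto simp: F_sel)
qed (use X Y in \<open>auto simp: F_sel\<close>)

lemma F_addcat: "addcat F"
proof
  fix X Y Z W f g h
  assume X: "X \<in> Obj F" and Y: "Y \<in> Obj F" and Z: "Z \<in> Obj F" and W: "W \<in> Obj F"
    and f: "f \<in> Hom F W X" and g: "g \<in> Hom F X Y" and h: "h \<in> Hom F Y Z"
  show "Cmp F W X Z (Cmp F X Y Z h g) f = Cmp F W Y Z h (Cmp F W X Y g f)"
  proof (rule F_eqI[where m = "length Z" and n = "length W"])
    fix k i assume k: "k < length Z" and i: "i < length W"
    have "Cmp F W X Z (Cmp F X Y Z h g) f $$ (k, i) =
       (\<Sum>j<length X. \<Sum>l<length Y. h $$ (k, l) * g $$ (l, j) * f $$ (j, i) * (wt (X ! j) (Y ! l) (Z ! k) * wt (W ! i) (X ! j) (Z ! k)))"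
      using k i by (simp add: sum_distrib_right sum_distrib_left ac_simps)
    also have "\<dots> = (\<Sum>j<length X. \<Sum>l<length Y. h $$ (k, l) * g $$ (l, j) * f $$ (j, i) * (wt (W ! i) (X ! j) (Y ! l) * wt (W ! i) (Y ! l) (Z ! k)))"
      using k i X Y Z W by (intro sum.cong refl) (simp add: wt_cocycle F_nth)
    also have "\<dots> = Cmp F W Y Z h (Cmp F W X Y g f) $$ (k, i)"
      using k i by (subst sum.swap) (simp add: sum_distrib_right sum_distrib_left ac_simps)
    finally show "Cmp F W X Z (Cmp F X Y Z h g) f $$ (k, i) = Cmp F W Y Z h (Cmp F W X Y g f) $$ (k, i)" .
  qed auto
next
  fix X Y f assume *: "X \<in> Obj F" "Y \<in> Obj F" "f \<in> Hom F X Y"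
  then have f: "f \<in> carrier_mat (length Y) (length X)" by (simp add: F_sel)
  show "Cmp F X Y Y (Idn F Y) f = f"
    by (rule F_eqI[OF _ f]) (use * f in \<open>auto simp: F_sel(3) F_nth mult_delta\<close>)
  show "Cmp F X X Y f (Idn F X) = f"
    by (rule F_eqI[OF _ f]) (use * f in \<open>auto simp: F_sel(3) F_nth mult_delta\<close>)
  show "\<exists>g\<in>Hom F X Y. Pls F X Y f g = Zer F X Y"
    using f by (intro bexI[of _ "- f"]) (auto simp: F_sel)
next
  fix X Y Z f g h assume *: "X \<in> Obj F" "Y \<in> Obj F" "Z \<in> Obj F" "f \<in> Hom F X Y" "g \<in> Hom F Y Z" "h \<in> Hom F Y Z"
  show "Cmp F X Y Z (Pls F Y Z g h) f = Pls F X Z (Cmp F X Y Z g f) (Cmp F X Y Z h f)"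
    by (rule F_eqI[where m = "length Z" and n = "length X"]) (use * in \<open>auto simp: F_sel sum.distrib distrib_left distrib_right\<close>)
next
  fix X Y Z f g h assume *: "X \<in> Obj F" "Y \<in> Obj F" "Z \<in> Obj F" "f \<in> Hom F X Y" "g \<in> Hom F X Y" "h \<in> Hom F Y Z"
  show "Cmp F X Y Z h (Pls F X Y f g) = Pls F X Z (Cmp F X Y Z h f) (Cmp F X Y Z h g)"
    by (rule F_eqI[where m = "length Z" and n = "length X"]) (use * in \<open>auto simp: F_sel sum.distrib distrib_left distrib_right\<close>)
next
  fix X Y assume *: "X \<in> Obj F" "Y \<in> Obj F"
  then show "\<exists>S. biproduct F X Y S" unfolding biproduct_iff using is_biproduct_append[of X Y] by (intro exI)
qed (auto simp: F_sel intro!: comm_add_mat)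

end

context ground
begin

interpretation F: addcat "F_pi u" by (rule F_addcat)

abbreviation "FF \<equiv> F_pi u"
abbreviation "wgt \<equiv> wt u"

lemma unit_or_dvd: "\<exists>y. x * y = 1" if "\<not> u dvd x"
  using u_local[OF that] by (metis dvdE)

text \<open>Elements outside (u) are units, and so is their product.\<close>

lemma u_prime: "u dvd x * y \<longleftrightarrow> u dvd x \<or> u dvd y"
proof
  assume *: "u dvd x * y"
  show "u dvd x \<or> u dvd y"
  proof (rule ccontr)
    assume "\<not> ?thesis"
    then obtain x' y' where "x * x' = 1" "y * y' = 1" using unit_or_dvd by blast
    then have "(x * y) * (x' * y') = 1" by (metis mult.assoc mult.commute mult_1)
    then show False using * u_nonunit by (metis dvd_mult2)
  qed
qed auto

lemma wt_nonzero [simp]: "wgt X Y Z \<noteq> 0"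
  using u_nonzero by (simp add: wt_def)

lemma wt_eq_1 [simp]: "c_exp X Y Z = 0 \<Longrightarrow> wgt X Y Z = 1"
  by (simp add: wt_def)

lemma dvd_wt: "1 \<le> c_exp X Y Z \<Longrightarrow> u dvd wgt X Y Z"
  by (auto simp: wt_def intro!: dvd_power)

lemma wt_dvd_u: "c_exp X Y Z \<le> 1 \<Longrightarrow> wgt X Y Z dvd u"
proof -
  assume "c_exp X Y Z \<le> 1"
  then have "nat (c_exp X Y Z) = 0 \<or> nat (c_exp X Y Z) = 1" by linarith
  then show ?thesis unfolding wt_def by auto
qed

text \<open>The cocycle identity along the two paths around the square. These equations carry one
  component of a morphism to the other in the computation of kernels and cokernels.\<close>

lemma wt_exact_square:
  assumes "exact_square X Y1 Y2 Z" "W \<in> Xpi"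
  shows "wgt W X Y1 * wgt W Y1 Z = wgt W X Y2 * wgt W Y2 Z"
    and "wgt Y1 Z W * wgt X Y1 W = wgt Y2 Z W * wgt X Y2 W"
proof -
  have X: "X \<in> Xpi" "Y1 \<in> Xpi" "Y2 \<in> Xpi" "Z \<in> Xpi" and c: "c_exp X Y1 Z = c_exp X Y2 Z"
    using assms unfolding exact_square_def by auto
  have w: "wgt X Y1 Z = wgt X Y2 Z" unfolding wt_def c ..
  show "wgt W X Y1 * wgt W Y1 Z = wgt W X Y2 * wgt W Y2 Z"
    using wt_cocycle[of W X Y1 Z u] wt_cocycle[of W X Y2 Z u] X assms w by simp
  show "wgt Y1 Z W * wgt X Y1 W = wgt Y2 Z W * wgt X Y2 W"
    using wt_cocycle[of X Y1 Z W u] wt_cocycle[of X Y2 Z W u] X assms w by simp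
qed

text \<open>The direct sum of \<open>n\<close> maps (1, 1) : X -> Y1 (+) Y2, written in basic
  morphisms; \<open>sq_out\<close> is that of (1, -1) : Y1 (+) Y2 -> Z.\<close>

definition sq_in :: "nat \<Rightarrow> 'r mat" where
  "sq_in n = mat (n + n) n (\<lambda>(j, i). if j = i \<or> j = n + i then 1 else 0)"

definition sq_out :: "nat \<Rightarrow> 'r mat" where
  "sq_out n = mat n (n + n) (\<lambda>(k, j). if j = k then 1 else if j = n + k then - 1 else 0)"

context
  fixes n Xs Y1 Y2 Zs
  assumes len: "length Xs = n" "length Y1 = n" "length Y2 = n" "length Zs = n"
    and sq: "\<And>i. i < n \<Longrightarrow> exact_square (Xs ! i) (Y1 ! i) (Y2 ! i) (Zs ! i)"
begin

lemma sq_nth: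
  "i < n \<Longrightarrow> Xs ! i \<in> Xpi" "i < n \<Longrightarrow> Y1 ! i \<in> Xpi" "i < n \<Longrightarrow> Y2 ! i \<in> Xpi" "i < n \<Longrightarrow> Zs ! i \<in> Xpi"
  using sq unfolding exact_square_def by auto

lemma sq_Obj [simp]: "Xs \<in> Obj FF" "Y1 @ Y2 \<in> Obj FF" "Zs \<in> Obj FF"
  using sq_nth len by (auto simp: F_sel in_set_conv_nth)

lemma sq_hom [simp]: "sq_in n \<in> Hom FF Xs (Y1 @ Y2)" "sq_out n \<in> Hom FF (Y1 @ Y2) Zs"
  unfolding sq_in_def sq_out_def by (simp_all add: F_sel len)

lemma sq_nth_append: "i < n \<Longrightarrow> (Y1 @ Y2) ! i = Y1 ! i" "(Y1 @ Y2) ! (n + i) = Y2 ! i"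
  using len by (auto simp: nth_append)

lemma cmp_sq_in:
  assumes "i < length Ws"
  shows "k < n \<Longrightarrow> Cmp FF Ws Xs (Y1 @ Y2) (sq_in n) b $$ (k, i) = b $$ (k, i) * wgt (Ws ! i) (Xs ! k) (Y1 ! k)"
    and "k < n \<Longrightarrow> Cmp FF Ws Xs (Y1 @ Y2) (sq_in n) b $$ (n + k, i) = b $$ (k, i) * wgt (Ws ! i) (Xs ! k) (Y2 ! k)"
proof -
  assume k: "k < n"
  have "Cmp FF Ws Xs (Y1 @ Y2) (sq_in n) b $$ (k, i) =
     (\<Sum>j<n. if j = k then b $$ (j, i) * wgt (Ws ! i) (Xs ! j) (Y1 ! k) else 0)"
    using k assms len by (auto simp: sq_in_def sq_nth_append simp del: sum.delta sum.delta' intro!: sum.cong)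
  then show "Cmp FF Ws Xs (Y1 @ Y2) (sq_in n) b $$ (k, i) = b $$ (k, i) * wgt (Ws ! i) (Xs ! k) (Y1 ! k)"
    using k by simp
  have "Cmp FF Ws Xs (Y1 @ Y2) (sq_in n) b $$ (n + k, i) =
     (\<Sum>j<n. if j = k then b $$ (j, i) * wgt (Ws ! i) (Xs ! j) (Y2 ! k) else 0)"
    using k assms len by (auto simp: sq_in_def sq_nth_append simp del: sum.delta sum.delta' intro!: sum.cong)
  then show "Cmp FF Ws Xs (Y1 @ Y2) (sq_in n) b $$ (n + k, i) = b $$ (k, i) * wgt (Ws ! i) (Xs ! k) (Y2 ! k)"
    using k by simp
qed

lemma cmp_sq_out:
  assumes "i < length Ws" "k < n"
  shows "Cmp FF Ws (Y1 @ Y2) Zs (sq_out n) b $$ (k, i) =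
    b $$ (k, i) * wgt (Ws ! i) (Y1 ! k) (Zs ! k) - b $$ (n + k, i) * wgt (Ws ! i) (Y2 ! k) (Zs ! k)"
proof -
  have "Cmp FF Ws (Y1 @ Y2) Zs (sq_out n) b $$ (k, i) =
     (\<Sum>j<n. if j = k then b $$ (j, i) * wgt (Ws ! i) (Y1 ! j) (Zs ! k) else 0) +
     (\<Sum>j<n. if j = k then - (b $$ (n + j, i) * wgt (Ws ! i) (Y2 ! j) (Zs ! k)) else 0)"
    using assms len by (auto simp: sq_out_def sum_lessThan_add sq_nth_append simp del: sum.delta sum.delta' intro!: sum.cong arg_cong2[of _ _ _ _ plus])
  then show ?thesis using assms by simp
qed

lemma cmp_sq_in_r:
  assumes "i < n" "k < length Ws"
  shows "Cmp FF Xs (Y1 @ Y2) Ws b (sq_in n) $$ (k, i) =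
    b $$ (k, i) * wgt (Xs ! i) (Y1 ! i) (Ws ! k) + b $$ (k, n + i) * wgt (Xs ! i) (Y2 ! i) (Ws ! k)"
proof -
  have "Cmp FF Xs (Y1 @ Y2) Ws b (sq_in n) $$ (k, i) =
     (\<Sum>j<n. if j = i then b $$ (k, j) * wgt (Xs ! i) (Y1 ! j) (Ws ! k) else 0) +
     (\<Sum>j<n. if j = i then b $$ (k, n + j) * wgt (Xs ! i) (Y2 ! j) (Ws ! k) else 0)"
    using assms len by (auto simp: sq_in_def sum_lessThan_add sq_nth_append simp del: sum.delta sum.delta' intro!: sum.cong arg_cong2[of _ _ _ _ plus])
  then show ?thesis using assms by simp
qed

lemma cmp_sq_out_r:
  assumes "k < length Ws"
  shows "i < n \<Longrightarrow> Cmp FF (Y1 @ Y2) Zs Ws b (sq_out n) $$ (k, i) = b $$ (k, i) * wgt (Y1 ! i) (Zs ! i) (Ws ! k)"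
    and "i < n \<Longrightarrow> Cmp FF (Y1 @ Y2) Zs Ws b (sq_out n) $$ (k, n + i) = - (b $$ (k, i) * wgt (Y2 ! i) (Zs ! i) (Ws ! k))"
proof -
  assume i: "i < n"
  have "Cmp FF (Y1 @ Y2) Zs Ws b (sq_out n) $$ (k, i) =
     (\<Sum>j<n. if j = i then b $$ (k, j) * wgt (Y1 ! i) (Zs ! j) (Ws ! k) else 0)"
    using i assms len by (auto simp: sq_out_def sq_nth_append simp del: sum.delta sum.delta' intro!: sum.cong)
  then show "Cmp FF (Y1 @ Y2) Zs Ws b (sq_out n) $$ (k, i) = b $$ (k, i) * wgt (Y1 ! i) (Zs ! i) (Ws ! k)"
    using i by simp
  have "Cmp FF (Y1 @ Y2) Zs Ws b (sq_out n) $$ (k, n + i) =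
     (\<Sum>j<n. if j = i then - (b $$ (k, j) * wgt (Y2 ! i) (Zs ! j) (Ws ! k)) else 0)"
    using i assms len by (auto simp: sq_out_def sq_nth_append simp del: sum.delta sum.delta' intro!: sum.cong)
  then show "Cmp FF (Y1 @ Y2) Zs Ws b (sq_out n) $$ (k, n + i) = - (b $$ (k, i) * wgt (Y2 ! i) (Zs ! i) (Ws ! k))"
    using i by simp
qed

lemma less_n_cases: "j < n + n \<Longrightarrow> (j < n \<Longrightarrow> thesis) \<Longrightarrow> (\<And>k. k < n \<Longrightarrow> j = n + k \<Longrightarrow> thesis) \<Longrightarrow> thesis"
  by (metis add_less_cancel_left le_Suc_ex not_le)

lemma sq_zero: "Cmp FF Xs (Y1 @ Y2) Zs (sq_out n) (sq_in n) = Zer FF Xs Zs"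
proof (rule F_eqI[where m = n and n = n])
  fix k i assume ki: "k < n" "i < n"
  have "Cmp FF Xs (Y1 @ Y2) Zs (sq_out n) (sq_in n) $$ (k, i) =
      (if k = i then wgt (Xs ! i) (Y1 ! i) (Zs ! k) - wgt (Xs ! i) (Y2 ! i) (Zs ! k) else 0)"
    using ki len by (subst cmp_sq_out) (auto simp: sq_in_def)
  also have "\<dots> = 0" using sq[of i] ki unfolding exact_square_def wt_def by auto
  finally show "Cmp FF Xs (Y1 @ Y2) Zs (sq_out n) (sq_in n) $$ (k, i) = Zer FF Xs Zs $$ (k, i)"
    using ki len by (simp add: F_sel)
qed (auto simp: len F_sel)

text \<open>Entry by entry, one of the exponents of W -> X -> Y1 and W -> X -> Y2 is 0. There the
  preimage is the entry of \<open>a\<close> itself, and the other component follows by cancelling a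
  nonzero weight.\<close>

lemma sq_kernel: "is_kernel FF Xs (Y1 @ Y2) Zs (sq_in n) (sq_out n)"
  unfolding is_kernel_def
proof (intro conjI ballI impI sq_zero sq_hom)
  fix Ws a assume W: "Ws \<in> Obj FF" and a: "a \<in> Hom FF Ws (Y1 @ Y2)"
    and z: "Cmp FF Ws (Y1 @ Y2) Zs (sq_out n) a = Zer FF Ws Zs"
  have a': "a \<in> carrier_mat (n + n) (length Ws)" using a len by (simp add: F_sel)
  have e: "a $$ (k, i) * wgt (Ws ! i) (Y1 ! k) (Zs ! k) = a $$ (n + k, i) * wgt (Ws ! i) (Y2 ! k) (Zs ! k)"
    if "k < n" "i < length Ws" for k i
    using arg_cong[OF z, of "\<lambda>M. M $$ (k, i)"] that len by (simp add: cmp_sq_out F_sel del: F_cmp_index)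
  define b where "b = mat n (length Ws) (\<lambda>(k, i). if c_exp (Ws ! i) (Xs ! k) (Y1 ! k) = 0 then a $$ (k, i) else a $$ (n + k, i))"
  have b: "b \<in> Hom FF Ws Xs" unfolding b_def by (simp add: F_sel len)
  have ab: "b $$ (k, i) * wgt (Ws ! i) (Xs ! k) (Y1 ! k) = a $$ (k, i) \<and> b $$ (k, i) * wgt (Ws ! i) (Xs ! k) (Y2 ! k) = a $$ (n + k, i)"
    if ki: "k < n" "i < length Ws" for k i
  proof -
    have Wi: "Ws ! i \<in> Xpi" using W ki F_nth by auto
    note w = wt_exact_square(1)[OF sq[OF ki(1)] Wi]
    show ?thesis
    proof (cases "c_exp (Ws ! i) (Xs ! k) (Y1 ! k) = 0")
      case True
      then have "a $$ (k, i) * wgt (Ws ! i) (Xs ! k) (Y2 ! k) * wgt (Ws ! i) (Y2 ! k) (Zs ! k) = a $$ (n + k, i) * wgt (Ws ! i) (Y2 ! k) (Zs ! k)"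
        using w e[OF ki] by (simp add: mult.assoc)
      then show ?thesis using True ki by (simp add: b_def)
    next
      case False
      then have 0: "c_exp (Ws ! i) (Xs ! k) (Y2 ! k) = 0" using sq[OF ki(1)] Wi unfolding exact_square_def by blast
      then have "a $$ (n + k, i) * wgt (Ws ! i) (Xs ! k) (Y1 ! k) * wgt (Ws ! i) (Y1 ! k) (Zs ! k) = a $$ (k, i) * wgt (Ws ! i) (Y1 ! k) (Zs ! k)"
        using w e[OF ki] by (simp add: mult.assoc)
      then show ?thesis using False 0 ki by (simp add: b_def)
    qed
  qed
  show "\<exists>!b. b \<in> Hom FF Ws Xs \<and> Cmp FF Ws Xs (Y1 @ Y2) (sq_in n) b = a"
  proof (rule ex1I[of _ b], intro conjI b)
    show "Cmp FF Ws Xs (Y1 @ Y2) (sq_in n) b = a"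
    proof (rule F_eqI[OF _ a'])
      fix j i assume ji: "j < n + n" "i < length Ws"
      show "Cmp FF Ws Xs (Y1 @ Y2) (sq_in n) b $$ (j, i) = a $$ (j, i)"
        using ji(1) by (rule less_n_cases) (use ji ab in \<open>auto simp: cmp_sq_in simp del: F_cmp_index\<close>)
    qed (use len in auto)
    fix b' assume b': "b' \<in> Hom FF Ws Xs \<and> Cmp FF Ws Xs (Y1 @ Y2) (sq_in n) b' = a"
    show "b' = b"
    proof (rule F_eqI[where m = n and n = "length Ws"])
      fix k i assume ki: "k < n" "i < length Ws"
      have "b' $$ (k, i) * wgt (Ws ! i) (Xs ! k) (Y1 ! k) = a $$ (k, i)"
        using b' cmp_sq_in(1)[OF ki(2,1), of b'] by simp
      then show "b' $$ (k, i) = b $$ (k, i)" using ab[OF ki] by (metis mult_right_cancel wt_nonzero)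
    qed (use b b' len in \<open>auto simp: F_sel\<close>)
  qed
qed

text \<open>As for the kernel, with one of the exponents of Y1 -> Z -> W and Y2 -> Z -> W equal to
  0. The minus signs are those of \<open>sq_out\<close>.\<close>

lemma sq_cokernel: "is_cokernel FF Xs (Y1 @ Y2) Zs (sq_in n) (sq_out n)"
  unfolding is_cokernel_def
proof (intro conjI ballI impI sq_zero sq_hom)
  fix Ws a assume W: "Ws \<in> Obj FF" and a: "a \<in> Hom FF (Y1 @ Y2) Ws"
    and z: "Cmp FF Xs (Y1 @ Y2) Ws a (sq_in n) = Zer FF Xs Ws"
  have a': "a \<in> carrier_mat (length Ws) (n + n)" using a len by (simp add: F_sel)
  have e: "a $$ (k, i) * wgt (Xs ! i) (Y1 ! i) (Ws ! k) = - a $$ (k, n + i) * wgt (Xs ! i) (Y2 ! i) (Ws ! k)"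
    if "i < n" "k < length Ws" for k i
    using arg_cong[OF z, of "\<lambda>M. M $$ (k, i)"] that len
    by (simp add: cmp_sq_in_r F_sel eq_neg_iff_add_eq_0 del: F_cmp_index)
  define b where "b = mat (length Ws) n (\<lambda>(k, i). if c_exp (Y1 ! i) (Zs ! i) (Ws ! k) = 0 then a $$ (k, i) else - a $$ (k, n + i))"
  have b: "b \<in> Hom FF Zs Ws" unfolding b_def by (simp add: F_sel len)
  have ab: "b $$ (k, i) * wgt (Y1 ! i) (Zs ! i) (Ws ! k) = a $$ (k, i) \<and> b $$ (k, i) * wgt (Y2 ! i) (Zs ! i) (Ws ! k) = - a $$ (k, n + i)"
    if ki: "i < n" "k < length Ws" for k i
  proof -
    have Wi: "Ws ! k \<in> Xpi" using W ki F_nth by auto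
    note w = wt_exact_square(2)[OF sq[OF ki(1)] Wi]
    show ?thesis
    proof (cases "c_exp (Y1 ! i) (Zs ! i) (Ws ! k) = 0")
      case True
      then have "a $$ (k, i) * wgt (Y2 ! i) (Zs ! i) (Ws ! k) * wgt (Xs ! i) (Y2 ! i) (Ws ! k) = - a $$ (k, n + i) * wgt (Xs ! i) (Y2 ! i) (Ws ! k)"
        using w e[OF ki] by (simp add: mult.assoc)
      then have "a $$ (k, i) * wgt (Y2 ! i) (Zs ! i) (Ws ! k) = - a $$ (k, n + i)" by (metis mult_right_cancel wt_nonzero)
      then show ?thesis using True ki by (simp add: b_def)
    next
      case False
      then have 0: "c_exp (Y2 ! i) (Zs ! i) (Ws ! k) = 0" using sq[OF ki(1)] Wi unfolding exact_square_def by blast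
      then have "- a $$ (k, n + i) * wgt (Y1 ! i) (Zs ! i) (Ws ! k) * wgt (Xs ! i) (Y1 ! i) (Ws ! k) = a $$ (k, i) * wgt (Xs ! i) (Y1 ! i) (Ws ! k)"
        using w e[OF ki] by (simp add: mult.assoc)
      then have "- a $$ (k, n + i) * wgt (Y1 ! i) (Zs ! i) (Ws ! k) = a $$ (k, i)" by (metis mult_right_cancel wt_nonzero)
      then show ?thesis using False 0 ki by (simp add: b_def)
    qed
  qed
  show "\<exists>!b. b \<in> Hom FF Zs Ws \<and> Cmp FF (Y1 @ Y2) Zs Ws b (sq_out n) = a"
  proof (rule ex1I[of _ b], intro conjI b)
    show "Cmp FF (Y1 @ Y2) Zs Ws b (sq_out n) = a"
    proof (rule F_eqI[OF _ a'])
      fix k j assume ji: "k < length Ws" "j < n + n"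
      show "Cmp FF (Y1 @ Y2) Zs Ws b (sq_out n) $$ (k, j) = a $$ (k, j)"
        using ji(2) by (rule less_n_cases) (use ji ab in \<open>auto simp: cmp_sq_out_r simp del: F_cmp_index\<close>)
    qed (use len in auto)
    fix b' assume b': "b' \<in> Hom FF Zs Ws \<and> Cmp FF (Y1 @ Y2) Zs Ws b' (sq_out n) = a"
    show "b' = b"
    proof (rule F_eqI[where m = "length Ws" and n = n])
      fix k i assume ki: "k < length Ws" "i < n"
      have "b' $$ (k, i) * wgt (Y1 ! i) (Zs ! i) (Ws ! k) = a $$ (k, i)"
        using b' cmp_sq_out_r(1)[OF ki, of b'] by simp
      then show "b' $$ (k, i) = b $$ (k, i)" using ab[OF ki(2,1)] by (metis mult_right_cancel wt_nonzero)
    qed (use b b' len in \<open>auto simp: F_sel\<close>)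
  qed
qed

text \<open>A morphism from a list of projective points lifts entry by entry, through whichever of the
  two middle terms costs no power of \<open>u\<close>.\<close>

lemma sq_lift:
  assumes P: "set Ps \<subseteq> proj_pts" and q: "q \<in> Hom FF Ps Zs"
  obtains t where "t \<in> Hom FF Ps (Y1 @ Y2)" "Cmp FF Ps (Y1 @ Y2) Zs (sq_out n) t = q"
proof -
  have q': "q \<in> carrier_mat n (length Ps)" using q len by (simp add: F_sel)
  define t where "t = mat (n + n) (length Ps) (\<lambda>(j, i).
      if j < n then (if c_exp (Ps ! i) (Y1 ! j) (Zs ! j) = 0 then q $$ (j, i) else 0)
      else (if c_exp (Ps ! i) (Y1 ! (j - n)) (Zs ! (j - n)) = 0 then 0 else - q $$ (j - n, i)))"
  have "Cmp FF Ps (Y1 @ Y2) Zs (sq_out n) t = q"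
  proof (rule F_eqI[OF _ q'])
    fix k i assume ki: "k < n" "i < length Ps"
    then have "Ps ! i \<in> proj_pts" using P by auto
    then have "c_exp (Ps ! i) (Y1 ! k) (Zs ! k) = 0 \<or> c_exp (Ps ! i) (Y2 ! k) (Zs ! k) = 0"
      using sq[OF ki(1)] unfolding exact_square_def by blast
    then show "Cmp FF Ps (Y1 @ Y2) Zs (sq_out n) t $$ (k, i) = q $$ (k, i)"
      using ki by (auto simp: cmp_sq_out t_def simp del: F_cmp_index)
  qed (use len in auto)
  moreover have "t \<in> Hom FF Ps (Y1 @ Y2)" unfolding t_def by (simp add: F_sel len)
  ultimately show ?thesis using that by blast
qed

end

end

section \<open>The given exact structure and its projectives\<close>

locale exact_ground = ground u for u :: "'r::idom" +
  fixes E :: "(pt set list, 'r mat) conflation set"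
  assumes exact_E: "F_pi_exact_structure u E"
begin

sublocale FE: excat "F_pi u" E
  by (intro excat.intro excat_axioms.intro F_addcat)
    (use exact_E in \<open>auto simp: F_pi_exact_structure_def frobenius_category_def\<close>)

lemma frob_E: "frobenius_category FF E"
  using exact_E unfolding F_pi_exact_structure_def by simp

lemma F_proj_inj: "projective_obj FF E X \<longleftrightarrow> injective_obj FF E X"
  using frob_E unfolding frobenius_category_def by blast

lemma F_indec_proj:
  "indecomposable FF X \<Longrightarrow> projective_obj FF E X \<longleftrightarrow> (\<exists>x y. \<bar>x - y\<bar> = pi \<and> iso_obj FF X [M_obj x y])"
  using exact_E F_proj_inj[of X] unfolding F_pi_exact_structure_def by blast

lemma single_Obj [simp]: "[X] \<in> Obj FF \<longleftrightarrow> X \<in> Xpi"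
  by (simp add: F_sel)

text \<open>The endomorphism ring of a point is the ground domain, in which 0 and 1 are the only
  idempotents.\<close>

lemma single_indec:
  assumes "X \<in> Xpi" shows "indecomposable FF [X]"
proof (rule FE.indecomposableI)
  show "\<not> zero_obj FF [X]"
  proof
    assume "zero_obj FF [X]"
    then have "(1\<^sub>m 1 :: 'r mat) $$ (0, 0) = 0\<^sub>m 1 1 $$ (0, 0)" unfolding zero_obj_def by (simp add: F_sel)
    then show False by simp
  qed
  fix e assume e: "e \<in> Hom FF [X] [X]" "Cmp FF [X] [X] [X] e e = e"
  have "Cmp FF [X] [X] [X] e e $$ (0, 0) = e $$ (0, 0) * e $$ (0, 0)"
    using assms by (subst F_cmp_index) simp_all
  then have "e $$ (0, 0) = 0 \<or> e $$ (0, 0) = 1" using e(2) by (metis mult_cancel_left1 mult_eq_0_iff)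
  then show "e = Zer FF [X] [X] \<or> e = Idn FF [X]"
    using e(1) F_eqI[of e 1 1 "0\<^sub>m 1 1"] F_eqI[of e 1 1 "1\<^sub>m 1"] by (auto simp: F_sel)
qed (use assms in auto)

lemma c_exp_round_trip_proj:
  assumes "X \<in> Xpi" "P \<in> proj_pts" "c_exp X P X = 0"
  shows "X \<in> proj_pts"
proof -
  obtain x y where X: "x \<le> y" "y \<le> x + 2 * pi" "X = E_obj x y" using assms(1) by (rule Xpi_E_obj)
  obtain z w where P: "P = E_obj z w" "w = z \<or> w = z + 2 * pi" using assms(2) unfolding proj_pts_E by metis
  then have zw: "z \<le> w" "w \<le> z + 2 * pi" by auto
  obtain k where "(x, y) = elift k z w" using assms(3) unfolding X P c_exp_E_round_trip[OF X(1,2) zw] by auto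
  then have "y = x \<or> y = x + 2 * pi" using P(2) by (auto simp: elift_def algebra_simps split: if_splits)
  then show ?thesis unfolding X proj_pts_E by auto
qed

text \<open>\<open>E\<close> describes its projectives only up to isomorphism. An isomorphism
  between [X] and [P] makes \<open>wgt X P X\<close> a unit, so its exponent is 0 and
  \<open>X\<close> itself is a boundary point.\<close>

lemma single_proj_iff:
  assumes "X \<in> Xpi" shows "projective_obj FF E [X] \<longleftrightarrow> X \<in> proj_pts"
proof
  assume "projective_obj FF E [X]"
  then obtain x y where xy: "\<bar>x - y\<bar> = pi" "iso_obj FF [X] [M_obj x y]"
    using F_indec_proj[OF single_indec[OF assms]] by auto
  define P where "P = M_obj x y"
  have P: "P \<in> proj_pts" unfolding P_def proj_pts_def using xy(1) by blast
  obtain f g where "Cmp FF [X] [P] [X] g f = Idn FF [X]" using FE.iso_objE[OF xy(2)] unfolding P_def by metis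
  then have "Cmp FF [X] [P] [X] g f $$ (0, 0) = 1" by (simp add: F_sel)
  then have 1: "g $$ (0, 0) * f $$ (0, 0) * wgt X P X = 1" by (subst (asm) F_cmp_index) simp_all
  have "\<not> 1 \<le> c_exp X P X"
    using dvd_wt u_nonunit 1 by (metis dvd_triv_right dvd_trans)
  then have "c_exp X P X = 0" using c_exp_nonneg[of X P X] P assms by simp
  then show "X \<in> proj_pts" using c_exp_round_trip_proj[OF assms P] by simp
next
  assume "X \<in> proj_pts"
  then obtain x y where "\<bar>x - y\<bar> = pi" "X = M_obj x y" unfolding proj_pts_def by auto
  moreover have "iso_obj FF [X] [X]" using assms by (intro FE.iso_obj_refl) simp
  ultimately show "projective_obj FF E [X]" using F_indec_proj[OF single_indec[OF assms]] by blast
qed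

text \<open>Each member of a list is a retract of it, and a list is an iterated biproduct of its
  members.\<close>

lemma proj_list_iff: "projective_obj FF E Xs \<longleftrightarrow> set Xs \<subseteq> proj_pts"
proof
  assume P: "projective_obj FF E Xs"
  then have X: "Xs \<in> Obj FF" unfolding projective_obj_def by simp
  show "set Xs \<subseteq> proj_pts"
  proof
    fix Y assume "Y \<in> set Xs"
    then obtain l where l: "l < length Xs" "Y = Xs ! l" by (auto simp: in_set_conv_nth)
    have Y: "Y \<in> Xpi" using F_nth[OF X l(1)] l by simp
    let ?i = "mat (length Xs) 1 (\<lambda>(j, i). if j = l then 1 else 0) :: 'r mat"
    let ?q = "mat 1 (length Xs) (\<lambda>(i, j). if j = l then 1 else 0) :: 'r mat"
    have "Cmp FF [Y] Xs [Y] ?q ?i = Idn FF [Y]"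
      by (rule F_eqI[where m = 1 and n = 1]) (use l Y in \<open>auto simp: F_sel mult_delta\<close>)
    then have "projective_obj FF E [Y]"
      by (intro FE.projective_retract[OF P, of "[Y]" ?i ?q]) (use Y in \<open>auto simp: F_sel\<close>)
    then show "Y \<in> proj_pts" using single_proj_iff[OF Y] by simp
  qed
next
  show "set Xs \<subseteq> proj_pts \<Longrightarrow> projective_obj FF E Xs"
  proof (induction Xs)
    case Nil
    have "\<exists>g\<in>Hom FF [] Y. Cmp FF [] Y Z d g = f" if "f \<in> Hom FF [] Z" for Y Z d f
      using that by (intro bexI[of _ "0\<^sub>m (length Y) 0"] F_eqI[where m = "length Z" and n = 0]) (auto simp: F_sel)
    then show ?case unfolding projective_obj_def by (auto simp: F_sel(1))
  next
    case (Cons X Xs)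
    then have X: "X \<in> Xpi" and Xs: "Xs \<in> Obj FF" "projective_obj FF E Xs" by (auto simp: F_sel)
    then show ?case
      using FE.projective_biproduct[OF is_biproduct_append[of "[X]" u Xs]] single_proj_iff[OF X] Cons.prems by simp
  qed
qed

lemma inj_list_iff: "injective_obj FF E Xs \<longleftrightarrow> set Xs \<subseteq> proj_pts"
  using proj_list_iff F_proj_inj by simp

text \<open>Membership in \<open>E\<close> cannot be checked directly. But \<open>Zs\<close> is the
  target of a deflation from a projective; this is a list of boundary points, so the deflation lifts
  through \<open>sq_out\<close>, and a kernel-cokernel pair with such a lift is a
  conflation.\<close>

lemma sq_conf:
  assumes len: "length Xs = n" "length Y1 = n" "length Y2 = n" "length Zs = n"
    and sq: "\<And>i. i < n \<Longrightarrow> exact_square (Xs ! i) (Y1 ! i) (Y2 ! i) (Zs ! i)"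
  shows "(Xs, Y1 @ Y2, Zs, sq_in n, sq_out n) \<in> E"
proof -
  note ob = sq_Obj[OF len sq]
  have "\<exists>V P i d. projective_obj FF E P \<and> (V, P, Zs, i, d) \<in> E"
    using frob_E ob(3) unfolding frobenius_category_def by blast
  then obtain V P i d where P: "projective_obj FF E P" and c: "(V, P, Zs, i, d) \<in> E" by auto
  obtain t where t: "t \<in> Hom FF P (Y1 @ Y2)" "Cmp FF P (Y1 @ Y2) Zs (sq_out n) t = d"
    using sq_lift[OF len sq, of P d] P FE.confD(7)[OF c] by (auto simp: proj_list_iff)
  have "deflation E P Zs d" using c unfolding deflation_def by blast
  then show ?thesis
    using FE.conf_of_factor_defl[OF sq_kernel[OF len sq] sq_cokernel[OF len sq] ob FE.confD(2)[OF c] t(1)] t(2) by simp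
qed

section \<open>Stably null matrices\<close>

definition null_mat :: "pt set list \<Rightarrow> pt set list \<Rightarrow> 'r mat \<Rightarrow> bool" where
  "null_mat Xs Ys f \<longleftrightarrow> (\<forall>j < length Ys. \<forall>i < length Xs. nonnull (Xs ! i) (Ys ! j) \<longrightarrow> u dvd f $$ (j, i))"

text \<open>At a nonnull position every factorisation costs a factor \<open>u\<close>. Conversely
  each entry factors through a projective point of its own, at a cost of at most \<open>u\<close>,
  and at no cost in null positions.\<close>

lemma F_null_iff:
  assumes X: "Xs \<in> Obj FF" and Y: "Ys \<in> Obj FF"
  shows "f \<in> stably_null FF E Xs Ys \<longleftrightarrow> f \<in> Hom FF Xs Ys \<and> null_mat Xs Ys f"
proof
  assume "f \<in> stably_null FF E Xs Ys"
  then obtain P a b where P: "projective_obj FF E P" and ab: "a \<in> Hom FF Xs P" "b \<in> Hom FF P Ys" and f: "f = Cmp FF Xs P Ys b a"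
    unfolding stably_null_def by blast
  have PP: "set P \<subseteq> proj_pts" using P proj_list_iff by simp
  then have "P ! a \<in> proj_pts" if "a < length P" for a using that by auto
  then have "u dvd f $$ (j, i)" if "j < length Ys" "i < length Xs" "nonnull (Xs ! i) (Ys ! j)" for j i
    unfolding f using that by (subst F_cmp_index) (auto intro!: dvd_sum dvd_mult dvd_wt simp: nonnull_def)
  then show "f \<in> Hom FF Xs Ys \<and> null_mat Xs Ys f" unfolding null_mat_def f by (simp add: F_sel)
next
  assume *: "f \<in> Hom FF Xs Ys \<and> null_mat Xs Ys f"
  let ?n = "length Xs" and ?m = "length Ys"
  have "\<exists>P r. P \<in> proj_pts \<and> f $$ (j, i) = r * wgt (Xs ! i) P (Ys ! j)" if ji: "j < ?m" "i < ?n" for j i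
  proof (cases "nonnull (Xs ! i) (Ys ! j)")
    case True
    obtain P where P: "P \<in> proj_pts" "c_exp (Xs ! i) P (Ys ! j) \<le> 1"
      using c_exp_proj_le_1 X Y ji F_nth by metis
    have "wgt (Xs ! i) P (Ys ! j) dvd f $$ (j, i)"
      using wt_dvd_u[OF P(2)] * True ji unfolding null_mat_def by (metis dvd_trans)
    then show ?thesis using P(1) by (metis dvdE mult.commute)
  next
    case False
    then obtain P where P: "P \<in> proj_pts" "c_exp (Xs ! i) P (Ys ! j) < 1" unfolding nonnull_def by auto
    then have "c_exp (Xs ! i) P (Ys ! j) = 0" using c_exp_nonneg[OF F_nth[OF X ji(2)] proj_pts_Xpi[OF P(1)] F_nth[OF Y ji(1)]] P(2) by simp
    then show ?thesis using P(1) by (intro exI[of _ P] exI[of _ "f $$ (j, i)"]) simp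
  qed
  then obtain P r where Pr: "\<And>j i. j < ?m \<Longrightarrow> i < ?n \<Longrightarrow> P j i \<in> proj_pts \<and> f $$ (j, i) = r j i * wgt (Xs ! i) (P j i) (Ys ! j)"
    by metis
  \<comment> \<open>These points form one list, the pair (j, i) having position j * n + i.\<close>
  define Ps where "Ps = map (\<lambda>l. P (l div ?n) (l mod ?n)) [0..<?m * ?n]"
  define a where "a = mat (?m * ?n) ?n (\<lambda>(l, i). if l mod ?n = i then 1 else 0 :: 'r)"
  define b where "b = mat ?m (?m * ?n) (\<lambda>(j, l). if l div ?n = j then r (l div ?n) (l mod ?n) else 0)"
  have lt: "l div ?n < ?m" "l mod ?n < ?n" if "l < ?m * ?n" for l
    using that by (auto simp: less_mult_imp_div_less intro!: mod_less_divisor gr0I)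
  have PP: "set Ps \<subseteq> proj_pts" unfolding Ps_def using Pr lt by auto
  have "Cmp FF Xs Ps Ys b a = f"
  proof (rule F_eqI[where m = ?m and n = ?n])
    fix j i assume ji: "j < ?m" "i < ?n"
    have l: "l div ?n = j \<and> l mod ?n = i \<longleftrightarrow> l = j * ?n + i" for l
    proof -
      have "Xs \<noteq> []" using ji by auto
      then show ?thesis using ji div_mult_mod_eq[of l ?n] by (auto simp: add.commute[of "j * ?n"])
    qed
    have lj: "(j * ?n + i) div ?n = j" "(j * ?n + i) mod ?n = i" using l by blast+
    have "Suc j * ?n \<le> ?m * ?n" using ji by (intro mult_right_mono) auto
    then have l': "j * ?n + i < ?m * ?n" using ji by simp
    have "Cmp FF Xs Ps Ys b a $$ (j, i) = (\<Sum>l<?m * ?n. if l = j * ?n + i then r j i * wgt (Xs ! i) (P j i) (Ys ! j) else 0)"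
      using ji l by (subst F_cmp_index) (auto simp: lj Ps_def a_def b_def mult_delta simp del: sum.delta sum.delta' intro!: sum.cong)
    then show "Cmp FF Xs Ps Ys b a $$ (j, i) = f $$ (j, i)" using Pr[OF ji] l' by simp
  qed (use * in \<open>auto simp: F_sel\<close>)
  moreover have "a \<in> Hom FF Xs Ps" "b \<in> Hom FF Ps Ys" unfolding a_def b_def Ps_def by (simp_all add: F_sel)
  ultimately show "f \<in> stably_null FF E Xs Ys"
    unfolding stably_null_def using PP proj_list_iff[of Ps] inj_list_iff[of Ps] by blast
qed

end

section \<open>The equivariant category\<close>

text \<open>\<open>p_unit\<close> is the condition on the residue characteristic in the form
  required for averaging.\<close>

locale equivariant = exact_ground u E for u :: "'r::idom" and E +
  fixes p :: nat
  assumes p_pos: "p > 0" and p_unit: "\<exists>v. of_nat p * v = (1::'r)"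
begin

abbreviation "Q \<equiv> F_pi_eq p u"
abbreviation "EQ \<equiv> eq_exact p u E"

definition act :: "int \<Rightarrow> pt set list \<Rightarrow> pt set list" where
  "act g = map (rot p g)"

lemma length_act [simp]: "length (act g X) = length X"
  by (simp add: act_def)

lemma act_nth [simp]: "i < length X \<Longrightarrow> act g X ! i = rot p g (X ! i)"
  by (simp add: act_def)

lemma act_Obj [simp]: "X \<in> Obj FF \<Longrightarrow> act g X \<in> Obj FF"
  by (auto simp: F_sel act_def)

lemma act_act [simp]: "X \<in> Obj FF \<Longrightarrow> act g (act h X) = act (g + h) X"
  by (rule nth_equalityI) (auto simp: rot_rot F_nth)

lemma act_0 [simp]: "X \<in> Obj FF \<Longrightarrow> act 0 X = X"
  by (rule nth_equalityI) (auto simp: F_nth)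

lemma act_mod [simp]: "X \<in> Obj FF \<Longrightarrow> act (g mod int p) X = act g X"
  by (rule nth_equalityI) (auto simp: F_nth rot_mod p_pos)

lemma act_mod_add [simp]:
  "X \<in> Obj FF \<Longrightarrow> act (g mod int p + h) X = act (g + h) X"
  "X \<in> Obj FF \<Longrightarrow> act (h + g mod int p) X = act (h + g) X"
  by (metis act_mod mod_add_left_eq, metis act_mod mod_add_right_eq)

lemma hom_act: "Hom FF (act g X) (act h Y) = Hom FF X Y" "Hom FF (act g X) Y = Hom FF X Y" "Hom FF X (act h Y) = Hom FF X Y"
  by (simp_all add: F_sel)

lemma hom_any [simp]:
  "length X' = length X \<Longrightarrow> length Z' = length Z \<Longrightarrow> Cmp FF X Y Z g f \<in> Hom FF X' Z'"
  "f \<in> Hom FF X' Z' \<Longrightarrow> g \<in> Hom FF X' Z' \<Longrightarrow> Pls FF X Z f g \<in> Hom FF X' Z'"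
  by (simp_all add: F_sel)

text \<open>Rotation preserves exponents, so composition is given by the same formula on rotated
  objects; this lets a rotation be moved through composites.\<close>

lemma cmp_act:
  assumes "X \<in> Obj FF" "Y \<in> Obj FF" "Z \<in> Obj FF"
  shows "Cmp FF (act g X) (act g Y) (act g Z) = Cmp FF X Y Z"
proof (intro ext)
  fix a b show "Cmp FF (act g X) (act g Y) (act g Z) a b = Cmp FF X Y Z a b"
    by (rule F_eqI[where m = "length Z" and n = "length X"])
      (use assms in \<open>auto simp: wt_def F_nth intro!: sum.cong\<close>)
qed

lemma cmp_act':
  assumes "X \<in> Obj FF" "Y \<in> Obj FF" "Z \<in> Obj FF" "X' = act g X" "Y' = act g Y" "Z' = act g Z"
  shows "Cmp FF X' Y' Z' = Cmp FF X Y Z"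
  using assms by (simp add: cmp_act)

text \<open>The structure maps extended periodically to all integers, so that the cocycle law holds
  for ordinary addition.\<close>

definition xi :: "'r eqobj \<Rightarrow> int \<Rightarrow> 'r mat" where
  "xi X g = snd X (g mod int p)"

lemma carrier_mod_group [simp]: "carrier (integer_mod_group p) = {0..<int p}"
  using p_pos by (simp add: integer_mod_group_def)

lemma mod_carrier [simp]: "g mod int p \<in> {0..<int p}"
  using p_pos by simp

lemma Q_sel: "Cmp Q X Y Z = Cmp FF (fst X) (fst Y) (fst Z)" "Idn Q X = Idn FF (fst X)"
  "Zer Q X Y = Zer FF (fst X) (fst Y)" "Pls Q X Y = Pls FF (fst X) (fst Y)"
  by (simp_all add: F_pi_eq_def Let_def)

lemma Q_objD:
  assumes "X \<in> Obj Q"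
  shows "fst X \<in> Obj FF" "xi X g \<in> Hom FF (fst X) (fst X)"
    "Cmp FF (act (g + h) (fst X)) (act g (fst X)) (fst X) (xi X g) (xi X h) = xi X (g + h)"
    "xi X (g mod int p) = xi X g" "xi X 0 = Idn FF (fst X)"
proof -
  obtain X0 x where X: "X = (X0, x)" by (cases X)
  have *: "X0 \<in> Obj FF" "\<And>g. g \<in> {0..<int p} \<Longrightarrow> iso_mor FF (act g X0) X0 (x g)"
    "\<And>g h. g \<in> {0..<int p} \<Longrightarrow> h \<in> {0..<int p} \<Longrightarrow>
       x ((g + h) mod int p) = Cmp FF (act g (act h X0)) (act g X0) X0 (x g) (x h)"
    using assms unfolding X F_pi_eq_def Let_def act_def by auto
  show ob [simp]: "fst X \<in> Obj FF" using * X by simp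
  show in1: "xi X g \<in> Hom FF (fst X) (fst X)" for g
    using *(2)[OF mod_carrier[of g]] unfolding X xi_def iso_mor_def by (simp add: hom_act)
  show co: "Cmp FF (act (g + h) (fst X)) (act g (fst X)) (fst X) (xi X g) (xi X h) = xi X (g + h)" for g h
    using *(3)[OF mod_carrier[of g] mod_carrier[of h]] *(1) unfolding X xi_def
    by (simp add: mod_simps)
  show "xi X (g mod int p) = xi X g" unfolding xi_def by simp
  have "iso_mor FF (fst X) (fst X) (xi X 0)"
    using *(2)[OF mod_carrier[of 0]] *(1) unfolding X xi_def by simp
  then obtain y where y: "y \<in> Hom FF (fst X) (fst X)" "Cmp FF (fst X) (fst X) (fst X) y (xi X 0) = Idn FF (fst X)"
    unfolding iso_mor_def by auto
  \<comment> \<open>The cocycle law makes \<open>xi X 0\<close> idempotent, and an invertible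
    idempotent is the identity.\<close>
  have "Cmp FF (fst X) (fst X) (fst X) y (Cmp FF (fst X) (fst X) (fst X) (xi X 0) (xi X 0)) = xi X 0"
    using FE.cmp_ctx[OF y(2), of "fst X" "xi X 0"] in1[of 0] y by simp
  moreover have "Cmp FF (fst X) (fst X) (fst X) (xi X 0) (xi X 0) = xi X 0" using co[of 0 0] by simp
  ultimately show "xi X 0 = Idn FF (fst X)" using y(2) by simp
qed

text \<open>Both the structure maps and the rotated objects depend on \<open>g\<close> modulo
  \<open>p\<close> only, so the condition may range over all integers.\<close>

lemma Q_hom_iff:
  assumes "X \<in> Obj Q" "Y \<in> Obj Q"
  shows "f \<in> Hom Q X Y \<longleftrightarrow> f \<in> Hom FF (fst X) (fst Y) \<and>
    (\<forall>g. Cmp FF (act g (fst X)) (fst X) (fst Y) f (xi X g) = Cmp FF (act g (fst X)) (act g (fst Y)) (fst Y) (xi Y g) f)"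
proof -
  obtain X0 x where X: "X = (X0, x)" by (cases X)
  obtain Y0 y where Y: "Y = (Y0, y)" by (cases Y)
  have ob: "X0 \<in> Obj FF" "Y0 \<in> Obj FF" using Q_objD assms X Y by force+
  have "(\<forall>g \<in> {0..<int p}. Cmp FF (act g X0) X0 Y0 f (x g) = Cmp FF (act g X0) (act g Y0) Y0 (y g) f) \<longleftrightarrow>
    (\<forall>g. Cmp FF (act g X0) X0 Y0 f (xi X g) = Cmp FF (act g X0) (act g Y0) Y0 (xi Y g) f)"
  proof safe
    fix g assume "\<forall>g \<in> {0..<int p}. Cmp FF (act g X0) X0 Y0 f (x g) = Cmp FF (act g X0) (act g Y0) Y0 (y g) f"
    from bspec[OF this mod_carrier[of g]] show "Cmp FF (act g X0) X0 Y0 f (xi X g) = Cmp FF (act g X0) (act g Y0) Y0 (xi Y g) f"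
      using ob unfolding xi_def X Y by simp
  next
    fix g assume *: "\<forall>g. Cmp FF (act g X0) X0 Y0 f (xi X g) = Cmp FF (act g X0) (act g Y0) Y0 (xi Y g) f" and g: "g \<in> {0..<int p}"
    then have "g mod int p = g" by simp
    then show "Cmp FF (act g X0) X0 Y0 f (x g) = Cmp FF (act g X0) (act g Y0) Y0 (y g) f"
      using *[rule_format, of g] unfolding xi_def X Y by simp
  qed
  then show ?thesis unfolding X Y by (simp add: F_pi_eq_def Let_def act_def[symmetric])
qed

text \<open>Inverse to \<open>xi\<close>: builds an equivariant object from a periodic family on the
  integers.\<close>

definition mk_eq :: "pt set list \<Rightarrow> (int \<Rightarrow> 'r mat) \<Rightarrow> 'r eqobj" where
  "mk_eq X x = (X, \<lambda>g\<in>{0..<int p}. x g)"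

lemma mk_eq:
  assumes X: "X \<in> Obj FF" and x: "\<And>g. x g \<in> Hom FF X X" "x 0 = Idn FF X" "\<And>g. x (g mod int p) = x g"
    and co: "\<And>g h. Cmp FF (act (g + h) X) (act g X) X (x g) (x h) = x (g + h)"
  shows "mk_eq X x \<in> Obj Q" "fst (mk_eq X x) = X" "xi (mk_eq X x) = x"
proof -
  show "fst (mk_eq X x) = X" by (simp add: mk_eq_def)
  show "xi (mk_eq X x) = x" by (rule ext) (use x(3) p_pos in \<open>simp add: xi_def mk_eq_def\<close>)
  have iso: "iso_mor FF (act g X) X (x g)" for g
    unfolding iso_mor_def
  proof (intro conjI bexI[of _ "x (- g)"])
    have "Cmp FF (act g X) X (act g X) = Cmp FF X (act (- g) X) X"
      by (rule cmp_act'[where g = g]) (use X in auto)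
    then show "Cmp FF (act g X) X (act g X) (x (- g)) (x g) = Idn FF (act g X)"
      using co[of "- g" g] X x(2) by (simp add: F_sel)
    show "Cmp FF X (act g X) X (x g) (x (- g)) = Idn FF X"
      using co[of g "- g"] X x(2) by simp
  qed (use x(1) in \<open>simp_all add: hom_act\<close>)
  show "mk_eq X x \<in> Obj Q"
    unfolding mk_eq_def F_pi_eq_def Let_def act_def[symmetric] using X iso co x(3) by simp
qed

lemma Q_addcat_part:
  assumes "X \<in> Obj Q" "Y \<in> Obj Q" "Z \<in> Obj Q"
  shows "f \<in> Hom Q X Y \<Longrightarrow> g \<in> Hom Q Y Z \<Longrightarrow> Cmp Q X Y Z g f \<in> Hom Q X Z"
    and "f \<in> Hom Q X Y \<Longrightarrow> f' \<in> Hom Q X Y \<Longrightarrow> Pls Q X Y f f' \<in> Hom Q X Y"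
    and "f \<in> Hom Q X Y \<Longrightarrow> FE.neg (fst X) (fst Y) f \<in> Hom Q X Y"
    and "Idn Q X \<in> Hom Q X X" "Zer Q X Y \<in> Hom Q X Y"
proof -
  note [simp] = Q_objD(1)[OF assms(1)] Q_objD(1)[OF assms(2)] Q_objD(1)[OF assms(3)]
    Q_objD(2)[OF assms(1)] Q_objD(2)[OF assms(2)] Q_objD(2)[OF assms(3)] hom_act
  note iff = Q_hom_iff[OF assms(1) assms(2)] Q_hom_iff[OF assms(2) assms(3)] Q_hom_iff[OF assms(1) assms(3)] Q_hom_iff[OF assms(1) assms(1)]
  show "Cmp Q X Y Z g f \<in> Hom Q X Z" if f: "f \<in> Hom Q X Y" and g: "g \<in> Hom Q Y Z"
  proof -
    note [simp] = f[unfolded iff, THEN conjunct1] g[unfolded iff, THEN conjunct1]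
    note fe = f[unfolded iff, THEN conjunct2, rule_format] and ge = g[unfolded iff, THEN conjunct2, rule_format]
    show ?thesis unfolding iff Q_sel
    proof (intro conjI allI)
      fix h
      have "Cmp FF (act h (fst X)) (fst X) (fst Z) (Cmp FF (fst X) (fst Y) (fst Z) g f) (xi X h) =
          Cmp FF (act h (fst X)) (act h (fst Y)) (fst Z) (Cmp FF (act h (fst Y)) (fst Y) (fst Z) g (xi Y h)) f"
        by (simp add: FE.cmp_assoc fe)
      also have "\<dots> = Cmp FF (act h (fst X)) (act h (fst Z)) (fst Z) (xi Z h) (Cmp FF (act h (fst X)) (act h (fst Y)) (act h (fst Z)) g f)"
        by (simp add: FE.cmp_assoc ge)
      finally show "Cmp FF (act h (fst X)) (fst X) (fst Z) (Cmp FF (fst X) (fst Y) (fst Z) g f) (xi X h) =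
         Cmp FF (act h (fst X)) (act h (fst Z)) (fst Z) (xi Z h) (Cmp FF (fst X) (fst Y) (fst Z) g f)"
        by (simp add: cmp_act)
    qed simp
  qed
  have pls: "Pls FF (act h A) (act h B) = Pls FF A B" for h A B by (intro ext) (simp add: F_sel)
  have neg: "FE.neg (act h A) (act h B) a = FE.neg A B a" if "A \<in> Obj FF" "B \<in> Obj FF" "a \<in> Hom FF A B" for h A B a
    by (rule FE.neg_unique) (use that FE.neg_in[of "act h A" "act h B" a] FE.pls_neg[of "act h A" "act h B" a] pls[of h A B] in \<open>auto simp: F_sel(4) hom_act\<close>)
  show "Pls Q X Y f f' \<in> Hom Q X Y" if f: "f \<in> Hom Q X Y" and f': "f' \<in> Hom Q X Y"
  proof -
    note [simp] = f[unfolded iff, THEN conjunct1] f'[unfolded iff, THEN conjunct1]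
    note fe = f[unfolded iff, THEN conjunct2, rule_format] and fe' = f'[unfolded iff, THEN conjunct2, rule_format]
    have "Cmp FF (act h (fst X)) (act h (fst Y)) (fst Y) (xi Y h) (Pls FF (fst X) (fst Y) f f') =
        Pls FF (act h (fst X)) (fst Y) (Cmp FF (act h (fst X)) (act h (fst Y)) (fst Y) (xi Y h) f)
          (Cmp FF (act h (fst X)) (act h (fst Y)) (fst Y) (xi Y h) f')" for h
      using FE.cmp_plsr[of "act h (fst X)" "act h (fst Y)" "fst Y" f f' "xi Y h"] by (simp add: pls)
    then show ?thesis unfolding iff Q_sel by (simp add: FE.cmp_plsl fe fe')
  qed
  show "FE.neg (fst X) (fst Y) f \<in> Hom Q X Y" if f: "f \<in> Hom Q X Y"
  proof -
    note [simp] = f[unfolded iff, THEN conjunct1]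
    note fe = f[unfolded iff, THEN conjunct2, rule_format]
    have "Cmp FF (act h (fst X)) (act h (fst Y)) (fst Y) (xi Y h) (FE.neg (fst X) (fst Y) f) =
        FE.neg (act h (fst X)) (fst Y) (Cmp FF (act h (fst X)) (act h (fst Y)) (fst Y) (xi Y h) f)" for h
      using FE.cmp_negr[of "act h (fst X)" "act h (fst Y)" "fst Y" f "xi Y h"] by (simp add: neg)
    then show ?thesis unfolding iff by (simp add: FE.cmp_negl fe)
  qed
  show "Idn Q X \<in> Hom Q X X" unfolding iff Q_sel
  proof (intro conjI allI)
    fix h show "Cmp FF (act h (fst X)) (fst X) (fst X) (Idn FF (fst X)) (xi X h) =
        Cmp FF (act h (fst X)) (act h (fst X)) (fst X) (xi X h) (Idn FF (fst X))"
      using FE.cmp_idr[of "act h (fst X)" "fst X" "xi X h"] by (simp add: F_sel(3) FE.cmp_idl[unfolded F_sel(3)])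
  qed simp
  show "Zer Q X Y \<in> Hom Q X Y" unfolding iff Q_sel
  proof (intro conjI allI)
    fix h show "Cmp FF (act h (fst X)) (fst X) (fst Y) (Zer FF (fst X) (fst Y)) (xi X h) =
        Cmp FF (act h (fst X)) (act h (fst Y)) (fst Y) (xi Y h) (Zer FF (fst X) (fst Y))"
      using FE.cmp_zerr[of "act h (fst X)" "act h (fst Y)" "fst Y" "xi Y h"] FE.cmp_zerl[of "act h (fst X)" "fst X" "fst Y" "xi X h"]
      by (simp add: F_sel(4))
  qed simp
qed

end

context equivariant
begin

lemma is_biproduct_act:
  assumes "is_biproduct FF A B S i j q r"
  shows "is_biproduct FF (act g A) (act g B) (act g S) i j q r"
proof -
  have *: "Idn FF (act g X) = Idn FF X" "Zer FF (act g X) (act g Y) = Zer FF X Y" "Pls FF (act g X) (act g Y) = Pls FF X Y" for X Y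
    by (simp_all add: F_sel fun_eq_iff)
  show ?thesis using assms unfolding is_biproduct_def by (simp add: hom_act * cmp_act)
qed

text \<open>The middle object inherits the structure \<open>i (xi X g) q + j (xi Y g) r\<close>, for
  which the given injections and projections are equivariant.\<close>

lemma Q_biproduct:
  assumes X: "X \<in> Obj Q" and Y: "Y \<in> Obj Q" and b: "is_biproduct FF (fst X) (fst Y) S i j q r"
  obtains Z where "Z \<in> Obj Q" "fst Z = S" "is_biproduct Q X Y Z i j q r"
proof -
  note [simp] = Q_objD(1)[OF X] Q_objD(1)[OF Y] Q_objD(2)[OF X] Q_objD(2)[OF Y] hom_act FE.is_biproductD[OF b]
  note bg = is_biproduct_act[OF b]
  define x where "x g = Pls FF S S
      (Cmp FF (act g S) (fst X) S i (Cmp FF (act g S) (act g (fst X)) (fst X) (xi X g) q))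
      (Cmp FF (act g S) (fst Y) S j (Cmp FF (act g S) (act g (fst Y)) (fst Y) (xi Y g) r))" for g
  have x_in [simp]: "x g \<in> Hom FF S S" for g
    unfolding x_def by simp
  have xq: "Cmp FF (act g S) S (fst X) q (x g) = Cmp FF (act g S) (act g (fst X)) (fst X) (xi X g) q"
    and xr: "Cmp FF (act g S) S (fst Y) r (x g) = Cmp FF (act g S) (act g (fst Y)) (fst Y) (xi Y g) r"
    and ix: "Cmp FF (act g (fst X)) (act g S) S (x g) i = Cmp FF (act g (fst X)) (fst X) S i (xi X g)"
    and jx: "Cmp FF (act g (fst Y)) (act g S) S (x g) j = Cmp FF (act g (fst Y)) (fst Y) S j (xi Y g)" for g
  proof -
    have x': "x g = Pls FF (act g S) S
      (Cmp FF (act g S) (fst X) S i (Cmp FF (act g S) (act g (fst X)) (fst X) (xi X g) q))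
      (Cmp FF (act g S) (fst Y) S j (Cmp FF (act g S) (act g (fst Y)) (fst Y) (xi Y g) r))"
      unfolding x_def by (simp add: F_sel)
    note bi = FE.is_biproductD(8-11)[OF bg[of g]]
    show "Cmp FF (act g S) S (fst X) q (x g) = Cmp FF (act g S) (act g (fst X)) (fst X) (xi X g) q"
      "Cmp FF (act g S) S (fst Y) r (x g) = Cmp FF (act g S) (act g (fst Y)) (fst Y) (xi Y g) r"
      unfolding x' by (simp_all add: FE.cmp_plsr FE.biproduct_ctx[OF b])
    show "Cmp FF (act g (fst X)) (act g S) S (x g) i = Cmp FF (act g (fst X)) (fst X) S i (xi X g)"
      "Cmp FF (act g (fst Y)) (act g S) S (x g) j = Cmp FF (act g (fst Y)) (fst Y) S j (xi Y g)"
      unfolding x' by (simp_all add: FE.cmp_plsl FE.cmp_assoc bi)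
  qed
  have x0: "x 0 = Idn FF S"
    unfolding x_def using FE.is_biproductD(12)[OF b] by (simp add: Q_objD(5)[OF X] Q_objD(5)[OF Y])
  have xm: "x (g mod int p) = x g" for g
    unfolding x_def by (simp add: Q_objD(4)[OF X] Q_objD(4)[OF Y])
  have co: "Cmp FF (act (g + h) S) (act g S) S (x g) (x h) = x (g + h)" for g h
  proof (rule FE.biproduct_out_eqI[OF bg[of "g + h"], of S])
    have 1: "Cmp FF (act (g + h) (fst X)) (act (g + h) S) (act g S) (x h) i = Cmp FF (act (g + h) (fst X)) (act g (fst X)) (act g S) i (xi X h)"
      using ix[of h] cmp_act[of "act h (fst X)" "act h S" S g] cmp_act[of "act h (fst X)" "fst X" S g] by simp
    show "Cmp FF (act (g + h) (fst X)) (act (g + h) S) S (Cmp FF (act (g + h) S) (act g S) S (x g) (x h)) i =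
        Cmp FF (act (g + h) (fst X)) (act (g + h) S) S (x (g + h)) i"
      by (simp add: FE.cmp_assoc 1 ix Q_objD(3)[OF X] FE.cmp_ctx[OF ix])
    have 2: "Cmp FF (act (g + h) (fst Y)) (act (g + h) S) (act g S) (x h) j = Cmp FF (act (g + h) (fst Y)) (act g (fst Y)) (act g S) j (xi Y h)"
      using jx[of h] cmp_act[of "act h (fst Y)" "act h S" S g] cmp_act[of "act h (fst Y)" "fst Y" S g] by simp
    show "Cmp FF (act (g + h) (fst Y)) (act (g + h) S) S (Cmp FF (act (g + h) S) (act g S) S (x g) (x h)) j =
        Cmp FF (act (g + h) (fst Y)) (act (g + h) S) S (x (g + h)) j"
      by (simp add: FE.cmp_assoc 2 jx Q_objD(3)[OF Y] FE.cmp_ctx[OF jx])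
  qed simp_all
  note Z = mk_eq[of S x, OF _ x_in x0 xm co, simplified]
  define Z where "Z = mk_eq S x"
  have Z: "Z \<in> Obj Q" "fst Z = S" "xi Z = x" using Z unfolding Z_def by auto
  have "i \<in> Hom Q X Z" "j \<in> Hom Q Y Z" "q \<in> Hom Q Z X" "r \<in> Hom Q Z Y"
    using X Y Z by (auto simp: Q_hom_iff xq xr ix jx)
  then have "is_biproduct Q X Y Z i j q r"
    using b X Y Z unfolding is_biproduct_def by (simp add: Q_sel)
  then show ?thesis using that Z by blast
qed

lemma Q_hom_F: "X \<in> Obj Q \<Longrightarrow> Y \<in> Obj Q \<Longrightarrow> f \<in> Hom Q X Y \<Longrightarrow> f \<in> Hom FF (fst X) (fst Y)"
  using Q_hom_iff by blast

sublocale QQ: addcat Q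
proof
  fix X Y assume *: "X \<in> Obj Q" "Y \<in> Obj Q"
  then obtain S where "biproduct FF (fst X) (fst Y) S" using FE.biproduct_ex Q_objD(1) by metis
  then obtain i j q r where "is_biproduct FF (fst X) (fst Y) S i j q r" unfolding biproduct_iff by auto
  then obtain Z where "is_biproduct Q X Y Z i j q r" using Q_biproduct * by metis
  then show "\<exists>S. biproduct Q X Y S" unfolding biproduct_iff by blast
next
  fix X Y f assume *: "X \<in> Obj Q" "Y \<in> Obj Q" "f \<in> Hom Q X Y"
  then show "\<exists>g\<in>Hom Q X Y. Pls Q X Y f g = Zer Q X Y"
    using Q_addcat_part(3)[of X Y X f] Q_hom_F[of X Y f] Q_objD(1)
    by (intro bexI[of _ "FE.neg (fst X) (fst Y) f"]) (auto simp: Q_sel)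
next
  fix X Y f g assume *: "X \<in> Obj Q" "Y \<in> Obj Q" "f \<in> Hom Q X Y" "g \<in> Hom Q X Y"
  note [simp] = Q_objD(1)[OF *(1)] Q_objD(1)[OF *(2)] Q_hom_F[OF *(1,2,3)] Q_hom_F[OF *(1,2,4)]
  show "Pls Q X Y f g = Pls Q X Y g f" unfolding Q_sel by (rule FE.pls_comm) simp_all
  fix h assume h: "h \<in> Hom Q X Y"
  note [simp] = Q_hom_F[OF *(1,2) h]
  show "Pls Q X Y (Pls Q X Y f g) h = Pls Q X Y f (Pls Q X Y g h)" unfolding Q_sel by (rule FE.pls_assoc) simp_all
next
  fix X Y f assume *: "X \<in> Obj Q" "Y \<in> Obj Q" "f \<in> Hom Q X Y"
  show "Pls Q X Y f (Zer Q X Y) = f" unfolding Q_sel by (rule FE.pls_zer) (use * Q_objD(1) Q_hom_F in blast)+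
next
  fix X Y Z f g h assume *: "X \<in> Obj Q" "Y \<in> Obj Q" "Z \<in> Obj Q" "f \<in> Hom Q X Y" "g \<in> Hom Q Y Z" "h \<in> Hom Q Y Z"
  show "Cmp Q X Y Z (Pls Q Y Z g h) f = Pls Q X Z (Cmp Q X Y Z g f) (Cmp Q X Y Z h f)"
    unfolding Q_sel by (rule FE.cmp_plsl) (use * Q_objD(1) Q_hom_F in blast)+
next
  fix X Y Z f g h assume *: "X \<in> Obj Q" "Y \<in> Obj Q" "Z \<in> Obj Q" "f \<in> Hom Q X Y" "g \<in> Hom Q X Y" "h \<in> Hom Q Y Z"
  show "Cmp Q X Y Z h (Pls Q X Y f g) = Pls Q X Z (Cmp Q X Y Z h f) (Cmp Q X Y Z h g)"
    unfolding Q_sel by (rule FE.cmp_plsr) (use * Q_objD(1) Q_hom_F in blast)+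
qed ((blast intro: Q_addcat_part) | (simp add: Q_sel Q_hom_F Q_objD(1) FE.cmp_assoc; fail))+

section \<open>Averaging over the group\<close>

definition pinv :: 'r where "pinv = (SOME v. of_nat p * v = 1)"

lemma pinv: "of_nat p * pinv = (1::'r)"
  unfolding pinv_def using p_unit by (rule someI_ex)

text \<open>The action of \<open>g\<close> on Hom(X, Y), conjugation by the structure maps, with
  \<open>xi X (- g)\<close> in the role of the inverse of \<open>xi X g\<close>. Equivariant
  morphisms are fixed by it.\<close>

definition tw :: "'r eqobj \<Rightarrow> 'r eqobj \<Rightarrow> int \<Rightarrow> 'r mat \<Rightarrow> 'r mat" where
  "tw X Y g f = Cmp FF (fst X) (act g (fst X)) (fst Y)
     (Cmp FF (act g (fst X)) (act g (fst Y)) (fst Y) (xi Y g) f) (xi X (- g))"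

text \<open>The Reynolds operator, which projects the morphisms of \<open>F\<^sub>\<pi>\<close> onto the equivariant ones.\<close>

definition avg :: "'r eqobj \<Rightarrow> 'r eqobj \<Rightarrow> 'r mat \<Rightarrow> 'r mat" where
  "avg X Y f = mat (length (fst Y)) (length (fst X)) (\<lambda>(j, i). \<Sum>g\<in>{0..<int p}. pinv * tw X Y g f $$ (j, i))"

lemma avg_F: "avg X Y f \<in> Hom FF (fst X) (fst Y)"
  by (simp add: avg_def F_sel)

lemma sum_shift:
  fixes \<phi> :: "int \<Rightarrow> 'r"
  assumes "\<And>g. \<phi> (g mod int p) = \<phi> g"
  shows "(\<Sum>g\<in>{0..<int p}. \<phi> (g + h)) = (\<Sum>g\<in>{0..<int p}. \<phi> g)"
proof -
  have "(\<Sum>g\<in>{0..<int p}. \<phi> (g + h)) = (\<Sum>g\<in>{0..<int p}. \<phi> ((g + h) mod int p))"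
    by (simp add: assms)
  also have "\<dots> = (\<Sum>g\<in>{0..<int p}. \<phi> g)"
    by (rule sum.reindex_bij_witness[where i = "\<lambda>g. (g - h) mod int p" and j = "\<lambda>g. (g + h) mod int p"])
      (use p_pos in \<open>auto simp: mod_simps\<close>)
  finally show ?thesis .
qed

lemma cmp_sum_l:
  "Cmp FF X Y Z (mat (length Z) (length Y) (\<lambda>(j, i). \<Sum>g\<in>G. v * A g $$ (j, i))) f =
   mat (length Z) (length X) (\<lambda>(j, i). \<Sum>g\<in>G. v * Cmp FF X Y Z (A g) f $$ (j, i))"
proof (rule F_eqI[where m = "length Z" and n = "length X"])
  fix k i assume ki: "k < length Z" "i < length X"
  then show "Cmp FF X Y Z (mat (length Z) (length Y) (\<lambda>(j, i). \<Sum>g\<in>G. v * A g $$ (j, i))) f $$ (k, i) =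
    mat (length Z) (length X) (\<lambda>(j, i). \<Sum>g\<in>G. v * Cmp FF X Y Z (A g) f $$ (j, i)) $$ (k, i)"
    by (simp add: sum_distrib_left sum_distrib_right mult.assoc) (rule sum.swap)
qed auto

lemma cmp_sum_r:
  "Cmp FF X Y Z f (mat (length Y) (length X) (\<lambda>(j, i). \<Sum>g\<in>G. v * A g $$ (j, i))) =
   mat (length Z) (length X) (\<lambda>(j, i). \<Sum>g\<in>G. v * Cmp FF X Y Z f (A g) $$ (j, i))"
proof (rule F_eqI[where m = "length Z" and n = "length X"])
  fix k i assume ki: "k < length Z" "i < length X"
  then show "Cmp FF X Y Z f (mat (length Y) (length X) (\<lambda>(j, i). \<Sum>g\<in>G. v * A g $$ (j, i))) $$ (k, i) =
    mat (length Z) (length X) (\<lambda>(j, i). \<Sum>g\<in>G. v * Cmp FF X Y Z f (A g) $$ (j, i)) $$ (k, i)"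
    by (simp add: sum_distrib_left sum_distrib_right mult.assoc mult.left_commute) (rule sum.swap)
qed auto

context
  fixes X Y :: "'r eqobj"
  assumes X: "X \<in> Obj Q" and Y: "Y \<in> Obj Q"
begin

lemma xi_inv: "Cmp FF (fst X) (act g (fst X)) (fst X) (xi X g) (xi X (- g)) = Idn FF (fst X)"
  using Q_objD[OF X] Q_objD(3)[OF X, of g "- g"] by simp

lemma tw_mod: "tw X Y (g mod int p) f = tw X Y g f"
proof -
  have "xi X (- (g mod int p)) = xi X (- g)"
    using Q_objD(4)[OF X, of "- (g mod int p)"] Q_objD(4)[OF X, of "- g"] by (metis mod_minus_eq)
  then show ?thesis unfolding tw_def using Q_objD(1)[OF X] Q_objD(1)[OF Y] Q_objD(4)[OF Y] by simp
qed

text \<open>Replacing g by g + h compensates for passing the structure map of \<open>h\<close> from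
  one side to the other; summed over the group, this makes the average equivariant.\<close>

lemma tw_equiv:
  assumes f: "f \<in> Hom FF (fst X) (fst Y)"
  shows "Cmp FF (act h (fst X)) (fst X) (fst Y) (tw X Y (g + h) f) (xi X h) =
    Cmp FF (act h (fst X)) (act h (fst Y)) (fst Y) (xi Y h) (tw X Y g f)"
proof -
  let ?X = "fst X" and ?Y = "fst Y" and ?k = "g + h"
  note [simp] = Q_objD(1)[OF X] Q_objD(1)[OF Y] Q_objD(2)[OF X] Q_objD(2)[OF Y] hom_act f
  have 1: "xi Y ?k = Cmp FF (act ?k ?Y) (act h ?Y) ?Y (xi Y h) (xi Y g)"
    using Q_objD(3)[OF Y, of h g] by (simp add: add.commute)
  have 2: "Cmp FF (act h ?X) ?X (act ?k ?X) (xi X (- g - h)) (xi X h) = xi X (- g)"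
    using Q_objD(3)[OF X, of "- ?k" h] cmp_act[of "act (- g) ?X" "act (- ?k) ?X" ?X ?k] by (simp add: algebra_simps)
  have 3: "tw X Y g f = Cmp FF (act h ?X) (act ?k ?X) (act h ?Y) (Cmp FF (act ?k ?X) (act ?k ?Y) (act h ?Y) (xi Y g) f) (xi X (- g))"
    unfolding tw_def using cmp_act[of ?X "act g ?X" ?Y h] cmp_act[of "act g ?X" "act g ?Y" ?Y h] by (simp add: add.commute)
  show ?thesis unfolding 3 by (simp add: tw_def 1 2 FE.cmp_assoc)
qed

lemma avg_Q: assumes f: "f \<in> Hom FF (fst X) (fst Y)" shows "avg X Y f \<in> Hom Q X Y"
  unfolding Q_hom_iff[OF X Y]
proof (intro conjI allI avg_F)
  fix h
  let ?X = "fst X" and ?Y = "fst Y"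
  have e: "(\<Sum>g\<in>{0..<int p}. pinv * Cmp FF (act h ?X) ?X ?Y (tw X Y g f) (xi X h) $$ (j, i)) =
      (\<Sum>g\<in>{0..<int p}. pinv * Cmp FF (act h ?X) (act h ?Y) ?Y (xi Y h) (tw X Y g f) $$ (j, i))" for j i
    by (subst sum_shift[symmetric, where h = h]) (simp_all only: tw_equiv[OF f] tw_mod)
  have 1: "Cmp FF (act h ?X) ?X ?Y (avg X Y f) (xi X h) =
    mat (length ?Y) (length ?X) (\<lambda>(j, i). \<Sum>g\<in>{0..<int p}. pinv * Cmp FF (act h ?X) ?X ?Y (tw X Y g f) (xi X h) $$ (j, i))"
    using cmp_sum_l[of "act h ?X" ?X ?Y] unfolding avg_def by simp
  have 2: "Cmp FF (act h ?X) (act h ?Y) ?Y (xi Y h) (avg X Y f) =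
    mat (length ?Y) (length ?X) (\<lambda>(j, i). \<Sum>g\<in>{0..<int p}. pinv * Cmp FF (act h ?X) (act h ?Y) ?Y (xi Y h) (tw X Y g f) $$ (j, i))"
    using cmp_sum_r[of "act h ?X" "act h ?Y" ?Y] unfolding avg_def by simp
  show "Cmp FF (act h ?X) ?X ?Y (avg X Y f) (xi X h) = Cmp FF (act h ?X) (act h ?Y) ?Y (xi Y h) (avg X Y f)"
    unfolding 1 2 e ..
qed

lemma avg_id: assumes f: "f \<in> Hom Q X Y" shows "avg X Y f = f"
proof -
  note [simp] = Q_objD(1)[OF X] Q_objD(1)[OF Y] Q_objD(2)[OF X] Q_objD(2)[OF Y] hom_act Q_hom_F[OF X Y f]
  have "Cmp FF (act g (fst X)) (act g (fst Y)) (fst Y) (xi Y g) f = Cmp FF (act g (fst X)) (fst X) (fst Y) f (xi X g)" for g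
    using f unfolding Q_hom_iff[OF X Y] by simp
  then have "tw X Y g f = f" for g
    unfolding tw_def by (simp add: FE.cmp_assoc xi_inv)
  moreover have "f \<in> carrier_mat (length (fst Y)) (length (fst X))" using Q_hom_F[OF X Y f] by (simp add: F_sel)
  ultimately show ?thesis
    unfolding avg_def by (intro F_eqI) (auto simp: mult.assoc[symmetric] pinv)
qed

end

lemma tw_cmp_l:
  assumes X: "X \<in> Obj Q" and Y: "Y \<in> Obj Q" and Z: "Z \<in> Obj Q" and f: "f \<in> Hom FF (fst X) (fst Y)" and k: "k \<in> Hom Q Y Z"
  shows "tw X Z g (Cmp FF (fst X) (fst Y) (fst Z) k f) = Cmp FF (fst X) (fst Y) (fst Z) k (tw X Y g f)"
proof -
  note [simp] = Q_objD(1)[OF X] Q_objD(1)[OF Y] Q_objD(1)[OF Z] Q_objD(2)[OF X] Q_objD(2)[OF Y] Q_objD(2)[OF Z] hom_act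
    Q_hom_F[OF Y Z k] f
  have 1: "Cmp FF (act g (fst Y)) (act g (fst Z)) (fst Z) (xi Z g) k = Cmp FF (act g (fst Y)) (fst Y) (fst Z) k (xi Y g)"
    using k unfolding Q_hom_iff[OF Y Z] by simp
  have 2: "Cmp FF (fst X) (fst Y) (fst Z) k f = Cmp FF (act g (fst X)) (act g (fst Y)) (act g (fst Z)) k f" by (simp add: cmp_act)
  show ?thesis unfolding 2 tw_def by (simp add: FE.cmp_assoc FE.cmp_ctx[OF 1])
qed

lemma tw_cmp_r:
  assumes X: "X \<in> Obj Q" and Y: "Y \<in> Obj Q" and Z: "Z \<in> Obj Q" and f: "f \<in> Hom Q X Y" and k: "k \<in> Hom FF (fst Y) (fst Z)"
  shows "tw X Z g (Cmp FF (fst X) (fst Y) (fst Z) k f) = Cmp FF (fst X) (fst Y) (fst Z) (tw Y Z g k) f"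
proof -
  note [simp] = Q_objD(1)[OF X] Q_objD(1)[OF Y] Q_objD(1)[OF Z] Q_objD(2)[OF X] Q_objD(2)[OF Y] Q_objD(2)[OF Z] hom_act
    Q_hom_F[OF X Y f] k
  have 1: "Cmp FF (fst X) (act g (fst X)) (act g (fst Y)) f (xi X (- g)) = Cmp FF (fst X) (fst Y) (act g (fst Y)) (xi Y (- g)) f"
    using f[unfolded Q_hom_iff[OF X Y], THEN conjunct2, rule_format, of "- g"]
      cmp_act[of "act (- g) (fst X)" "fst X" "fst Y" g] cmp_act[of "act (- g) (fst X)" "act (- g) (fst Y)" "fst Y" g] by simp
  have 2: "Cmp FF (fst X) (fst Y) (fst Z) k f = Cmp FF (act g (fst X)) (act g (fst Y)) (act g (fst Z)) k f" by (simp add: cmp_act)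
  show ?thesis unfolding 2 tw_def by (simp add: FE.cmp_assoc 1)
qed

text \<open>With \<open>avg_id\<close> this gives the pattern behind the kernels, cokernels, lifts
  and extensions below: a solution in \<open>F_pi\<close> of a factorisation problem with
  equivariant data becomes an equivariant solution when averaged.\<close>

lemma avg_cmp_l:
  assumes "X \<in> Obj Q" "Y \<in> Obj Q" "Z \<in> Obj Q" "f \<in> Hom FF (fst X) (fst Y)" "k \<in> Hom Q Y Z"
  shows "Cmp FF (fst X) (fst Y) (fst Z) k (avg X Y f) = avg X Z (Cmp FF (fst X) (fst Y) (fst Z) k f)"
  unfolding avg_def cmp_sum_r tw_cmp_l[OF assms] ..

lemma avg_cmp_r:
  assumes "X \<in> Obj Q" "Y \<in> Obj Q" "Z \<in> Obj Q" "f \<in> Hom Q X Y" "k \<in> Hom FF (fst Y) (fst Z)"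
  shows "Cmp FF (fst X) (fst Y) (fst Z) (avg Y Z k) f = avg X Z (Cmp FF (fst X) (fst Y) (fst Z) k f)"
  unfolding avg_def cmp_sum_l tw_cmp_r[OF assms] ..

section \<open>Equivariant conflations\<close>

lemma EQ_iff: "(X, Y, Z, i, d) \<in> EQ \<longleftrightarrow> X \<in> Obj Q \<and> Y \<in> Obj Q \<and> Z \<in> Obj Q \<and>
     i \<in> Hom Q X Y \<and> d \<in> Hom Q Y Z \<and> (fst X, fst Y, fst Z, i, d) \<in> E"
  by (simp add: eq_exact_def)

lemma EQ_kernel:
  assumes "(X, Y, Z, i, d) \<in> EQ" shows "is_kernel Q X Y Z i d"
  unfolding is_kernel_def
proof (intro conjI ballI impI)
  note ob = assms[unfolded EQ_iff]
  have E: "(fst X, fst Y, fst Z, i, d) \<in> E" using ob by simp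
  show "i \<in> Hom Q X Y" "d \<in> Hom Q Y Z" "Cmp Q X Y Z d i = Zer Q X Z"
    using ob FE.confD(8)[OF E] by (auto simp: Q_sel)
  fix W a assume W: "W \<in> Obj Q" and a: "a \<in> Hom Q W Y" and z: "Cmp Q W Y Z d a = Zer Q W Z"
  have aF: "a \<in> Hom FF (fst W) (fst Y)" using Q_hom_F W ob a by blast
  obtain b where b: "b \<in> Hom FF (fst W) (fst X)" "Cmp FF (fst W) (fst X) (fst Y) i b = a"
    using FE.kernelD[OF FE.confD(4)[OF E], of "fst W" a] Q_objD(1)[OF W] aF z by (auto simp: Q_sel)
  have "Cmp FF (fst W) (fst X) (fst Y) i (avg W X b) = a"
    using avg_cmp_l[of W X Y b i] avg_id[of W Y a] b W ob a by simp
  moreover have "avg W X b \<in> Hom Q W X" using avg_Q W ob b by blast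
  moreover have "c = avg W X b" if "c \<in> Hom Q W X" "Cmp FF (fst W) (fst X) (fst Y) i c = a" for c
    using FE.kernel_mono[OF FE.confD(4)[OF E], of "fst W" c "avg W X b"] FE.confD(1-3)[OF E] Q_objD(1)[OF W]
      that Q_hom_F[OF W _ that(1)] ob avg_F[of W X b] calculation(1) by auto
  ultimately show "\<exists>!b. b \<in> Hom Q W X \<and> Cmp Q W X Y i b = a" by (auto simp: Q_sel)
qed

lemma EQ_cokernel:
  assumes "(X, Y, Z, i, d) \<in> EQ" shows "is_cokernel Q X Y Z i d"
  unfolding is_cokernel_def
proof (intro conjI ballI impI)
  note ob = assms[unfolded EQ_iff]
  have E: "(fst X, fst Y, fst Z, i, d) \<in> E" using ob by simp
  show "i \<in> Hom Q X Y" "d \<in> Hom Q Y Z" "Cmp Q X Y Z d i = Zer Q X Z"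
    using ob FE.confD(8)[OF E] by (auto simp: Q_sel)
  fix W a assume W: "W \<in> Obj Q" and a: "a \<in> Hom Q Y W" and z: "Cmp Q X Y W a i = Zer Q X W"
  have aF: "a \<in> Hom FF (fst Y) (fst W)" using Q_hom_F W ob a by blast
  obtain b where b: "b \<in> Hom FF (fst Z) (fst W)" "Cmp FF (fst Y) (fst Z) (fst W) b d = a"
    using FE.cokernelD[OF FE.confD(5)[OF E], of "fst W" a] Q_objD(1)[OF W] aF z by (auto simp: Q_sel)
  have "Cmp FF (fst Y) (fst Z) (fst W) (avg Z W b) d = a"
    using avg_cmp_r[of Y Z W d b] avg_id[of Y W a] b W ob a by simp
  moreover have "avg Z W b \<in> Hom Q Z W" using avg_Q W ob b by blast
  moreover have "c = avg Z W b" if "c \<in> Hom Q Z W" "Cmp FF (fst Y) (fst Z) (fst W) c d = a" for c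
    using FE.cokernel_epi[OF FE.confD(5)[OF E], of "fst W" c "avg Z W b"] FE.confD(1-3)[OF E] Q_objD(1)[OF W]
      that Q_hom_F[OF _ W that(1)] ob avg_F[of Z W b] calculation(1) by auto
  ultimately show "\<exists>!b. b \<in> Hom Q Z W \<and> Cmp Q Y Z W b d = a" by (auto simp: Q_sel)
qed

lemma Q_injective:
  assumes X: "X \<in> Obj Q" and inj: "injective_obj FF E (fst X)"
  shows "injective_obj Q EQ X"
  unfolding injective_obj_def
proof (intro conjI X allI impI ballI)
  fix A B k f assume "inflation EQ A B k" and f: "f \<in> Hom Q A X"
  then obtain Z d where c: "(A, B, Z, k, d) \<in> EQ" unfolding inflation_def by auto
  note ob = c[unfolded EQ_iff]
  have "inflation E (fst A) (fst B) k" using ob unfolding inflation_def by blast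
  then obtain g where g: "g \<in> Hom FF (fst B) (fst X)" "Cmp FF (fst A) (fst B) (fst X) g k = f"
    using inj Q_hom_F[OF _ X f] ob unfolding injective_obj_def by blast
  then have "Cmp FF (fst A) (fst B) (fst X) (avg B X g) k = f"
    using avg_cmp_r[of A B X k g] avg_id[of A X f] ob X f by simp
  then show "\<exists>g\<in>Hom Q B X. Cmp Q A B X g k = f"
    using avg_Q[of B X g] ob X g by (intro bexI[of _ "avg B X g"]) (auto simp: Q_sel)
qed

lemma Q_projective:
  assumes X: "X \<in> Obj Q" and proj: "projective_obj FF E (fst X)"
  shows "projective_obj Q EQ X"
  unfolding projective_obj_def
proof (intro conjI X allI impI ballI)
  fix B Z d f assume "deflation EQ B Z d" and f: "f \<in> Hom Q X Z"
  then obtain A k where c: "(A, B, Z, k, d) \<in> EQ" unfolding deflation_def by auto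
  note ob = c[unfolded EQ_iff]
  have "deflation E (fst B) (fst Z) d" using ob unfolding deflation_def by blast
  then obtain g where g: "g \<in> Hom FF (fst X) (fst B)" "Cmp FF (fst X) (fst B) (fst Z) d g = f"
    using proj Q_hom_F[OF X _ f] ob unfolding projective_obj_def by blast
  then have "Cmp FF (fst X) (fst B) (fst Z) d (avg X B g) = f"
    using avg_cmp_l[of X B Z g d] avg_id[of X Z f] ob X f by simp
  then show "\<exists>g\<in>Hom Q X B. Cmp Q X B Z d g = f"
    using avg_Q[of X B g] ob X g by (intro bexI[of _ "avg X B g"]) (auto simp: Q_sel)
qed

text \<open>A test object for the rotated sequence is rotated back.\<close>

lemma is_cokernel_act:
  assumes c: "is_cokernel FF X Y Z i d" and ob [simp]: "X \<in> Obj FF" "Y \<in> Obj FF" "Z \<in> Obj FF"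
  shows "is_cokernel FF (act g X) (act g Y) (act g Z) i d"
  unfolding is_cokernel_def
proof (intro conjI ballI impI)
  show "i \<in> Hom FF (act g X) (act g Y)" "d \<in> Hom FF (act g Y) (act g Z)" "Cmp FF (act g X) (act g Y) (act g Z) d i = Zer FF (act g X) (act g Z)"
    using c unfolding is_cokernel_def by (auto simp: hom_act cmp_act F_sel(4))
  fix W a assume [simp]: "W \<in> Obj FF" and a: "a \<in> Hom FF (act g Y) W" and z: "Cmp FF (act g X) (act g Y) W a i = Zer FF (act g X) W"
  have 1: "Cmp FF (act g X) (act g Y) W = Cmp FF X Y (act (- g) W)" by (rule cmp_act'[where g = g]) auto
  have 2: "Cmp FF (act g Y) (act g Z) W = Cmp FF Y Z (act (- g) W)" by (rule cmp_act'[where g = g]) auto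
  have "Cmp FF X Y (act (- g) W) a i = Zer FF X (act (- g) W)" using z unfolding 1 by (simp add: F_sel(4))
  moreover have "a \<in> Hom FF Y (act (- g) W)" using a by (simp add: hom_act)
  ultimately have "\<exists>!b. b \<in> Hom FF Z (act (- g) W) \<and> Cmp FF Y Z (act (- g) W) b d = a"
    using c unfolding is_cokernel_def by simp
  then show "\<exists>!b. b \<in> Hom FF (act g Z) W \<and> Cmp FF (act g Y) (act g Z) W b d = a"
    unfolding 2 by (simp add: hom_act)
qed

text \<open>The composites \<open>d (xi Y g)\<close> kill \<open>m\<close>, so the structure maps of
  \<open>Y\<close> descend to the cokernel; uniqueness of the factorisations gives the cocycle
  law.\<close>

lemma Q_quotient:
  assumes X: "X \<in> Obj Q" and Y: "Y \<in> Obj Q" and m: "m \<in> Hom Q X Y" and c: "(fst X, fst Y, W, m, d) \<in> E"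
  obtains Z where "(X, Y, Z, m, d) \<in> EQ"
proof -
  let ?X = "fst X" and ?Y = "fst Y"
  note [simp] = FE.confD[OF c] Q_objD(2)[OF X] Q_objD(2)[OF Y] hom_act
  have me: "Cmp FF (act g ?X) (act g ?Y) ?Y (xi Y g) m = Cmp FF (act g ?X) ?X ?Y m (xi X g)" for g
    using m unfolding Q_hom_iff[OF X Y] by simp
  note ck = is_cokernel_act[OF FE.confD(5)[OF c] FE.confD(1-3)[OF c]]
  \<comment> \<open>The choice depends on \<open>g\<close> only through \<open>xi Y g\<close> and
    rotated objects, so it is periodic.\<close>
  define w where "w g = (SOME b. b \<in> Hom FF W W \<and> Cmp FF (act g ?Y) (act g W) W b d = Cmp FF (act g ?Y) ?Y W d (xi Y g))" for g
  have w: "w g \<in> Hom FF W W" "Cmp FF (act g ?Y) (act g W) W (w g) d = Cmp FF (act g ?Y) ?Y W d (xi Y g)" for g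
  proof -
    have "Cmp FF (act g ?X) (act g ?Y) W (Cmp FF (act g ?Y) ?Y W d (xi Y g)) m = Zer FF (act g ?X) W"
      by (simp add: FE.cmp_assoc me FE.cmp_ctx[OF FE.confD(8)[OF c]])
    then obtain b where "b \<in> Hom FF (act g W) W" "Cmp FF (act g ?Y) (act g W) W b d = Cmp FF (act g ?Y) ?Y W d (xi Y g)"
      by - (rule FE.cokernelD[OF ck[of g], of W "Cmp FF (act g ?Y) ?Y W d (xi Y g)"], simp_all)
    then have "\<exists>b. b \<in> Hom FF W W \<and> Cmp FF (act g ?Y) (act g W) W (b) d = Cmp FF (act g ?Y) ?Y W d (xi Y g)"
      by (auto simp: hom_act)
    from someI_ex[OF this] have "w g \<in> Hom FF W W \<and> Cmp FF (act g ?Y) (act g W) W (w g) d = Cmp FF (act g ?Y) ?Y W d (xi Y g)"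
      unfolding w_def .
    then show "w g \<in> Hom FF W W" "Cmp FF (act g ?Y) (act g W) W (w g) d = Cmp FF (act g ?Y) ?Y W d (xi Y g)" by auto
  qed
  note [simp] = w(1)
  have "w 0 = Idn FF W"
    by (rule FE.cokernel_epi[OF FE.confD(5)[OF c], of W]) (use w(2)[of 0] in \<open>auto simp: Q_objD(5)[OF Y]\<close>)
  moreover have "w (g mod int p) = w g" for g
    unfolding w_def by (simp add: Q_objD(4)[OF Y])
  moreover have "Cmp FF (act (g + h) W) (act g W) W (w g) (w h) = w (g + h)" for g h
  proof (rule FE.cokernel_epi[OF ck[of "g + h"], of W])
    have 1: "Cmp FF (act (g + h) ?Y) (act (g + h) W) (act g W) (w h) d = Cmp FF (act (g + h) ?Y) (act g ?Y) (act g W) d (xi Y h)"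
      using w(2)[of h] cmp_act[of "act h ?Y" "act h W" W g] cmp_act[of "act h ?Y" ?Y W g] by simp
    show "Cmp FF (act (g + h) ?Y) (act (g + h) W) W (Cmp FF (act (g + h) W) (act g W) W (w g) (w h)) d =
       Cmp FF (act (g + h) ?Y) (act (g + h) W) W (w (g + h)) d"
      by (simp add: FE.cmp_assoc 1 w(2) FE.cmp_ctx[OF w(2)] Q_objD(3)[OF Y])
  qed simp_all
  ultimately have Z: "mk_eq W w \<in> Obj Q" "fst (mk_eq W w) = W" "xi (mk_eq W w) = w"
    using mk_eq[of W w] by auto
  have "d \<in> Hom Q Y (mk_eq W w)" using Y Z by (simp add: Q_hom_iff w(2))
  then show ?thesis using that[of "mk_eq W w"] X Y Z m c by (simp add: EQ_iff)
qed

text \<open>Dually, the structure maps of \<open>Y\<close> restrict to the kernel.\<close>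

lemma Q_subobject:
  assumes Y: "Y \<in> Obj Q" and Z: "Z \<in> Obj Q" and m: "m \<in> Hom Q Y Z" and c: "(W, fst Y, fst Z, k, m) \<in> E"
  obtains X where "(X, Y, Z, k, m) \<in> EQ"
proof -
  let ?Z = "fst Z" and ?Y = "fst Y"
  note [simp] = FE.confD[OF c] Q_objD(2)[OF Z] Q_objD(2)[OF Y] hom_act
  have me: "Cmp FF (act g ?Y) ?Y ?Z m (xi Y g) = Cmp FF (act g ?Y) (act g ?Z) ?Z (xi Z g) m" for g
    using m unfolding Q_hom_iff[OF Y Z] by simp
  have z: "Cmp FF (act g W) (act g ?Y) (act g ?Z) m k = Zer FF (act g W) (act g ?Z)" for g
    using FE.confD(8)[OF c] by (simp add: cmp_act F_sel(4))
  note kk = FE.kernel_mono[OF FE.confD(4)[OF c] FE.confD(1-3)[OF c]]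
  define w where "w g = (SOME b. b \<in> Hom FF W W \<and> Cmp FF (act g W) W ?Y k b = Cmp FF (act g W) (act g ?Y) ?Y (xi Y g) k)" for g
  have w: "w g \<in> Hom FF W W" "Cmp FF (act g W) W ?Y k (w g) = Cmp FF (act g W) (act g ?Y) ?Y (xi Y g) k" for g
  proof -
    have "Cmp FF (act g W) ?Y ?Z m (Cmp FF (act g W) (act g ?Y) ?Y (xi Y g) k) = Zer FF (act g W) ?Z"
      by (simp add: FE.cmp_ctx[OF me] FE.cmp_assoc z)
    then obtain b where "b \<in> Hom FF (act g W) W" "Cmp FF (act g W) W ?Y k b = Cmp FF (act g W) (act g ?Y) ?Y (xi Y g) k"
      by - (rule FE.kernelD[OF FE.confD(4)[OF c], of "act g W" "Cmp FF (act g W) (act g ?Y) ?Y (xi Y g) k"], simp_all)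
    then have "\<exists>b. b \<in> Hom FF W W \<and> Cmp FF (act g W) W ?Y k (b) = Cmp FF (act g W) (act g ?Y) ?Y (xi Y g) k"
      by (auto simp: hom_act)
    from someI_ex[OF this] have "w g \<in> Hom FF W W \<and> Cmp FF (act g W) W ?Y k (w g) = Cmp FF (act g W) (act g ?Y) ?Y (xi Y g) k"
      unfolding w_def .
    then show "w g \<in> Hom FF W W" "Cmp FF (act g W) W ?Y k (w g) = Cmp FF (act g W) (act g ?Y) ?Y (xi Y g) k" by auto
  qed
  note [simp] = w(1)
  have "w 0 = Idn FF W"
    by (rule kk[of W]) (use w(2)[of 0] in \<open>auto simp: Q_objD(5)[OF Y]\<close>)
  moreover have "w (g mod int p) = w g" for g
    unfolding w_def by (simp add: Q_objD(4)[OF Y])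
  moreover have "Cmp FF (act (g + h) W) (act g W) W (w g) (w h) = w (g + h)" for g h
  proof (rule kk[of "act (g + h) W"])
    have 1: "Cmp FF (act (g + h) W) (act g W) (act g ?Y) k (w h) = Cmp FF (act (g + h) W) (act (g + h) ?Y) (act g ?Y) (xi Y h) k"
      using w(2)[of h] cmp_act[of "act h W" W ?Y g] cmp_act[of "act h W" "act h ?Y" ?Y g] by simp
    have 2: "Cmp FF (act (g + h) W) (act (g + h) ?Y) ?Y (xi Y (g + h)) k =
       Cmp FF (act (g + h) W) (act g ?Y) ?Y (xi Y g) (Cmp FF (act (g + h) W) (act (g + h) ?Y) (act g ?Y) (xi Y h) k)"
      by (simp add: FE.cmp_assoc[symmetric] Q_objD(3)[OF Y])
    show "Cmp FF (act (g + h) W) W ?Y k (Cmp FF (act (g + h) W) (act g W) W (w g) (w h)) =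
       Cmp FF (act (g + h) W) W ?Y k (w (g + h))"
      by (simp add: w(2) 2 FE.cmp_ctx[OF w(2)] FE.cmp_assoc 1)
  qed simp_all
  ultimately have X: "mk_eq W w \<in> Obj Q" "fst (mk_eq W w) = W" "xi (mk_eq W w) = w"
    using mk_eq[of W w] by auto
  have "k \<in> Hom Q (mk_eq W w) Y" using Y X by (simp add: Q_hom_iff w(2))
  then show ?thesis using that[of "mk_eq W w"] X Y Z m c by (simp add: EQ_iff)
qed

end

section \<open>Induced objects, enough injectives and enough projectives\<close>

context equivariant
begin

text \<open>The summands of S(I) are numbered g * n + i for the i-th summand of gI, where n is the
  length of \<open>I\<close>; \<open>sh n h\<close> is the permutation of these numbers induced by
  \<open>h\<close>.\<close>

definition sh :: "nat \<Rightarrow> int \<Rightarrow> nat \<Rightarrow> nat" where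
  "sh n h b = nat ((h + int (b div n)) mod int p) * n + b mod n"

lemma sh_props:
  assumes b: "b < p * n"
  shows "sh n h b < p * n" "int (sh n h b div n) = (h + int (b div n)) mod int p" "sh n h b mod n = b mod n"
    "b div n < p" "b mod n < n"
proof -
  have n: "n > 0" using b by (cases n) auto
  show bm: "b mod n < n" using n by simp
  show "b div n < p" using b by (simp add: less_mult_imp_div_less)
  define c where "c = nat ((h + int (b div n)) mod int p)"
  have c: "c < p" "int c = (h + int (b div n)) mod int p" unfolding c_def using p_pos
    by (auto simp: nat_less_iff)
  have s: "sh n h b = c * n + b mod n" unfolding sh_def c_def ..
  have "(c + 1) * n \<le> p * n" using c by (intro mult_right_mono) auto
  then show "sh n h b < p * n" unfolding s using bm by simp
  show "int (sh n h b div n) = (h + int (b div n)) mod int p" unfolding s c(2)[symmetric] using n by simp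
  show "sh n h b mod n = b mod n" unfolding s by simp
qed

lemma sh_eqI:
  assumes "a < p * n" "b < p * n"
  shows "a mod n = b mod n \<and> int (a div n) = (h + int (b div n)) mod int p \<longleftrightarrow> a = sh n h b"
  using sh_props(2,3)[OF assms(2), of h] div_mult_mod_eq[of a n] div_mult_mod_eq[of "sh n h b" n]
  by (metis of_nat_eq_iff)

lemma sh_sh: "b < p * n \<Longrightarrow> sh n g (sh n h b) = sh n (g + h) b"
  unfolding sh_def[of n g] sh_def[of n "g + h"] by (simp add: sh_props mod_simps add.assoc)

lemma sh_0: "b < p * n \<Longrightarrow> sh n 0 b = b"
  using sh_eqI[of b n b 0] sh_props(4)[of b n] by simp

lemma sh_mod: "sh n (h mod int p) b = sh n h b"
  unfolding sh_def by (simp add: mod_simps)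

lemma sh_swap: "a < p * n \<Longrightarrow> b < p * n \<Longrightarrow> a = sh n h b \<longleftrightarrow> b = sh n (- h) a"
  by (auto simp: sh_sh sh_0)

definition S_pts :: "pt set list \<Rightarrow> pt set list" where
  "S_pts I = map (\<lambda>a. rot p (int (a div length I)) (I ! (a mod length I))) [0..<p * length I]"

definition S_act :: "pt set list \<Rightarrow> int \<Rightarrow> 'r mat" where
  "S_act I h = mat (p * length I) (p * length I) (\<lambda>(a, b). if a = sh (length I) h b then 1 else 0)"

text \<open>\<open>S\<close> on lists: \<open>S_obj\<close> treats a single point, but enough
  injectives and projectives call for \<open>S\<close> of an arbitrary list.\<close>

definition S_list :: "pt set list \<Rightarrow> 'r eqobj" where
  "S_list I = mk_eq (S_pts I) (S_act I)"

lemma length_S_pts [simp]: "length (S_pts I) = p * length I"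
  by (simp add: S_pts_def)

context
  fixes I assumes I [simp]: "I \<in> Obj FF"
begin

lemma S_pts_nth: "a < p * length I \<Longrightarrow> S_pts I ! a = act (int (a div length I)) I ! (a mod length I)"
  using sh_props(5)[of a "length I"] by (simp add: S_pts_def)

lemma S_pts_Obj [simp]: "S_pts I \<in> Obj FF"
  using F_nth[OF I] sh_props(5) by (auto simp: F_sel S_pts_def)

lemma S_pts_Xpi: "a < p * length I \<Longrightarrow> S_pts I ! a \<in> Xpi"
  using F_nth[OF S_pts_Obj] by simp

lemma S_pts_sh: "b < p * length I \<Longrightarrow> S_pts I ! (sh (length I) h b) = rot p h (S_pts I ! b)"
  using F_nth[OF I] sh_props(1-3)[of b "length I" h] sh_props(4,5)[of b "length I"]
  by (simp add: S_pts_def rot_rot rot_mod p_pos)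

lemma cmp_S_act_r:
  assumes "Ws \<in> Obj FF" "k < length Ws" "b < p * length I"
  shows "Cmp FF (act h (S_pts I)) (S_pts I) Ws f (S_act I h) $$ (k, b) = f $$ (k, sh (length I) h b)"
proof -
  have "Cmp FF (act h (S_pts I)) (S_pts I) Ws f (S_act I h) $$ (k, b) =
     (\<Sum>c<p * length I. if c = sh (length I) h b then f $$ (k, c) * wgt (act h (S_pts I) ! b) (S_pts I ! c) (Ws ! k) else 0)"
    using assms by (subst F_cmp_index) (auto simp: S_act_def simp del: sum.delta sum.delta' intro!: sum.cong)
  also have "\<dots> = f $$ (k, sh (length I) h b)"
    using assms sh_props(1)[of b "length I" h] F_nth[of Ws u k] S_pts_Xpi[of b] by (simp add: S_pts_sh)
  finally show ?thesis .
qed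

lemma cmp_S_act_l:
  assumes "Ws \<in> Obj FF" "k < length Ws" "a < p * length I"
  shows "Cmp FF Ws (act h (S_pts I)) (S_pts I) (S_act I h) f $$ (a, k) = f $$ (sh (length I) (- h) a, k)"
proof -
  have "Cmp FF Ws (act h (S_pts I)) (S_pts I) (S_act I h) f $$ (a, k) =
     (\<Sum>c<p * length I. if c = sh (length I) (- h) a then f $$ (c, k) * wgt (Ws ! k) (act h (S_pts I) ! c) (S_pts I ! a) else 0)"
    using assms sh_swap[of a "length I"]
    by (subst F_cmp_index) (auto simp: S_act_def simp del: sum.delta sum.delta' intro!: sum.cong)
  also have "\<dots> = f $$ (sh (length I) (- h) a, k)"
    using assms sh_props(1)[of a "length I" "- h"] F_nth[of Ws u k] S_pts_Xpi[of a] by (simp add: S_pts_sh rot_rot)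
  finally show ?thesis .
qed

lemma S_list: "S_list I \<in> Obj Q" "fst (S_list I) = S_pts I" "xi (S_list I) = S_act I"
proof -
  let ?n = "length I"
  have 1: "S_act I g \<in> Hom FF (S_pts I) (S_pts I)" for g by (simp add: S_act_def F_sel)
  have 2: "S_act I 0 = Idn FF (S_pts I)"
    by (rule F_eqI[where m = "p * ?n" and n = "p * ?n"]) (auto simp: S_act_def F_sel sh_0)
  have 3: "S_act I (g mod int p) = S_act I g" for g by (simp add: S_act_def sh_mod)
  have 4: "Cmp FF (act (g + h) (S_pts I)) (act g (S_pts I)) (S_pts I) (S_act I g) (S_act I h) = S_act I (g + h)" for g h
  proof (rule F_eqI[where m = "p * ?n" and n = "p * ?n"])
    fix a b assume ab: "a < p * ?n" "b < p * ?n"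
    have "sh ?n (- g) a = sh ?n h b \<longleftrightarrow> a = sh ?n (g + h) b"
      using ab sh_props(1)[of a ?n "- g"] sh_props(1)[of b ?n h] sh_swap[of a ?n "sh ?n h b" g] sh_sh[of b ?n g h] by metis
    then show "Cmp FF (act (g + h) (S_pts I)) (act g (S_pts I)) (S_pts I) (S_act I g) (S_act I h) $$ (a, b) = S_act I (g + h) $$ (a, b)"
      using ab sh_props(1)[of a ?n "- g"] by (subst cmp_S_act_l) (auto simp: S_act_def)
  qed (auto simp: S_act_def)
  show "S_list I \<in> Obj Q" "fst (S_list I) = S_pts I" "xi (S_list I) = S_act I"
    using mk_eq[OF S_pts_Obj 1 2 3 4] unfolding S_list_def by auto
qed

text \<open>The adjunctions between \<open>S\<close> and the forgetful functor: into gI,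
  \<open>coind\<close> is \<open>xi T (- g)\<close> followed by the rotation of \<open>i\<close>; on
  gI, \<open>ind\<close> is the rotation of \<open>d\<close> followed by
  \<open>xi T g\<close>.\<close>

definition coind :: "'r eqobj \<Rightarrow> 'r mat \<Rightarrow> 'r mat" where
  "coind T i = mat (p * length I) (length (fst T)) (\<lambda>(a, t).
     Cmp FF (fst T) (act (int (a div length I)) (fst T)) (act (int (a div length I)) I) i (xi T (- int (a div length I))) $$ (a mod length I, t))"

definition ind :: "'r eqobj \<Rightarrow> 'r mat \<Rightarrow> 'r mat" where
  "ind T d = mat (length (fst T)) (p * length I) (\<lambda>(t, a).
     Cmp FF (act (int (a div length I)) I) (act (int (a div length I)) (fst T)) (fst T) (xi T (int (a div length I))) d $$ (t, a mod length I))"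

lemma coind_hom:
  assumes T: "T \<in> Obj Q" and i: "i \<in> Hom FF (fst T) I"
  shows "coind T i \<in> Hom Q T (S_list I)"
  unfolding Q_hom_iff[OF T S_list(1)] S_list
proof (intro conjI allI)
  let ?n = "length I" and ?T = "fst T"
  note [simp] = Q_objD(1)[OF T] Q_objD(2)[OF T] hom_act i
  show "coind T i \<in> Hom FF ?T (S_pts I)" by (simp add: coind_def F_sel)
  fix h
  show "Cmp FF (act h ?T) ?T (S_pts I) (coind T i) (xi T h) = Cmp FF (act h ?T) (act h (S_pts I)) (S_pts I) (S_act I h) (coind T i)"
  proof (rule F_eqI[where m = "p * ?n" and n = "length ?T"])
    fix a t assume at: "a < p * ?n" "t < length ?T"
    define g where "g = int (a div ?n)"
    define g' where "g' = int (sh ?n (- h) a div ?n)"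
    have g': "g' = (g - h) mod int p" unfolding g'_def g_def using sh_props(2)[OF at(1), of "- h"] by simp
    note sh = sh_props(1-3)[OF at(1), of "- h"] sh_props(4,5)[OF at(1)]
    have "Cmp FF (act h ?T) ?T (S_pts I) (coind T i) (xi T h) $$ (a, t) =
        Cmp FF (act h ?T) ?T (act g I) (Cmp FF ?T (act g ?T) (act g I) i (xi T (- g))) (xi T h) $$ (a mod ?n, t)"
      using at sh by (simp add: coind_def S_pts_nth g_def del: act_nth)
    also have "Cmp FF (act h ?T) ?T (act g I) (Cmp FF ?T (act g ?T) (act g I) i (xi T (- g))) (xi T h) =
        Cmp FF (act h ?T) (act g ?T) (act g I) i (Cmp FF (act h ?T) ?T (act g ?T) (xi T (- g)) (xi T h))"
      by (simp add: FE.cmp_assoc)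
    \<comment> \<open>Lowering the index \<open>g\<close> by \<open>h\<close>, modulo
      \<open>p\<close>, absorbs \<open>xi T h\<close>.\<close>
    also have "Cmp FF (act h ?T) ?T (act g ?T) (xi T (- g)) (xi T h) = xi T (- g')"
    proof -
      have "Cmp FF (act h ?T) ?T (act g ?T) = Cmp FF (act (- g + h) ?T) (act (- g) ?T) ?T"
        by (rule cmp_act'[where g = g]) auto
      moreover have "xi T (- g + h) = xi T (- g')"
        unfolding g' using Q_objD(4)[OF T, of "- g + h"] Q_objD(4)[OF T, of "- ((g - h) mod int p)"] by (simp add: mod_minus_eq)
      ultimately show ?thesis using Q_objD(3)[OF T, of "- g" h] by simp
    qed
    also have "Cmp FF (act h ?T) (act g ?T) (act g I) i (xi T (- g')) = Cmp FF ?T (act g' ?T) (act g' I) i (xi T (- g'))"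
    proof -
      have "Cmp FF (act h ?T) (act g ?T) (act g I) = Cmp FF ?T (act g' ?T) (act g' I)"
        by (rule cmp_act'[where g = h]) (auto simp: g')
      then show ?thesis by simp
    qed
    also have "\<dots> $$ (a mod ?n, t) = coind T i $$ (sh ?n (- h) a, t)"
      using at sh by (simp add: coind_def g'_def del: F_cmp_index)
    also have "\<dots> = Cmp FF (act h ?T) (act h (S_pts I)) (S_pts I) (S_act I h) (coind T i) $$ (a, t)"
      using at by (subst cmp_S_act_l) simp_all
    finally show "Cmp FF (act h ?T) ?T (S_pts I) (coind T i) (xi T h) $$ (a, t) =
       Cmp FF (act h ?T) (act h (S_pts I)) (S_pts I) (S_act I h) (coind T i) $$ (a, t)" .
  qed auto
qed

lemma ind_hom:
  assumes T: "T \<in> Obj Q" and d: "d \<in> Hom FF I (fst T)"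
  shows "ind T d \<in> Hom Q (S_list I) T"
  unfolding Q_hom_iff[OF S_list(1) T] S_list
proof (intro conjI allI)
  let ?n = "length I" and ?T = "fst T"
  note [simp] = Q_objD(1)[OF T] Q_objD(2)[OF T] hom_act d
  show "ind T d \<in> Hom FF (S_pts I) ?T" by (simp add: ind_def F_sel)
  fix h
  show "Cmp FF (act h (S_pts I)) (S_pts I) ?T (ind T d) (S_act I h) = Cmp FF (act h (S_pts I)) (act h ?T) ?T (xi T h) (ind T d)"
  proof (rule F_eqI[where m = "length ?T" and n = "p * ?n"])
    fix t b assume bt: "t < length ?T" "b < p * ?n"
    define g where "g = int (b div ?n)"
    define g' where "g' = int (sh ?n h b div ?n)"
    have g': "g' = (h + g) mod int p" unfolding g'_def g_def using sh_props(2)[OF bt(2), of h] by simp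
    note sh = sh_props(1-3)[OF bt(2), of h] sh_props(4,5)[OF bt(2)]
    have "Cmp FF (act h (S_pts I)) (S_pts I) ?T (ind T d) (S_act I h) $$ (t, b) = ind T d $$ (t, sh ?n h b)"
      using bt by (subst cmp_S_act_r) simp_all
    also have "\<dots> = Cmp FF (act g' I) (act g' ?T) ?T (xi T g') d $$ (t, b mod ?n)"
      using bt sh by (simp add: ind_def g'_def del: F_cmp_index)
    also have "Cmp FF (act g' I) (act g' ?T) ?T (xi T g') d = Cmp FF (act (h + g) I) (act (h + g) ?T) ?T (xi T (h + g)) d"
      unfolding g' using Q_objD(4)[OF T] by simp
    also have "\<dots> = Cmp FF (act (h + g) I) (act h ?T) ?T (xi T h) (Cmp FF (act (h + g) I) (act (h + g) ?T) (act h ?T) (xi T g) d)"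
      by (simp add: FE.cmp_assoc[symmetric] Q_objD(3)[OF T])
    also have "Cmp FF (act (h + g) I) (act (h + g) ?T) (act h ?T) (xi T g) d = Cmp FF (act g I) (act g ?T) ?T (xi T g) d"
    proof -
      have "Cmp FF (act (h + g) I) (act (h + g) ?T) (act h ?T) = Cmp FF (act g I) (act g ?T) ?T"
        by (rule cmp_act'[where g = h]) auto
      then show ?thesis by simp
    qed
    also have "Cmp FF (act (h + g) I) (act h ?T) ?T (xi T h) (Cmp FF (act g I) (act g ?T) ?T (xi T g) d) $$ (t, b mod ?n) =
        Cmp FF (act h (S_pts I)) (act h ?T) ?T (xi T h) (ind T d) $$ (t, b)"
      using bt sh F_nth[OF I] by (simp add: ind_def g_def S_pts_nth rot_rot)
    finally show "Cmp FF (act h (S_pts I)) (S_pts I) ?T (ind T d) (S_act I h) $$ (t, b) =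
       Cmp FF (act h (S_pts I)) (act h ?T) ?T (xi T h) (ind T d) $$ (t, b)" .
  qed auto
qed

text \<open>The summand with g = 0 is \<open>I\<close> itself, and there \<open>coind\<close> and
  \<open>ind\<close> restrict to the original morphism. This is the component to which
  \<open>infl_component\<close> and \<open>defl_component\<close> are applied.\<close>

lemma S_pts_summand:
  obtains B i j q r where "is_biproduct FF I B (S_pts I) i j q r"
    "\<And>T f. T \<in> Obj Q \<Longrightarrow> f \<in> Hom FF (fst T) I \<Longrightarrow> Cmp FF (fst T) (S_pts I) I q (coind T f) = f"
    "\<And>T f. T \<in> Obj Q \<Longrightarrow> f \<in> Hom FF I (fst T) \<Longrightarrow> Cmp FF I (S_pts I) (fst T) (ind T f) i = f"
proof -
  let ?n = "length I"
  define B where "B = drop ?n (S_pts I)"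
  have n: "?n \<le> p * ?n" using p_pos by (cases p) auto
  have ln: "l < p * ?n" if "l < ?n" for l by (rule less_le_trans[OF that n])
  have take: "take ?n (S_pts I) = I"
  proof (rule nth_equalityI)
    fix i assume "i < length (take ?n (S_pts I))"
    then have "i < ?n" by simp
    moreover from this have "i < p * ?n" by (rule less_le_trans[OF _ n])
    ultimately show "take ?n (S_pts I) ! i = I ! i" using F_nth[OF I] by (simp add: S_pts_def)
  qed (use n in auto)
  then have app: "I @ B = S_pts I" unfolding B_def by (metis append_take_drop_id)
  have nth: "S_pts I ! l = I ! l" if "l < ?n" for l using that by (simp add: app[symmetric] nth_append)
  have lB: "length I + length B = p * ?n" using n unfolding B_def by simp
  have B: "B \<in> Obj FF" using S_pts_Obj unfolding B_def F_sel by (auto dest: in_set_dropD)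
  note bi = is_biproduct_append[OF I B, unfolded app lB]
  let ?i = "mat (p * ?n) ?n (\<lambda>(j, l). if j = l then 1 else 0) :: 'r mat"
  let ?q = "mat ?n (p * ?n) (\<lambda>(l, j). if j = l then 1 else 0) :: 'r mat"
  have 1: "Cmp FF (fst T) (S_pts I) I ?q (coind T f) = f" if T: "T \<in> Obj Q" and f: "f \<in> Hom FF (fst T) I" for T f
  proof (rule F_eqI[where m = ?n and n = "length (fst T)"])
    note [simp] = Q_objD(1)[OF T] f
    fix l t assume lt: "l < ?n" "t < length (fst T)"
    have "Cmp FF (fst T) (S_pts I) I ?q (coind T f) $$ (l, t) =
       (\<Sum>j<p * ?n. if j = l then coind T f $$ (j, t) * wgt (fst T ! t) (S_pts I ! j) (I ! l) else 0)"
      using lt ln by (subst F_cmp_index) (auto simp del: sum.delta sum.delta' intro!: sum.cong)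
    also have "\<dots> = coind T f $$ (l, t)" using lt ln F_nth[OF I] F_nth[OF Q_objD(1)[OF T]] by (simp add: nth)
    also have "\<dots> = f $$ (l, t)" using lt ln by (simp add: coind_def Q_objD(5)[OF T] del: F_cmp_index)
    finally show "Cmp FF (fst T) (S_pts I) I ?q (coind T f) $$ (l, t) = f $$ (l, t)" .
  qed (use f in \<open>auto simp: F_sel\<close>)
  have 2: "Cmp FF I (S_pts I) (fst T) (ind T f) ?i = f" if T: "T \<in> Obj Q" and f: "f \<in> Hom FF I (fst T)" for T f
  proof (rule F_eqI[where m = "length (fst T)" and n = ?n])
    note [simp] = Q_objD(1)[OF T] f
    fix t l assume lt: "t < length (fst T)" "l < ?n"
    have "Cmp FF I (S_pts I) (fst T) (ind T f) ?i $$ (t, l) =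
       (\<Sum>j<p * ?n. if j = l then ind T f $$ (t, j) * wgt (I ! l) (S_pts I ! j) (fst T ! t) else 0)"
      using lt ln by (subst F_cmp_index) (auto simp del: sum.delta sum.delta' intro!: sum.cong)
    also have "\<dots> = ind T f $$ (t, l)" using lt ln F_nth[OF I] F_nth[OF Q_objD(1)[OF T]] by (simp add: nth)
    also have "\<dots> = f $$ (t, l)" using lt ln by (simp add: ind_def Q_objD(5)[OF T] del: F_cmp_index)
    finally show "Cmp FF I (S_pts I) (fst T) (ind T f) ?i $$ (t, l) = f $$ (t, l)" .
  qed (use f in \<open>auto simp: F_sel\<close>)
  show ?thesis using that[OF bi 1 2] by blast
qed

lemma S_pts_proj:
  assumes "set I \<subseteq> proj_pts" shows "set (S_pts I) \<subseteq> proj_pts"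
proof
  fix P assume "P \<in> set (S_pts I)"
  then obtain a where a: "a < p * length I" "P = rot p (int (a div length I)) (I ! (a mod length I))"
    by (auto simp: S_pts_def)
  then have "I ! (a mod length I) \<in> proj_pts" using sh_props(5)[OF a(1)] assms nth_mem by blast
  then show "P \<in> proj_pts" unfolding a(2) by simp
qed

end

text \<open>An inflation of the underlying list of \<open>T\<close> into an injective is coinduced.
  One component of the result is an inflation, so the whole is one, and its cokernel carries an
  equivariant structure.\<close>

lemma Q_enough_inj:
  assumes T: "T \<in> Obj Q"
  obtains J W m d where "set (fst J) \<subseteq> proj_pts" "(T, J, W, m, d) \<in> EQ"
proof -
  obtain I W i d where I: "injective_obj FF E I" and c: "(fst T, I, W, i, d) \<in> E"
    using frob_E Q_objD(1)[OF T] unfolding frobenius_category_def by meson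
  have IO: "I \<in> Obj FF" and i: "i \<in> Hom FF (fst T) I" using FE.confD[OF c] by auto
  obtain B k j q r where b: "is_biproduct FF I B (S_pts I) k j q r" and q: "Cmp FF (fst T) (S_pts I) I q (coind I T i) = i"
    using S_pts_summand[OF IO] T i by metis
  note S = S_list[OF IO]
  have m: "coind I T i \<in> Hom Q T (S_list I)" using coind_hom[OF IO T i] .
  have "inflation E (fst T) I i" using c unfolding inflation_def by blast
  then have "inflation E (fst T) (S_pts I) (coind I T i)"
    using FE.infl_component[OF b] Q_hom_F[OF T S(1) m] q S(2) by simp
  then obtain W' d' where "(fst T, fst (S_list I), W', coind I T i, d') \<in> E" unfolding inflation_def S(2) by blast
  then obtain Z where Z: "(T, S_list I, Z, coind I T i, d') \<in> EQ" using Q_quotient[OF T S(1) m] by metis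
  have "set (fst (S_list I)) \<subseteq> proj_pts" using S_pts_proj[OF IO] I S(2) inj_list_iff by simp
  then show ?thesis using that Z by blast
qed

lemma Q_enough_proj:
  assumes T: "T \<in> Obj Q"
  obtains V J k m where "set (fst J) \<subseteq> proj_pts" "(V, J, T, k, m) \<in> EQ"
proof -
  obtain V I i d where I: "projective_obj FF E I" and c: "(V, I, fst T, i, d) \<in> E"
    using frob_E Q_objD(1)[OF T] unfolding frobenius_category_def by meson
  have IO: "I \<in> Obj FF" and d: "d \<in> Hom FF I (fst T)" using FE.confD[OF c] by auto
  obtain B k j q r where b: "is_biproduct FF I B (S_pts I) k j q r" and q: "Cmp FF I (S_pts I) (fst T) (ind I T d) k = d"
    using S_pts_summand[OF IO] T d by metis
  note S = S_list[OF IO]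
  have m: "ind I T d \<in> Hom Q (S_list I) T" using ind_hom[OF IO T d] .
  have "deflation E I (fst T) d" using c unfolding deflation_def by blast
  then have "deflation E (S_pts I) (fst T) (ind I T d)"
    using FE.defl_component[OF b] Q_hom_F[OF S(1) T m] q S(2) by simp
  then obtain W' d' where "(W', fst (S_list I), fst T, d', ind I T d) \<in> E" unfolding deflation_def S(2) by blast
  then obtain Z where Z: "(Z, S_list I, T, d', ind I T d) \<in> EQ" using Q_subobject[OF S(1) T m] by metis
  have "set (fst (S_list I)) \<subseteq> proj_pts" using S_pts_proj[OF IO] I S(2) proj_list_iff by simp
  then show ?thesis using that Z by blast
qed

text \<open>A projective object is a retract of a cover supported on projective points; in the other
  direction, lifts in \<open>F_pi\<close> are averaged.\<close>

lemma Q_proj_iff: "projective_obj Q EQ X \<longleftrightarrow> X \<in> Obj Q \<and> set (fst X) \<subseteq> proj_pts"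
proof
  assume P: "projective_obj Q EQ X"
  then have X: "X \<in> Obj Q" unfolding projective_obj_def by simp
  obtain V J k m where J: "set (fst J) \<subseteq> proj_pts" "(V, J, X, k, m) \<in> EQ" using Q_enough_proj[OF X] .
  have ob: "J \<in> Obj Q" "m \<in> Hom Q J X" using J unfolding EQ_iff by auto
  have "deflation EQ J X m" using J unfolding deflation_def by blast
  then obtain s where s: "s \<in> Hom Q X J" "Cmp Q X J X m s = Idn Q X"
    using P QQ.idn_in[OF X] unfolding projective_obj_def by blast
  have "projective_obj FF E (fst X)"
    by (rule FE.projective_retract[of "fst J" "fst X" s m])
      (use J ob s X proj_list_iff Q_hom_F Q_objD(1) in \<open>auto simp: Q_sel\<close>)
  then show "X \<in> Obj Q \<and> set (fst X) \<subseteq> proj_pts" using X proj_list_iff by simp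
qed (use Q_projective proj_list_iff in blast)

lemma Q_inj_iff: "injective_obj Q EQ X \<longleftrightarrow> X \<in> Obj Q \<and> set (fst X) \<subseteq> proj_pts"
proof
  assume P: "injective_obj Q EQ X"
  then have X: "X \<in> Obj Q" unfolding injective_obj_def by simp
  obtain V J k m where J: "set (fst J) \<subseteq> proj_pts" "(X, J, V, m, k) \<in> EQ" using Q_enough_inj[OF X] .
  have ob: "J \<in> Obj Q" "m \<in> Hom Q X J" using J unfolding EQ_iff by auto
  have "inflation EQ X J m" using J unfolding inflation_def by blast
  then obtain s where s: "s \<in> Hom Q J X" "Cmp Q X J X s m = Idn Q X"
    using P QQ.idn_in[OF X] unfolding injective_obj_def by blast
  have "projective_obj FF E (fst X)"
    by (rule FE.projective_retract[of "fst J" "fst X" m s])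
      (use J ob s X proj_list_iff Q_hom_F Q_objD(1) in \<open>auto simp: Q_sel\<close>)
  then show "X \<in> Obj Q \<and> set (fst X) \<subseteq> proj_pts" using X proj_list_iff by simp
qed (use Q_injective inj_list_iff in blast)

sublocale QF: frobcat Q EQ
proof
  fix X Y Z i d assume c: "(X, Y, Z, i, d) \<in> EQ"
  then show "X \<in> Obj Q \<and> Y \<in> Obj Q \<and> Z \<in> Obj Q \<and> is_kernel Q X Y Z i d \<and> is_cokernel Q X Y Z i d"
    using EQ_kernel EQ_cokernel EQ_iff by blast
next
  fix X show "projective_obj Q EQ X \<longleftrightarrow> injective_obj Q EQ X" by (simp add: Q_proj_iff Q_inj_iff)
next
  fix X assume X: "X \<in> Obj Q"
  obtain J W m d where J: "set (fst J) \<subseteq> proj_pts" "(X, J, W, m, d) \<in> EQ" using Q_enough_inj[OF X] .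
  then have "injective_obj Q EQ J" unfolding Q_inj_iff EQ_iff by blast
  then show "\<exists>I W i d. injective_obj Q EQ I \<and> (X, I, W, i, d) \<in> EQ" using J by blast
next
  fix X assume X: "X \<in> Obj Q"
  obtain V J k m where J: "set (fst J) \<subseteq> proj_pts" "(V, J, X, k, m) \<in> EQ" using Q_enough_proj[OF X] .
  then have "projective_obj Q EQ J" unfolding Q_proj_iff EQ_iff by blast
  then show "\<exists>V P i d. projective_obj Q EQ P \<and> (V, P, X, i, d) \<in> EQ" using J by blast
next
  fix V P T i d Y B g h j f
  assume c1: "(V, P, T, i, d) \<in> EQ" and c2: "(Y, B, T, g, h) \<in> EQ" and j: "j \<in> Hom Q P B" "Cmp Q P B T h j = d"
    and f: "f \<in> Hom Q V Y" "Cmp Q V Y B g f = Cmp Q V P B j i"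
  note o1 = c1[unfolded EQ_iff] and o2 = c2[unfolded EQ_iff]
  have jF: "j \<in> Hom FF (fst P) (fst B)" "f \<in> Hom FF (fst V) (fst Y)" using Q_hom_F o1 o2 j f by blast+
  have E1: "(fst V, fst P, fst T, i, d) \<in> E" and E2: "(fst Y, fst B, fst T, g, h) \<in> E" using o1 o2 by auto
  have po: "is_pushout FF (fst V) (fst P) (fst Y) (fst B) i f j g"
    by (rule FE.pushout_of_conf_mor[OF E1 E2 jF(1) _ jF(2)]) (use j f in \<open>auto simp: Q_sel\<close>)
  show "is_pushout Q V P Y B i f j g"
    unfolding is_pushout_def
  proof (intro conjI ballI impI)
    fix W a b assume W: "W \<in> Obj Q" and a: "a \<in> Hom Q P W" and b: "b \<in> Hom Q Y W" and e: "Cmp Q V P W a i = Cmp Q V Y W b f"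
    have aF: "a \<in> Hom FF (fst P) (fst W)" "b \<in> Hom FF (fst Y) (fst W)" using Q_hom_F o1 o2 a b W by blast+
    obtain w where w: "w \<in> Hom FF (fst B) (fst W)" "Cmp FF (fst P) (fst B) (fst W) w j = a" "Cmp FF (fst Y) (fst B) (fst W) w g = b"
      using FE.pushoutD[OF po, of "fst W" a b] aF e Q_objD(1)[OF W] by (auto simp: Q_sel)
    have w': "Cmp FF (fst P) (fst B) (fst W) (avg B W w) j = a" "Cmp FF (fst Y) (fst B) (fst W) (avg B W w) g = b"
      using avg_cmp_r[of P B W j w] avg_cmp_r[of Y B W g w] avg_id[of P W a] avg_id[of Y W b] w o1 o2 j a b W by auto
    show "\<exists>!w. w \<in> Hom Q B W \<and> Cmp Q P B W w j = a \<and> Cmp Q Y B W w g = b"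
    proof (rule ex1I[of _ "avg B W w"], intro conjI)
      show "avg B W w \<in> Hom Q B W" using avg_Q w o2 W by blast
      fix v assume v: "v \<in> Hom Q B W \<and> Cmp Q P B W v j = a \<and> Cmp Q Y B W v g = b"
      then have "v \<in> Hom FF (fst B) (fst W)" using Q_hom_F o2 W by blast
      then show "v = avg B W w"
        using FE.pushout_unique[OF po, of "fst W" v "avg B W w"] v w' avg_F[of B W w] Q_objD(1)[OF W] by (auto simp: Q_sel)
    qed (use w' in \<open>auto simp: Q_sel\<close>)
  qed (use o1 o2 j f in auto)
qed

text \<open>A factorisation in \<open>F_pi\<close> passes through a projective that carries no group
  action. Its first half extends along an equivariant inflation into \<open>J\<close>, and the
  resulting morphism from \<open>J\<close> is averaged; the factorisation then passes through
  \<open>J\<close>.\<close>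

lemma Q_null_iff:
  assumes X: "X \<in> Obj Q" and Y: "Y \<in> Obj Q"
  shows "f \<in> stably_null Q EQ X Y \<longleftrightarrow> f \<in> Hom Q X Y \<and> null_mat (fst X) (fst Y) f"
proof
  assume f: "f \<in> stably_null Q EQ X Y"
  then have "f \<in> Hom Q X Y" using X Y by simp
  moreover obtain P a b where P: "projective_obj Q EQ P" "P \<in> Obj Q" and ab: "a \<in> Hom Q X P" "b \<in> Hom Q P Y"
    and e: "f = Cmp Q X P Y b a" using f by (rule QF.nullE)
  have "projective_obj FF E (fst P)" "injective_obj FF E (fst P)"
    using P unfolding Q_proj_iff proj_list_iff inj_list_iff by auto
  then have "f \<in> stably_null FF E (fst X) (fst Y)"
    unfolding e Q_sel stably_null_def using Q_hom_F X Y P ab by blast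
  ultimately show "f \<in> Hom Q X Y \<and> null_mat (fst X) (fst Y) f"
    using F_null_iff Q_objD(1) X Y by blast
next
  assume *: "f \<in> Hom Q X Y \<and> null_mat (fst X) (fst Y) f"
  then have "f \<in> stably_null FF E (fst X) (fst Y)"
    using F_null_iff Q_objD(1) X Y Q_hom_F by blast
  then obtain P a b where P: "injective_obj FF E P" and a: "a \<in> Hom FF (fst X) P" and b: "b \<in> Hom FF P (fst Y)"
    and e: "f = Cmp FF (fst X) P (fst Y) b a" unfolding stably_null_def by blast
  obtain J W m d where J: "set (fst J) \<subseteq> proj_pts" "(X, J, W, m, d) \<in> EQ" using Q_enough_inj[OF X] .
  note ob = J(2)[unfolded EQ_iff]
  have "inflation E (fst X) (fst J) m" using ob unfolding inflation_def by blast
  then obtain a' where a': "a' \<in> Hom FF (fst J) P" "Cmp FF (fst X) (fst J) P a' m = a"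
    using P a unfolding injective_obj_def by blast
  have PO: "P \<in> Obj FF" using P unfolding injective_obj_def by simp
  define t where "t = Cmp FF (fst J) P (fst Y) b a'"
  have t: "t \<in> Hom FF (fst J) (fst Y)" unfolding t_def by simp
  have "Cmp FF (fst X) (fst J) (fst Y) t m = f"
    unfolding t_def e using FE.cmp_assoc[of "fst X" "fst J" P "fst Y" m a' b] a' b PO ob Q_objD(1) Q_hom_F[of X J m] X Y by auto
  then have "Cmp FF (fst X) (fst J) (fst Y) (avg J Y t) m = f"
    using avg_cmp_r[of X J Y m t] avg_id[OF X Y, of f] * X Y ob t by simp
  moreover have "avg J Y t \<in> Hom Q J Y" using avg_Q t ob Y by blast
  moreover have "injective_obj Q EQ J" using J ob unfolding Q_inj_iff by simp
  ultimately show "f \<in> stably_null Q EQ X Y"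
    using QF.nullI[of J m X "avg J Y t" Y] ob by (simp add: Q_sel)
qed

end

section \<open>Morphisms between the objects \<open>SX\<close>\<close>

context ground
begin

text \<open>If one of the two factors passes through a projective point for free, the cocycle
  identity bounds the exponent through \<open>Y\<close> below by the one through that point.\<close>

lemma c_exp_pos_of_null_factor:
  assumes "X \<in> Xpi" "Y \<in> Xpi" "Z \<in> Xpi" "nonnull X Z" "\<not> nonnull X Y \<or> \<not> nonnull Y Z"
  shows "1 \<le> c_exp X Y Z"
  using assms(5)
proof
  assume "\<not> nonnull X Y"
  then obtain P where P: "P \<in> proj_pts" "c_exp X P Y < 1" unfolding nonnull_def by auto
  have "c_exp P Y Z + c_exp X P Z = c_exp X P Y + c_exp X Y Z" by (rule c_exp_cocycle)
  moreover have "1 \<le> c_exp X P Z" "0 \<le> c_exp P Y Z" using assms P unfolding nonnull_def by (auto intro: c_exp_nonneg)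
  ultimately show ?thesis using P by linarith
next
  assume "\<not> nonnull Y Z"
  then obtain P where P: "P \<in> proj_pts" "c_exp Y P Z < 1" unfolding nonnull_def by auto
  have "c_exp Y P Z + c_exp X Y Z = c_exp X Y P + c_exp X P Z" by (rule c_exp_cocycle)
  moreover have "1 \<le> c_exp X P Z" "0 \<le> c_exp X Y P" using assms P unfolding nonnull_def by (auto intro: c_exp_nonneg)
  ultimately show ?thesis using P by linarith
qed

lemma c_exp_swap: "X \<in> Xpi \<Longrightarrow> Y \<in> Xpi \<Longrightarrow> c_exp X Y X = c_exp Y X Y"
  using c_exp_refl(1)[of X X] c_exp_refl(1)[of Y Y] unfolding c_exp_def by simp

end

lemma dvd_of_diff: "c dvd a - b \<Longrightarrow> c dvd a \<Longrightarrow> c dvd b" for a b c :: "'b::idom"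
  using dvd_diff[of c a "a - b"] by simp

context equivariant
begin

abbreviation "SO \<equiv> S_obj p :: pt set \<Rightarrow> 'r eqobj"

lemma S_obj_eq: "X \<in> Xpi \<Longrightarrow> SO X = S_list [X]"
proof -
  have "sh 1 h b < p \<longleftrightarrow> True" "int (sh 1 h b) = (h + int b) mod int p" for h b
    using p_pos by (auto simp: sh_def nat_less_iff)
  then have "int k = (h + int b) mod int p \<longleftrightarrow> k = sh 1 h b" for k h b
    by (metis of_nat_eq_iff)
  then show ?thesis
    unfolding S_obj_def S_list_def mk_eq_def S_pts_def S_act_def by simp
qed

lemma sh1: "sh 1 h b = nat ((h + int b) mod int p)"
  by (simp add: sh_def)

lemma SO_props:
  assumes "X \<in> Xpi"
  shows "SO X \<in> Obj Q" "length (fst (SO X)) = p" "a < p \<Longrightarrow> fst (SO X) ! a = rot p (int a) X"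
    "set (fst (SO X)) \<subseteq> Xpi"
  using S_list[of "[X]"] assms S_pts_nth[of "[X]" a] S_pts_Obj[of "[X]"] by (auto simp: S_obj_eq F_sel)

text \<open>Hom(SX, SY) is the sum over k of Hom(X, \<gamma>^k Y): entry (a, b) depends on a - b
  only, and \<open>\<phi> k\<close> is the coefficient of X -> \<gamma>^k Y.\<close>

definition circ :: "(int \<Rightarrow> 'r) \<Rightarrow> 'r mat" where
  "circ \<phi> = mat p p (\<lambda>(a, b). \<phi> ((int a - int b) mod int p))"

lemma circ_index [simp]: "a < p \<Longrightarrow> b < p \<Longrightarrow> circ \<phi> $$ (a, b) = \<phi> ((int a - int b) mod int p)"
  by (simp add: circ_def)

lemma circ_eqI:
  assumes "\<And>k. k \<in> {0..<int p} \<Longrightarrow> \<phi> k = \<psi> k" shows "circ \<phi> = circ \<psi>"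
  unfolding circ_def using assms p_pos by (intro eq_matI) auto

text \<open>Equivariance says f(k, b + h) = f(k - h, b) with indices modulo \<open>p\<close>, so the
  first column determines the matrix.\<close>

lemma circ_hom_iff:
  assumes X: "X \<in> Xpi" and Y: "Y \<in> Xpi"
  shows "f \<in> Hom Q (SO X) (SO Y) \<longleftrightarrow> (\<exists>\<phi>. f = circ \<phi>)"
proof -
  have X': "[X] \<in> Obj FF" and Y': "[Y] \<in> Obj FF" using X Y by simp_all
  note SX = S_list[OF X'] and SY = S_list[OF Y']
  have e: "Cmp FF (act h (S_pts [X])) (S_pts [X]) (S_pts [Y]) f (S_act [X] h) =
      Cmp FF (act h (S_pts [X])) (act h (S_pts [Y])) (S_pts [Y]) (S_act [Y] h) f \<longleftrightarrow>
      (\<forall>k<p. \<forall>b<p. f $$ (k, sh 1 h b) = f $$ (sh 1 (- h) k, b))" (is "?L = ?R \<longleftrightarrow> ?A") for h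
  proof -
    have i: "?L $$ (k, b) = f $$ (k, sh 1 h b)" "?R $$ (k, b) = f $$ (sh 1 (- h) k, b)" if "k < p" "b < p" for k b
      using cmp_S_act_r[OF X' S_pts_Obj[OF Y'], of k b h f] cmp_S_act_l[OF Y' act_Obj[OF S_pts_Obj[OF X']], of b h k h f] that
      by simp_all
    show ?thesis
    proof
      assume "?L = ?R" then show ?A using i by metis
    next
      assume ?A then show "?L = ?R" using i by (intro F_eqI[where m = p and n = p]) auto
    qed
  qed
  have "f \<in> Hom Q (SO X) (SO Y) \<longleftrightarrow> f \<in> carrier_mat p p \<and> (\<forall>h. \<forall>k<p. \<forall>b<p. f $$ (k, sh 1 h b) = f $$ (sh 1 (- h) k, b))"
    unfolding S_obj_eq[OF X] S_obj_eq[OF Y] Q_hom_iff[OF SX(1) SY(1)] SX SY e by (simp add: F_sel)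
  also have "\<dots> \<longleftrightarrow> (\<exists>\<phi>. f = circ \<phi>)"
  proof
    assume *: "f \<in> carrier_mat p p \<and> (\<forall>h. \<forall>k<p. \<forall>b<p. f $$ (k, sh 1 h b) = f $$ (sh 1 (- h) k, b))"
    define \<phi> where "\<phi> j = f $$ (nat (j mod int p), 0)" for j
    have "f = circ \<phi>"
    proof (rule F_eqI[where m = p and n = p])
      fix k b assume kb: "k < p" "b < p"
      have "f $$ (k, sh 1 (int b) 0) = f $$ (sh 1 (- int b) k, 0)" using * kb p_pos by blast
      then show "f $$ (k, b) = circ \<phi> $$ (k, b)" using kb unfolding sh1 by (simp add: \<phi>_def)
    qed (use * in \<open>auto simp: circ_def\<close>)
    then show "\<exists>\<phi>. f = circ \<phi>" by blast
  next
    assume "\<exists>\<phi>. f = circ \<phi>"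
    then obtain \<phi> where f: "f = circ \<phi>" by blast
    have "sh 1 h b < p" for h b unfolding sh1 using p_pos by (simp add: nat_less_iff)
    moreover have "int (sh 1 h b) = (h + int b) mod int p" for h b unfolding sh1 using p_pos by simp
    ultimately show "f \<in> carrier_mat p p \<and> (\<forall>h. \<forall>k<p. \<forall>b<p. f $$ (k, sh 1 h b) = f $$ (sh 1 (- h) k, b))"
      unfolding f by (auto simp: mod_simps algebra_simps, simp add: circ_def)
  qed
  finally show ?thesis .
qed

lemma circ_hom [simp]: "X \<in> Xpi \<Longrightarrow> Y \<in> Xpi \<Longrightarrow> circ \<phi> \<in> Hom Q (SO X) (SO Y)"
  using circ_hom_iff by blast

lemma wt_rot:
  assumes "X \<in> Xpi" "Y \<in> Xpi" "Z \<in> Xpi"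
  shows "wgt (rot p b X) (rot p j Y) (rot p a Z) = wgt X (rot p ((j - b) mod int p) Y) (rot p ((a - b) mod int p) Z)"
proof -
  have "wgt (rot p b X) (rot p j Y) (rot p a Z) = wgt (rot p b X) (rot p b (rot p (j - b) Y)) (rot p b (rot p (a - b) Z))"
    using assms by (simp add: rot_rot)
  also have "\<dots> = wgt X (rot p (j - b) Y) (rot p (a - b) Z)" using assms unfolding wt_def by (subst c_exp_rot) auto
  finally show ?thesis using assms by (simp add: rot_mod p_pos)
qed

text \<open>A convolution over Z/p, weighted by the structure constants of X -> \<gamma>^k Y ->
  \<gamma>^m Z.\<close>

lemma circ_cmp:
  assumes X: "X \<in> Xpi" and Y: "Y \<in> Xpi" and Z: "Z \<in> Xpi"
  shows "Cmp Q (SO X) (SO Y) (SO Z) (circ \<psi>) (circ \<phi>) =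
    circ (\<lambda>m. \<Sum>k\<in>{0..<int p}. \<phi> k * \<psi> ((m - k) mod int p) * wgt X (rot p k Y) (rot p m Z))"
proof (rule F_eqI[where m = p and n = p])
  note S = SO_props[OF X] SO_props[OF Y] SO_props[OF Z]
  fix a b assume ab: "a < p" "b < p"
  have "Cmp Q (SO X) (SO Y) (SO Z) (circ \<psi>) (circ \<phi>) $$ (a, b) =
      (\<Sum>j<p. \<psi> ((int a - int j) mod int p) * \<phi> ((int j - int b) mod int p) * wgt X (rot p ((int j - int b) mod int p) Y) (rot p ((int a - int b) mod int p) Z))"
    unfolding Q_sel using ab S X Y Z by (subst F_cmp_index) (auto simp: wt_rot intro!: sum.cong)
  also have "\<dots> = (\<Sum>k\<in>{0..<int p}. \<phi> k * \<psi> (((int a - int b) mod int p - k) mod int p) * wgt X (rot p k Y) (rot p ((int a - int b) mod int p) Z))"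
    by (rule sum.reindex_bij_witness[where i = "\<lambda>k. nat ((k + int b) mod int p)" and j = "\<lambda>j. (int j - int b) mod int p"])
      (use p_pos in \<open>auto simp: mod_simps nat_less_iff ac_simps\<close>)
  finally show "Cmp Q (SO X) (SO Y) (SO Z) (circ \<psi>) (circ \<phi>) $$ (a, b) =
     circ (\<lambda>m. \<Sum>k\<in>{0..<int p}. \<phi> k * \<psi> ((m - k) mod int p) * wgt X (rot p k Y) (rot p m Z)) $$ (a, b)"
    using ab by simp
qed (use SO_props(2)[OF X] SO_props(2)[OF Z] in \<open>auto simp: Q_sel circ_def\<close>)

text \<open>\<open>circ (dl k)\<close> is the morphism SX -> SY induced by the basic morphism X ->
  \<gamma>^k Y.\<close>

definition dl :: "int \<Rightarrow> int \<Rightarrow> 'r" where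
  "dl k j = (if j = k then 1 else 0)"

lemma circ_idn: "X \<in> Xpi \<Longrightarrow> Idn Q (SO X) = circ (dl 0)"
  using SO_props(2)[of X] unfolding Q_sel F_sel(3)
  by (intro F_eqI[where m = p and n = p]) (auto simp: circ_def dl_def mod_eq_0_iff_dvd mod_eq_dvd_iff[symmetric])

lemma circ_pls: "X \<in> Xpi \<Longrightarrow> Y \<in> Xpi \<Longrightarrow> Pls Q (SO X) (SO Y) (circ \<phi>) (circ \<psi>) = circ (\<lambda>k. \<phi> k + \<psi> k)"
  unfolding Q_sel F_sel(5) by (intro F_eqI[where m = p and n = p]) (auto simp: circ_def)

lemma circ_zer: "X \<in> Xpi \<Longrightarrow> Y \<in> Xpi \<Longrightarrow> Zer Q (SO X) (SO Y) = circ (\<lambda>k. 0)"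
  using SO_props(2)[of X] SO_props(2)[of Y] unfolding Q_sel F_sel(4)
  by (intro F_eqI[where m = p and n = p]) (auto simp: circ_def)

lemma circ_neg: "X \<in> Xpi \<Longrightarrow> Y \<in> Xpi \<Longrightarrow> QQ.neg (SO X) (SO Y) (circ \<phi>) = circ (\<lambda>k. - \<phi> k)"
  by (rule QQ.neg_unique[symmetric]) (auto simp: circ_pls circ_zer SO_props)

lemma circ_null_iff:
  assumes X: "X \<in> Xpi" and Y: "Y \<in> Xpi"
  shows "circ \<phi> \<in> stably_null Q EQ (SO X) (SO Y) \<longleftrightarrow> (\<forall>k\<in>{0..<int p}. nonnull X (rot p k Y) \<longrightarrow> u dvd \<phi> k)"
proof -
  have nn: "nonnull (rot p (int b) X) (rot p (int a) Y) \<longleftrightarrow> nonnull X (rot p ((int a - int b) mod int p) Y)" for a b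
    using nonnull_rot[of X "rot p (int a - int b) Y" p "int b"] X Y by (simp add: rot_rot rot_mod p_pos)
  have "null_mat (fst (SO X)) (fst (SO Y)) (circ \<phi>) \<longleftrightarrow> (\<forall>k\<in>{0..<int p}. nonnull X (rot p k Y) \<longrightarrow> u dvd \<phi> k)"
  proof
    assume *: "null_mat (fst (SO X)) (fst (SO Y)) (circ \<phi>)"
    show "\<forall>k\<in>{0..<int p}. nonnull X (rot p k Y) \<longrightarrow> u dvd \<phi> k"
    proof (intro ballI impI)
      fix k assume k: "k \<in> {0..<int p}" "nonnull X (rot p k Y)"
      then have nk: "nat k < p" by auto
      then have "nonnull (rot p (int 0) X) (rot p (int (nat k)) Y) \<longrightarrow> u dvd circ \<phi> $$ (nat k, 0)"
        using * p_pos SO_props(2,3)[OF X] SO_props(2,3)[OF Y] unfolding null_mat_def by metis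
      then show "u dvd \<phi> k" using k X p_pos nk by simp
    qed
  next
    assume "\<forall>k\<in>{0..<int p}. nonnull X (rot p k Y) \<longrightarrow> u dvd \<phi> k"
    then show "null_mat (fst (SO X)) (fst (SO Y)) (circ \<phi>)"
      unfolding null_mat_def using SO_props(2,3)[OF X] SO_props(2,3)[OF Y] by (simp add: nn p_pos)
  qed
  then show ?thesis using X Y by (simp add: Q_null_iff SO_props)
qed

section \<open>Stable morphisms between the objects SX\<close>

abbreviation "DD \<equiv> C_pi_eq p u E"
abbreviation "cls X Y \<equiv> stable_class Q EQ X Y"

lemma DD_eq: "DD = stable_category Q EQ"
  by (simp add: C_pi_eq_def)

lemma cls_circ_eq_iff:
  assumes X: "X \<in> Xpi" and Y: "Y \<in> Xpi"
  shows "cls (SO X) (SO Y) (circ \<phi>) = cls (SO X) (SO Y) (circ \<psi>) \<longleftrightarrow>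
    (\<forall>k\<in>{0..<int p}. nonnull X (rot p k Y) \<longrightarrow> u dvd \<phi> k - \<psi> k)"
  using assms by (simp add: QF.cl_eq_iff SO_props circ_neg circ_pls circ_null_iff)

text \<open>Stably a coefficient counts modulo \<open>u\<close>, and only at nonnull translates,
  where 1 represents a nonzero class.\<close>

lemma SO_hom_zero_iff:
  assumes X: "X \<in> Xpi" and Y: "Y \<in> Xpi"
  shows "Hom DD (SO X) (SO Y) = {Zer DD (SO X) (SO Y)} \<longleftrightarrow> (\<forall>k. \<not> nonnull X (rot p k Y))"
proof -
  have "Hom DD (SO X) (SO Y) = {Zer DD (SO X) (SO Y)} \<longleftrightarrow>
      (\<forall>\<phi>. cls (SO X) (SO Y) (circ \<phi>) = cls (SO X) (SO Y) (circ (\<lambda>k. 0)))"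
    unfolding DD_eq QF.D_sel circ_zer[OF X Y] using circ_hom_iff[OF X Y] by (auto simp: image_iff) blast+
  also have "\<dots> \<longleftrightarrow> (\<forall>k\<in>{0..<int p}. \<not> nonnull X (rot p k Y))"
    unfolding cls_circ_eq_iff[OF X Y] using u_nonunit by auto
  also have "\<dots> \<longleftrightarrow> (\<forall>k. \<not> nonnull X (rot p k Y))"
    using rot_mod[OF Y p_pos] mod_carrier by metis
  finally show ?thesis .
qed

lemma circ_dl_cmp:
  assumes X: "X \<in> Xpi" and Y: "Y \<in> Xpi" and Z: "Z \<in> Xpi" and k: "k \<in> {0..<int p}"
  shows "Cmp Q (SO X) (SO Y) (SO Z) (circ \<psi>) (circ (dl k)) = circ (\<lambda>m. \<psi> ((m - k) mod int p) * wgt X (rot p k Y) (rot p m Z))"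
  unfolding circ_cmp[OF assms(1-3)] using k by (intro circ_eqI) (simp add: dl_def mult_delta if_distrib[of "\<lambda>x. x * _"] cong: if_cong)

text \<open>Exponent 0 makes X -> \<gamma>^k Y an isomorphism whose inverse is basic as well. The
  induced morphisms between SX and SY are mutually inverse already before passing to the stable
  category.\<close>

lemma SO_iso:
  assumes X: "X \<in> Xpi" and Y: "Y \<in> Xpi" and c: "c_exp X (rot p k Y) X = 0"
  shows "iso_obj DD (SO X) (SO Y)"
proof -
  define k' where "k' = k mod int p"
  have k': "k' \<in> {0..<int p}" "(- k') mod int p \<in> {0..<int p}" unfolding k'_def using p_pos by auto
  have c': "c_exp X (rot p k' Y) X = 0" using c X Y unfolding k'_def by (simp add: rot_mod p_pos)
  then have "c_exp (rot p k' Y) X (rot p k' Y) = 0" using X Y c_exp_swap by simp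
  then have "c_exp (rot p (- k') (rot p k' Y)) (rot p (- k') X) (rot p (- k') (rot p k' Y)) = 0"
    using X Y by (subst c_exp_rot) simp_all
  then have c'': "c_exp Y (rot p ((- k') mod int p) X) Y = 0" using X Y by (simp add: rot_rot rot_mod p_pos)
  have 0: "(m - k') mod int p = (- k') mod int p \<longleftrightarrow> m = 0" "(m - (- k') mod int p) mod int p = k' \<longleftrightarrow> m = 0"
    if "m \<in> {0..<int p}" for m
  proof -
    have d: "int p dvd m \<longleftrightarrow> m = 0" using that by (auto simp: dvd_eq_mod_eq_0)
    show "(m - k') mod int p = (- k') mod int p \<longleftrightarrow> m = 0" unfolding mod_eq_dvd_iff using d by simp
    have "(m - (- k') mod int p) mod int p = (m + k') mod int p" by (simp add: mod_simps)
    moreover have "k' = k' mod int p" using k' by simp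
    moreover have "(m + k') mod int p = k' mod int p \<longleftrightarrow> m = 0" unfolding mod_eq_dvd_iff using d by simp
    ultimately show "(m - (- k') mod int p) mod int p = k' \<longleftrightarrow> m = 0" by metis
  qed
  have 1: "Cmp Q (SO X) (SO Y) (SO X) (circ (dl ((- k') mod int p))) (circ (dl k')) = Idn Q (SO X)"
    unfolding circ_dl_cmp[OF X Y X k'(1)] circ_idn[OF X] using X c' by (intro circ_eqI) (auto simp: dl_def 0)
  have 2: "Cmp Q (SO Y) (SO X) (SO Y) (circ (dl k')) (circ (dl ((- k') mod int p))) = Idn Q (SO Y)"
    unfolding circ_dl_cmp[OF Y X Y k'(2)] circ_idn[OF Y] using Y c'' by (intro circ_eqI) (auto simp: dl_def 0)
  have "iso_mor (stable_category Q EQ) (SO X) (SO Y) (cls (SO X) (SO Y) (circ (dl k')))"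
    by (rule QF.D_iso_morI[where g = "circ (dl ((- k') mod int p))"]) (use X Y 1 2 SO_props in auto)
  then show ?thesis unfolding iso_obj_def DD_eq using X Y SO_props by auto
qed

lemma dvd_circ_sum_0:
  assumes X: "X \<in> Xpi" and Y: "Y \<in> Xpi"
    and c: "\<And>k. k \<in> {0..<int p} \<Longrightarrow> u dvd \<phi> k \<or> 1 \<le> c_exp X (rot p k Y) X"
  shows "u dvd (\<Sum>k\<in>{0..<int p}. \<phi> k * \<psi> ((0 - k) mod int p) * wgt X (rot p k Y) (rot p 0 X))"
  by (intro dvd_sum) (use c X dvd_wt in fastforce)

text \<open>If each round trip X -> \<gamma>^k Y -> X costs a factor \<open>u\<close>, the
  coefficient at 0 of a composite SX -> SY -> SX vanishes modulo \<open>u\<close>, while that of the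
  identity is 1.\<close>

lemma SO_iso_imp:
  assumes X: "X \<in> Xpi" and Y: "Y \<in> Xpi" and nn: "nonnull X X" and iso: "iso_obj DD (SO X) (SO Y)"
  obtains k where "c_exp X (rot p k Y) X = 0"
proof (rule ccontr)
  assume *: "\<not> thesis"
  have c: "1 \<le> c_exp X (rot p k Y) X" for k
    using that[of k] * c_exp_nonneg[of X "rot p k Y" X] X Y by fastforce
  obtain f g where fg: "f \<in> Hom Q (SO X) (SO Y)" "g \<in> Hom Q (SO Y) (SO X)"
    "cls (SO X) (SO X) (Cmp Q (SO X) (SO Y) (SO X) g f) = cls (SO X) (SO X) (Idn Q (SO X))"
    using iso unfolding iso_obj_def DD_eq iso_mor_def by auto
  obtain \<phi> \<psi> where e: "f = circ \<phi>" "g = circ \<psi>" using fg circ_hom_iff X Y by metis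
  have "nonnull X (rot p 0 X)" using nn X by simp
  then have "u dvd (\<Sum>k\<in>{0..<int p}. \<phi> k * \<psi> ((0 - k) mod int p) * wgt X (rot p k Y) (rot p 0 X)) - dl 0 0"
    using fg(3) p_pos unfolding e circ_cmp[OF X Y X] circ_idn[OF X] cls_circ_eq_iff[OF X X] by (elim ballE[of _ _ 0]) auto
  moreover have "u dvd (\<Sum>k\<in>{0..<int p}. \<phi> k * \<psi> ((0 - k) mod int p) * wgt X (rot p k Y) (rot p 0 X))"
    using dvd_circ_sum_0[OF X Y] c by blast
  ultimately have "u dvd dl 0 0" by (rule dvd_of_diff)
  then show False using u_nonunit by (simp add: dl_def)
qed

lemma SO_zero: "X \<in> proj_pts \<Longrightarrow> zero_obj DD (SO X)"
proof -
  assume X: "X \<in> proj_pts"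
  have "\<not> nonnull X (rot p k X)" for k unfolding nonnull_def using X by (auto intro!: bexI[of _ X])
  then show ?thesis
    unfolding zero_obj_def DD_eq using X SO_props(1)[of X] by (simp add: circ_idn circ_zer cls_circ_eq_iff)
qed

text \<open>Modulo \<open>u\<close> the coefficient at 0 is multiplicative, so for an idempotent it
  is 0 or 1. At the possible other nonnull index m the equation becomes (2 \<phi>(0) - 1) \<phi>(m)
  = 0, where 2 \<phi>(0) - 1 is -1 or 1 modulo \<open>u\<close>.\<close>

lemma SO_indecomposable:
  assumes X: "X \<in> Xpi" and nn: "nonnull X X"
    and c: "\<And>k. k \<in> {1..<int p} \<Longrightarrow> 1 \<le> c_exp X (rot p k X) X"
    and k1: "\<And>k. k \<in> {1..<int p} \<Longrightarrow> nonnull X (rot p k X) \<Longrightarrow> k = k1"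
  shows "indecomposable DD (SO X)"
  unfolding DD_eq
proof (rule QF.D.indecomposableI)
  note S = SO_props(1)[OF X]
  show "SO X \<in> Obj (stable_category Q EQ)" using S by simp
  show "\<not> zero_obj (stable_category Q EQ) (SO X)"
    unfolding zero_obj_def using nn X p_pos u_nonunit
    by (auto simp: circ_idn circ_zer cls_circ_eq_iff dl_def intro!: bexI[of _ 0])
  fix e assume e: "e \<in> Hom (stable_category Q EQ) (SO X) (SO X)" and ee: "Cmp (stable_category Q EQ) (SO X) (SO X) (SO X) e e = e"
  obtain \<phi> where \<phi>: "e = cls (SO X) (SO X) (circ \<phi>)" using e circ_hom_iff[OF X X] by auto
  let ?t = "\<lambda>m k. \<phi> k * \<phi> ((m - k) mod int p) * wgt X (rot p k X) (rot p m X)"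
  have sq: "u dvd (\<Sum>k\<in>{0..<int p}. ?t m k) - \<phi> m" if "m \<in> {0..<int p}" "nonnull X (rot p m X)" for m
    using ee that S unfolding \<phi> by (simp add: circ_cmp[OF X X X] X cls_circ_eq_iff)
  have "u dvd (\<Sum>k\<in>{0..<int p}. ?t 0 k) - \<phi> 0" using sq[of 0] nn X p_pos by simp
  moreover have "(\<Sum>k\<in>{0..<int p}. ?t 0 k) = ?t 0 0 + (\<Sum>k\<in>{0..<int p} - {0}. ?t 0 k)"
    using p_pos by (intro sum.remove) auto
  moreover have "u dvd (\<Sum>k\<in>{0..<int p} - {0}. ?t 0 k)"
    by (intro dvd_sum dvd_mult dvd_wt) (use c X in auto)
  moreover have "?t 0 0 = \<phi> 0 * \<phi> 0" using X by simp
  ultimately have "u dvd (\<phi> 0 * \<phi> 0 + (\<Sum>k\<in>{0..<int p} - {0}. ?t 0 k)) - \<phi> 0"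
    and r: "u dvd (\<Sum>k\<in>{0..<int p} - {0}. ?t 0 k)" using X by simp_all
  then have "u dvd ((\<phi> 0 * \<phi> 0 + (\<Sum>k\<in>{0..<int p} - {0}. ?t 0 k)) - \<phi> 0) - (\<Sum>k\<in>{0..<int p} - {0}. ?t 0 k)"
    by (rule dvd_diff)
  then have "u dvd \<phi> 0 * \<phi> 0 - \<phi> 0" by (simp add: algebra_simps)
  then have 0: "u dvd \<phi> 0 \<or> u dvd \<phi> 0 - 1"
    using u_prime[of "\<phi> 0" "\<phi> 0 - 1"] by (simp add: algebra_simps)
  have 1: "u dvd \<phi> m" if m: "m \<in> {0..<int p}" "nonnull X (rot p m X)" "m \<noteq> 0" for m
  proof -
    have mk: "m = k1" using k1[of m] m by auto
    have "(\<Sum>k\<in>{0..<int p}. ?t m k) = ?t m 0 + (\<Sum>k\<in>{0..<int p} - {0}. ?t m k)"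
      using p_pos by (intro sum.remove) auto
    also have "(\<Sum>k\<in>{0..<int p} - {0}. ?t m k) = ?t m m + (\<Sum>k\<in>{0..<int p} - {0} - {m}. ?t m k)"
      using m by (intro sum.remove) auto
    also have "?t m 0 = \<phi> 0 * \<phi> m" using m X by simp
    also have "?t m m = \<phi> 0 * \<phi> m" using m X by simp
    finally have s: "(\<Sum>k\<in>{0..<int p}. ?t m k) - \<phi> m = (2 * \<phi> 0 - 1) * \<phi> m + (\<Sum>k\<in>{0..<int p} - {0} - {m}. ?t m k)"
      by (simp add: algebra_simps)
    have "u dvd ?t m k" if k: "k \<in> {0..<int p} - {0} - {m}" for k
    proof -
      have "\<not> nonnull X (rot p k X)" using k1[of k] k mk by auto
      then have "1 \<le> c_exp X (rot p k X) (rot p m X)"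
        using c_exp_pos_of_null_factor[of X "rot p k X" "rot p m X"] X m by simp
      then show ?thesis by (intro dvd_mult dvd_wt)
    qed
    then have "u dvd (\<Sum>k\<in>{0..<int p} - {0} - {m}. ?t m k)" by (rule dvd_sum)
    then have "u dvd (2 * \<phi> 0 - 1) * \<phi> m" using sq[OF m(1,2)] unfolding s by (subst (asm) dvd_add_left_iff)
    moreover have "\<not> u dvd 2 * \<phi> 0 - 1"
    proof
      assume d: "u dvd 2 * \<phi> 0 - 1"
      from 0 show False
      proof
        assume "u dvd \<phi> 0"
        then have "u dvd 1" using dvd_of_diff[OF d] by (simp add: dvd_mult)
        then show False using u_nonunit by simp
      next
        assume "u dvd \<phi> 0 - 1"
        then have "u dvd 2 * (\<phi> 0 - 1)" by (rule dvd_mult)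
        moreover have "2 * (\<phi> 0 - 1) = (2 * \<phi> 0 - 1) - 1" by (simp add: algebra_simps)
        ultimately have "u dvd 1" using dvd_of_diff[of u "2 * \<phi> 0 - 1" 1] d by metis
        then show False using u_nonunit by simp
      qed
    qed
    ultimately show ?thesis using u_prime by blast
  qed
  show "e = Zer (stable_category Q EQ) (SO X) (SO X) \<or> e = Idn (stable_category Q EQ) (SO X)"
    using 0
  proof
    assume "u dvd \<phi> 0"
    then have "e = Zer (stable_category Q EQ) (SO X) (SO X)"
      unfolding \<phi> QF.D_sel circ_zer[OF X X] cls_circ_eq_iff[OF X X] using 1 by (metis diff_zero)
    then show ?thesis ..
  next
    assume "u dvd \<phi> 0 - 1"
    then have "e = Idn (stable_category Q EQ) (SO X)"
      unfolding \<phi> QF.D_sel circ_idn[OF X] cls_circ_eq_iff[OF X X] using 1 by (auto simp: dl_def)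
    then show ?thesis ..
  qed
qed

end

section \<open>The residue field\<close>

context ground
begin

abbreviation "RR \<equiv> (class_ring :: 'r ring)"
abbreviation "UI \<equiv> PIdl\<^bsub>RR\<^esub> u"

lemma class_cring: "cring RR"
  by unfold_locales (auto simp: mult.commute Units_def algebra_simps intro: exI[of _ "- _"])

lemma UI_iff: "x \<in> UI \<longleftrightarrow> u dvd x"
  by (auto simp: cgenideal_def dvd_def mult.commute)

lemma UI_ideal: "ideal UI RR"
  by (rule cring.cgenideal_ideal[OF class_cring]) simp

definition coset :: "'r \<Rightarrow> 'r set" where
  "coset a = UI +>\<^bsub>RR\<^esub> a"

lemma coset_eq_iff: "coset a = coset b \<longleftrightarrow> u dvd a - b"
proof -
  have c: "coset a = {x. u dvd x - a}" for a
  proof (intro equalityI subsetI)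
    fix x assume "x \<in> coset a"
    then show "x \<in> {x. u dvd x - a}" unfolding coset_def a_r_coset_def' by (auto simp: UI_iff)
  next
    fix x assume "x \<in> {x. u dvd x - a}"
    then show "x \<in> coset a" unfolding coset_def a_r_coset_def' by (auto simp: UI_iff intro!: bexI[of _ "x - a"])
  qed
  show ?thesis unfolding c
  proof
    assume "{x. u dvd x - a} = {x. u dvd x - b}"
    then have "a \<in> {x. u dvd x - b}" by auto
    then show "u dvd a - b" by simp
  next
    assume "u dvd a - b"
    then have "u dvd x - a \<longleftrightarrow> u dvd x - b" for x
      by (metis diff_add_cancel add_diff_eq dvd_add_left_iff)
    then show "{x. u dvd x - a} = {x. u dvd x - b}" by simp
  qed
qed

lemma residue_field_carrier: "carrier (residue_field u) = range coset"
  unfolding residue_field_def FactRing_def A_RCOSETS_def' coset_def by auto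

lemma coset_hom:
  "coset a \<otimes>\<^bsub>residue_field u\<^esub> coset b = coset (a * b)" "coset a \<oplus>\<^bsub>residue_field u\<^esub> coset b = coset (a + b)"
  "\<one>\<^bsub>residue_field u\<^esub> = coset 1" "\<zero>\<^bsub>residue_field u\<^esub> = coset 0"
proof -
  have h: "(+>\<^bsub>RR\<^esub>) UI \<in> Ring.ring_hom RR (RR Quot UI)" using ideal.rcos_ring_hom[OF UI_ideal] .
  show "coset a \<otimes>\<^bsub>residue_field u\<^esub> coset b = coset (a * b)" "coset a \<oplus>\<^bsub>residue_field u\<^esub> coset b = coset (a + b)"
    "\<one>\<^bsub>residue_field u\<^esub> = coset 1"
    using Ring.ring_hom_mult[OF h, of a b] Ring.ring_hom_add[OF h, of a b] Ring.ring_hom_one[OF h] unfolding residue_field_def coset_def by auto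
  show "\<zero>\<^bsub>residue_field u\<^esub> = coset 0"
    unfolding residue_field_def coset_def FactRing_def a_r_coset_def' by auto
qed

lemma residue_inverse:
  assumes "x \<in> carrier (residue_field u)" "x \<noteq> \<zero>\<^bsub>residue_field u\<^esub>"
  obtains y where "y \<in> carrier (residue_field u)" "y \<otimes>\<^bsub>residue_field u\<^esub> x = \<one>\<^bsub>residue_field u\<^esub>"
proof -
  obtain a where a: "x = coset a" using assms(1) residue_field_carrier by auto
  then have "\<not> u dvd a" using assms(2) by (simp add: coset_hom coset_eq_iff)
  then obtain b where "a * b = 1" using unit_or_dvd by blast
  then show ?thesis using that[of "coset b"] a by (simp add: coset_hom residue_field_carrier mult.commute)
qed

end

section \<open>Rigidity and conflations of the objects SX\<close>

context equivariant
begin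

text \<open>With k = 0 the only nonnull translate, a stable endomorphism amounts to its coefficient
  at 0 modulo \<open>u\<close>.\<close>

lemma SO_rigid:
  assumes X: "X \<in> Xpi" and nn: "nonnull X X"
    and c: "\<And>k. k \<in> {1..<int p} \<Longrightarrow> 1 \<le> c_exp X (rot p k X) X"
    and n: "\<And>k. k \<in> {1..<int p} \<Longrightarrow> \<not> nonnull X (rot p k X)"
  shows "rigid p u E (SO X)"
  unfolding rigid_def
proof
  show "indecomposable DD (SO X)" using SO_indecomposable[OF X nn c] n by blast
  note S = SO_props(1)[OF X]
  have eq: "cls (SO X) (SO X) (circ \<phi>) = cls (SO X) (SO X) (circ \<psi>) \<longleftrightarrow> coset (\<phi> 0) = coset (\<psi> 0)" for \<phi> \<psi>
  proof -
    have K: "k = 0" if "k \<in> {0..<int p}" "nonnull X (rot p k X)" for k using n[of k] that by fastforce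
    have "(\<forall>k\<in>{0..<int p}. nonnull X (rot p k X) \<longrightarrow> u dvd \<phi> k - \<psi> k) \<longleftrightarrow> u dvd \<phi> 0 - \<psi> 0"
    proof
      assume *: "\<forall>k\<in>{0..<int p}. nonnull X (rot p k X) \<longrightarrow> u dvd \<phi> k - \<psi> k"
      have "nonnull X (rot p 0 X) \<longrightarrow> u dvd \<phi> 0 - \<psi> 0" by (rule bspec[OF *]) (use p_pos in simp)
      then show "u dvd \<phi> 0 - \<psi> 0" using nn X by simp
    next
      assume *: "u dvd \<phi> 0 - \<psi> 0"
      show "\<forall>k\<in>{0..<int p}. nonnull X (rot p k X) \<longrightarrow> u dvd \<phi> k - \<psi> k"
        using K * by blast
    qed
    then show ?thesis unfolding cls_circ_eq_iff[OF X X] coset_eq_iff .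
  qed
  \<comment> \<open>The value does not depend on the chosen \<phi>, since by \<open>eq\<close> the
    class determines \<phi>(0) modulo \<open>u\<close>.\<close>
  define h where "h F = coset ((SOME \<phi>. F = cls (SO X) (SO X) (circ \<phi>)) 0)" for F
  have h: "h (cls (SO X) (SO X) (circ \<phi>)) = coset (\<phi> 0)" for \<phi>
  proof -
    have "cls (SO X) (SO X) (circ \<phi>) = cls (SO X) (SO X) (circ (SOME \<psi>. cls (SO X) (SO X) (circ \<phi>) = cls (SO X) (SO X) (circ \<psi>)))"
      by (rule someI[of "\<lambda>\<psi>. cls (SO X) (SO X) (circ \<phi>) = cls (SO X) (SO X) (circ \<psi>)" \<phi>]) simp
    then show ?thesis unfolding eq h_def by simp
  qed
  let ?End = "end_ring DD (SO X)"
  have car: "carrier ?End = range (\<lambda>\<phi>. cls (SO X) (SO X) (circ \<phi>))"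
    unfolding end_ring_def DD_eq using circ_hom_iff[OF X X] by auto
  have mul: "coset ((\<Sum>k\<in>{0..<int p}. \<phi> k * \<psi> ((0 - k) mod int p) * wgt X (rot p k X) (rot p 0 X))) = coset (\<psi> 0 * \<phi> 0)" for \<phi> \<psi>
  proof -
    let ?t = "\<lambda>k. \<phi> k * \<psi> ((0 - k) mod int p) * wgt X (rot p k X) (rot p 0 X)"
    have "sum ?t {0..<int p} = ?t 0 + sum ?t ({0..<int p} - {0})"
      using p_pos by (intro sum.remove) auto
    moreover have "u dvd sum ?t ({0..<int p} - {0})"
      by (intro dvd_sum dvd_mult dvd_wt) (use c X in auto)
    ultimately show ?thesis unfolding coset_eq_iff using X by (simp add: mult.commute)
  qed
  have "h \<in> Ring.ring_hom ?End (residue_field u)"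
  proof (rule Ring.ring_hom_memI)
    fix F assume "F \<in> carrier ?End"
    then show "h F \<in> carrier (residue_field u)" unfolding car residue_field_carrier using h by auto
  next
    fix F G assume "F \<in> carrier ?End" "G \<in> carrier ?End"
    then obtain \<phi> \<psi> where F: "F = cls (SO X) (SO X) (circ \<phi>)" and G: "G = cls (SO X) (SO X) (circ \<psi>)" unfolding car by auto
    have "F \<otimes>\<^bsub>?End\<^esub> G = cls (SO X) (SO X) (circ (\<lambda>m. \<Sum>k\<in>{0..<int p}. \<psi> k * \<phi> ((m - k) mod int p) * wgt X (rot p k X) (rot p m X)))"
      unfolding end_ring_def DD_eq F G using S X by (simp add: circ_cmp)
    then show "h (F \<otimes>\<^bsub>?End\<^esub> G) = h F \<otimes>\<^bsub>residue_field u\<^esub> h G"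
      unfolding F G h coset_hom using mul by (simp add: h)
    have "F \<oplus>\<^bsub>?End\<^esub> G = cls (SO X) (SO X) (circ (\<lambda>k. \<phi> k + \<psi> k))"
      unfolding end_ring_def DD_eq F G using S X by (simp add: circ_pls)
    then show "h (F \<oplus>\<^bsub>?End\<^esub> G) = h F \<oplus>\<^bsub>residue_field u\<^esub> h G"
      unfolding F G h coset_hom by (simp add: h)
  next
    show "h \<one>\<^bsub>?End\<^esub> = \<one>\<^bsub>residue_field u\<^esub>"
      unfolding end_ring_def DD_eq coset_hom by (simp add: circ_idn X h dl_def)
  qed
  moreover have "bij_betw h (carrier ?End) (carrier (residue_field u))"
    unfolding bij_betw_def
  proof
    show "inj_on h (carrier ?End)" unfolding car inj_on_def by (auto simp: h eq)
    show "h ` carrier ?End = carrier (residue_field u)"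
      unfolding car residue_field_carrier by (auto simp: h image_iff)
  qed
  ultimately show "is_ring_iso ?End (residue_field u)" unfolding is_ring_iso_def ring_iso_def by blast
qed

text \<open>As the endomorphism ring is a field, the nonzero class of X -> \<gamma>^k X has a left
  inverse; if the round trip cost a factor \<open>u\<close>, the coefficient at 0 of the product
  would vanish modulo \<open>u\<close>. Since \<open>Y\<close> is only isomorphic to SX, the
  endomorphism is carried to \<open>Y\<close> and back.\<close>

lemma rigid_no_endo:
  assumes X: "X \<in> Xpi" and r: "rigid p u E Y" and iso: "iso_obj DD Y (SO X)" and nn: "nonnull X X"
    and k: "k \<in> {0..<int p}" "nonnull X (rot p k X)"
  shows "c_exp X (rot p k X) X = 0"
proof (rule ccontr)
  assume "c_exp X (rot p k X) X \<noteq> 0"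
  then have c: "1 \<le> c_exp X (rot p k X) X" using c_exp_nonneg[of X "rot p k X" X] X by simp
  note S = SO_props(1)[OF X]
  let ?D = "stable_category Q EQ"
  obtain f g where fg [simp]: "Y \<in> Obj ?D" "SO X \<in> Obj ?D" "f \<in> Hom ?D Y (SO X)" "g \<in> Hom ?D (SO X) Y"
    "Cmp ?D Y (SO X) Y g f = Idn ?D Y" "Cmp ?D (SO X) Y (SO X) f g = Idn ?D (SO X)"
    using iso unfolding DD_eq by (rule QF.D.iso_objE)
  define e where "e = cls (SO X) (SO X) (circ (dl k))"
  have e [simp]: "e \<in> Hom ?D (SO X) (SO X)" unfolding e_def using X by simp
  define e' where "e' = Cmp ?D Y (SO X) Y g (Cmp ?D Y (SO X) (SO X) e f)"
  have [simp]: "e' \<in> Hom ?D Y Y" unfolding e'_def by (simp del: QF.D_sel)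
  let ?End = "end_ring DD Y"
  have End: "carrier ?End = Hom ?D Y Y" "\<zero>\<^bsub>?End\<^esub> = Zer ?D Y Y" "\<one>\<^bsub>?End\<^esub> = Idn ?D Y"
    "a \<otimes>\<^bsub>?End\<^esub> b = Cmp ?D Y Y Y a b" "a \<oplus>\<^bsub>?End\<^esub> b = Pls ?D Y Y a b" for a b
    unfolding end_ring_def DD_eq by simp_all
  have ret: "Cmp ?D (SO X) Y (SO X) f (Cmp ?D (SO X) Y Y e' g) = e"
    unfolding e'_def by (simp add: QF.D.cmp_assoc QF.D.cmp_ctx[OF fg(6)] del: QF.D_sel)
  have e0: "e' \<noteq> Zer ?D Y Y"
  proof
    assume "e' = Zer ?D Y Y"
    then have "e = Zer ?D (SO X) (SO X)" using ret by (simp del: QF.D_sel)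
    then have "u dvd dl k k - 0" using k unfolding e_def QF.D_sel circ_zer[OF X X] cls_circ_eq_iff[OF X X] by blast
    then show False using u_nonunit by (simp add: dl_def)
  qed
  obtain h where h: "h \<in> Ring.ring_hom ?End (residue_field u)" "bij_betw h (carrier ?End) (carrier (residue_field u))"
    using r unfolding rigid_def is_ring_iso_def ring_iso_def by blast
  have z: "Zer ?D Y Y \<in> carrier ?End" and e'c: "e' \<in> carrier ?End" unfolding End(1) by (simp_all del: QF.D_sel add: QF.D.zer_in)
  \<comment> \<open>A ring homomorphism is required to preserve sums and products and the unit; that
    it preserves zero follows from h(0) + h(0) = h(0).\<close>
  have h0: "h (Zer ?D Y Y) = \<zero>\<^bsub>residue_field u\<^esub>"
  proof -
    have "h (Zer ?D Y Y) \<oplus>\<^bsub>residue_field u\<^esub> h (Zer ?D Y Y) = h (Zer ?D Y Y)"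
      using Ring.ring_hom_add[OF h(1) z z] unfolding End by (simp del: QF.D_sel add: QF.D.zer_in)
    moreover obtain a where a: "h (Zer ?D Y Y) = coset a"
      using Ring.ring_hom_closed[OF h(1) z] residue_field_carrier by auto
    ultimately have "u dvd (a + a) - a" unfolding a coset_hom coset_eq_iff by simp
    then show ?thesis unfolding a coset_hom coset_eq_iff by simp
  qed
  have "h e' \<noteq> \<zero>\<^bsub>residue_field u\<^esub>" using inj_onD[OF bij_betw_imp_inj_on[OF h(2)] _ e'c z] e0 h0 by metis
  then obtain y where y: "y \<in> carrier (residue_field u)" "y \<otimes>\<^bsub>residue_field u\<^esub> h e' = \<one>\<^bsub>residue_field u\<^esub>"
    using residue_inverse Ring.ring_hom_closed[OF h(1) e'c] by metis
  obtain s where s: "s \<in> carrier ?End" "y = h s" using y(1) bij_betw_imp_surj_on[OF h(2)] by (metis imageE)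
  have "h (s \<otimes>\<^bsub>?End\<^esub> e') = h \<one>\<^bsub>?End\<^esub>" using y s Ring.ring_hom_mult[OF h(1) s(1) e'c] Ring.ring_hom_one[OF h(1)] by simp
  moreover have sH [simp]: "s \<in> Hom ?D Y Y" using s unfolding End by simp
  moreover have "s \<otimes>\<^bsub>?End\<^esub> e' \<in> carrier ?End" "\<one>\<^bsub>?End\<^esub> \<in> carrier ?End"
    unfolding End by (simp_all del: QF.D_sel add: QF.D.idn_in)
  ultimately have "s \<otimes>\<^bsub>?End\<^esub> e' = \<one>\<^bsub>?End\<^esub>" by (intro inj_onD[OF bij_betw_imp_inj_on[OF h(2)]])
  then have se: "Cmp ?D Y Y Y s e' = Idn ?D Y" unfolding End .
  have fe: "Cmp ?D Y Y (SO X) f e' = Cmp ?D Y (SO X) (SO X) e f"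
    unfolding e'_def by (simp add: QF.D.cmp_ctx[OF fg(6)] del: QF.D_sel)
  have eg: "Cmp ?D (SO X) Y Y e' g = Cmp ?D (SO X) (SO X) Y g e"
    unfolding e'_def by (simp add: QF.D.cmp_assoc del: QF.D_sel)
  define t where "t = Cmp ?D (SO X) Y (SO X) f (Cmp ?D (SO X) Y Y s g)"
  have t: "t \<in> Hom ?D (SO X) (SO X)" unfolding t_def by (simp del: QF.D_sel)
  have "Cmp ?D (SO X) (SO X) (SO X) t e = Cmp ?D (SO X) Y (SO X) f (Cmp ?D (SO X) Y Y s (Cmp ?D (SO X) Y Y e' g))"
    unfolding t_def eg by (simp add: QF.D.cmp_assoc del: QF.D_sel)
  also have "\<dots> = Idn ?D (SO X)" by (simp add: QF.D.cmp_ctx[OF se] del: QF.D_sel)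
  finally have te: "Cmp ?D (SO X) (SO X) (SO X) t e = Idn ?D (SO X)" .
  obtain \<psi> where \<psi>: "t = cls (SO X) (SO X) (circ \<psi>)" using t circ_hom_iff[OF X X] by auto
  have "cls (SO X) (SO X) (circ (\<lambda>m. \<psi> ((m - k) mod int p) * wgt X (rot p k X) (rot p m X))) = cls (SO X) (SO X) (circ (dl 0))"
    using te S X k unfolding \<psi> e_def by (simp add: circ_dl_cmp circ_idn)
  moreover have "nonnull X (rot p 0 X)" "0 \<in> {0..<int p}" using nn X p_pos by auto
  ultimately have "u dvd \<psi> ((0 - k) mod int p) * wgt X (rot p k X) (rot p 0 X) - dl 0 0"
    unfolding cls_circ_eq_iff[OF X X] by blast
  moreover have "u dvd \<psi> ((0 - k) mod int p) * wgt X (rot p k X) (rot p 0 X)" using c X by (intro dvd_mult dvd_wt) simp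
  ultimately have "u dvd dl 0 0" by (rule dvd_of_diff)
  then show False using u_nonunit by (simp add: dl_def)
qed

lemma F_neg: "X \<in> Obj FF \<Longrightarrow> Y \<in> Obj FF \<Longrightarrow> f \<in> Hom FF X Y \<Longrightarrow> FE.neg X Y f = - f"
  by (rule FE.neg_unique[symmetric]) (auto simp: F_sel)

lemma Q_neg:
  assumes "X \<in> Obj Q" "Y \<in> Obj Q" "f \<in> Hom Q X Y" shows "QQ.neg X Y f = - f"
proof -
  have f: "f \<in> Hom FF (fst X) (fst Y)" using assms Q_hom_F by blast
  have "FE.neg (fst X) (fst Y) f = - f" using F_neg assms f Q_objD(1) by blast
  then have "- f \<in> Hom Q X Y" using Q_addcat_part(3)[of X Y X f] assms by simp
  then show ?thesis
    by (intro QQ.neg_unique[symmetric]) (use assms f in \<open>auto simp: Q_sel F_sel\<close>)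
qed

text \<open>The \<open>p\<close> rotated copies of the square form one conflation. Its maps are
  spelled out by \<open>i\<close>, \<open>j\<close>, \<open>q\<close>, \<open>r\<close> and
  \<open>circ (dl 0)\<close>, because the factorisations for approximations are computed from these
  components.\<close>

lemma S_conflation:
  assumes sq: "exact_square X Y1 Y2 Z"
  obtains A i j q r where "is_biproduct Q (SO Y1) (SO Y2) A i j q r"
    "(SO X, A, SO Z, Pls Q (SO X) A (Cmp Q (SO X) (SO Y1) A i (circ (dl 0))) (Cmp Q (SO X) (SO Y2) A j (circ (dl 0))),
      Pls Q A (SO Z) (Cmp Q A (SO Y1) (SO Z) (circ (dl 0)) q) (QQ.neg A (SO Z) (Cmp Q A (SO Y2) (SO Z) (circ (dl 0)) r))) \<in> EQ"
proof -
  have X: "X \<in> Xpi" "Y1 \<in> Xpi" "Y2 \<in> Xpi" "Z \<in> Xpi" using sq unfolding exact_square_def by auto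
  note S = SO_props(1,2)[OF X(1)] SO_props(1,2)[OF X(2)] SO_props(1,2)[OF X(3)] SO_props(1,2)[OF X(4)]
  note nth = SO_props(3)[OF X(1)] SO_props(3)[OF X(2)] SO_props(3)[OF X(3)] SO_props(3)[OF X(4)]
  have Y: "fst (SO Y1) \<in> Obj FF" "fst (SO Y2) \<in> Obj FF" using S Q_objD(1) by auto
  obtain A where A: "A \<in> Obj Q" "fst A = fst (SO Y1) @ fst (SO Y2)"
    and bA: "is_biproduct Q (SO Y1) (SO Y2) A
      (mat (p + p) p (\<lambda>(j, l). if j = l then 1 else 0)) (mat (p + p) p (\<lambda>(j, l). if j = p + l then 1 else 0))
      (mat p (p + p) (\<lambda>(l, j). if j = l then 1 else 0)) (mat p (p + p) (\<lambda>(l, j). if j = p + l then 1 else 0))"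
    (is "is_biproduct Q _ _ A ?i ?j ?q ?r")
    using Q_biproduct[OF S(3) S(5) is_biproduct_append[OF Y]] S by metis
  note bD = QQ.is_biproductD[OF bA]
  have A1: "fst A ! c = rot p (int c) Y1" "fst A ! (p + c) = rot p (int c) Y2" if "c < p" for c
    using that S nth unfolding A(2) by (simp_all add: nth_append)
  have lA: "length (fst A) = p + p" using S unfolding A(2) by simp
  have cd: "circ (dl 0) $$ (a, b) = (if a = b then 1 else 0)" if "a < p" "b < p" for a b
    using that by (simp add: dl_def mod_eq_0_iff_dvd mod_eq_dvd_iff[symmetric])
  let ?f1 = "Cmp Q (SO X) (SO Y1) A ?i (circ (dl 0))" and ?f2 = "Cmp Q (SO X) (SO Y2) A ?j (circ (dl 0))"
  let ?g1 = "Cmp Q A (SO Y1) (SO Z) (circ (dl 0)) ?q" and ?g2 = "Cmp Q A (SO Y2) (SO Z) (circ (dl 0)) ?r"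
  have split: "thesis" if "c < p + p" "c < p \<Longrightarrow> thesis" "\<And>d. d < p \<Longrightarrow> c = p + d \<Longrightarrow> thesis" for c thesis
    using that by (metis add_less_cancel_left le_Suc_ex not_le)
  have f1: "?f1 $$ (c, x) = (if c = x then 1 else 0)" and f2: "?f2 $$ (c, x) = (if c = p + x then 1 else 0)"
    if c: "c < p + p" and x: "x < p" for c x
  proof -
    have "?f1 $$ (c, x) = (\<Sum>l<p. if l = x then (if c = l then wgt (fst (SO X) ! x) (fst (SO Y1) ! l) (fst A ! c) else 0) else 0)"
      unfolding Q_sel using c x S lA by (subst F_cmp_index) (auto simp: cd simp del: circ_index sum.delta sum.delta' intro!: sum.cong)
    then show "?f1 $$ (c, x) = (if c = x then 1 else 0)" using x nth X by (simp add: A1)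
    have "?f2 $$ (c, x) = (\<Sum>l<p. if l = x then (if c = p + l then wgt (fst (SO X) ! x) (fst (SO Y2) ! l) (fst A ! c) else 0) else 0)"
      unfolding Q_sel using c x S lA by (subst F_cmp_index) (auto simp: cd simp del: circ_index sum.delta sum.delta' intro!: sum.cong)
    then show "?f2 $$ (c, x) = (if c = p + x then 1 else 0)" using x nth X by (simp add: A1)
  qed
  have g1: "?g1 $$ (z, c) = (if c = z then 1 else 0)" and g2: "?g2 $$ (z, c) = (if c = p + z then 1 else 0)"
    if c: "c < p + p" and z: "z < p" for c z
  proof -
    have "?g1 $$ (z, c) = (\<Sum>l<p. if l = z then (if c = l then wgt (fst A ! c) (fst (SO Y1) ! l) (fst (SO Z) ! z) else 0) else 0)"
      unfolding Q_sel using c z S lA by (subst F_cmp_index) (auto simp: cd simp del: circ_index sum.delta sum.delta' intro!: sum.cong)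
    then show "?g1 $$ (z, c) = (if c = z then 1 else 0)" using z nth X by (simp add: A1)
    have "?g2 $$ (z, c) = (\<Sum>l<p. if l = z then (if c = p + l then wgt (fst A ! c) (fst (SO Y2) ! l) (fst (SO Z) ! z) else 0) else 0)"
      unfolding Q_sel using c z S lA by (subst F_cmp_index) (auto simp: cd simp del: circ_index sum.delta sum.delta' intro!: sum.cong)
    then show "?g2 $$ (z, c) = (if c = p + z then 1 else 0)" using z nth X by (simp add: A1)
  qed
  have f_hom: "?f1 \<in> Hom Q (SO X) A" "?f2 \<in> Hom Q (SO X) A" "?g1 \<in> Hom Q A (SO Z)" "?g2 \<in> Hom Q A (SO Z)"
    using S X bD by (auto intro!: QQ.cmp_in)
  have f: "Pls Q (SO X) A ?f1 ?f2 = sq_in p"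
    by (rule F_eqI[where m = "p + p" and n = p])
      (use f1 f2 lA S p_pos in \<open>auto simp: Q_sel F_sel(5) sq_in_def simp del: F_cmp_index\<close>)
  have "Pls Q A (SO Z) ?g1 (- ?g2) = sq_out p"
    by (rule F_eqI[where m = p and n = "p + p"])
      (use g1 g2 lA S p_pos in \<open>auto simp: Q_sel F_sel(5) sq_out_def simp del: F_cmp_index\<close>)
  then have g: "Pls Q A (SO Z) ?g1 (QQ.neg A (SO Z) ?g2) = sq_out p" using Q_neg[OF A(1) S(7) f_hom(4)] by simp
  have "(fst (SO X), fst (SO Y1) @ fst (SO Y2), fst (SO Z), sq_in p, sq_out p) \<in> E"
    by (rule sq_conf) (use S nth exact_square_rot[OF sq] in auto)
  moreover have "sq_in p \<in> Hom Q (SO X) A" unfolding f[symmetric] using f_hom S A by (intro QQ.pls_in)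
  moreover have "sq_out p \<in> Hom Q A (SO Z)" unfolding g[symmetric] using f_hom S A by (intro QQ.pls_in QQ.neg_in)
  ultimately have "(SO X, A, SO Z, Pls Q (SO X) A ?f1 ?f2, Pls Q A (SO Z) ?g1 (QQ.neg A (SO Z) ?g2)) \<in> EQ"
    unfolding f g EQ_iff A(2)[symmetric] using S A by simp
  then show ?thesis using that bA by blast
qed

end

section \<open>Noncrossing periodic families of arcs\<close>

definition cross :: "real \<times> real \<Rightarrow> real \<times> real \<Rightarrow> bool" where
  "cross X Y \<longleftrightarrow> fst X < fst Y \<and> fst Y < snd X \<and> snd X < snd Y \<or> fst Y < fst X \<and> fst X < snd Y \<and> snd Y < snd X"

lemma cross_sym: "cross X Y \<longleftrightarrow> cross Y X"
  unfolding cross_def by blast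

definition arc_strip :: "real \<Rightarrow> (real \<times> real) set" where
  "arc_strip t = {(x, y). x < y \<and> y \<le> x + t}"

definition arc_orbit :: "real \<Rightarrow> real \<times> real \<Rightarrow> (real \<times> real) set" where
  "arc_orbit t X = range (\<lambda>k::int. (fst X + of_int k * t, snd X + of_int k * t))"

lemma arc_orbit_self [simp]: "X \<in> arc_orbit t X"
  unfolding arc_orbit_def by (rule range_eqI[of _ _ 0]) simp

lemma arc_orbit_sym: "Y \<in> arc_orbit t X \<Longrightarrow> X \<in> arc_orbit t Y"
proof -
  assume "Y \<in> arc_orbit t X"
  then obtain k :: int where "Y = (fst X + of_int k * t, snd X + of_int k * t)" unfolding arc_orbit_def by auto
  then show ?thesis unfolding arc_orbit_def by - (rule range_eqI[of _ _ "- k"], simp)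
qed

lemma arc_orbit_trans: "Y \<in> arc_orbit t X \<Longrightarrow> Z \<in> arc_orbit t Y \<Longrightarrow> Z \<in> arc_orbit t X"
proof -
  assume "Y \<in> arc_orbit t X" "Z \<in> arc_orbit t Y"
  then obtain k :: int and l :: int where "Y = (fst X + of_int k * t, snd X + of_int k * t)" "Z = (fst Y + of_int l * t, snd Y + of_int l * t)"
    unfolding arc_orbit_def by blast
  then show ?thesis unfolding arc_orbit_def by - (rule range_eqI[of _ _ "k + l"], simp add: algebra_simps)
qed

lemma finite_max_ex:
  fixes f :: "'a \<Rightarrow> 'b::linorder" assumes "finite W" "Z0 \<in> W"
  obtains Z where "Z \<in> W" "\<And>Y. Y \<in> W \<Longrightarrow> f Y \<le> f Z"
proof -
  have "Max (f ` W) \<in> f ` W" using assms by (intro Max_in) auto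
  then obtain Z where "Z \<in> W" "Max (f ` W) = f Z" by auto
  then show ?thesis using that[of Z] assms Max_ge[of "f ` W"] by auto
qed

lemma cross_open:
  assumes "cross Z Y"
  shows "\<exists>e>0. \<forall>Z'. dist Z' Z < e \<longrightarrow> cross Z' Y"
proof -
  have "open {Z. cross Z Y}"
    unfolding cross_def by (intro open_Collect_disj open_Collect_conj open_Collect_less continuous_intros)
  then show ?thesis using assms unfolding open_dist by blast
qed

lemma int_mult_gap: "t > 0 \<Longrightarrow> of_int n * t \<le> - t \<or> n = 0 \<or> t \<le> of_int n * t" for n :: int and t :: real
  using mult_right_mono[of 1 "of_int n" t] mult_right_mono[of "of_int n" "- 1" t] by (cases n "0 :: int" rule: linorder_cases) auto

lemma orbit_dist:
  assumes "t > 0" "Y \<in> arc_orbit t S" "Z \<in> arc_orbit t S" "dist Y Z < t" shows "Y = Z"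
proof -
  obtain k l :: int where kl: "Y = (fst S + of_int k * t, snd S + of_int k * t)" "Z = (fst S + of_int l * t, snd S + of_int l * t)"
    using assms(2,3) unfolding arc_orbit_def by blast
  have "\<bar>fst Y - fst Z\<bar> < t" using assms(4) dist_fst_le[of Y Z] by (simp add: dist_real_def)
  then have "\<bar>of_int (k - l) * t\<bar> < t" unfolding kl by (simp add: algebra_simps)
  then have "k - l = 0" using int_mult_gap[OF assms(1), of "k - l"] by linarith
  then show ?thesis using kl by simp
qed

text \<open>At most one point of the orbit lies within t / 2 of \<open>Z\<close>; if it is not
  \<open>Z\<close>, its distance from \<open>Z\<close> serves as the bound.\<close>

lemma orbit_separated:
  assumes t: "t > 0" shows "\<exists>e>0. \<forall>Y\<in>arc_orbit t S. dist Y Z < e \<longrightarrow> Y = Z"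
proof (cases "\<exists>Y\<in>arc_orbit t S. dist Y Z < t / 2 \<and> Y \<noteq> Z")
  case True
  then obtain Y where Y: "Y \<in> arc_orbit t S" "dist Y Z < t / 2" "Y \<noteq> Z" by blast
  have "Y' = Z" if "Y' \<in> arc_orbit t S" "dist Y' Z < dist Y Z" for Y'
  proof -
    have "dist Y' Y < t" using dist_triangle2[of Y' Y Z] that(2) Y(2) by linarith
    then show ?thesis using orbit_dist[OF t that(1) Y(1)] that(2) by simp
  qed
  then show ?thesis using Y(3) by (intro exI[of _ "dist Y Z"]) auto
qed (use t in \<open>auto intro: exI[of _ "t / 2"]\<close>)

text \<open>Crossing is invariant under a common translation, so a translate on one side is traded
  for one on the other.\<close>

lemma orbit_cross:
  "Y \<in> arc_orbit t X \<Longrightarrow> \<exists>Z'. Z' \<in> arc_orbit t Z \<and> (cross Z Y \<longleftrightarrow> cross Z' X)"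
proof -
  assume "Y \<in> arc_orbit t X"
  then obtain k :: int where Y: "Y = (fst X + of_int k * t, snd X + of_int k * t)" unfolding arc_orbit_def by auto
  let ?Z = "(fst Z + of_int (- k) * t, snd Z + of_int (- k) * t)"
  have "?Z \<in> arc_orbit t Z" unfolding arc_orbit_def by (rule range_eqI[of _ _ "- k"]) simp
  moreover have "cross Z Y \<longleftrightarrow> cross ?Z X" unfolding Y cross_def by auto
  ultimately show ?thesis by blast
qed

text \<open>The length is at most \<open>t\<close>, so a translate by a nonzero multiple of
  \<open>t\<close> lies entirely beyond one of the ends.\<close>

lemma orbit_noncrossing:
  assumes t: "t > 0" and X: "X \<in> arc_strip t" and Y: "Y \<in> arc_orbit t X" shows "\<not> cross X Y"
proof
  obtain k :: int where Y: "Y = (fst X + of_int k * t, snd X + of_int k * t)" using Y unfolding arc_orbit_def by auto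
  have X: "fst X < snd X" "snd X \<le> fst X + t" using X unfolding arc_strip_def by auto
  assume "cross X Y"
  then have "0 < of_int k * t \<and> of_int k * t < t \<or> of_int k * t < 0 \<and> - t < of_int k * t"
    using X unfolding Y cross_def fst_conv snd_conv by argo
  then show False using int_mult_gap[OF t, of k] t by - (elim disjE conjE; simp)
qed

text \<open>The combinatorial image of a cluster. \<open>isolated\<close> is discreteness; as
  noncrossing is a closed condition, maximality makes the family closed in the strip, and both
  together give finiteness on bounded parts away from the diagonal.\<close>

locale arcs =
  fixes t :: real and \<Lambda> :: "(real \<times> real) set"
  assumes t: "t > 0"
    and strip: "\<Lambda> \<subseteq> arc_strip t"
    and periodic: "\<And>X Y. X \<in> \<Lambda> \<Longrightarrow> Y \<in> arc_orbit t X \<Longrightarrow> Y \<in> \<Lambda>"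
    and noncrossing: "\<And>X Y. X \<in> \<Lambda> \<Longrightarrow> Y \<in> \<Lambda> \<Longrightarrow> \<not> cross X Y"
    and maximal: "\<And>Z. Z \<in> arc_strip t \<Longrightarrow> (\<And>Y. Y \<in> \<Lambda> \<Longrightarrow> \<not> cross Z Y) \<Longrightarrow> Z \<in> \<Lambda>"
    and isolated: "\<And>Z. Z \<in> \<Lambda> \<Longrightarrow> \<exists>e>0. \<forall>Y\<in>\<Lambda>. dist Y Z < e \<longrightarrow> Y = Z"
begin

lemma stripD: "(x, y) \<in> \<Lambda> \<Longrightarrow> x < y \<and> y \<le> x + t"
  using strip unfolding arc_strip_def by auto

lemma shift: "(x, y) \<in> \<Lambda> \<Longrightarrow> (x + of_int k * t, y + of_int k * t) \<in> \<Lambda>"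
  by (rule periodic) (auto simp: arc_orbit_def)

lemma shift1: "(x, y) \<in> \<Lambda> \<Longrightarrow> (x + t, y + t) \<in> \<Lambda>" "(x, y) \<in> \<Lambda> \<Longrightarrow> (x - t, y - t) \<in> \<Lambda>"
  using shift[of x y 1] shift[of x y "-1"] by simp_all

lemma nc: "(x, y) \<in> \<Lambda> \<Longrightarrow> (v, w) \<in> \<Lambda> \<Longrightarrow> \<not> (x < v \<and> v < y \<and> y < w)"
  using noncrossing[of "(x, y)" "(v, w)"] unfolding cross_def by simp

text \<open>Crossing is an open condition, so an arc that crosses a limit of members crosses nearby
  members as well.\<close>

lemma closed_in_strip:
  assumes "Z \<in> arc_strip t" "\<And>e. e > 0 \<Longrightarrow> \<exists>Y\<in>\<Lambda>. dist Y Z < e"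
  shows "Z \<in> \<Lambda>"
proof (rule maximal[OF assms(1)])
  fix Y assume Y: "Y \<in> \<Lambda>"
  show "\<not> cross Z Y"
  proof
    assume "cross Z Y"
    then obtain e where e: "e > 0" "\<forall>Z'. dist Z' Z < e \<longrightarrow> cross Z' Y" using cross_open by blast
    obtain Z' where "Z' \<in> \<Lambda>" "dist Z' Z < e" using assms(2)[OF e(1)] by auto
    then show False using e(2) noncrossing Y by blast
  qed
qed

text \<open>An infinite part has a limit point by Bolzano-Weierstrass. \<open>K\<close> stays off
  the diagonal, so the limit is an arc of the strip, hence a member, and thus isolated.\<close>

lemma finite_part:
  assumes "closed K" "bounded K" "\<And>x y. (x, y) \<in> K \<Longrightarrow> x < y"
  shows "finite (\<Lambda> \<inter> K)"
proof (rule ccontr)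
  assume inf: "\<not> finite (\<Lambda> \<inter> K)"
  define K' where "K' = K \<inter> {Z. snd Z \<le> fst Z + t}"
  have "closed {Z :: real \<times> real. snd Z \<le> fst Z + t}" by (intro closed_Collect_le continuous_intros)
  then have K': "compact K'" using assms unfolding K'_def compact_eq_bounded_closed by (auto intro: bounded_subset)
  have sub: "\<Lambda> \<inter> K \<subseteq> K'" unfolding K'_def using stripD by auto
  obtain Z where Z: "Z \<in> K'" "Z islimpt (\<Lambda> \<inter> K)"
    using Heine_Borel_imp_Bolzano_Weierstrass[OF K' inf sub] by blast
  have "Z \<in> arc_strip t" using Z(1) assms(3) unfolding K'_def arc_strip_def by (cases Z) auto
  then have ZL: "Z \<in> \<Lambda>" using closed_in_strip Z(2) unfolding islimpt_approachable by blast
  then obtain e where "e > 0" "\<forall>Y\<in>\<Lambda>. dist Y Z < e \<longrightarrow> Y = Z" using isolated by blast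
  then show False using Z(2) unfolding islimpt_approachable by blast
qed

lemma finite_box:
  assumes "v < w" shows "finite (\<Lambda> \<inter> {x..v} \<times> {w..y})"
  by (rule finite_part) (use assms in \<open>auto intro!: closed_Times compact_imp_bounded compact_Times\<close>)

text \<open>Among the finitely many arcs properly inside (a, c) and over a given one, take a
  longest, (v, w). An arc inside (a, c) that passes over its end \<open>v\<close> would cross it or
  be longer, so \<open>v\<close>, or \<open>w\<close> in case v = a, can be joined to both
  \<open>a\<close> and \<open>c\<close>.\<close>

lemma apex:
  assumes ac: "(a, c) \<in> \<Lambda>"
  obtains b where "a < b" "b < c" "(a, b) \<in> \<Lambda>" "(b, c) \<in> \<Lambda>"
proof -
  have l: "a < c" "c \<le> a + t" using stripD ac by auto
  show ?thesis
  proof (cases "\<exists>v w. (v, w) \<in> \<Lambda> \<and> a \<le> v \<and> w \<le> c \<and> (v, w) \<noteq> (a, c)")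
    case False
    \<comment> \<open>Here no member ends strictly between \<open>a\<close> and \<open>c\<close>,
      and any interior point would serve.\<close>
    define b where "b = (a + c) / 2"
    have b: "a < b" "b < c" using l unfolding b_def by (auto simp: field_simps)
    have "(a, b) \<in> \<Lambda>"
    proof (rule maximal)
      fix Y assume Y: "Y \<in> \<Lambda>"
      obtain x y where xy: "Y = (x, y)" by (cases Y)
      show "\<not> cross (a, b) Y"
        using nc[OF ac, of x y] nc[of x y a c] Y ac False b unfolding xy cross_def fst_conv snd_conv
        by (metis less_le_not_le linorder_not_le order.strict_trans prod.inject)
    qed (use l b in \<open>auto simp: arc_strip_def\<close>)
    moreover have "(b, c) \<in> \<Lambda>"
    proof (rule maximal)
      fix Y assume Y: "Y \<in> \<Lambda>"
      obtain x y where xy: "Y = (x, y)" by (cases Y)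
      show "\<not> cross (b, c) Y"
        using nc[OF ac, of x y] nc[of x y a c] Y ac False b unfolding xy cross_def fst_conv snd_conv
        by (metis less_le_not_le linorder_not_le order.strict_trans prod.inject)
    qed (use l b in \<open>auto simp: arc_strip_def\<close>)
    ultimately show ?thesis using that b by blast
  next
    case True
    then obtain v0 w0 where vw0: "(v0, w0) \<in> \<Lambda>" "a \<le> v0" "w0 \<le> c" "(v0, w0) \<noteq> (a, c)" by auto
    \<comment> \<open>The arcs inside (a, c) and over (v0, w0); v0 < w0 keeps the box off the
      diagonal.\<close>
    define W where "W = \<Lambda> \<inter> {a..v0} \<times> {w0..c} - {(a, c)}"
    have "finite W" unfolding W_def using finite_box[of v0 w0 a c] stripD[OF vw0(1)] by auto
    moreover have "(v0, w0) \<in> W" unfolding W_def using vw0 by auto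
    ultimately obtain Z where Z: "Z \<in> W" "\<And>Y. Y \<in> W \<Longrightarrow> snd Y - fst Y \<le> snd Z - fst Z"
      by (rule finite_max_ex[where f = "\<lambda>Y. snd Y - fst Y"]) auto
    obtain v w where vw: "Z = (v, w)" by (cases Z)
    have vwL: "(v, w) \<in> \<Lambda>" "a \<le> v" "v \<le> v0" "w0 \<le> w" "w \<le> c" "(v, w) \<noteq> (a, c)" using Z(1) unfolding vw W_def by auto
    have v0w0: "v0 < w0" using stripD vw0(1) by auto
    have mx: "\<not> (x \<le> v \<and> w \<le> y \<and> (x, y) \<noteq> (v, w) \<and> a \<le> x \<and> y \<le> c \<and> (x, y) \<noteq> (a, c))" if "(x, y) \<in> \<Lambda>" for x y
    proof
      assume *: "x \<le> v \<and> w \<le> y \<and> (x, y) \<noteq> (v, w) \<and> a \<le> x \<and> y \<le> c \<and> (x, y) \<noteq> (a, c)"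
      then have "(x, y) \<in> W" using vwL that unfolding W_def by auto
      then have "y - x \<le> w - v" using Z(2)[of "(x, y)"] unfolding vw by simp
      then show False using * by auto
    qed
    show ?thesis
    proof (cases "a < v")
      case True
      have "(a, v) \<in> \<Lambda>"
      proof (rule maximal)
        fix Y assume Y: "Y \<in> \<Lambda>"
        obtain x y where xy: "Y = (x, y)" by (cases Y)
        have Y': "(x, y) \<in> \<Lambda>" using Y xy by simp
        show "\<not> cross (a, v) Y"
          using nc[OF ac Y'] nc[OF Y' ac] nc[OF Y' vwL(1)] nc[OF vwL(1) Y'] mx[OF Y'] True vwL v0w0
          unfolding xy cross_def fst_conv snd_conv by auto
      qed (use l vwL True v0w0 in \<open>auto simp: arc_strip_def\<close>)
      moreover have "(v, c) \<in> \<Lambda>"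
      proof (rule maximal)
        fix Y assume Y: "Y \<in> \<Lambda>"
        obtain x y where xy: "Y = (x, y)" by (cases Y)
        have Y': "(x, y) \<in> \<Lambda>" using Y xy by simp
        show "\<not> cross (v, c) Y"
          using nc[OF ac Y'] nc[OF Y' ac] nc[OF Y' vwL(1)] nc[OF vwL(1) Y'] mx[OF Y'] True vwL v0w0
          unfolding xy cross_def fst_conv snd_conv by auto
      qed (use l vwL True v0w0 in \<open>auto simp: arc_strip_def\<close>)
      ultimately show ?thesis using that[of v] True vwL v0w0 by auto
    next
      case False
      then have va: "v = a" "w < c" using vwL by auto
      have "(w, c) \<in> \<Lambda>"
      proof (rule maximal)
        fix Y assume Y: "Y \<in> \<Lambda>"
        obtain x y where xy: "Y = (x, y)" by (cases Y)
        have Y': "(x, y) \<in> \<Lambda>" using Y xy by simp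
        show "\<not> cross (w, c) Y"
          using nc[OF ac Y'] nc[OF Y' ac] nc[OF Y' vwL(1)] nc[OF vwL(1) Y'] mx[OF Y'] va vwL v0w0
          unfolding xy cross_def fst_conv snd_conv by auto
      qed (use l vwL va v0w0 in \<open>auto simp: arc_strip_def\<close>)
      then show ?thesis using that[of w] va vwL v0w0 by auto
    qed
  qed
qed

text \<open>Without such an arc, consider a longest member (a, b) over a given one: no member passes
  over its end \<open>a\<close>, and therefore (a, a + t) crosses no member.\<close>

lemma loop:
  obtains x where "(x, x + t) \<in> \<Lambda>"
proof (rule ccontr)
  assume "\<not> thesis"
  then have no: "(x, x + t) \<notin> \<Lambda>" for x using that by blast
  have "\<Lambda> \<noteq> {}" using maximal[of "(0, t)"] no[of 0] t unfolding arc_strip_def by auto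
  then obtain a0 b0 where ab0: "(a0, b0) \<in> \<Lambda>" by auto
  \<comment> \<open>An arc over (a0, b0) has length at most \<open>t\<close>, so its ends lie in
    this box.\<close>
  define W where "W = \<Lambda> \<inter> {b0 - t..a0} \<times> {b0..a0 + t}"
  have "finite W" unfolding W_def using finite_box[of a0 b0] stripD[OF ab0] by auto
  moreover have "(a0, b0) \<in> W" unfolding W_def using ab0 stripD[OF ab0] by auto
  ultimately obtain Z where Z: "Z \<in> W" "\<And>Y. Y \<in> W \<Longrightarrow> snd Y - fst Y \<le> snd Z - fst Z"
    by (rule finite_max_ex[where f = "\<lambda>Y. snd Y - fst Y"]) auto
  obtain a b where ab: "Z = (a, b)" by (cases Z)
  have abL: "(a, b) \<in> \<Lambda>" "a \<le> a0" "b0 \<le> b" using Z(1) unfolding ab W_def by auto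
  have "b < a + t" using stripD[OF abL(1)] no[of a] abL(1) by (metis order_le_less)
  have *: "\<not> (x < a \<and> a < y)" if Y: "(x, y) \<in> \<Lambda>" for x y
  proof
    assume xy: "x < a \<and> a < y"
    then have "b \<le> y" using nc[OF Y abL(1)] by auto
    then have "(x, y) \<in> W" using xy Y abL stripD[OF Y] unfolding W_def by auto
    then show False using Z(2)[of "(x, y)"] xy \<open>b \<le> y\<close> unfolding ab by simp
  qed
  have "(a, a + t) \<in> \<Lambda>"
  proof (rule maximal)
    fix Y assume Y: "Y \<in> \<Lambda>"
    obtain x y where xy: "Y = (x, y)" by (cases Y)
    show "\<not> cross (a, a + t) Y"
      using *[of x y] *[of "x - t" "y - t"] shift1(2)[of x y] Y unfolding xy cross_def by auto
  qed (use t in \<open>auto simp: arc_strip_def\<close>)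
  then show False using no by blast
qed

text \<open>A translate of a loop passes over (a, c), so there is a shortest member properly over
  it. Its apex is not strictly between \<open>a\<close> and \<open>c\<close>; hence one of its sides
  still covers (a, c), and by minimality equals it.\<close>

lemma outer:
  assumes ac: "(a, c) \<in> \<Lambda>" and l: "c < a + t"
  shows "(\<exists>d. c < d \<and> (a, d) \<in> \<Lambda> \<and> (c, d) \<in> \<Lambda>) \<or> (\<exists>d. d < a \<and> (d, c) \<in> \<Lambda> \<and> (d, a) \<in> \<Lambda>)"
proof -
  have a_c: "a < c" using stripD[OF ac] by auto
  obtain x0 where x0: "(x0, x0 + t) \<in> \<Lambda>" by (rule loop)
  \<comment> \<open>The translate of the loop that starts last among those starting at or before
    \<open>a\<close>.\<close>
  define k where "k = \<lfloor>(a - x0) / t\<rfloor>"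
  define q where "q = x0 + of_int k * t"
  have qL: "(q, q + t) \<in> \<Lambda>" using shift[OF x0, of k] unfolding q_def by (simp add: ac_simps)
  have "of_int k \<le> (a - x0) / t" "(a - x0) / t < of_int k + 1" unfolding k_def by linarith+
  then have q: "q \<le> a" "a < q + t" using t unfolding q_def by (auto simp: field_simps)
  then have qc: "c \<le> q + t" using nc[OF qL ac] l by (cases "q = a") auto
  define W where "W = \<Lambda> \<inter> {c - t..a} \<times> {c..a + t} - {(a, c)}"
  have "finite W" unfolding W_def using finite_box[of a c] a_c by auto
  moreover have "(q, q + t) \<in> W" unfolding W_def using qL q qc l by auto
  ultimately obtain Z where Z: "Z \<in> W" "\<And>Y. Y \<in> W \<Longrightarrow> fst Y - snd Y \<le> fst Z - snd Z"
    by (rule finite_max_ex[where f = "\<lambda>Y. fst Y - snd Y"]) auto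
  obtain v w where vw: "Z = (v, w)" by (cases Z)
  have vwL: "(v, w) \<in> \<Lambda>" "v \<le> a" "c \<le> w" "(v, w) \<noteq> (a, c)" using Z(1) unfolding vw W_def by auto
  have mn: "(x, y) = (a, c)" if "(x, y) \<in> \<Lambda>" "x \<le> a" "c \<le> y" "y - x < w - v" for x y
  proof (rule ccontr)
    assume "(x, y) \<noteq> (a, c)"
    then have "(x, y) \<in> W" using that stripD[OF that(1)] unfolding W_def by auto
    then show False using Z(2)[of "(x, y)"] that(4) unfolding vw by simp
  qed
  obtain b where b: "v < b" "b < w" "(v, b) \<in> \<Lambda>" "(b, w) \<in> \<Lambda>" using apex[OF vwL(1)] .
  have "b \<le> a \<or> c \<le> b"
    using nc[OF b(3) ac] nc[OF ac b(4)] vwL b by (cases "v = a"; cases "w = c") auto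
  then show ?thesis
  proof
    assume "c \<le> b"
    then have "(v, b) = (a, c)" using mn[OF b(3)] vwL b by simp
    then show ?thesis using b vwL by auto
  next
    assume "b \<le> a"
    then have "(b, w) = (a, c)" using mn[OF b(4)] vwL b by simp
    then show ?thesis using b vwL by auto
  qed
qed

text \<open>The quadrilateral with diagonal (a, c): \<open>b\<close> is the apex inside, and the
  opposite vertex lies to the right of \<open>c\<close>, to the left of \<open>a\<close>, or, for a
  loop, is a translate of \<open>b\<close>. \<open>S\<close> is the other diagonal.\<close>

definition flip_data :: "real \<Rightarrow> real \<Rightarrow> real \<Rightarrow> real \<times> real \<Rightarrow> bool" where
  "flip_data a b c S \<longleftrightarrow> a < b \<and> b < c \<and> (a, c) \<in> \<Lambda> \<and> (a, b) \<in> \<Lambda> \<and> (b, c) \<in> \<Lambda> \<and>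
     ((\<exists>d. c < a + t \<and> c < d \<and> (a, d) \<in> \<Lambda> \<and> (c, d) \<in> \<Lambda> \<and> S = (b, d)) \<or>
      (\<exists>d. c < a + t \<and> d < a \<and> (d, c) \<in> \<Lambda> \<and> (d, a) \<in> \<Lambda> \<and> S = (d, b)) \<or>
      (c = a + t \<and> S = (b, b + t)))"

lemma flip_data_ex:
  assumes "(a, c) \<in> \<Lambda>" obtains b S where "flip_data a b c S"
proof -
  obtain b where b: "a < b" "b < c" "(a, b) \<in> \<Lambda>" "(b, c) \<in> \<Lambda>" using apex[OF assms] .
  have "c < a + t \<or> c = a + t" using stripD[OF assms] by auto
  then show ?thesis
    using that outer[OF assms] b assms unfolding flip_data_def by blast
qed

lemma shorter_not_orbit:
  "Y \<in> arc_orbit t (a, c) \<Longrightarrow> snd Y - fst Y = c - a"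
  unfolding arc_orbit_def by auto

lemma adjacent_not_orbit:
  assumes "(c, d) \<in> arc_orbit t (a, c)" "a < c" "c < a + t" shows False
proof -
  obtain k :: int where "c = a + of_int k * t" using assms(1) unfolding arc_orbit_def by auto
  then have k: "0 < of_int k * t" "of_int k * t < 1 * t" using assms by auto
  then have "0 < k" using t by (simp add: zero_less_mult_iff)
  moreover have "k < 1" using k(2) t by (metis mult_less_cancel_right_pos of_int_less_1_iff)
  ultimately show False by simp
qed

context
  fixes a b c S
  assumes fd: "flip_data a b c S"
begin

lemma fdD: "a < b" "b < c" "(a, c) \<in> \<Lambda>" "(a, b) \<in> \<Lambda>" "(b, c) \<in> \<Lambda>" "c \<le> a + t"
  using fd stripD unfolding flip_data_def by auto

lemma side_not_orbit: "(a, b) \<notin> arc_orbit t (a, c)" "(b, c) \<notin> arc_orbit t (a, c)"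
  using shorter_not_orbit fdD by fastforce+

lemma flip_strip: "S \<in> arc_strip t"
  using fd stripD unfolding flip_data_def arc_strip_def by fastforce

lemma flip_cross: "cross S (a, c)"
  using fd stripD t unfolding flip_data_def cross_def by auto

text \<open>Crossing the diagonal but none of the four sides leaves only the segment joining the
  other two vertices. The sides are first seen not to be translates of (a, c), so that the
  hypothesis applies to them.\<close>

lemma flip_unique:
  assumes Z: "(x, y) \<in> arc_strip t" and n: "\<And>Y. Y \<in> \<Lambda> \<Longrightarrow> Y \<notin> arc_orbit t (a, c) \<Longrightarrow> \<not> cross (x, y) Y"
    and cr: "cross (x, y) (a, c)"
  shows "(x, y) \<in> arc_orbit t S"
proof -
  note s1 = n[OF fdD(4) side_not_orbit(1)] and s2 = n[OF fdD(5) side_not_orbit(2)]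
  have xy: "x < y" "y \<le> x + t" using Z unfolding arc_strip_def by auto
  from fd consider (1) d where "c < a + t" "c < d" "(a, d) \<in> \<Lambda>" "(c, d) \<in> \<Lambda>" "S = (b, d)"
    | (2) d where "c < a + t" "d < a" "(d, c) \<in> \<Lambda>" "(d, a) \<in> \<Lambda>" "S = (d, b)"
    | (3) "c = a + t" "S = (b, b + t)" unfolding flip_data_def by blast
  then show ?thesis
  proof cases
    case 1
    have "(a, d) \<notin> arc_orbit t (a, c)" using shorter_not_orbit[of "(a, d)" a c] 1 by auto
    then have s3: "\<not> cross (x, y) (a, d)" using n 1 by blast
    have "(c, d) \<notin> arc_orbit t (a, c)" using adjacent_not_orbit[of c d a] 1 fdD by auto
    then have s4: "\<not> cross (x, y) (c, d)" using n 1 by blast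
    have "x = b \<and> y = d" using s1 s2 s3 s4 cr fdD(1,2) xy 1(2) unfolding cross_def fst_conv snd_conv by argo
    then show ?thesis using 1 by simp
  next
    case 2
    have "(d, c) \<notin> arc_orbit t (a, c)" using shorter_not_orbit[of "(d, c)" a c] 2 by auto
    then have s3: "\<not> cross (x, y) (d, c)" using n 2 by blast
    have "(d, a) \<notin> arc_orbit t (a, c)"
    proof
      assume "(d, a) \<in> arc_orbit t (a, c)"
      then obtain k :: int where "a = c + of_int k * t" unfolding arc_orbit_def by auto
      then have "(c, c + (c - a)) \<in> arc_orbit t (a, c)"
        unfolding arc_orbit_def by (intro range_eqI[of _ _ "- k"]) auto
      then show False using adjacent_not_orbit 2 fdD by force
    qed
    then have s4: "\<not> cross (x, y) (d, a)" using n 2 by blast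
    have "x = d \<and> y = b" using s1 s2 s3 s4 cr fdD(1,2) xy 2(2) unfolding cross_def fst_conv snd_conv by argo
    then show ?thesis using 2 by simp
  next
    case 3
    \<comment> \<open>For a loop the two outer sides are translates of the inner ones: (b - t, a)
      and (c, b + t).\<close>
    have o: "(v - t, w - t) \<notin> arc_orbit t (a, c)" "(v + t, w + t) \<notin> arc_orbit t (a, c)" if "w - v < c - a" for v w
      using that shorter_not_orbit[of "(v - t, w - t)" a c] shorter_not_orbit[of "(v + t, w + t)" a c] by auto
    have s3: "\<not> cross (x, y) (b - t, c - t)" using n[OF shift1(2)[OF fdD(5)] o(1)] fdD by auto
    have s4: "\<not> cross (x, y) (a + t, b + t)" using n[OF shift1(1)[OF fdD(4)] o(2)] fdD by auto
    have ct: "c - t = a" "a + t = c" using 3 by auto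
    have i: "b - t < a" "c < b + t" using fdD 3 by auto
    have w: "x \<le> b \<or> y \<noteq> b" "x = b \<Longrightarrow> y \<le> b + t" "y = b \<Longrightarrow> b - t \<le> x" using xy by auto
    \<comment> \<open>Both (b, b + t) and its translate (b - t, b) cross the loop.\<close>
    have "(x = b \<and> y = b + t) \<or> (x = b - t \<and> y = b)"
      using s1 s2 s3 s4 cr fdD(1,2) xy(1) w i unfolding cross_def fst_conv snd_conv ct by argo
    then show ?thesis
    proof
      assume "x = b - t \<and> y = b"
      then show ?thesis using 3 unfolding arc_orbit_def by (intro range_eqI[of _ _ "-1"]) auto
    qed (use 3 in auto)
  qed
qed

text \<open>Inside the quadrilateral an arc that meets the new diagonal and crosses no side can only
  be the old diagonal.\<close>

lemma flip_noncrossing: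
  assumes Y: "(x, y) \<in> \<Lambda>" and o: "(x, y) \<notin> arc_orbit t (a, c)"
  shows "\<not> cross S (x, y)"
proof -
  have ne: "\<not> (x = a \<and> y = c)" using o by (metis arc_orbit_self)
  note n1 = nc[OF Y fdD(4)] nc[OF fdD(4) Y] nc[OF Y fdD(5)] nc[OF fdD(5) Y] nc[OF Y fdD(3)] nc[OF fdD(3) Y]
  from fd consider (1) d where "c < a + t" "c < d" "(a, d) \<in> \<Lambda>" "(c, d) \<in> \<Lambda>" "S = (b, d)"
    | (2) d where "c < a + t" "d < a" "(d, c) \<in> \<Lambda>" "(d, a) \<in> \<Lambda>" "S = (d, b)"
    | (3) "c = a + t" "S = (b, b + t)" unfolding flip_data_def by blast
  then show ?thesis
  proof cases
    case 1
    note n2 = nc[OF Y 1(3)] nc[OF 1(3) Y] nc[OF Y 1(4)] nc[OF 1(4) Y]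
    show ?thesis using n1 n2 ne fdD(1,2) 1(2) unfolding 1(5) cross_def fst_conv snd_conv by argo
  next
    case 2
    note n2 = nc[OF Y 2(3)] nc[OF 2(3) Y] nc[OF Y 2(4)] nc[OF 2(4) Y]
    show ?thesis using n1 n2 ne fdD(1,2) 2(2) unfolding 2(5) cross_def fst_conv snd_conv by argo
  next
    case 3
    have ct: "a + t = c" using 3 by simp
    note s1 = shift1(1)[OF fdD(4), unfolded ct] and s2 = shift1(1)[OF fdD(5)]
    note n2 = nc[OF Y s1] nc[OF s1 Y] nc[OF Y s2] nc[OF s2 Y]
    \<comment> \<open>The arc (b, b + t) also crosses the next translate of the loop, which is
      excluded by \<open>o\<close>.\<close>
    have o': "\<not> (x = c \<and> y = c + t)"
    proof
      assume "x = c \<and> y = c + t"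
      then have "(x, y) \<in> arc_orbit t (a, c)" using 3 unfolding arc_orbit_def by (intro range_eqI[of _ _ 1]) auto
      then show False using o by simp
    qed
    have w: "x = c \<Longrightarrow> y \<le> c + t" "y = c \<Longrightarrow> a \<le> x" "b + t < c + t" "c < b + t" using stripD[OF Y] fdD 3 by auto
    show ?thesis using n1 n2 ne o' w fdD(1,2) unfolding 3(2) cross_def fst_conv snd_conv by argo
  qed
qed

end

text \<open>Reduction to \<open>flip_unique\<close>: the translate of (a, c) that \<open>Z\<close>
  crosses is moved back to (a, c).\<close>

lemma flip_unique':
  assumes fd: "flip_data a b c S" and Z: "Z \<in> arc_strip t"
    and n: "\<And>Y. Y \<in> \<Lambda> \<Longrightarrow> Y \<notin> arc_orbit t (a, c) \<Longrightarrow> \<not> cross Z Y"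
  shows "Z \<in> \<Lambda> \<or> Z \<in> arc_orbit t S"
proof (cases "\<exists>Y\<in>arc_orbit t (a, c). cross Z Y")
  case False
  then have "Z \<in> \<Lambda>" using maximal[OF Z] n by blast
  then show ?thesis ..
next
  case True
  then obtain Y where Y: "Y \<in> arc_orbit t (a, c)" "cross Z Y" by blast
  then obtain k :: int where k: "Y = (a + of_int k * t, c + of_int k * t)" unfolding arc_orbit_def by auto
  define x y where "x = fst Z - of_int k * t" and "y = snd Z - of_int k * t"
  have Zxy: "Z = (x + of_int k * t, y + of_int k * t)" unfolding x_def y_def by simp
  have "(x, y) \<in> arc_orbit t S"
  proof (rule flip_unique[OF fd])
    show "(x, y) \<in> arc_strip t" using Z unfolding Zxy arc_strip_def by simp
    show "cross (x, y) (a, c)" using Y(2) unfolding Zxy k cross_def by simp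
    fix X assume X: "X \<in> \<Lambda>" "X \<notin> arc_orbit t (a, c)"
    let ?X = "(fst X + of_int k * t, snd X + of_int k * t)"
    have o: "?X \<in> arc_orbit t X" unfolding arc_orbit_def by auto
    then have "?X \<in> \<Lambda>" "?X \<notin> arc_orbit t (a, c)"
      using X periodic arc_orbit_sym arc_orbit_trans by blast+
    then show "\<not> cross (x, y) X" using n[of ?X] unfolding Zxy cross_def by simp
  qed
  moreover have "Z \<in> arc_orbit t (x, y)" unfolding Zxy arc_orbit_def by auto
  ultimately show ?thesis using arc_orbit_trans by blast
qed

lemma flip_noncrossing':
  assumes fd: "flip_data a b c S" and Y: "Y \<in> \<Lambda>" "Y \<notin> arc_orbit t (a, c)" and Z: "Z \<in> arc_orbit t S"
  shows "\<not> cross Z Y"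
proof -
  obtain Y' where Y': "Y' \<in> arc_orbit t Y" "cross Y Z \<longleftrightarrow> cross Y' S" using orbit_cross[OF Z, of Y] by blast
  have "Y' \<in> \<Lambda>" "Y' \<notin> arc_orbit t (a, c)" using Y Y'(1) periodic arc_orbit_sym arc_orbit_trans by blast+
  then show ?thesis using flip_noncrossing[OF fd, of "fst Y'" "snd Y'"] Y'(2) cross_sym by (metis prod.collapse)
qed

text \<open>Since the family is closed in the strip, isolation holds at every arc of the strip,
  member or not.\<close>

lemma separated:
  assumes "Z \<in> arc_strip t" shows "\<exists>e>0. \<forall>Y\<in>\<Lambda>. dist Y Z < e \<longrightarrow> Y = Z"
proof (rule ccontr)
  assume *: "\<not> ?thesis"
  then have "Z \<in> \<Lambda>" using closed_in_strip[OF assms] by blast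
  then show False using isolated * by blast
qed

text \<open>Maximality: the removed orbit cannot return because \<open>S\<close> crosses (a, c), and
  by \<open>flip_unique'\<close> any other arc that crosses nothing is an old member or a translate
  of \<open>S\<close>.\<close>

lemma flip_arcs:
  assumes fd: "flip_data a b c S"
  shows "arcs t (\<Lambda> - arc_orbit t (a, c) \<union> arc_orbit t S)"
proof (unfold_locales, goal_cases)
  case 1 then show ?case by (rule t)
next
  case 2
  have "arc_orbit t S \<subseteq> arc_strip t" using flip_strip[OF fd] by (auto simp: arc_orbit_def arc_strip_def)
  then show ?case using strip by auto
next
  case (3 X Y)
  then show ?case using periodic arc_orbit_sym arc_orbit_trans by blast
next
  case (4 X Y)
  have *: "\<not> cross V W" if V: "V \<in> arc_orbit t S" and W: "W \<in> arc_orbit t S" for V W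
  proof -
    have "V \<in> arc_strip t" using V flip_strip[OF fd] by (auto simp: arc_orbit_def arc_strip_def)
    moreover have "W \<in> arc_orbit t V" using V W arc_orbit_sym arc_orbit_trans by blast
    ultimately show ?thesis by (rule orbit_noncrossing[OF t])
  qed
  from 4 show ?case using * noncrossing flip_noncrossing'[OF fd] cross_sym by blast
next
  case (5 Z)
  have "Z \<in> \<Lambda> \<or> Z \<in> arc_orbit t S" using flip_unique'[OF fd 5(1)] 5(2) by blast
  moreover have "Z \<notin> arc_orbit t (a, c)"
  proof
    assume Z: "Z \<in> arc_orbit t (a, c)"
    obtain W where "W \<in> arc_orbit t S" "cross W Z"
    proof -
      have "(a, c) \<in> arc_orbit t Z" using Z by (rule arc_orbit_sym)
      then obtain W where "W \<in> arc_orbit t S" "cross S (a, c) \<longleftrightarrow> cross W Z" using orbit_cross by blast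
      then show thesis using that flip_cross[OF fd] by blast
    qed
    then show False using 5(2)[of W] cross_sym by blast
  qed
  ultimately show ?case by blast
next
  case (6 Z)
  have Zs: "Z \<in> arc_strip t" using 6 strip flip_strip[OF fd] by (auto simp: arc_orbit_def arc_strip_def)
  then obtain e1 where e1: "e1 > 0" "\<forall>Y\<in>\<Lambda>. dist Y Z < e1 \<longrightarrow> Y = Z" using separated by blast
  obtain e2 where e2: "e2 > 0" "\<forall>Y\<in>arc_orbit t S. dist Y Z < e2 \<longrightarrow> Y = Z" using orbit_separated t by blast
  show ?case using e1 e2 by (intro exI[of _ "min e1 e2"]) auto
qed

end

section \<open>Almost rigid objects and compatibility\<close>

text \<open>For t = \<theta>, the arcs that represent the same object as (a, b): its rotations and
  those of its flip (b, a + 2 pi). Higher powers of \<sigma> add nothing because 2 pi = p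
  \<theta>.\<close>

definition olifts :: "real \<Rightarrow> real \<Rightarrow> real \<Rightarrow> (real \<times> real) set" where
  "olifts t a b = arc_orbit t (a, b) \<union> arc_orbit t (b, a + 2 * pi)"

text \<open>The rectangle of \<open>nonnull_E_iff\<close>: the basic morphism from \<open>X\<close>
  to the point with lift \<open>V\<close> is stably nonzero.\<close>

definition hits :: "real \<times> real \<Rightarrow> real \<times> real \<Rightarrow> bool" where
  "hits X V \<longleftrightarrow> fst X \<le> fst V \<and> fst V < snd X \<and> snd X \<le> snd V \<and> snd V < fst X + 2 * pi"

lemma oliftsI: "(a + of_int n * t, b + of_int n * t) \<in> olifts t a b" "(b + of_int n * t, a + 2 * pi + of_int n * t) \<in> olifts t a b"
  unfolding olifts_def arc_orbit_def by auto

lemma oliftsE: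
  assumes "V \<in> olifts t a b"
  obtains n :: int where "V = (a + of_int n * t, b + of_int n * t)" | n :: int where "V = (b + of_int n * t, a + 2 * pi + of_int n * t)"
  using assms unfolding olifts_def arc_orbit_def by auto

text \<open>Either the shrunk, the enlarged, a shifted or the original arc avoids \<open>(x, y)\<close>, depending
  on whether a translate of \<open>(a, b)\<close> contains \<open>(x, y)\<close>.\<close>

lemma perturb:
  assumes t: "t > 0" and X: "(x, y) \<in> arc_strip t" and AB: "(a, b) \<in> arc_strip t"
    and nc: "\<And>Z. Z \<in> arc_orbit t (a, b) \<Longrightarrow> \<not> cross (x, y) Z"
  obtains v w \<sigma> \<tau> e where "(v, w) \<in> arc_orbit t (a, b)" "e > 0"
    "\<And>\<epsilon>. \<lbrakk>0 < \<epsilon>; \<epsilon> < e\<rbrakk> \<Longrightarrow> v + \<sigma> * \<epsilon> \<le> w + \<tau> * \<epsilon> \<and> w + \<tau> * \<epsilon> \<le> v + \<sigma> * \<epsilon> + 2 * t"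
    "\<And>\<epsilon> n :: int. \<lbrakk>0 < \<epsilon>; \<epsilon> < e; x \<le> v + \<sigma> * \<epsilon> + of_int n * t; v + \<sigma> * \<epsilon> + of_int n * t < y; y \<le> w + \<tau> * \<epsilon> + of_int n * t\<rbrakk> \<Longrightarrow> False"
    "\<And>\<epsilon> n :: int. \<lbrakk>0 < \<epsilon>; \<epsilon> < e; v + \<sigma> * \<epsilon> + of_int n * t < x; x \<le> w + \<tau> * \<epsilon> + of_int n * t; w + \<tau> * \<epsilon> + of_int n * t < y\<rbrakk> \<Longrightarrow> False"
proof (cases "\<exists>v w. (v, w) \<in> arc_orbit t (a, b) \<and> v \<le> x \<and> y \<le> w \<and> (v, w) \<noteq> (x, y)")
  case False
  have nc': "\<not> cross (x, y) (a + of_int n * t, b + of_int n * t)" for n :: int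
    by (rule nc) (auto simp: arc_orbit_def)
  have nn: "\<not> (a + of_int n * t \<le> x \<and> y \<le> b + of_int n * t \<and> \<not> (a + of_int n * t = x \<and> b + of_int n * t = y))" for n :: int
    using False by (auto simp: arc_orbit_def)
  note AB' = AB[unfolded arc_strip_def, simplified] and X' = X[unfolded arc_strip_def, simplified]
  show ?thesis
  \<comment> \<open>Shrinking at both ends; it works because no translate contains (x, y)
    properly.\<close>
  proof (rule that[of a b "(b - a) / 2" 1 "-1"])
    fix \<epsilon> :: real and n :: int assume e: "0 < \<epsilon>" "\<epsilon> < (b - a) / 2"
    show False if "x \<le> a + 1 * \<epsilon> + of_int n * t" "a + 1 * \<epsilon> + of_int n * t < y" "y \<le> b + - 1 * \<epsilon> + of_int n * t"
      using that e nc'[of n] nn[of n] unfolding cross_def fst_conv snd_conv by argo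
    show False if "a + 1 * \<epsilon> + of_int n * t < x" "x \<le> b + - 1 * \<epsilon> + of_int n * t" "b + - 1 * \<epsilon> + of_int n * t < y"
      using that e nc'[of n] nn[of n] unfolding cross_def fst_conv snd_conv by argo
  qed (use AB' in \<open>auto simp: field_simps\<close>)
next
  case True
  then obtain v w where vw: "(v, w) \<in> arc_orbit t (a, b)" "v \<le> x" "y \<le> w" "(v, w) \<noteq> (x, y)" by blast
  have l: "w - v = b - a" using vw(1) unfolding arc_orbit_def by auto
  note AB' = AB[unfolded arc_strip_def, simplified] and X' = X[unfolded arc_strip_def, simplified]
  have g: "of_int n * t \<le> - t \<or> of_int n * t = 0 \<or> t \<le> of_int n * t" for n :: int using int_mult_gap[OF t, of n] by auto
  consider "b - a < t" | "b - a = t" "v = x" | "b - a = t" "v < x" using AB' vw by linarith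
  then show ?thesis
  proof cases
    case 1
    show ?thesis
    \<comment> \<open>A containing translate shorter than \<open>t\<close> is enlarged at both ends,
      and stays shorter than \<open>t\<close>.\<close>
    proof (rule that[of v w "(t - (b - a)) / 2" "-1" 1])
      fix \<epsilon> :: real and n :: int assume "0 < \<epsilon>" "\<epsilon> < (t - (b - a)) / 2"
      then have e: "0 < \<epsilon>" "\<epsilon> + \<epsilon> < t - (b - a)" by auto
      show False if "x \<le> v + - 1 * \<epsilon> + of_int n * t" "v + - 1 * \<epsilon> + of_int n * t < y" "y \<le> w + 1 * \<epsilon> + of_int n * t"
        using that e g[of n] vw(2,3) l X' by - (elim disjE conjE; linarith)
      show False if "v + - 1 * \<epsilon> + of_int n * t < x" "x \<le> w + 1 * \<epsilon> + of_int n * t" "w + 1 * \<epsilon> + of_int n * t < y"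
        using that e g[of n] vw(2,3) l X' by - (elim disjE conjE; linarith)
    qed (use AB' vw l 1 t in \<open>auto simp: field_simps\<close>)
  next
    case 2
    have yw: "y < w" using 2 vw by auto
    show ?thesis
    \<comment> \<open>A loop that starts together with (x, y) is shifted to the left.\<close>
    proof (rule that[of v w "w - y" "-1" "-1"])
      fix \<epsilon> :: real and n :: int assume e: "0 < \<epsilon>" "\<epsilon> < w - y"
      show False if "x \<le> v + - 1 * \<epsilon> + of_int n * t" "v + - 1 * \<epsilon> + of_int n * t < y" "y \<le> w + - 1 * \<epsilon> + of_int n * t"
        using that e g[of n] vw(2,3) l X' 2 by - (elim disjE conjE; linarith)
      show False if "v + - 1 * \<epsilon> + of_int n * t < x" "x \<le> w + - 1 * \<epsilon> + of_int n * t" "w + - 1 * \<epsilon> + of_int n * t < y"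
        using that e g[of n] vw(2,3) l X' 2 by - (elim disjE conjE; linarith)
    qed (use AB' vw l 2 yw t in \<open>auto simp: field_simps\<close>)
  next
    case 3
    show ?thesis
    \<comment> \<open>A loop that starts before \<open>x\<close> works without perturbation.\<close>
    proof (rule that[of v w 1 0 0])
      fix \<epsilon> :: real and n :: int
      show False if "x \<le> v + 0 * \<epsilon> + of_int n * t" "v + 0 * \<epsilon> + of_int n * t < y" "y \<le> w + 0 * \<epsilon> + of_int n * t"
        using that g[of n] vw(2,3) l X' 3 by - (elim disjE conjE; linarith)
      show False if "v + 0 * \<epsilon> + of_int n * t < x" "x \<le> w + 0 * \<epsilon> + of_int n * t" "w + 0 * \<epsilon> + of_int n * t < y"
        using that g[of n] vw(2,3) l X' 3 by - (elim disjE conjE; linarith)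
    qed (use AB' vw l 3 t in \<open>auto simp: field_simps\<close>)
  qed
qed

text \<open>The offset 2 keeps all terms strictly below \<open>d\<close>.\<close>

lemma null_sequence:
  "0 < d \<Longrightarrow> 0 < d / of_nat (n + 2) \<and> d / of_nat (n + 2) < d" "(\<lambda>n. d / of_nat (n + 2)) \<longlonglongrightarrow> 0" for d :: real
  using divide_strict_left_mono[of 1 "of_nat (n + 2)" d] LIMSEQ_ignore_initial_segment[OF lim_const_over_n[of d], of 2]
  by auto

locale cluster_category = equivariant u E p for u :: "'r::idom" and E p +
  assumes p3: "p \<ge> 3" and p_odd: "odd p"
begin

abbreviation "t \<equiv> theta p"
abbreviation "SEp x y \<equiv> SE p x y :: 'r eqobj"

lemma t_pos: "t > 0" and p_t: "of_nat p * t = 2 * pi" and t_lt: "2 * t < 2 * pi"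
proof -
  show 1: "t > 0" "of_nat p * t = 2 * pi" using p_pos unfolding theta_def by auto
  have "3 * t \<le> of_nat p * t" using p3 1(1) by (intro mult_right_mono) auto
  then show "2 * t < 2 * pi" using 1 by linarith
qed

lemma DD_refl: "X \<in> Obj DD \<Longrightarrow> iso_obj DD X X"
  and DD_sym: "iso_obj DD X Y \<Longrightarrow> iso_obj DD Y X"
  and DD_trans: "iso_obj DD X Y \<Longrightarrow> iso_obj DD Y Z \<Longrightarrow> iso_obj DD X Z"
  unfolding DD_eq by (rule QF.D.iso_obj_refl QF.D.iso_obj_sym QF.D.iso_obj_trans, assumption+)+

text \<open>2 pi = p \<theta> turns the even powers of \<sigma> into rotations, and the odd ones
  into rotations of the flip.\<close>

lemma elift_olift: "elift k (a + of_int g * t) (b + of_int g * t) \<in> olifts t a b"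
proof (cases "even k")
  case True
  then obtain m where m: "k = 2 * m" by auto
  have "elift k (a + of_int g * t) (b + of_int g * t) = (a + of_int (g + m * int p) * t, b + of_int (g + m * int p) * t)"
    using p_t unfolding elift_def m by (simp add: algebra_simps)
  then show ?thesis using oliftsI(1)[of a "g + m * int p" t b] by simp
next
  case False
  then obtain m where m: "k = 2 * m + 1" by (rule oddE)
  have "elift k (a + of_int g * t) (b + of_int g * t) = (b + of_int (g + m * int p) * t, a + 2 * pi + of_int (g + m * int p) * t)"
    using p_t unfolding elift_def m by (simp add: algebra_simps)
  then show ?thesis using oliftsI(2)[of b "g + m * int p" t a] by simp
qed

lemma olift_elift:
  assumes "V \<in> olifts t a b" obtains g k where "V = elift k (a + of_int g * t) (b + of_int g * t)"
  using assms
proof (cases rule: oliftsE)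
  case (1 n) then show ?thesis using that[of 0 n] by simp
next
  case (2 n) then show ?thesis using that[of 1 n] by (simp add: elift_def algebra_simps)
qed

text \<open>Flipping twice is the translation by 2 pi, a multiple of \<theta>.\<close>

lemma olifts_flip: "olifts t b (a + 2 * pi) = olifts t a b"
proof -
  have e: "arc_orbit t (a + 2 * pi, b + 2 * pi) = arc_orbit t (a, b)"
  proof -
    have o: "(a + 2 * pi, b + 2 * pi) \<in> arc_orbit t (a, b)"
      unfolding arc_orbit_def by (rule range_eqI[of _ _ "int p"]) (simp add: p_t)
    then show ?thesis using arc_orbit_trans arc_orbit_sym by blast
  qed
  show ?thesis unfolding olifts_def e by blast
qed

lemma olifts_orbit: "V \<in> arc_orbit t (a, b) \<Longrightarrow> olifts t (fst V) (snd V) = olifts t a b"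
proof -
  assume V: "V \<in> arc_orbit t (a, b)"
  then obtain n :: int where n: "V = (a + of_int n * t, b + of_int n * t)" unfolding arc_orbit_def by auto
  have "(snd V, fst V + 2 * pi) \<in> arc_orbit t (b, a + 2 * pi)"
    unfolding arc_orbit_def n by (auto simp: algebra_simps)
  then show ?thesis unfolding olifts_def prod.collapse
    using V arc_orbit_trans arc_orbit_sym by blast
qed

lemma olifts_eq: "V \<in> olifts t a b \<Longrightarrow> olifts t (fst V) (snd V) = olifts t a b"
  using olifts_orbit[of V a b] olifts_orbit[of V b "a + 2 * pi"] olifts_flip[of b a] unfolding olifts_def[of t a b] by auto

lemma olifts_self: "(a, b) \<in> olifts t a b"
  unfolding olifts_def by auto

lemma SE_iso:
  assumes "a \<le> b" "b \<le> a + 2 * pi" "(x, y) \<in> olifts t a b"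
  shows "x \<le> y" "y \<le> x + 2 * pi" "iso_obj DD (SEp x y) (SEp a b)"
proof -
  show xy: "x \<le> y" "y \<le> x + 2 * pi" using assms by (auto elim: oliftsE)
  obtain g k where gk: "(x, y) = elift k (a + of_int g * t) (b + of_int g * t)" using assms(3) by (rule olift_elift)
  have "c_exp (E_obj x y) (rot p g (E_obj a b)) (E_obj x y) = 0"
    unfolding rot_E_obj by (subst c_exp_E_round_trip) (use assms xy gk in auto)
  then show "iso_obj DD (SEp x y) (SEp a b)" unfolding SE_def by (intro SO_iso) (use assms xy in auto)
qed

lemma nonnull_self: "x < y \<Longrightarrow> y < x + 2 * pi \<Longrightarrow> nonnull (E_obj x y) (E_obj x y)"
  by (subst nonnull_E_iff) (auto intro!: exI[of _ 0])

lemma SE_iso_imp: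
  assumes "x < y" "y < x + 2 * pi" "a \<le> b" "b \<le> a + 2 * pi" "iso_obj DD (SEp x y) (SEp a b)"
  shows "(x, y) \<in> olifts t a b"
proof -
  obtain k where "c_exp (E_obj x y) (rot p k (E_obj a b)) (E_obj x y) = 0"
    by (rule SO_iso_imp[of "E_obj x y" "E_obj a b"]) (use assms nonnull_self[of x y] in \<open>auto simp: SE_def\<close>)
  then obtain j where "(x, y) = elift j (a + of_int k * t) (b + of_int k * t)"
    unfolding rot_E_obj by (subst (asm) c_exp_E_round_trip) (use assms in auto)
  then show ?thesis using elift_olift by metis
qed

lemma nonnull_rot_iff:
  assumes "x \<le> y" "y \<le> x + 2 * pi" "a \<le> b" "b \<le> a + 2 * pi"
  shows "nonnull (E_obj x y) (rot p g (E_obj a b)) \<longleftrightarrow> (\<exists>k. hits (x, y) (elift k (a + of_int g * t) (b + of_int g * t)))"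
  unfolding rot_E_obj by (subst nonnull_E_iff) (use assms in \<open>auto simp: hits_def\<close>)

lemma SE_hom_zero_iff:
  assumes "x \<le> y" "y \<le> x + 2 * pi" "a \<le> b" "b \<le> a + 2 * pi"
  shows "Hom DD (SEp x y) (SEp a b) = {Zer DD (SEp x y) (SEp a b)} \<longleftrightarrow> (\<forall>V\<in>olifts t a b. \<not> hits (x, y) V)"
proof -
  have "Hom DD (SEp x y) (SEp a b) = {Zer DD (SEp x y) (SEp a b)} \<longleftrightarrow>
     (\<forall>g. \<not> nonnull (E_obj x y) (rot p g (E_obj a b)))"
    unfolding SE_def by (rule SO_hom_zero_iff) (use assms in auto)
  also have "\<dots> \<longleftrightarrow> (\<forall>V\<in>olifts t a b. \<not> hits (x, y) V)"
    unfolding nonnull_rot_iff[OF assms] using elift_olift olift_elift by metis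
  finally show ?thesis .
qed

text \<open>Exponent 0 would identify (x, y) with a rotation of itself up to \<sigma>^j. For even
  \<open>j\<close> this makes \<open>k\<close> a multiple of \<open>p\<close>; for odd
  \<open>j\<close> it yields 2 k = - j p, which is impossible for odd \<open>p\<close>.\<close>

lemma rot_exp_pos:
  assumes "x \<le> y" "y \<le> x + 2 * pi" "\<not> int p dvd k"
  shows "1 \<le> c_exp (E_obj x y) (rot p k (E_obj x y)) (E_obj x y)"
proof -
  have "c_exp (E_obj x y) (rot p k (E_obj x y)) (E_obj x y) \<noteq> 0"
  proof
    assume "c_exp (E_obj x y) (rot p k (E_obj x y)) (E_obj x y) = 0"
    then obtain j where j: "(x, y) = elift j (x + of_int k * t) (y + of_int k * t)"
      unfolding rot_E_obj by (subst (asm) c_exp_E_round_trip) (use assms in auto)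
    have pi_t: "pi = of_nat p / 2 * t" using p_t by simp
    show False
    proof (cases "even j")
      case True
      then obtain m where m: "j = 2 * m" by auto
      have "of_int k * t + of_int (2 * m) * pi = 0" using j unfolding elift_def m by simp
      then have "of_int (k + m * int p) * t = 0" unfolding pi_t by (simp add: algebra_simps)
      then have "of_int (k + m * int p) = (0 :: real)" using t_pos by (metis mult_eq_0_iff less_irrefl)
      then have "k + m * int p = 0" by (simp only: of_int_eq_0_iff)
      then have "k = int p * (- m)" by (simp add: algebra_simps)
      then show False using assms(3) by simp
    next
      case False
      then obtain m where m: "j = 2 * m + 1" by (rule oddE)
      have e: "elift j (x + of_int k * t) (y + of_int k * t) =
          (y + of_int k * t + of_int j * pi - pi, x + of_int k * t + of_int j * pi + pi)"
      proof -
        have d: "(of_int j - 1) * pi = of_int j * pi - pi" "(of_int j + 1) * pi = of_int j * pi + pi"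
          by (simp_all add: left_diff_distrib distrib_right)
        show ?thesis using False by (simp only: elift_def if_False d add_diff_eq add.assoc[symmetric])
      qed
      have "x = y + of_int k * t + of_int j * pi - pi \<and> y = x + of_int k * t + of_int j * pi + pi"
        by (rule Pair_inject[OF trans[OF j e]], rule conjI)
      then have "of_int k * t + of_int j * pi = 0" by argo
      then have "of_int (2 * k + (2 * m + 1) * int p) * t = 0" unfolding pi_t m by (simp add: field_simps)
      then have "of_int (2 * k + (2 * m + 1) * int p) = (0 :: real)" using t_pos by (metis mult_eq_0_iff less_irrefl)
      then have "2 * k + (2 * m + 1) * int p = 0" by (simp only: of_int_eq_0_iff)
      then have "(2 * m + 1) * int p = 2 * (- k)" by linarith
      then have "even ((2 * m + 1) * int p)" by (metis dvd_triv_left)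
      then show False using p_odd by simp
    qed
  qed
  moreover have "0 \<le> c_exp (E_obj x y) (rot p k (E_obj x y)) (E_obj x y)" by (rule c_exp_nonneg) (use assms in auto)
  ultimately show ?thesis by linarith
qed

lemma not_dvd: "k \<in> {1..<int p} \<Longrightarrow> \<not> int p dvd k"
  by (auto dest: zdvd_imp_le)

text \<open>A rotated copy of (x, y) can be hit only through its flip (y + n t, x + 2 pi + n t) with
  n = -1, and this requires length exactly \<open>t\<close>. So arcs shorter than \<open>t\<close>
  are rigid, and loops carry one further stable endomorphism.\<close>

lemma strip_nonnull_rot:
  assumes xy: "x < y" "y \<le> x + t" and k: "k \<in> {1..<int p}" and n: "nonnull (E_obj x y) (rot p k (E_obj x y))"
  shows "y = x + t" "k = int p - 1"
proof -
  have "x \<le> y" "y \<le> x + 2 * pi" using xy t_lt t_pos by auto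
  then obtain j where hj: "hits (x, y) (elift j (x + of_int k * t) (y + of_int k * t))"
    using n nonnull_rot_iff[of x y x y k] by blast
  define V where j: "V = elift j (x + of_int k * t) (y + of_int k * t)"
  have V: "hits (x, y) V" using hj unfolding j .
  have "y = x + t \<and> k = int p - 1"
  proof (cases "even j")
    case True
    then obtain m where m: "j = 2 * m" by auto
    have Vk: "V = (x + of_int (k + m * int p) * t, y + of_int (k + m * int p) * t)"
      using p_t unfolding j elift_def m by (simp add: algebra_simps)
    have "of_int (k + m * int p) * t < t" "0 \<le> of_int (k + m * int p) * t"
      using V xy unfolding Vk hits_def fst_conv snd_conv by linarith+
    then have "k + m * int p = 0" using int_mult_gap[OF t_pos, of "k + m * int p"] t_pos by - (elim disjE; linarith)
    then have "k = int p * (- m)" by (simp add: algebra_simps)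
    then show ?thesis using not_dvd[OF k] by simp
  next
    case False
    then obtain m where m: "j = 2 * m + 1" by (rule oddE)
    define n where "n = k + m * int p"
    have Vk: "V = (y + of_int n * t, x + 2 * pi + of_int n * t)"
      using p_t unfolding j elift_def m n_def by (simp add: algebra_simps)
    have h: "x \<le> y + of_int n * t" "of_int n * t < 0" using V unfolding Vk hits_def by auto
    have e: "of_int (n + 1) * t = of_int n * t + t" by (simp add: algebra_simps)
    have "- t < of_int (n + 1) * t" "of_int (n + 1) * t < t" using h xy(2) t_pos unfolding e by linarith+
    then have n1: "n = -1" using int_mult_gap[OF t_pos, of "n + 1"] by - (elim disjE; linarith)
    then have "k + 1 = int p * (- m)" unfolding n_def by (simp add: algebra_simps)
    then have "int p dvd k + 1" by simp
    then have "k + 1 = int p" using k zdvd_imp_le[of "int p" "k + 1"] by auto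
    moreover have "y = x + t" using h(1) n1 xy(2) by simp
    ultimately show ?thesis by simp
  qed
  then show "y = x + t" "k = int p - 1" by auto
qed

lemma strip_bounds: "x < y \<Longrightarrow> y \<le> x + t \<Longrightarrow> x \<le> y \<and> y \<le> x + 2 * pi \<and> y < x + 2 * pi"
  using t_lt t_pos by auto

lemma SE_indecomposable:
  assumes "x < y" "y \<le> x + t" shows "indecomposable DD (SEp x y)"
  unfolding SE_def
proof (rule SO_indecomposable[of _ "int p - 1"])
  note b = strip_bounds[OF assms]
  show "E_obj x y \<in> Xpi" using b by simp
  show "nonnull (E_obj x y) (E_obj x y)" using nonnull_self assms b by auto
  show "1 \<le> c_exp (E_obj x y) (rot p k (E_obj x y)) (E_obj x y)" if "k \<in> {1..<int p}" for k
    by (rule rot_exp_pos) (use b not_dvd that in auto)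
qed (use strip_nonnull_rot assms in auto)

lemma SE_is_rigid:
  assumes "x < y" "y < x + t" shows "rigid p u E (SEp x y)"
  unfolding SE_def
proof (rule SO_rigid)
  note b = strip_bounds[OF assms(1) less_imp_le[OF assms(2)]]
  show "E_obj x y \<in> Xpi" using b by simp
  show "nonnull (E_obj x y) (E_obj x y)" using nonnull_self assms b by auto
  show "1 \<le> c_exp (E_obj x y) (rot p k (E_obj x y)) (E_obj x y)" if "k \<in> {1..<int p}" for k
    by (rule rot_exp_pos) (use b not_dvd that in auto)
qed (use strip_nonnull_rot assms in force)

section \<open>Arcs of rigid and almost rigid objects\<close>

lemma indecomposable_iso_length:
  assumes "indecomposable DD Y" "iso_obj DD Y (SEp x y)" "x \<le> y" "y \<le> x + 2 * pi"
  shows "x < y" "y < x + 2 * pi"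
proof -
  have "\<not> zero_obj DD (SEp x y)"
    using assms(1,2) QF.D.zero_obj_iso DD_sym unfolding indecomposable_def DD_eq by blast
  then have "E_obj x y \<notin> proj_pts" using SO_zero unfolding SE_def by blast
  then show "x < y" "y < x + 2 * pi" using assms(3,4) unfolding proj_pts_E by (auto simp: order_less_le)
qed

text \<open>For lengths from \<open>t\<close> to 2 pi - t the flip (y - t, x + 2 pi - t) is hit.
  This gives a nonzero endomorphism attached to the rotation by p - 1, which
  \<open>rigid_no_endo\<close> and \<open>rot_exp_pos\<close> rule out.\<close>

lemma rigid_length:
  assumes r: "rigid p u E Y" and iso: "iso_obj DD Y (SEp x y)" and xy: "x \<le> y" "y \<le> x + 2 * pi"
  shows "0 < y - x \<and> y - x < t \<or> 2 * pi - t < y - x \<and> y - x < 2 * pi"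
proof (rule ccontr)
  assume *: "\<not> ?thesis"
  have "indecomposable DD Y" using r unfolding rigid_def by simp
  note l = indecomposable_iso_length[OF this iso xy]
  have m: "t \<le> y - x" "y - x \<le> 2 * pi - t" using * l by linarith+
  have "nonnull (E_obj x y) (rot p (int p - 1) (E_obj x y))"
  proof (subst nonnull_rot_iff[OF xy xy], rule exI[of _ "-1"])
    show "hits (x, y) (elift (-1) (x + of_int (int p - 1) * t) (y + of_int (int p - 1) * t))"
      using m l t_pos p_t unfolding elift_def hits_def by (simp add: algebra_simps)
  qed
  then have "c_exp (E_obj x y) (rot p (int p - 1) (E_obj x y)) (E_obj x y) = 0"
    by (intro rigid_no_endo[OF _ r]) (use iso nonnull_self[OF l] xy p3 in \<open>auto simp: SE_def\<close>)
  moreover have "\<not> int p dvd int p - 1" using not_dvd[of "int p - 1"] p3 by simp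
  ultimately show False using rot_exp_pos[OF xy, of "int p - 1"] by simp
qed

lemma SE_flip:
  assumes "x \<le> y" "y \<le> x + 2 * pi" shows "iso_obj DD (SEp x y) (SEp y (x + 2 * pi))"
proof -
  have "(y, x + 2 * pi) \<in> olifts t x y" using olifts_self[of y "x + 2 * pi"] olifts_flip[of y x] by simp
  then show ?thesis using SE_iso(3)[OF assms] DD_sym by blast
qed

text \<open>Lengths of rigid objects lie in two closed intervals at the ends of [0, 2 pi], and so do
  their limits; the flip exchanges the two intervals.\<close>

lemma almost_rigid_strip:
  assumes "almost_rigid p u E Y"
  obtains x y where "x < y" "y \<le> x + t" "iso_obj DD Y (SEp x y)"
proof -
  have ind: "indecomposable DD Y" using assms unfolding almost_rigid_def by simp
  obtain Ys where Ys: "\<And>n. rigid p u E (Ys n)" "converges_to p u E Ys Y" using assms unfolding almost_rigid_def by blast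
  obtain xs ys x y where c: "\<And>n. xs n \<le> ys n \<and> ys n \<le> xs n + 2 * pi \<and> iso_obj DD (Ys n) (SEp (xs n) (ys n))"
    "x \<le> y" "y \<le> x + 2 * pi" "iso_obj DD Y (SEp x y)" "xs \<longlonglongrightarrow> x" "ys \<longlonglongrightarrow> y"
    using Ys(2) unfolding converges_to_def by blast
  note l = indecomposable_iso_length[OF ind c(4,2,3)]
  have "ys n - xs n \<in> {0..t} \<union> {2 * pi - t..2 * pi}" for n using rigid_length[OF Ys(1), of n "xs n" "ys n"] c(1)[of n] by auto
  moreover have "(\<lambda>n. ys n - xs n) \<longlonglongrightarrow> y - x" using c by (intro tendsto_diff)
  moreover have "closed ({0..t} \<union> {2 * pi - t..2 * pi})" by auto
  ultimately have "y - x \<in> {0..t} \<union> {2 * pi - t..2 * pi}" by (meson closed_sequentially)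
  then consider "y - x \<le> t" | "2 * pi - t \<le> y - x" by auto
  then show thesis
  proof cases
    case 1 then show ?thesis using that[of x y] l c by simp
  next
    case 2
    have "iso_obj DD Y (SEp y (x + 2 * pi))" using DD_trans[OF c(4) SE_flip] c by simp
    then show ?thesis using that[of y "x + 2 * pi"] l 2 by simp
  qed
qed

lemma SE_Obj: "x \<le> y \<Longrightarrow> y \<le> x + 2 * pi \<Longrightarrow> SEp x y \<in> Obj DD"
  unfolding DD_eq SE_def QF.D_sel by (rule SO_props) simp

lemma SE_almost_rigid:
  assumes xy: "x < y" "y \<le> x + t" shows "almost_rigid p u E (SEp x y)"
  unfolding almost_rigid_def
proof (intro conjI exI allI)
  \<comment> \<open>Shrinking by less than (y - x) / 2 at both ends leaves a nondegenerate arc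
    shorter than \<open>t\<close>, hence a rigid object.\<close>
  define e where "e n = (y - x) / 2 / of_nat (n + 2)" for n :: nat
  have "0 < e n \<and> e n < (y - x) / 2" for n using null_sequence(1)[of "(y - x) / 2" n] xy unfolding e_def by simp
  then have e: "0 < e n" "2 * e n < y - x" for n by (auto simp: field_simps)
  have e0: "e \<longlonglongrightarrow> 0" unfolding e_def by (rule null_sequence(2))
  let ?Ys = "\<lambda>n. SEp (x + e n) (y - e n)"
  show "indecomposable DD (SEp x y)" using xy by (rule SE_indecomposable)
  show "rigid p u E (?Ys n)" for n using e[of n] xy by (intro SE_is_rigid) auto
  show "converges_to p u E ?Ys (SEp x y)"
    unfolding converges_to_def
  proof (intro exI conjI allI)
    fix n
    show 1: "x + e n \<le> y - e n" "y - e n \<le> x + e n + 2 * pi" using e[of n] strip_bounds[OF xy] by auto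
    show "iso_obj DD (?Ys n) (SEp (x + e n) (y - e n))" by (intro DD_refl SE_Obj 1)
    show "x \<le> y" "y \<le> x + 2 * pi" using strip_bounds[OF xy] by auto
    then show "iso_obj DD (SEp x y) (SEp x y)" by (intro DD_refl SE_Obj)
    show "(\<lambda>n. x + e n) \<longlonglongrightarrow> x" "(\<lambda>n. y - e n) \<longlonglongrightarrow> y"
      using tendsto_add[OF tendsto_const e0, of x] tendsto_diff[OF tendsto_const e0, of y] by simp_all
  qed
qed

text \<open>The arcs supplied by \<open>perturb\<close>, taken along a null sequence, converge to a
  translate of (a, b). The last two conclusions of \<open>perturb\<close> say that neither their
  direct nor their flipped lifts are hit.\<close>

lemma compatibleI:
  assumes X: "iso_obj DD X (SEp x y)" "(x, y) \<in> arc_strip t" and Y: "iso_obj DD Y (SEp a b)" "(a, b) \<in> arc_strip t"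
    and nc: "\<And>Z. Z \<in> arc_orbit t (a, b) \<Longrightarrow> \<not> cross (x, y) Z"
  shows "compatible p u E X Y"
proof -
  note X' = X(2)[unfolded arc_strip_def, simplified] and Y' = Y(2)[unfolded arc_strip_def, simplified]
  obtain v w \<sigma> \<tau> d where vw: "(v, w) \<in> arc_orbit t (a, b)" and d: "d > 0"
    and len: "\<And>\<epsilon>. \<lbrakk>0 < \<epsilon>; \<epsilon> < d\<rbrakk> \<Longrightarrow> v + \<sigma> * \<epsilon> \<le> w + \<tau> * \<epsilon> \<and> w + \<tau> * \<epsilon> \<le> v + \<sigma> * \<epsilon> + 2 * t"
    and P1: "\<And>\<epsilon> n :: int. \<lbrakk>0 < \<epsilon>; \<epsilon> < d; x \<le> v + \<sigma> * \<epsilon> + of_int n * t; v + \<sigma> * \<epsilon> + of_int n * t < y; y \<le> w + \<tau> * \<epsilon> + of_int n * t\<rbrakk> \<Longrightarrow> False"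
    and P2: "\<And>\<epsilon> n :: int. \<lbrakk>0 < \<epsilon>; \<epsilon> < d; v + \<sigma> * \<epsilon> + of_int n * t < x; x \<le> w + \<tau> * \<epsilon> + of_int n * t; w + \<tau> * \<epsilon> + of_int n * t < y\<rbrakk> \<Longrightarrow> False"
    by (rule perturb[OF t_pos X(2) Y(2)]) (erule nc, rule that, assumption, assumption, blast, blast, blast)
  define e where "e n = d / of_nat (n + 2)" for n :: nat
  have e: "0 < e n" "e n < d" for n using null_sequence(1)[OF d, of n] unfolding e_def by auto
  have e0: "e \<longlonglongrightarrow> 0" unfolding e_def by (rule null_sequence(2))
  have bnd: "v + \<sigma> * e n \<le> w + \<tau> * e n" "w + \<tau> * e n \<le> v + \<sigma> * e n + 2 * pi" for n using len[OF e, of n] t_lt by auto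
  have vw': "v \<le> w" "w \<le> v + 2 * pi" using strip_bounds Y' vw by (auto simp: arc_orbit_def)
  let ?Ys = "\<lambda>n. SEp (v + \<sigma> * e n) (w + \<tau> * e n)"
  have "iso_obj DD (SEp v w) (SEp a b)" by (rule SE_iso) (use vw Y' strip_bounds in \<open>auto simp: olifts_def\<close>)
  then have "iso_obj DD Y (SEp v w)" using Y(1) DD_sym DD_trans by blast
  moreover have "(\<lambda>n. v + \<sigma> * e n) \<longlonglongrightarrow> v" "(\<lambda>n. w + \<tau> * e n) \<longlonglongrightarrow> w"
    using tendsto_add[OF tendsto_const tendsto_mult_right_zero[OF e0]] by fastforce+
  ultimately have "converges_to p u E ?Ys Y"
    unfolding converges_to_def
    by (intro exI[of _ "\<lambda>n. v + \<sigma> * e n"] exI[of _ "\<lambda>n. w + \<tau> * e n"] exI[of _ v] exI[of _ w])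
      (use bnd vw' DD_refl[OF SE_Obj[OF bnd]] in auto)
  moreover have "Hom DD X (?Ys n) = {Zer DD X (?Ys n)}" for n
  proof -
    have "\<not> hits (x, y) V" if "V \<in> olifts t (v + \<sigma> * e n) (w + \<tau> * e n)" for V
      using that
    proof (cases rule: oliftsE)
      case (1 k)
      then show ?thesis using P1[OF e, of n k] unfolding hits_def by auto
    next
      case (2 k)
      then show ?thesis using P2[OF e, of n k] unfolding hits_def by auto
    qed
    then have *: "Hom DD (SEp x y) (?Ys n) = {Zer DD (SEp x y) (?Ys n)}"
      by (subst SE_hom_zero_iff) (use bnd[of n] X' strip_bounds in auto)
    show ?thesis
      using QF.D.iso_obj_hom_zero[of "SEp x y" X "?Ys n" "?Ys n"] * DD_sym[OF X(1)] DD_refl[OF SE_Obj[OF bnd[of n]]]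
      unfolding DD_eq by blast
  qed
  ultimately show ?thesis unfolding compatible_def by blast
qed

text \<open>Crossing is strict, so it persists along a convergent sequence; depending on the order
  of the ends, the direct lift or its flip is then hit.\<close>

lemma compatible_not_cross:
  assumes c: "compatible p u E X Y"
    and X: "iso_obj DD X (SEp x y)" "(x, y) \<in> arc_strip t" and Y: "iso_obj DD Y (SEp a b)" "(a, b) \<in> arc_strip t"
  shows "\<not> cross (x, y) (a, b)"
proof
  assume cr: "cross (x, y) (a, b)"
  note X' = X(2)[unfolded arc_strip_def, simplified] and Y' = Y(2)[unfolded arc_strip_def, simplified]
  obtain Ys where Ys: "converges_to p u E Ys Y" "\<And>n. Hom DD X (Ys n) = {Zer DD X (Ys n)}"
    using c unfolding compatible_def by blast
  obtain xs ys x' y' where s': "\<And>n. xs n \<le> ys n \<and> ys n \<le> xs n + 2 * pi \<and> iso_obj DD (Ys n) (SEp (xs n) (ys n))"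
    and l: "x' \<le> y'" "y' \<le> x' + 2 * pi" "iso_obj DD Y (SEp x' y')" "xs \<longlonglongrightarrow> x'" "ys \<longlonglongrightarrow> y'"
    using Ys(1) unfolding converges_to_def by blast
  then have s: "xs n \<le> ys n" "ys n \<le> xs n + 2 * pi" "iso_obj DD (Ys n) (SEp (xs n) (ys n))" for n by auto
  have "iso_obj DD (SEp a b) (SEp x' y')" using Y(1) l(3) DD_sym DD_trans by blast
  then have "(a, b) \<in> olifts t x' y'" by (rule SE_iso_imp[rotated 4]) (use Y' strip_bounds l in auto)
  then obtain vs ws where vw: "vs \<longlonglongrightarrow> a" "ws \<longlonglongrightarrow> b" "\<And>n. (vs n, ws n) \<in> olifts t (xs n) (ys n)"
  proof (cases rule: oliftsE)
    case (1 k)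
    show ?thesis
    proof (rule that[of "\<lambda>n. xs n + of_int k * t" "\<lambda>n. ys n + of_int k * t"])
      show "(\<lambda>n. xs n + of_int k * t) \<longlonglongrightarrow> a" "(\<lambda>n. ys n + of_int k * t) \<longlonglongrightarrow> b"
        using 1 l(4,5) by (auto intro!: tendsto_intros)
    qed (rule oliftsI)
  next
    case (2 k)
    show ?thesis
    proof (rule that[of "\<lambda>n. ys n + of_int k * t" "\<lambda>n. xs n + 2 * pi + of_int k * t"])
      show "(\<lambda>n. ys n + of_int k * t) \<longlonglongrightarrow> a" "(\<lambda>n. xs n + 2 * pi + of_int k * t) \<longlonglongrightarrow> b"
        using 2 l(4,5) by (auto intro!: tendsto_intros)
    qed (rule oliftsI)
  qed
  have nh: "\<not> hits (x, y) V" if "V \<in> olifts t (xs n) (ys n)" for V n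
  proof -
    have "Hom DD (SEp x y) (SEp (xs n) (ys n)) = {Zer DD (SEp x y) (SEp (xs n) (ys n))}"
      using QF.D.iso_obj_hom_zero[of X "SEp x y" "Ys n" "SEp (xs n) (ys n)"] X(1) s(3)[of n] Ys(2)[of n] unfolding DD_eq by blast
    then show ?thesis using that by (subst (asm) SE_hom_zero_iff) (use X' strip_bounds s in auto)
  qed
  \<comment> \<open>The inequalities with 2 pi are automatic for crossing arcs of the strip; with
    them the two alternatives imply \<open>hits\<close> for (v, w) and for (w, v + 2 pi).\<close>
  define pos where "pos = (\<lambda>v w. x < v \<and> v < y \<and> y < w \<and> w < x + 2 * pi \<or> v < x \<and> x < w \<and> w < y \<and> y < v + 2 * pi)"
  have "pos a b" using cr X' Y' t_lt t_pos unfolding cross_def pos_def fst_conv snd_conv by argo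
  have "open {Z. pos (fst Z) (snd Z)}"
    unfolding pos_def by (intro open_Collect_disj open_Collect_conj open_Collect_less continuous_intros)
  then have "eventually (\<lambda>n. (vs n, ws n) \<in> {Z. pos (fst Z) (snd Z)}) sequentially"
    by (rule topological_tendstoD[OF tendsto_Pair[OF vw(1,2)]]) (simp add: \<open>pos a b\<close>)
  then obtain n where n: "pos (vs n) (ws n)" by (auto simp: eventually_sequentially)
  have "(ws n, vs n + 2 * pi) \<in> olifts t (xs n) (ys n)"
    using olifts_eq[OF vw(3)[of n]] olifts_flip[of "ws n" "vs n"] olifts_self[of "ws n" "vs n + 2 * pi"] by simp
  then have "\<not> hits (x, y) (ws n, vs n + 2 * pi)" "\<not> hits (x, y) (vs n, ws n)" using nh vw(3) by blast+
  then show False using n unfolding pos_def hits_def by auto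
qed

lemma strip_iso_imp:
  assumes X: "(x, y) \<in> arc_strip t" and Y: "(a, b) \<in> arc_strip t" and iso: "iso_obj DD (SEp x y) (SEp a b)"
  shows "(x, y) \<in> arc_orbit t (a, b)"
proof -
  note X' = X[unfolded arc_strip_def, simplified] and Y' = Y[unfolded arc_strip_def, simplified]
  have "(x, y) \<in> olifts t a b" by (rule SE_iso_imp) (use X' Y' strip_bounds iso in auto)
  \<comment> \<open>The flip has length at least 2 pi - t, which exceeds \<open>t\<close>.\<close>
  moreover have "(x, y) \<notin> arc_orbit t (b, a + 2 * pi)" using X' Y' t_lt by (auto simp: arc_orbit_def)
  ultimately show ?thesis unfolding olifts_def by blast
qed

lemma strip_iso:
  assumes Y: "(a, b) \<in> arc_strip t" and o: "(x, y) \<in> arc_orbit t (a, b)"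
  shows "iso_obj DD (SEp x y) (SEp a b)"
  by (rule SE_iso) (use Y strip_bounds o in \<open>auto simp: olifts_def arc_strip_def\<close>)

end

section \<open>Clusters as maximal families of arcs\<close>

context cluster_category
begin

definition arcs_of :: "'r eqobj set \<Rightarrow> (real \<times> real) set" where
  "arcs_of L = {(x, y). (x, y) \<in> arc_strip t \<and> (\<exists>X\<in>L. iso_obj DD X (SEp x y))}"

lemma arcs_ofD: "(x, y) \<in> arcs_of L \<Longrightarrow> (x, y) \<in> arc_strip t \<and> (\<exists>X\<in>L. iso_obj DD X (SEp x y))"
  unfolding arcs_of_def by blast

lemma arcs_ofI: "(x, y) \<in> arc_strip t \<Longrightarrow> X \<in> L \<Longrightarrow> iso_obj DD X (SEp x y) \<Longrightarrow> (x, y) \<in> arcs_of L"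
  unfolding arcs_of_def by blast

lemma arcs_of_periodic:
  assumes "X \<in> arcs_of L" "Y \<in> arc_orbit t X" shows "Y \<in> arcs_of L"
proof -
  obtain x y a b where xy: "X = (x, y)" "Y = (a, b)" by fastforce
  obtain T where T: "T \<in> L" "iso_obj DD T (SEp x y)" and s: "(x, y) \<in> arc_strip t"
    using arcs_ofD[of x y L] assms(1) xy by blast
  have "(a, b) \<in> arc_strip t" using s assms(2) unfolding xy by (auto simp: arc_orbit_def arc_strip_def)
  moreover have "iso_obj DD T (SEp a b)"
    by (rule DD_trans[OF T(2) DD_sym[OF strip_iso[OF s]]]) (use assms(2) xy in auto)
  ultimately show ?thesis unfolding xy using T(1) by (intro arcs_ofI)
qed

lemma almost_rigid_arc:
  assumes "almost_rigid p u E X" "X \<in> L"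
  obtains x y where "(x, y) \<in> arcs_of L" "(x, y) \<in> arc_strip t" "iso_obj DD X (SEp x y)"
proof -
  obtain x y where "x < y" "y \<le> x + t" "iso_obj DD X (SEp x y)" by (rule almost_rigid_strip[OF assms(1)])
  moreover from this have "(x, y) \<in> arc_strip t" by (simp add: arc_strip_def)
  ultimately show ?thesis using that arcs_ofI assms(2) by blast
qed

text \<open>\<open>Y\<close> has every translate of (a, b) as an arc, so
  \<open>compatible_not_cross\<close> applies to all of them. The criterion is symmetric in
  \<open>X\<close> and \<open>Y\<close>, while the definition of compatibility is not.\<close>

lemma compatible_iff:
  assumes X: "iso_obj DD X (SEp x y)" "(x, y) \<in> arc_strip t" and Y: "iso_obj DD Y (SEp a b)" "(a, b) \<in> arc_strip t"
  shows "compatible p u E X Y \<longleftrightarrow> (\<forall>Z\<in>arc_orbit t (a, b). \<not> cross (x, y) Z)"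
proof
  assume c: "compatible p u E X Y"
  show "\<forall>Z\<in>arc_orbit t (a, b). \<not> cross (x, y) Z"
  proof
    fix Z assume Z: "Z \<in> arc_orbit t (a, b)"
    obtain v w where vw: "Z = (v, w)" by (cases Z)
    have s: "(v, w) \<in> arc_strip t" using Z Y(2) unfolding vw by (auto simp: arc_orbit_def arc_strip_def)
    have "iso_obj DD Y (SEp v w)" using Z Y strip_iso[OF Y(2)] DD_sym DD_trans unfolding vw by blast
    then show "\<not> cross (x, y) Z" unfolding vw using compatible_not_cross[OF c X _ s] by blast
  qed
qed (use compatibleI[OF X Y] in blast)

text \<open>\<open>topology\<close> has its intended meaning only once the family of sets is
  verified to be a topology.\<close>

lemma openin_almost_rigid:
  "openin (almost_rigid_topology p u E) U \<longleftrightarrow> U \<subseteq> iso_class p u E ` {X. almost_rigid p u E X} \<and>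
     openin (top_of_set (arc_strip t)) {(x, y) \<in> arc_strip t. iso_class p u E (SEp x y) \<in> U}"
proof -
  let ?A = "iso_class p u E ` {X. almost_rigid p u E X}"
  let ?S = "\<lambda>U. {(x, y) \<in> arc_strip t. iso_class p u E (SEp x y) \<in> U}"
  let ?P = "\<lambda>U. U \<subseteq> ?A \<and> openin (top_of_set (arc_strip t)) (?S U)"
  have "istopology ?P"
    unfolding istopology_def
  proof (intro conjI allI impI)
    fix U V assume "?P U" "?P V"
    moreover have "?S (U \<inter> V) = ?S U \<inter> ?S V" by auto
    ultimately show "U \<inter> V \<subseteq> ?A" "openin (top_of_set (arc_strip t)) (?S (U \<inter> V))" by (auto intro: openin_Int)
  next
    fix \<U> assume "\<forall>U\<in>\<U>. ?P U"
    moreover have "?S (\<Union>\<U>) = (\<Union>U\<in>\<U>. ?S U)" by auto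
    ultimately show "\<Union>\<U> \<subseteq> ?A" "openin (top_of_set (arc_strip t)) (?S (\<Union>\<U>))" by (auto intro: openin_Union)
  qed
  then show ?thesis
    unfolding almost_rigid_topology_def Let_def arc_strip_def by (simp only: topology_inverse')
qed

lemma iso_class_eq_iff:
  assumes "X \<in> Obj DD" "Y \<in> Obj DD" shows "iso_class p u E X = iso_class p u E Y \<longleftrightarrow> iso_obj DD X Y"
proof
  assume "iso_class p u E X = iso_class p u E Y"
  moreover have "Y \<in> iso_class p u E Y" unfolding iso_class_def using DD_refl assms by blast
  ultimately show "iso_obj DD X Y" unfolding iso_class_def by blast
next
  assume "iso_obj DD X Y"
  then show "iso_class p u E X = iso_class p u E Y" unfolding iso_class_def using DD_sym DD_trans by blast
qed

lemma almost_rigid_Obj: "almost_rigid p u E X \<Longrightarrow> X \<in> Obj DD"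
  unfolding almost_rigid_def indecomposable_def by blast

lemma strip_Obj: "(x, y) \<in> arc_strip t \<Longrightarrow> SEp x y \<in> Obj DD"
  using SE_Obj strip_bounds unfolding arc_strip_def by blast

lemma strip_almost_rigid: "(x, y) \<in> arc_strip t \<Longrightarrow> almost_rigid p u E (SEp x y)"
  using SE_almost_rigid unfolding arc_strip_def by blast

text \<open>An arc that crosses no member could be added to the cluster, and an open set that
  isolates a class isolates its arc up to translation.\<close>

lemma cluster_arcs:
  assumes L: "cluster p u E L" shows "arcs t (arcs_of L)"
proof
  have cs: "compatible_set p u E L" and mx: "\<And>L'. compatible_set p u E L' \<Longrightarrow> L \<subseteq> L' \<Longrightarrow> L' = L"
    and dt: "subtopology (almost_rigid_topology p u E) (iso_class p u E ` L) = discrete_topology (iso_class p u E ` L)"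
    using L unfolding cluster_def by auto
  have ar: "almost_rigid p u E X" if "X \<in> L" for X using cs that unfolding compatible_set_def by blast
  have pw: "\<not> iso_obj DD X Y \<and> compatible p u E X Y" if "X \<in> L" "Y \<in> L" "X \<noteq> Y" for X Y
    using cs that unfolding compatible_set_def pairwise_def by blast
  show "t > 0" by (rule t_pos)
  show "arcs_of L \<subseteq> arc_strip t" unfolding arcs_of_def by auto
  show "Y \<in> arcs_of L" if "X \<in> arcs_of L" "Y \<in> arc_orbit t X" for X Y using arcs_of_periodic that by blast
  show "\<not> cross X Y" if XY: "X \<in> arcs_of L" "Y \<in> arcs_of L" for X Y
  proof -
    obtain x y a b where xy: "X = (x, y)" "Y = (a, b)" by fastforce
    obtain T where T: "T \<in> L" "iso_obj DD T (SEp x y)" and s: "(x, y) \<in> arc_strip t" using arcs_ofD[of x y L] XY xy by blast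
    obtain T' where T': "T' \<in> L" "iso_obj DD T' (SEp a b)" and s': "(a, b) \<in> arc_strip t" using arcs_ofD[of a b L] XY xy by blast
    show ?thesis
    proof (cases "T = T'")
      case True
      then have "iso_obj DD (SEp a b) (SEp x y)" using T T' DD_sym DD_trans by blast
      then have "(a, b) \<in> arc_orbit t (x, y)" by (rule strip_iso_imp[OF s' s])
      then show ?thesis unfolding xy by (rule orbit_noncrossing[OF t_pos s])
    next
      case False
      then show ?thesis unfolding xy using pw[OF T(1) T'(1)] compatible_iff[OF T(2) s T'(2) s'] arc_orbit_self by blast
    qed
  qed
  show "Z \<in> arcs_of L" if Z: "Z \<in> arc_strip t" and nc: "\<And>Y. Y \<in> arcs_of L \<Longrightarrow> \<not> cross Z Y" for Z
  proof (rule ccontr)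
    assume nZ: "Z \<notin> arcs_of L"
    obtain a b where ab: "Z = (a, b)" by (cases Z)
    have s: "(a, b) \<in> arc_strip t" using Z ab by simp
    have refl: "iso_obj DD (SEp a b) (SEp a b)" using strip_Obj[OF s] DD_refl by blast
    have *: "\<not> iso_obj DD X (SEp a b) \<and> \<not> iso_obj DD (SEp a b) X \<and> compatible p u E X (SEp a b) \<and> compatible p u E (SEp a b) X"
      if X: "X \<in> L" for X
    proof -
      obtain x y where xy: "(x, y) \<in> arcs_of L" "(x, y) \<in> arc_strip t" "iso_obj DD X (SEp x y)"
        by (rule almost_rigid_arc[OF ar[OF X] X])
      have "\<not> iso_obj DD X (SEp a b)" using nZ arcs_ofI[OF s X] unfolding ab by blast
      moreover have "\<not> cross (a, b) W" if "W \<in> arc_orbit t (x, y)" for W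
        using arcs_of_periodic[OF xy(1) that] nc unfolding ab by blast
      moreover have "\<not> cross (x, y) W" if W: "W \<in> arc_orbit t (a, b)" for W
      proof
        assume "cross (x, y) W"
        then obtain W' where "W' \<in> arc_orbit t (x, y)" "cross W' (a, b)" using orbit_cross[OF W, of "(x, y)"] by blast
        then show False using arcs_of_periodic[OF xy(1)] nc cross_sym unfolding ab by blast
      qed
      ultimately show ?thesis
        using compatible_iff[OF xy(3,2) refl s] compatible_iff[OF refl s xy(3,2)] DD_sym by blast
    qed
    have "compatible_set p u E (insert (SEp a b) L)"
      unfolding compatible_set_def pairwise_insert
      using ar strip_almost_rigid[OF s] * pw by (auto simp: pairwise_def)
    then have "insert (SEp a b) L = L" by (rule mx) auto
    then have "SEp a b \<in> L" by blast
    then show False using * refl by blast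
  qed
  show "\<exists>e>0. \<forall>Y\<in>arcs_of L. dist Y Z < e \<longrightarrow> Y = Z" if Z: "Z \<in> arcs_of L" for Z
  proof -
    obtain a b where ab: "Z = (a, b)" by (cases Z)
    obtain T where T: "T \<in> L" "iso_obj DD T (SEp a b)" and s: "(a, b) \<in> arc_strip t" using arcs_ofD[of a b L] Z ab by blast
    let ?c = "iso_class p u E"
    have "openin (subtopology (almost_rigid_topology p u E) (?c ` L)) {?c T}" unfolding dt using T by auto
    then obtain U where U: "openin (almost_rigid_topology p u E) U" "{?c T} = U \<inter> ?c ` L"
      unfolding openin_subtopology by auto
    define W where "W = {(x, y) \<in> arc_strip t. ?c (SEp x y) \<in> U}"
    have "openin (top_of_set (arc_strip t)) W" using U(1) unfolding openin_almost_rigid W_def by blast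
    moreover have "Z \<in> W"
      using s T iso_class_eq_iff[OF almost_rigid_Obj[OF ar[OF T(1)]] strip_Obj[OF s]] U(2) unfolding W_def ab by auto
    ultimately obtain e where e: "e > 0" "\<And>Y. Y \<in> arc_strip t \<Longrightarrow> dist Y Z < e \<Longrightarrow> Y \<in> W"
      unfolding openin_euclidean_subtopology_iff by blast
    show ?thesis
    \<comment> \<open>Within \<open>e\<close> the classes agree, so the arcs are translates of each
      other; within \<open>t\<close> translates coincide.\<close>
    proof (intro exI[of _ "min e t"] conjI ballI impI)
      fix Y assume Y: "Y \<in> arcs_of L" "dist Y Z < min e t"
      obtain x y where xy: "Y = (x, y)" by (cases Y)
      obtain T' where T': "T' \<in> L" "iso_obj DD T' (SEp x y)" and s': "(x, y) \<in> arc_strip t" using arcs_ofD[of x y L] Y xy by blast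
      have "Y \<in> W" using e(2) Y s' xy by auto
      then have "?c (SEp x y) \<in> U" unfolding W_def xy by auto
      moreover have "?c (SEp x y) = ?c T'"
        using T' iso_class_eq_iff[OF strip_Obj[OF s'] almost_rigid_Obj[OF ar[OF T'(1)]]] DD_sym by blast
      ultimately have "?c T' = ?c T" using U(2) T'(1) by auto
      then have "iso_obj DD T' T" using iso_class_eq_iff ar almost_rigid_Obj T T' by blast
      then have "iso_obj DD (SEp x y) (SEp a b)" using T T' DD_sym DD_trans by blast
      then have "Y \<in> arc_orbit t Z" unfolding xy ab by (rule strip_iso_imp[OF s' s])
      then show "Y = Z" using orbit_dist[OF t_pos, of Y Z Z] Y(2) by simp
    qed (use e t_pos in auto)
  qed
qed

text \<open>Maximality of the arcs makes every compatible addition isomorphic to a member.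
  Discreteness rests on \<open>separated\<close>: the arcs accumulate nowhere in the strip.\<close>

lemma arcs_cluster:
  assumes ar: "\<And>X. X \<in> L \<Longrightarrow> almost_rigid p u E X"
    and ni: "\<And>X Y. X \<in> L \<Longrightarrow> Y \<in> L \<Longrightarrow> X \<noteq> Y \<Longrightarrow> \<not> iso_obj DD X Y"
    and A: "arcs t (arcs_of L)"
  shows "cluster p u E L"
proof -
  interpret A: arcs t "arcs_of L" by (rule A)
  let ?c = "iso_class p u E"
  have "compatible_set p u E L"
    unfolding compatible_set_def pairwise_def
  proof (intro conjI ballI impI)
    fix X Y assume XY: "X \<in> L" "Y \<in> L" "X \<noteq> Y"
    obtain x y where xy: "(x, y) \<in> arcs_of L" "(x, y) \<in> arc_strip t" "iso_obj DD X (SEp x y)"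
      by (rule almost_rigid_arc[OF ar[OF XY(1)] XY(1)])
    obtain a b where ab: "(a, b) \<in> arcs_of L" "(a, b) \<in> arc_strip t" "iso_obj DD Y (SEp a b)"
      by (rule almost_rigid_arc[OF ar[OF XY(2)] XY(2)])
    show "compatible p u E X Y"
      using compatible_iff[OF xy(3,2) ab(3,2)] A.noncrossing[OF xy(1)] A.periodic[OF ab(1)] by blast
  qed (use ar ni in auto)
  moreover have "L' = L" if L': "compatible_set p u E L'" "L \<subseteq> L'" for L'
  proof (rule ccontr)
    assume "L' \<noteq> L"
    then obtain X where X: "X \<in> L'" "X \<notin> L" using L'(2) by blast
    have ar': "almost_rigid p u E X" using L'(1) X unfolding compatible_set_def by blast
    have pw: "\<not> iso_obj DD X Y \<and> compatible p u E X Y" if "Y \<in> L" for Y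
    proof -
      have "pairwise (\<lambda>X Y. \<not> iso_obj DD X Y \<and> compatible p u E X Y) L'"
        using L'(1) unfolding compatible_set_def by (rule conjunct2)
      from pairwiseD[OF this X(1), of Y] show ?thesis using that L'(2) X(2) by blast
    qed
    obtain x y where xy: "(x, y) \<in> arc_strip t" "iso_obj DD X (SEp x y)" by (rule almost_rigid_arc[OF ar' X(1)])
    have "(x, y) \<in> arcs_of L"
    proof (rule A.maximal[OF xy(1)])
      fix Z assume Z: "Z \<in> arcs_of L"
      obtain a b where ab: "Z = (a, b)" by (cases Z)
      obtain Y where Y: "Y \<in> L" "iso_obj DD Y (SEp a b)" and s: "(a, b) \<in> arc_strip t" using arcs_ofD[of a b L] Z ab by blast
      show "\<not> cross (x, y) Z"
        using pw[OF Y(1)] compatible_iff[OF xy(2,1) Y(2) s] arc_orbit_self unfolding ab by blast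
    qed
    then obtain Y where "Y \<in> L" "iso_obj DD Y (SEp x y)" using arcs_ofD by blast
    then show False using pw xy(2) DD_sym DD_trans by blast
  qed
  moreover have "subtopology (almost_rigid_topology p u E) (?c ` L) = discrete_topology (?c ` L)"
  proof -
    let ?A = "?c ` {X. almost_rigid p u E X}"
    \<comment> \<open>Removing any part of the classes of \<open>L\<close> leaves an open set, so
      every subset of these classes is relatively open.\<close>
    have op: "openin (almost_rigid_topology p u E) (?A - (?c ` L - W))" for W
      unfolding openin_almost_rigid
    proof
      define F where "F = {(x, y) \<in> arc_strip t. ?c (SEp x y) \<in> ?c ` L - W}"
      have FL: "F \<subseteq> arcs_of L"
      proof
        fix Z assume "Z \<in> F"
        then obtain x y X where Z: "Z = (x, y)" "(x, y) \<in> arc_strip t" "X \<in> L" "?c (SEp x y) = ?c X" unfolding F_def by auto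
        have "iso_obj DD X (SEp x y)" using iso_class_eq_iff[OF strip_Obj[OF Z(2)] almost_rigid_Obj[OF ar[OF Z(3)]]] Z(4) DD_sym by blast
        then show "Z \<in> arcs_of L" unfolding Z(1) using Z(2,3) by (intro arcs_ofI)
      qed
      have "{(x, y) \<in> arc_strip t. ?c (SEp x y) \<in> ?A - (?c ` L - W)} = arc_strip t - F"
        unfolding F_def using strip_almost_rigid by auto
      moreover have "openin (top_of_set (arc_strip t)) (arc_strip t - F)"
        unfolding openin_euclidean_subtopology_iff
      proof (intro conjI ballI)
        fix Z assume Z: "Z \<in> arc_strip t - F"
        then obtain e where "e > 0" "\<forall>Y\<in>arcs_of L. dist Y Z < e \<longrightarrow> Y = Z" using A.separated by blast
        then show "\<exists>e>0. \<forall>Y\<in>arc_strip t. dist Y Z < e \<longrightarrow> Y \<in> arc_strip t - F" using Z FL by blast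
      qed auto
      ultimately show "openin (top_of_set (arc_strip t)) {(x, y) \<in> arc_strip t. ?c (SEp x y) \<in> ?A - (?c ` L - W)}" by simp
    qed auto
    have sub: "?c ` L \<subseteq> ?A" using ar by blast
    have "?A \<subseteq> topspace (almost_rigid_topology p u E)" using openin_subset[OF op[of "?c ` L"]] by simp
    then have "topspace (subtopology (almost_rigid_topology p u E) (?c ` L)) = ?c ` L"
      unfolding topspace_subtopology using sub by (intro Int_absorb1) (rule subset_trans)
    moreover have "openin (subtopology (almost_rigid_topology p u E) (?c ` L)) {z}" if "z \<in> ?c ` L" for z
      unfolding openin_subtopology using op[of "{z}"] that sub by (intro exI[of _ "?A - (?c ` L - {z})"]) blast
    ultimately have "discrete_topology (?c ` L) = subtopology (almost_rigid_topology p u E) (?c ` L)"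
      unfolding discrete_topology_unique by blast
    then show ?thesis by simp
  qed
  ultimately show ?thesis unfolding cluster_def by blast
qed

section \<open>Exchanging one object of a cluster\<close>

lemma arcs_of_insert_iso:
  "iso_obj DD T' (SEp x y) \<Longrightarrow> (x, y) \<in> arc_strip t \<Longrightarrow> arcs_of (insert T' M) = arcs_of M \<union> arc_orbit t (x, y)"
proof (intro equalityI subsetI)
  assume T': "iso_obj DD T' (SEp x y)" "(x, y) \<in> arc_strip t"
  have T'm: "(x, y) \<in> arcs_of (insert T' M)" using T' by (intro arcs_ofI) auto
  show "Z \<in> arcs_of M \<union> arc_orbit t (x, y)" if Z: "Z \<in> arcs_of (insert T' M)" for Z
  proof -
    obtain v w where vw: "Z = (v, w)" by (cases Z)
    obtain X where X: "X \<in> insert T' M" "iso_obj DD X (SEp v w)" and s: "(v, w) \<in> arc_strip t"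
      using arcs_ofD[of v w "insert T' M"] Z vw by blast
    show ?thesis
    proof (cases "X = T'")
      case True
      then have "iso_obj DD (SEp v w) (SEp x y)" using X T' DD_sym DD_trans by blast
      then show ?thesis using strip_iso_imp[OF s T'(2)] vw by blast
    next
      case False
      then show ?thesis using X s arcs_ofI unfolding vw by blast
    qed
  qed
  show "Z \<in> arcs_of (insert T' M)" if "Z \<in> arcs_of M \<union> arc_orbit t (x, y)" for Z
    using that arcs_of_periodic[OF T'm] unfolding arcs_of_def by blast
qed

context
  fixes L T a c
  assumes L: "cluster p u E L" and T: "T \<in> L" and ac: "(a, c) \<in> arc_strip t" "iso_obj DD T (SEp a c)"
begin

lemma cluster_almost_rigid: "X \<in> L \<Longrightarrow> almost_rigid p u E X"
  using L unfolding cluster_def compatible_set_def by blast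

lemma cluster_not_iso: "X \<in> L \<Longrightarrow> Y \<in> L \<Longrightarrow> X \<noteq> Y \<Longrightarrow> \<not> iso_obj DD X Y"
  using L unfolding cluster_def compatible_set_def pairwise_def by blast

lemma ac_arc: "(a, c) \<in> arcs_of L"
  using T ac by (intro arcs_ofI)

text \<open>Members are pairwise nonisomorphic, so with \<open>T\<close> exactly the translates of
  its arc disappear.\<close>

lemma arcs_of_remove: "arcs_of (L - {T}) = arcs_of L - arc_orbit t (a, c)"
proof (intro equalityI subsetI)
  fix Z assume "Z \<in> arcs_of (L - {T})"
  obtain x y where xy: "Z = (x, y)" by (cases Z)
  obtain X where X: "X \<in> L" "X \<noteq> T" "iso_obj DD X (SEp x y)" and s: "(x, y) \<in> arc_strip t"
    using arcs_ofD[of x y "L - {T}"] \<open>Z \<in> _\<close> xy by blast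
  have "(x, y) \<notin> arc_orbit t (a, c)"
    using strip_iso[OF ac(1)] X cluster_not_iso[OF X(1) T X(2)] ac(2) DD_sym DD_trans by blast
  then show "Z \<in> arcs_of L - arc_orbit t (a, c)" using arcs_ofI[OF s X(1,3)] xy by blast
next
  fix Z assume Z: "Z \<in> arcs_of L - arc_orbit t (a, c)"
  obtain x y where xy: "Z = (x, y)" by (cases Z)
  obtain X where X: "X \<in> L" "iso_obj DD X (SEp x y)" and s: "(x, y) \<in> arc_strip t"
    using arcs_ofD[of x y L] Z xy by blast
  have "X \<noteq> T"
  proof
    assume "X = T"
    then have "iso_obj DD (SEp x y) (SEp a c)" using X ac(2) DD_sym DD_trans by blast
    then show False using strip_iso_imp[OF s ac(1)] Z xy by blast
  qed
  then show "Z \<in> arcs_of (L - {T})" unfolding xy using X s by (intro arcs_ofI[of _ _ X]) auto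
qed

interpretation A: arcs t "arcs_of L" using cluster_arcs[OF L] .

text \<open>The new diagonal crosses (a, c), so it is isomorphic to no member of \<open>L\<close>;
  the rest is \<open>flip_arcs\<close> read back through \<open>arcs_cluster\<close>.\<close>

lemma exchange_ex:
  assumes fd: "A.flip_data a b c (v, w)"
  shows "exchanges p u E L T (SEp v w)"
proof -
  have s: "(v, w) \<in> arc_strip t" by (rule A.flip_strip[OF fd])
  have refl: "iso_obj DD (SEp v w) (SEp v w)" using strip_Obj[OF s] DD_refl by blast
  have nL: "(v, w) \<notin> arcs_of L" using A.flip_cross[OF fd] A.noncrossing ac_arc by blast
  have niso: "\<not> iso_obj DD X (SEp v w)" if "X \<in> L" for X using nL arcs_ofI[OF s that] by blast
  have "arcs_of (L - {T} \<union> {SEp v w}) = arcs_of L - arc_orbit t (a, c) \<union> arc_orbit t (v, w)"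
    using arcs_of_insert_iso[OF refl s, of "L - {T}"] arcs_of_remove by simp
  then have ar: "arcs t (arcs_of (L - {T} \<union> {SEp v w}))" using A.flip_arcs[OF fd] by simp
  have "cluster p u E (L - {T} \<union> {SEp v w})"
  proof (rule arcs_cluster[OF _ _ ar])
    show "almost_rigid p u E X" if "X \<in> L - {T} \<union> {SEp v w}" for X
      using that cluster_almost_rigid strip_almost_rigid[OF s] by blast
    show "\<not> iso_obj DD X Y" if "X \<in> L - {T} \<union> {SEp v w}" "Y \<in> L - {T} \<union> {SEp v w}" "X \<noteq> Y" for X Y
      using that cluster_not_iso niso DD_sym by blast
  qed
  then show ?thesis unfolding exchanges_def using niso[OF T] DD_sym by blast
qed

text \<open>The arc of \<open>T'\<close> crosses no remaining arc, so by \<open>flip_unique'\<close>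
  it is an old arc or a translate of the new diagonal.\<close>

lemma exchange_unique:
  assumes fd: "A.flip_data a b c (v, w)" and ex: "exchanges p u E L T T'"
  shows "iso_obj DD T' (SEp v w)"
proof -
  let ?M = "L - {T} \<union> {T'}"
  have cl: "cluster p u E ?M" and nT: "\<not> iso_obj DD T' T" using ex unfolding exchanges_def by auto
  have s: "(v, w) \<in> arc_strip t" by (rule A.flip_strip[OF fd])
  interpret B: arcs t "arcs_of ?M" by (rule cluster_arcs[OF cl])
  have ar: "almost_rigid p u E T'" using cl unfolding cluster_def compatible_set_def by blast
  obtain x y where xy: "(x, y) \<in> arcs_of ?M" "(x, y) \<in> arc_strip t" "iso_obj DD T' (SEp x y)"
    by (rule almost_rigid_arc[OF ar, of ?M]) auto
  have sub: "arcs_of L - arc_orbit t (a, c) \<subseteq> arcs_of ?M"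
    using arcs_of_insert_iso[OF xy(3,2), of "L - {T}"] arcs_of_remove by auto
  have "(x, y) \<in> arcs_of L \<or> (x, y) \<in> arc_orbit t (v, w)"
    by (rule A.flip_unique'[OF fd xy(2)]) (use B.noncrossing[OF xy(1)] sub in blast)
  then show ?thesis
  proof
    assume "(x, y) \<in> arc_orbit t (v, w)"
    then show ?thesis using strip_iso[OF s] xy(3) DD_trans by blast
  next
    \<comment> \<open>Here \<open>T'\<close> is isomorphic to a member other than \<open>T\<close>,
      hence equal to it; then L - {T} would itself be a cluster, although the compatible set
      \<open>L\<close> contains it properly.\<close>
    assume "(x, y) \<in> arcs_of L"
    then obtain X where X: "X \<in> L" "iso_obj DD X (SEp x y)" using arcs_ofD by blast
    have iX: "iso_obj DD X T'" using X(2) xy(3) DD_sym DD_trans by blast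
    have "X \<noteq> T" using nT iX DD_sym by blast
    have "X = T'"
    proof (rule ccontr)
      assume "X \<noteq> T'"
      moreover have "X \<in> ?M" "T' \<in> ?M" using X \<open>X \<noteq> T\<close> by auto
      ultimately show False using cl iX unfolding cluster_def compatible_set_def pairwise_def by blast
    qed
    then have "?M = L - {T}" using X(1) \<open>X \<noteq> T\<close> by blast
    then have "compatible_set p u E L \<longrightarrow> L = L - {T}" using cl unfolding cluster_def by (metis Diff_subset)
    then show ?thesis using L T unfolding cluster_def by blast
  qed
qed

end

end

section \<open>Approximations\<close>

context addcat
begin

lemma biproduct_row_column:
  assumes "is_biproduct C A B S i j q r" and [simp]: "W \<in> Obj C" "V \<in> Obj C"
    "t1 \<in> Hom C W A" "t2 \<in> Hom C W B" "h1 \<in> Hom C A V" "h2 \<in> Hom C B V"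
  shows "Cmp C W S V (Pls C S V (Cmp C S A V h1 q) (Cmp C S B V h2 r)) (Pls C W S (Cmp C W A S i t1) (Cmp C W B S j t2)) =
    Pls C W V (Cmp C W A V h1 t1) (Cmp C W B V h2 t2)"
proof -
  note [simp] = is_biproductD[OF assms(1)]
  have "Cmp C W S A q (Pls C W S (Cmp C W A S i t1) (Cmp C W B S j t2)) = t1"
    "Cmp C W S B r (Pls C W S (Cmp C W A S i t1) (Cmp C W B S j t2)) = t2"
    by (simp_all add: cmp_plsr biproduct_ctx[OF assms(1)])
  then show ?thesis by (simp add: cmp_plsl cmp_assoc)
qed

text \<open>Factorisations are computed between objects SX, whereas the objects of a cluster are
  only isomorphic to such.\<close>

lemma left_factor_iso:
  assumes iso: "iso_mor C T' T \<alpha>" and ob [simp]: "T' \<in> Obj C" "T \<in> Obj C" "A \<in> Obj C" and f [simp]: "f \<in> Hom C T A"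
    and V: "iso_obj C W V"
    and fac: "\<And>f'. f' \<in> Hom C T W \<Longrightarrow> \<exists>g\<in>Hom C A W. Cmp C T A W g f = f'"
    and f' [simp]: "f' \<in> Hom C T' V"
  shows "\<exists>g\<in>Hom C A V. Cmp C T' A V g (Cmp C T' T A f \<alpha>) = f'"
proof -
  obtain w w' where w [simp]: "W \<in> Obj C" "V \<in> Obj C" "w \<in> Hom C W V" "w' \<in> Hom C V W"
    "Cmp C V W V w w' = Idn C V" using iso_objE[OF V] by metis
  obtain \<beta> where \<alpha> [simp]: "\<alpha> \<in> Hom C T' T" "\<beta> \<in> Hom C T T'" "Cmp C T' T T' \<beta> \<alpha> = Idn C T'"
    using iso unfolding iso_mor_def by blast
  obtain g where g [simp]: "g \<in> Hom C A W" "Cmp C T A W g f = Cmp C T V W w' (Cmp C T T' V f' \<beta>)"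
    using fac[of "Cmp C T V W w' (Cmp C T T' V f' \<beta>)"] by auto
  have "Cmp C T' A V (Cmp C A W V w g) (Cmp C T' T A f \<alpha>) = Cmp C T' T V (Cmp C T W V w (Cmp C T A W g f)) \<alpha>"
    by (simp only: cmp_assoc cmp_in ob f w \<alpha> g(1))
  also have "Cmp C T W V w (Cmp C T A W g f) = Cmp C T T' V f' \<beta>"
    using cmp_assoc[of T V W V "Cmp C T T' V f' \<beta>" w' w] by simp
  also have "Cmp C T' T V (Cmp C T T' V f' \<beta>) \<alpha> = f'" by (simp add: cmp_assoc)
  finally show ?thesis by (intro bexI[of _ "Cmp C A W V w g"]) simp_all
qed

text \<open>The factorisation property is inherited by zero objects, biproducts and direct summands,
  so it suffices to test the members of \<open>U\<close>.\<close>

lemma left_approximationI: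
  assumes A: "A \<in> add_closure C U" and ob [simp]: "A \<in> Obj C" "T \<in> Obj C" and f [simp]: "f \<in> Hom C T A"
    and fac: "\<And>V f'. V \<in> U \<Longrightarrow> f' \<in> Hom C T V \<Longrightarrow> \<exists>g\<in>Hom C A V. Cmp C T A V g f = f'"
  shows "left_approximation C U T A f"
proof -
  have "X \<in> Obj C \<and> (\<forall>f'\<in>Hom C T X. \<exists>g\<in>Hom C A X. Cmp C T A X g f = f')" if "X \<in> add_closure C U" for X
    using that
  proof induction
    case (zero X)
    then have "X \<in> Obj C" by (simp add: zero_obj_def)
    moreover have "\<exists>g\<in>Hom C A X. Cmp C T A X g f = f'" if "f' \<in> Hom C T X" for f'
      using zero_obj_homs(1)[OF zero ob(2) that] \<open>X \<in> Obj C\<close> by (intro bexI[of _ "Zer C A X"]) simp_all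
    ultimately show ?case by blast
  next
    case (base X)
    then show ?case using fac by blast
  next
    case (sum A1 A2 X)
    then obtain i j q r where bp: "is_biproduct C A1 A2 X i j q r" unfolding biproduct_iff by blast
    note [simp] = is_biproductD[OF bp]
    have "\<exists>g\<in>Hom C A X. Cmp C T A X g f = f'" if [simp]: "f' \<in> Hom C T X" for f'
    proof -
      have m: "Cmp C T X A1 q f' \<in> Hom C T A1" "Cmp C T X A2 r f' \<in> Hom C T A2" by simp_all
      obtain g1 g2 where g [simp]: "g1 \<in> Hom C A A1" "Cmp C T A A1 g1 f = Cmp C T X A1 q f'"
        "g2 \<in> Hom C A A2" "Cmp C T A A2 g2 f = Cmp C T X A2 r f'"
        using sum.IH m by blast
      have "Cmp C T A X (Pls C A X (Cmp C A A1 X i g1) (Cmp C A A2 X j g2)) f = f'"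
        using biproduct_decomp_in[OF bp ob(2) that] by (simp add: cmp_plsl cmp_assoc)
      then show ?thesis by (intro bexI[of _ "Pls C A X (Cmp C A A1 X i g1) (Cmp C A A2 X j g2)"]) simp_all
    qed
    then show ?case by simp
  next
    case (summand X A1 A2)
    then obtain i j q r where bp: "is_biproduct C A1 A2 X i j q r" unfolding biproduct_iff by blast
    note [simp] = is_biproductD[OF bp]
    have "\<exists>g\<in>Hom C A A1. Cmp C T A A1 g f = f'" if [simp]: "f' \<in> Hom C T A1" for f'
    proof -
      have m: "Cmp C T A1 X i f' \<in> Hom C T X" by simp
      obtain g where g [simp]: "g \<in> Hom C A X" "Cmp C T A X g f = Cmp C T A1 X i f'"
        using summand.IH m by blast
      have "Cmp C T A A1 (Cmp C A X A1 q g) f = f'"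
        using biproduct_ctx(1)[OF bp ob(2) that] by (simp add: cmp_assoc)
      then show ?thesis by (intro bexI[of _ "Cmp C A X A1 q g"]) simp_all
    qed
    then show ?case by simp
  qed
  then show ?thesis unfolding left_approximation_def using A f by blast
qed

lemma right_factor_iso:
  assumes iso: "iso_mor C T' T \<epsilon>" and ob [simp]: "T' \<in> Obj C" "T \<in> Obj C" "B \<in> Obj C"
    and h [simp]: "h \<in> Hom C B T" "H \<in> Hom C B T'" "Cmp C B T' T \<epsilon> H = h"
    and V: "iso_obj C W V"
    and fac: "\<And>f'. f' \<in> Hom C W T \<Longrightarrow> \<exists>g\<in>Hom C W B. Cmp C W B T h g = f'"
    and f' [simp]: "f' \<in> Hom C V T'"
  shows "\<exists>g\<in>Hom C V B. Cmp C V B T' H g = f'"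
proof -
  obtain w w' where w [simp]: "W \<in> Obj C" "V \<in> Obj C" "w \<in> Hom C W V" "w' \<in> Hom C V W"
    "Cmp C V W V w w' = Idn C V" using iso_objE[OF V] by metis
  obtain \<beta> where \<epsilon> [simp]: "\<epsilon> \<in> Hom C T' T" "\<beta> \<in> Hom C T T'" "Cmp C T' T T' \<beta> \<epsilon> = Idn C T'"
    using iso unfolding iso_mor_def by blast
  obtain g where g [simp]: "g \<in> Hom C W B" "Cmp C W B T h g = Cmp C W T' T \<epsilon> (Cmp C W V T' f' w)"
    using fac[of "Cmp C W T' T \<epsilon> (Cmp C W V T' f' w)"] by auto
  have \<beta>\<epsilon>: "Cmp C Z T T' \<beta> (Cmp C Z T' T \<epsilon> k) = k" if "k \<in> Hom C Z T'" "Z \<in> Obj C" for Z k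
    using cmp_assoc[of Z T' T T' k \<epsilon> \<beta>] that by simp
  have 1: "Cmp C W B T' H g = Cmp C W V T' f' w"
  proof -
    have "Cmp C W T' T \<epsilon> (Cmp C W B T' H g) = Cmp C W B T h g"
      using cmp_assoc[of W B T' T g H \<epsilon>] by (simp del: g(2))
    also have "\<dots> = Cmp C W T' T \<epsilon> (Cmp C W V T' f' w)" by simp
    finally have x: "Cmp C W T' T \<epsilon> (Cmp C W B T' H g) = Cmp C W T' T \<epsilon> (Cmp C W V T' f' w)" .
    have l: "Cmp C W T T' \<beta> (Cmp C W T' T \<epsilon> (Cmp C W B T' H g)) = Cmp C W B T' H g"
      by (rule \<beta>\<epsilon>) simp_all
    have r: "Cmp C W T T' \<beta> (Cmp C W T' T \<epsilon> (Cmp C W V T' f' w)) = Cmp C W V T' f' w"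
      by (rule \<beta>\<epsilon>) simp_all
    show ?thesis by (rule trans[OF sym[OF l[unfolded x]] r])
  qed
  have "Cmp C V B T' H (Cmp C V W B g w') = Cmp C V W T' (Cmp C W B T' H g) w'" by (simp add: cmp_assoc)
  also have "\<dots> = f'" unfolding 1 by (simp add: cmp_assoc)
  finally show ?thesis by (intro bexI[of _ "Cmp C V W B g w'"]) simp_all
qed

lemma right_approximationI:
  assumes B: "B \<in> add_closure C U" and ob [simp]: "B \<in> Obj C" "T \<in> Obj C" and h [simp]: "h \<in> Hom C B T"
    and fac: "\<And>V f'. V \<in> U \<Longrightarrow> f' \<in> Hom C V T \<Longrightarrow> \<exists>g\<in>Hom C V B. Cmp C V B T h g = f'"
  shows "right_approximation C U T B h"
proof -
  have "X \<in> Obj C \<and> (\<forall>f'\<in>Hom C X T. \<exists>g\<in>Hom C X B. Cmp C X B T h g = f')" if "X \<in> add_closure C U" for X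
    using that
  proof induction
    case (zero X)
    then have "X \<in> Obj C" by (simp add: zero_obj_def)
    moreover have "\<exists>g\<in>Hom C X B. Cmp C X B T h g = f'" if "f' \<in> Hom C X T" for f'
      using zero_obj_homs(2)[OF zero ob(2) that] \<open>X \<in> Obj C\<close> by (intro bexI[of _ "Zer C X B"]) simp_all
    ultimately show ?case by blast
  next
    case (base X)
    then show ?case using fac by blast
  next
    case (sum A1 A2 X)
    then obtain i j q r where bp: "is_biproduct C A1 A2 X i j q r" unfolding biproduct_iff by blast
    note [simp] = is_biproductD[OF bp]
    have "\<exists>g\<in>Hom C X B. Cmp C X B T h g = f'" if [simp]: "f' \<in> Hom C X T" for f'
    proof -
      have m: "Cmp C A1 X T f' i \<in> Hom C A1 T" "Cmp C A2 X T f' j \<in> Hom C A2 T" by simp_all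
      obtain g1 g2 where g [simp]: "g1 \<in> Hom C A1 B" "Cmp C A1 B T h g1 = Cmp C A1 X T f' i"
        "g2 \<in> Hom C A2 B" "Cmp C A2 B T h g2 = Cmp C A2 X T f' j"
        using sum.IH m by blast
      have "Cmp C X A1 T (Cmp C A1 B T h g1) q = Cmp C X B T h (Cmp C X A1 B g1 q)"
        "Cmp C X A2 T (Cmp C A2 B T h g2) r = Cmp C X B T h (Cmp C X A2 B g2 r)"
        by (rule cmp_assoc; simp del: g(2,4))+
      then have "Cmp C X B T h (Pls C X B (Cmp C X A1 B g1 q) (Cmp C X A2 B g2 r)) = f'"
        using biproduct_decomp_out[OF bp ob(2) that] by (simp add: cmp_plsr)
      then show ?thesis by (intro bexI[of _ "Pls C X B (Cmp C X A1 B g1 q) (Cmp C X A2 B g2 r)"]) simp_all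
    qed
    then show ?case by simp
  next
    case (summand X A1 A2)
    then obtain i j q r where bp: "is_biproduct C A1 A2 X i j q r" unfolding biproduct_iff by blast
    note [simp] = is_biproductD[OF bp]
    have "\<exists>g\<in>Hom C A1 B. Cmp C A1 B T h g = f'" if [simp]: "f' \<in> Hom C A1 T" for f'
    proof -
      have m: "Cmp C X A1 T f' q \<in> Hom C X T" by simp
      obtain g where g [simp]: "g \<in> Hom C X B" "Cmp C X B T h g = Cmp C X A1 T f' q"
        using summand.IH m by blast
      have "Cmp C A1 B T h (Cmp C A1 X B g i) = Cmp C A1 X T (Cmp C X B T h g) i"
        by (rule cmp_assoc[symmetric]; simp del: g(2))
      also have "\<dots> = f'" by (simp add: cmp_assoc)
      finally show ?thesis by (intro bexI[of _ "Cmp C A1 X B g i"]) simp_all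
    qed
    then show ?case by simp
  qed
  then show ?thesis unfolding right_approximation_def using B h by blast
qed

lemma biproduct_add_closure:
  assumes "biproduct C A B S" "iso_obj C A A'" "iso_obj C B B'" "A' \<in> U" "B' \<in> U"
  shows "S \<in> add_closure C U"
proof -
  have "biproduct C A' B S" using assms(1,2) is_biproduct_iso biproduct_iff by metis
  then have "biproduct C B A' S" using is_biproduct_commute biproduct_iff by metis
  then have "biproduct C B' A' S" using assms(3) is_biproduct_iso biproduct_iff by metis
  moreover have "A' \<in> Obj C" "B' \<in> Obj C" using assms(2,3) unfolding iso_obj_def by auto
  ultimately show ?thesis using assms(4,5) by (blast intro: add_closure.intros)
qed

end

context equivariant
begin

abbreviation "DS \<equiv> stable_category Q EQ"

text \<open>Coefficient by coefficient: at a nonnull translate one of the two exponents is 0, and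
  \<phi>(k) is routed through that middle term. The values at null translates do not affect the
  class.\<close>

lemma left_factor:
  assumes X: "X \<in> Xpi" "Y1 \<in> Xpi" "Y2 \<in> Xpi" "W \<in> Xpi"
    and bp: "is_biproduct Q (SO Y1) (SO Y2) A i j q r"
    and c: "\<And>k. nonnull X (rot p k W) \<Longrightarrow> c_exp X Y1 (rot p k W) = 0 \<or> c_exp X Y2 (rot p k W) = 0"
    and \<Phi>: "\<Phi> \<in> Hom DS (SO X) (SO W)"
  shows "\<exists>G\<in>Hom DS A (SO W). Cmp DS (SO X) A (SO W) G
    (cls (SO X) A (Pls Q (SO X) A (Cmp Q (SO X) (SO Y1) A i (circ (dl 0))) (Cmp Q (SO X) (SO Y2) A j (circ (dl 0))))) = \<Phi>"
proof -
  note [simp] = SO_props(1)[OF X(1)] SO_props(1)[OF X(4)] QQ.is_biproductD[OF bp] circ_hom[OF X(1,2)] circ_hom[OF X(1,3)]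
    circ_hom[OF X(2,4)] circ_hom[OF X(3,4)]
  obtain \<phi> where \<Phi>': "\<Phi> = cls (SO X) (SO W) (circ \<phi>)"
    using \<Phi> circ_hom_iff[OF X(1,4)] by (auto elim!: QF.D_homE)
  define \<psi>1 where "\<psi>1 k = (if c_exp X Y1 (rot p k W) = 0 then \<phi> k else 0)" for k
  define \<psi>2 where "\<psi>2 k = (if c_exp X Y1 (rot p k W) \<noteq> 0 \<and> c_exp X Y2 (rot p k W) = 0 then \<phi> k else 0)" for k
  let ?f = "Pls Q (SO X) A (Cmp Q (SO X) (SO Y1) A i (circ (dl 0))) (Cmp Q (SO X) (SO Y2) A j (circ (dl 0)))"
  let ?g = "Pls Q A (SO W) (Cmp Q A (SO Y1) (SO W) (circ \<psi>1) q) (Cmp Q A (SO Y2) (SO W) (circ \<psi>2) r)"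
  have p0: "0 \<in> {0..<int p}" using p_pos by simp
  have "Cmp Q (SO X) A (SO W) ?g ?f = Pls Q (SO X) (SO W)
      (Cmp Q (SO X) (SO Y1) (SO W) (circ \<psi>1) (circ (dl 0))) (Cmp Q (SO X) (SO Y2) (SO W) (circ \<psi>2) (circ (dl 0)))"
    by (rule QQ.biproduct_row_column[OF bp]) simp_all
  also have "\<dots> = circ (\<lambda>m. \<psi>1 m * wgt X Y1 (rot p m W) + \<psi>2 m * wgt X Y2 (rot p m W))"
    unfolding circ_dl_cmp[OF X(1,2,4) p0] circ_dl_cmp[OF X(1,3,4) p0] circ_pls[OF X(1,4)]
    by (rule circ_eqI) (simp add: X)
  finally have e: "Cmp Q (SO X) A (SO W) ?g ?f = \<dots>" .
  have "cls (SO X) (SO W) (Cmp Q (SO X) A (SO W) ?g ?f) = \<Phi>"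
    unfolding e \<Phi>' cls_circ_eq_iff[OF X(1,4)]
  proof (intro ballI impI)
    fix k assume "nonnull X (rot p k W)"
    then show "u dvd \<psi>1 k * wgt X Y1 (rot p k W) + \<psi>2 k * wgt X Y2 (rot p k W) - \<phi> k"
      using c[of k] unfolding \<psi>1_def \<psi>2_def by auto
  qed
  then show ?thesis by (intro bexI[of _ "cls A (SO W) ?g"]) simp_all
qed

text \<open>The factor \<open>e\<close> will be 1 or -1, the sign of a component of the
  deflation.\<close>

lemma circ_scaled_dl_cmp:
  assumes X: "X \<in> Xpi" and Y: "Y \<in> Xpi" and Z: "Z \<in> Xpi"
  shows "Cmp Q (SO X) (SO Y) (SO Z) (circ (\<lambda>k. e * dl 0 k)) (circ \<phi>) = circ (\<lambda>m. e * \<phi> m * wgt X (rot p m Y) (rot p m Z))"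
  unfolding circ_cmp[OF assms]
proof (rule circ_eqI)
  fix m assume m: "m \<in> {0..<int p}"
  have "(\<Sum>k\<in>{0..<int p}. \<phi> k * (e * dl 0 ((m - k) mod int p)) * wgt X (rot p k Y) (rot p m Z)) =
    (\<Sum>k\<in>{0..<int p}. if k = m then e * \<phi> m * wgt X (rot p m Y) (rot p m Z) else 0)"
  proof (rule sum.cong)
    fix k assume k: "k \<in> {0..<int p}"
    have "(m - k) mod int p = 0 \<longleftrightarrow> m = k"
      using m k mod_eq_dvd_iff[of m "int p" k] by (auto simp: mod_eq_0_iff_dvd)
    then show "\<phi> k * (e * dl 0 ((m - k) mod int p)) * wgt X (rot p k Y) (rot p m Z) =
      (if k = m then e * \<phi> m * wgt X (rot p m Y) (rot p m Z) else 0)" unfolding dl_def by auto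
  qed simp
  also have "\<dots> = e * \<phi> m * wgt X (rot p m Y) (rot p m Z)" using m by (subst sum.delta) auto
  finally show "(\<Sum>k\<in>{0..<int p}. \<phi> k * (e * dl 0 ((m - k) mod int p)) * wgt X (rot p k Y) (rot p m Z)) = \<dots>" .
qed

text \<open>As in \<open>left_factor\<close>, but the second component of the deflation carries a
  minus sign, whence - \<phi>(k).\<close>

lemma right_factor:
  assumes X: "W \<in> Xpi" "Y1 \<in> Xpi" "Y2 \<in> Xpi" "Z \<in> Xpi"
    and bp: "is_biproduct Q (SO Y1) (SO Y2) A i j q r"
    and c: "\<And>k. nonnull W (rot p k Z) \<Longrightarrow> c_exp W (rot p k Y1) (rot p k Z) = 0 \<or> c_exp W (rot p k Y2) (rot p k Z) = 0"
    and \<Phi>: "\<Phi> \<in> Hom DS (SO W) (SO Z)"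
  shows "\<exists>G\<in>Hom DS (SO W) A. Cmp DS (SO W) A (SO Z)
    (cls A (SO Z) (Pls Q A (SO Z) (Cmp Q A (SO Y1) (SO Z) (circ (dl 0)) q) (QQ.neg A (SO Z) (Cmp Q A (SO Y2) (SO Z) (circ (dl 0)) r)))) G = \<Phi>"
proof -
  note [simp] = SO_props(1)[OF X(1)] SO_props(1)[OF X(4)] QQ.is_biproductD[OF bp] circ_hom[OF X(1,2)] circ_hom[OF X(1,3)]
    circ_hom[OF X(2,4)] circ_hom[OF X(3,4)]
  obtain \<phi> where \<Phi>': "\<Phi> = cls (SO W) (SO Z) (circ \<phi>)"
    using \<Phi> circ_hom_iff[OF X(1,4)] by (auto elim!: QF.D_homE)
  define \<psi>1 where "\<psi>1 k = (if c_exp W (rot p k Y1) (rot p k Z) = 0 then \<phi> k else 0)" for k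
  define \<psi>2 where "\<psi>2 k = (if c_exp W (rot p k Y1) (rot p k Z) \<noteq> 0 \<and> c_exp W (rot p k Y2) (rot p k Z) = 0 then - \<phi> k else 0)" for k
  let ?h = "Pls Q A (SO Z) (Cmp Q A (SO Y1) (SO Z) (circ (dl 0)) q) (QQ.neg A (SO Z) (Cmp Q A (SO Y2) (SO Z) (circ (dl 0)) r))"
  let ?g = "Pls Q (SO W) A (Cmp Q (SO W) (SO Y1) A i (circ \<psi>1)) (Cmp Q (SO W) (SO Y2) A j (circ \<psi>2))"
  have n: "QQ.neg A (SO Z) (Cmp Q A (SO Y2) (SO Z) (circ (dl 0)) r) = Cmp Q A (SO Y2) (SO Z) (circ (\<lambda>k. (- 1) * dl 0 k)) r"
    using QQ.cmp_negl[of A "SO Y2" "SO Z" r "circ (dl 0)"] circ_neg[OF X(3,4), of "dl 0"] by simp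
  have o: "circ (dl 0) = circ (\<lambda>k. 1 * dl 0 k)" by simp
  have "Cmp Q (SO W) A (SO Z) ?h ?g = Pls Q (SO W) (SO Z)
      (Cmp Q (SO W) (SO Y1) (SO Z) (circ (dl 0)) (circ \<psi>1)) (Cmp Q (SO W) (SO Y2) (SO Z) (circ (\<lambda>k. (- 1) * dl 0 k)) (circ \<psi>2))"
    unfolding n by (rule QQ.biproduct_row_column[OF bp]) simp_all
  also have "\<dots> = circ (\<lambda>m. 1 * \<psi>1 m * wgt W (rot p m Y1) (rot p m Z) + (- 1) * \<psi>2 m * wgt W (rot p m Y2) (rot p m Z))"
    unfolding o circ_scaled_dl_cmp[OF X(1,2,4)] circ_scaled_dl_cmp[OF X(1,3,4)] circ_pls[OF X(1,4)] ..
  finally have e: "Cmp Q (SO W) A (SO Z) ?h ?g = \<dots>" .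
  have "cls (SO W) (SO Z) (Cmp Q (SO W) A (SO Z) ?h ?g) = \<Phi>"
    unfolding e \<Phi>' cls_circ_eq_iff[OF X(1,4)]
  proof (intro ballI impI)
    fix k assume "nonnull W (rot p k Z)"
    then show "u dvd 1 * \<psi>1 k * wgt W (rot p k Y1) (rot p k Z) + (- 1) * \<psi>2 k * wgt W (rot p k Y2) (rot p k Z) - \<phi> k"
      using c[of k] unfolding \<psi>1_def \<psi>2_def by auto
  qed
  then show ?thesis by (intro bexI[of _ "cls (SO W) A ?g"]) simp_all
qed

end

section \<open>Exchange triangles\<close>

context cluster_category
begin

section \<open>The fourth vertex of the quadrilateral\<close>

lemma olifts_back: "(b - 2 * pi, a) \<in> olifts t a b"
  using oliftsI(2)[of b "- int p" t a] p_t by simp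

lemma olifts_front: "(b, a + 2 * pi) \<in> olifts t a b"
  using oliftsI(2)[of b 0 t a] by simp

context
  fixes \<Lambda> a b c v w
  assumes A: "arcs t \<Lambda>" and fd: "arcs.flip_data t \<Lambda> a b c (v, w)"
begin

interpretation A: arcs t \<Lambda> by (rule A)

abbreviation (input) "\<Lambda>' \<equiv> \<Lambda> - arc_orbit t (a, c)"

text \<open>A flipped lift differs by 2 pi in one coordinate from a member, and it can be read back
  as a member in two ways; which one is useful depends on the arc it is compared with.\<close>

lemma lift_arcs:
  assumes V: "(x, y) \<in> \<Lambda>'" and l: "(\<alpha>, \<beta>) \<in> olifts t x y"
  shows "(\<alpha>, \<beta>) \<in> \<Lambda>' \<or> (\<beta> - 2 * pi, \<alpha>) \<in> \<Lambda>' \<and> (\<beta>, \<alpha> + 2 * pi) \<in> \<Lambda>'"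
proof -
  have cl: "Y \<in> \<Lambda>'" if "Y \<in> arc_orbit t (x, y)" for Y
    using that V A.periodic arc_orbit_sym arc_orbit_trans by blast
  from l show ?thesis
  proof (cases rule: oliftsE)
    case (1 n)
    then show ?thesis by (intro disjI1 cl) (auto simp: arc_orbit_def)
  next
    case (2 n)
    have "(\<beta> - 2 * pi, \<alpha>) \<in> arc_orbit t (x, y)" unfolding arc_orbit_def by (rule range_eqI[of _ _ n]) (use 2 in simp)
    moreover have "(\<beta>, \<alpha> + 2 * pi) \<in> arc_orbit t (x, y)"
      unfolding arc_orbit_def by (rule range_eqI[of _ _ "n + int p"]) (use 2 p_t in \<open>simp add: distrib_right\<close>)
    ultimately show ?thesis using cl by blast
  qed
qed

lemma shorter: "(x, y) \<in> \<Lambda> \<Longrightarrow> y - x \<noteq> c - a \<Longrightarrow> (x, y) \<in> \<Lambda>'"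
  using A.shorter_not_orbit[of "(x, y)" a c] by auto

lemma orbit_shift: "(a + t, c + t) \<in> arc_orbit t (a, c)" "(a - t, c - t) \<in> arc_orbit t (a, c)"
  unfolding arc_orbit_def by (rule range_eqI[of _ _ 1], simp) (rule range_eqI[of _ _ "-1"], simp)

text \<open>The vertex is placed to the right of \<open>c\<close>, so that a <= b <= c <= d <= a + 2
  pi. If it lies to the left of \<open>a\<close>, or belongs to a loop, it is moved there by 2 pi,
  which the flip permits. The last conclusion is the one behind left approximations.\<close>

lemma flip_left:
  obtains d x y where "c \<le> d" "d \<le> a + 2 * pi" "d < b + 2 * pi" "(x, y) \<in> \<Lambda>'" "(a, d) \<in> olifts t x y"
    "(b, d) \<in> olifts t v w"
    "\<forall>x y \<alpha> \<beta>. (x, y) \<in> \<Lambda>' \<longrightarrow> (\<alpha>, \<beta>) \<in> olifts t x y \<longrightarrow> hits (a, c) (\<alpha>, \<beta>) \<longrightarrow> b \<le> \<alpha> \<or> d \<le> \<beta>"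
proof -
  note f = A.fdD[OF fd]
  \<comment> \<open>A hit direct lift that starts before \<open>b\<close> starts at
    \<open>a\<close>, as it would otherwise cross (a, b); a hit flipped lift starts at
    \<open>a\<close>, as it would otherwise cross (a, c). So only arcs ending at \<open>a\<close>
    have to be excluded, by \<open>dir\<close> and \<open>flp\<close>.\<close>
  have main: "b \<le> \<alpha> \<or> d \<le> \<beta>"
    if V: "(x, y) \<in> \<Lambda>'" "(\<alpha>, \<beta>) \<in> olifts t x y" "hits (a, c) (\<alpha>, \<beta>)"
      and dir: "(a, \<beta>) \<in> \<Lambda>' \<Longrightarrow> c < \<beta> \<Longrightarrow> \<beta> < d \<Longrightarrow> False"
      and flp: "(\<beta> - 2 * pi, a) \<in> \<Lambda>' \<Longrightarrow> \<beta> < a + 2 * pi \<Longrightarrow> \<beta> < d \<Longrightarrow> False" for x y \<alpha> \<beta> d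
  proof (rule ccontr)
    assume n: "\<not> ?thesis"
    have h: "a \<le> \<alpha>" "\<alpha> < c" "c \<le> \<beta>" "\<beta> < a + 2 * pi" using V(3) unfolding hits_def by auto
    from lift_arcs[OF V(1,2)] show False
    proof
      assume L: "(\<alpha>, \<beta>) \<in> \<Lambda>'"
      then have "\<alpha> = a" using A.nc[OF f(4), of \<alpha> \<beta>] h n f(2) by auto
      moreover have "(\<alpha>, \<beta>) \<noteq> (a, c)" using L arc_orbit_self by blast
      ultimately show False using dir L h n by auto
    next
      assume L: "(\<beta> - 2 * pi, \<alpha>) \<in> \<Lambda>' \<and> (\<beta>, \<alpha> + 2 * pi) \<in> \<Lambda>'"
      then have "\<alpha> = a" using A.nc[OF _ f(3), of "\<beta> - 2 * pi" \<alpha>] h by auto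
      then show False using flp L h n by auto
    qed
  qed
  from fd consider (1) d where "c < a + t" "c < d" "(a, d) \<in> \<Lambda>" "(c, d) \<in> \<Lambda>" "v = b" "w = d"
    | (2) d where "c < a + t" "d < a" "(d, c) \<in> \<Lambda>" "(d, a) \<in> \<Lambda>" "v = d" "w = b"
    | (3) "c = a + t" "v = b" "w = b + t" unfolding A.flip_data_def by blast
  then show thesis
  proof cases
    case 1
    have ad: "d \<le> a + t" using A.stripD[OF 1(3)] by simp
    show thesis
    proof (rule that[of d a d])
      show "(a, d) \<in> \<Lambda>'" using 1 by (intro shorter) auto
      show "\<forall>x y \<alpha> \<beta>. (x, y) \<in> \<Lambda>' \<longrightarrow> (\<alpha>, \<beta>) \<in> olifts t x y \<longrightarrow> hits (a, c) (\<alpha>, \<beta>) \<longrightarrow> b \<le> \<alpha> \<or> d \<le> \<beta>"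
      proof (intro allI impI, rule main)
        fix \<alpha> \<beta>
        show False if "(a, \<beta>) \<in> \<Lambda>'" "c < \<beta>" "\<beta> < d" using A.nc[OF _ 1(4), of a \<beta>] that f(1,2) by auto
        show False if "(\<beta> - 2 * pi, a) \<in> \<Lambda>'" "\<beta> < d" using A.stripD[of "\<beta> - 2 * pi" a] that ad t_lt by auto
      qed
    qed (use 1 f ad t_lt t_pos in \<open>auto simp: olifts_self\<close>)
  next
    case 2
    have dc: "c \<le> d + t" using A.stripD[OF 2(3)] by simp
    show thesis
    \<comment> \<open>The side (d, a) enters through its flip (a, d + 2 pi).\<close>
    proof (rule that[of "d + 2 * pi" d a])
      have "(d, a) \<notin> arc_orbit t (a, c)"
      proof
        assume "(d, a) \<in> arc_orbit t (a, c)"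
        then obtain k :: int where "a = c + of_int k * t" unfolding arc_orbit_def by auto
        then show False using int_mult_gap[OF t_pos, of k] f(1,2) 2(1) t_pos by - (elim disjE; simp)
      qed
      then show "(d, a) \<in> \<Lambda>'" using 2 by blast
      show "\<forall>x y \<alpha> \<beta>. (x, y) \<in> \<Lambda>' \<longrightarrow> (\<alpha>, \<beta>) \<in> olifts t x y \<longrightarrow> hits (a, c) (\<alpha>, \<beta>) \<longrightarrow> b \<le> \<alpha> \<or> d + 2 * pi \<le> \<beta>"
      proof (intro allI impI, rule main)
        fix \<alpha> \<beta>
        show False if "(a, \<beta>) \<in> \<Lambda>'" "c < \<beta>" using A.nc[OF 2(3), of a \<beta>] that f(1,2) 2 by auto
        show False if "(\<beta> - 2 * pi, a) \<in> \<Lambda>'" "\<beta> < d + 2 * pi"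
          using A.nc[OF _ 2(3), of "\<beta> - 2 * pi" a] that f(1,2) 2 by auto
      qed
    qed (use 2 f dc t_lt t_pos olifts_front in auto)
  next
    case 3
    show thesis
    \<comment> \<open>For a loop, the translate (b - t, a) of the side (b, c) enters through its
      flip (a, b - t + 2 pi).\<close>
    proof (rule that[of "b - t + 2 * pi" "b - t" "c - t"])
      show "(b - t, c - t) \<in> \<Lambda>'" using f by (intro shorter A.shift1) auto
      have "c - t = a" using 3 by simp
      then show "(a, b - t + 2 * pi) \<in> olifts t (b - t) (c - t)" using olifts_front[of "c - t" "b - t"] by simp
      show "(b, b - t + 2 * pi) \<in> olifts t v w" using oliftsI(2)[of "b + t" "-1" t b] 3 by (simp add: algebra_simps)
      show "\<forall>x y \<alpha> \<beta>. (x, y) \<in> \<Lambda>' \<longrightarrow> (\<alpha>, \<beta>) \<in> olifts t x y \<longrightarrow> hits (a, c) (\<alpha>, \<beta>) \<longrightarrow> b \<le> \<alpha> \<or> b - t + 2 * pi \<le> \<beta>"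
      proof (intro allI impI, rule main)
        fix \<alpha> \<beta>
        show False if "(a, \<beta>) \<in> \<Lambda>'" "c < \<beta>" using A.stripD[of a \<beta>] that 3 by auto
        show False if L: "(\<beta> - 2 * pi, a) \<in> \<Lambda>'" and b: "\<beta> < b - t + 2 * pi"
        proof -
          have "(\<beta> - 2 * pi, a) \<noteq> (a - t, c - t)" using L orbit_shift(2) by (metis Diff_iff)
          then have "\<beta> - 2 * pi \<noteq> a - t" using 3 by auto
          then show False
            using A.nc[OF A.shift1(2)[OF f(4)], of "\<beta> - 2 * pi" a] A.stripD[of "\<beta> - 2 * pi" a] L b 3 f(2) by auto
        qed
      qed
    qed (use 3 f t_lt t_pos in auto)
  qed
qed

text \<open>The mirror image of \<open>flip_left\<close>: the vertex is placed to the left, with d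
  <= a <= b <= c <= d + 2 pi.\<close>

lemma flip_right:
  obtains d x y where "d \<le> a" "c \<le> d + 2 * pi" "d < b" "b < d + 2 * pi" "(x, y) \<in> \<Lambda>'" "(d, c) \<in> olifts t x y"
    "(d, b) \<in> olifts t v w"
    "\<forall>x y \<alpha> \<beta>. (x, y) \<in> \<Lambda>' \<longrightarrow> (\<alpha>, \<beta>) \<in> olifts t x y \<longrightarrow> hits (\<alpha>, \<beta>) (a, c) \<longrightarrow> \<beta> \<le> b \<or> \<alpha> \<le> d"
proof -
  note f = A.fdD[OF fd]
  have main: "\<beta> \<le> b \<or> \<alpha> \<le> d"
    if V: "(x, y) \<in> \<Lambda>'" "(\<alpha>, \<beta>) \<in> olifts t x y" "hits (\<alpha>, \<beta>) (a, c)"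
      and dir: "(\<alpha>, c) \<in> \<Lambda>' \<Longrightarrow> \<alpha> < a \<Longrightarrow> d < \<alpha> \<Longrightarrow> False"
      and flp: "(c, \<alpha> + 2 * pi) \<in> \<Lambda>' \<Longrightarrow> d < \<alpha> \<Longrightarrow> False" for x y \<alpha> \<beta> d
  proof (rule ccontr)
    assume n: "\<not> ?thesis"
    have h: "\<alpha> \<le> a" "a < \<beta>" "\<beta> \<le> c" "c < \<alpha> + 2 * pi" using V(3) unfolding hits_def by auto
    from lift_arcs[OF V(1,2)] show False
    proof
      assume L: "(\<alpha>, \<beta>) \<in> \<Lambda>'"
      then have "\<beta> = c" using A.nc[OF _ f(5), of \<alpha> \<beta>] h n f(1) by auto
      moreover have "(\<alpha>, \<beta>) \<noteq> (a, c)" using L arc_orbit_self by blast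
      ultimately show False using dir L h n by auto
    next
      assume L: "(\<beta> - 2 * pi, \<alpha>) \<in> \<Lambda>' \<and> (\<beta>, \<alpha> + 2 * pi) \<in> \<Lambda>'"
      then have "\<beta> = c" using A.nc[OF f(5), of \<beta> "\<alpha> + 2 * pi"] h n by auto
      then show False using flp L n by auto
    qed
  qed
  from fd consider (1) d where "c < a + t" "c < d" "(a, d) \<in> \<Lambda>" "(c, d) \<in> \<Lambda>" "v = b" "w = d"
    | (2) d where "c < a + t" "d < a" "(d, c) \<in> \<Lambda>" "(d, a) \<in> \<Lambda>" "v = d" "w = b"
    | (3) "c = a + t" "v = b" "w = b + t" unfolding A.flip_data_def by blast
  then show thesis
  proof cases
    case 1
    have ad: "d \<le> a + t" using A.stripD[OF 1(3)] by simp
    show thesis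
    \<comment> \<open>The side (c, d) enters through its flip (d - 2 pi, c).\<close>
    proof (rule that[of "d - 2 * pi" c d])
      show "(c, d) \<in> \<Lambda>'" using A.adjacent_not_orbit[of c d a] 1 f(1,2) by auto
      show "\<forall>x y \<alpha> \<beta>. (x, y) \<in> \<Lambda>' \<longrightarrow> (\<alpha>, \<beta>) \<in> olifts t x y \<longrightarrow> hits (\<alpha>, \<beta>) (a, c) \<longrightarrow> \<beta> \<le> b \<or> \<alpha> \<le> d - 2 * pi"
      proof (intro allI impI, rule main)
        fix \<alpha> \<beta>
        show False if "(\<alpha>, c) \<in> \<Lambda>'" "\<alpha> < a" using A.nc[OF _ 1(3), of \<alpha> c] that f(1,2) 1 by auto
        show False if "(c, \<alpha> + 2 * pi) \<in> \<Lambda>'" "d - 2 * pi < \<alpha>"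
          using A.nc[OF 1(3), of c "\<alpha> + 2 * pi"] that f(1,2) 1 by auto
      qed
    qed (use 1 f ad t_lt t_pos olifts_back in auto)
  next
    case 2
    have dc: "c \<le> d + t" using A.stripD[OF 2(3)] by simp
    show thesis
    proof (rule that[of d d c])
      show "(d, c) \<in> \<Lambda>'" using 2 by (intro shorter) auto
      show "\<forall>x y \<alpha> \<beta>. (x, y) \<in> \<Lambda>' \<longrightarrow> (\<alpha>, \<beta>) \<in> olifts t x y \<longrightarrow> hits (\<alpha>, \<beta>) (a, c) \<longrightarrow> \<beta> \<le> b \<or> \<alpha> \<le> d"
      proof (intro allI impI, rule main)
        fix \<alpha> \<beta>
        show False if "(\<alpha>, c) \<in> \<Lambda>'" "\<alpha> < a" "d < \<alpha>" using A.nc[OF 2(4), of \<alpha> c] that f(1,2) by auto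
        show False if "(c, \<alpha> + 2 * pi) \<in> \<Lambda>'" "d < \<alpha>" using A.stripD[of c "\<alpha> + 2 * pi"] that dc t_lt by auto
      qed
    qed (use 2 f dc t_lt t_pos in \<open>auto simp: olifts_self\<close>)
  next
    case 3
    show thesis
    \<comment> \<open>For a loop, the translate (c, b + t) of the side (a, b) enters through its
      flip (b + t - 2 pi, c).\<close>
    proof (rule that[of "b + t - 2 * pi" "a + t" "b + t"])
      show "(a + t, b + t) \<in> \<Lambda>'" using f by (intro shorter A.shift1) auto
      show "(b + t - 2 * pi, c) \<in> olifts t (a + t) (b + t)" using olifts_back[of "b + t" "a + t"] 3 by simp
      show "(b + t - 2 * pi, b) \<in> olifts t v w" using olifts_back[of "b + t" b] 3 by simp
      show "\<forall>x y \<alpha> \<beta>. (x, y) \<in> \<Lambda>' \<longrightarrow> (\<alpha>, \<beta>) \<in> olifts t x y \<longrightarrow> hits (\<alpha>, \<beta>) (a, c) \<longrightarrow> \<beta> \<le> b \<or> \<alpha> \<le> b + t - 2 * pi"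
      proof (intro allI impI, rule main)
        fix \<alpha> \<beta>
        show False if "(\<alpha>, c) \<in> \<Lambda>'" "\<alpha> < a" using A.stripD[of \<alpha> c] that 3 by auto
        show False if L: "(c, \<alpha> + 2 * pi) \<in> \<Lambda>'" and b: "b + t - 2 * pi < \<alpha>"
        proof -
          have "(c, \<alpha> + 2 * pi) \<noteq> (a + t, c + t)" using L orbit_shift(1) by (metis Diff_iff)
          then have "\<alpha> + 2 * pi \<noteq> c + t" using 3 by auto
          then show False
            using A.nc[OF _ A.shift1(1)[OF f(5)], of c "\<alpha> + 2 * pi"] A.stripD[of c "\<alpha> + 2 * pi"] L b 3 f(1) by auto
        qed
      qed
    qed (use 3 f t_lt t_pos in auto)
  qed
qed

end

section \<open>Factorisations of basic morphisms through the sides\<close>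

lemma hits_elift: "hits (elift j x y) (elift j a c) \<longleftrightarrow> hits (x, y) (a, c)"
  unfolding hits_def elift_def by (auto simp: algebra_simps)

lemma elift_mono:
  "x \<le> a \<Longrightarrow> y \<le> c \<Longrightarrow> fst (elift j x y) \<le> fst (elift j a c) \<and> snd (elift j x y) \<le> snd (elift j a c)"
  unfolding elift_def by simp

text \<open>A hit lift with b <= \<alpha> lies above (b, c), and one with d <= \<beta> lies above
  (a, d). Either way the three points are comparable, and no power of \<open>u\<close> is
  lost.\<close>

lemma left_c_exp_zero:
  assumes o: "a \<le> b" "b \<le> c" "c \<le> d" "d \<le> a + 2 * pi" and xy: "x \<le> y" "y \<le> x + 2 * pi"
    and n: "nonnull (E_obj a c) (rot p k (E_obj x y))"
    and l: "\<And>\<alpha> \<beta>. \<lbrakk>(\<alpha>, \<beta>) \<in> olifts t x y; hits (a, c) (\<alpha>, \<beta>)\<rbrakk> \<Longrightarrow> b \<le> \<alpha> \<or> d \<le> \<beta>"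
  shows "c_exp (E_obj a c) (E_obj b c) (rot p k (E_obj x y)) = 0 \<or> c_exp (E_obj a c) (E_obj a d) (rot p k (E_obj x y)) = 0"
proof -
  obtain j where j: "hits (a, c) (elift j (x + of_int k * t) (y + of_int k * t))"
    using n nonnull_rot_iff[of a c x y k] o xy by auto
  obtain \<alpha> \<beta> where ab: "elift j (x + of_int k * t) (y + of_int k * t) = (\<alpha>, \<beta>)" by fastforce
  have h: "a \<le> \<alpha>" "\<alpha> < c" "c \<le> \<beta>" using j unfolding ab hits_def by auto
  have "b \<le> \<alpha> \<or> d \<le> \<beta>" using l elift_olift[of j x k y] j unfolding ab by blast
  then show ?thesis
  proof
    assume "b \<le> \<alpha>"
    then have "c_exp (E_obj a c) (E_obj b c) (E_obj (x + of_int k * t) (y + of_int k * t)) = 0"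
      by (intro c_exp_E_eq_0I[where i = 0 and k = j]) (use o xy h in \<open>auto simp: ab\<close>)
    then show ?thesis unfolding rot_E_obj by simp
  next
    assume "d \<le> \<beta>"
    then have "c_exp (E_obj a c) (E_obj a d) (E_obj (x + of_int k * t) (y + of_int k * t)) = 0"
      by (intro c_exp_E_eq_0I[where i = 0 and k = j]) (use o xy h in \<open>auto simp: ab\<close>)
    then show ?thesis unfolding rot_E_obj by simp
  qed
qed

text \<open>The rotation by \<open>k\<close> is moved from the target to (x, y), and the lift of (a,
  c) is undone by \<open>elift (- j)\<close>; then the hypothesis \<open>l\<close> on lifts of (x,
  y) applies.\<close>

lemma right_c_exp_zero:
  assumes o: "d \<le> a" "a \<le> b" "b \<le> c" "c \<le> d + 2 * pi" and xy: "x \<le> y" "y \<le> x + 2 * pi"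
    and n: "nonnull (E_obj x y) (rot p k (E_obj a c))"
    and l: "\<And>\<alpha> \<beta>. \<lbrakk>(\<alpha>, \<beta>) \<in> olifts t x y; hits (\<alpha>, \<beta>) (a, c)\<rbrakk> \<Longrightarrow> \<beta> \<le> b \<or> \<alpha> \<le> d"
  shows "c_exp (E_obj x y) (rot p k (E_obj a b)) (rot p k (E_obj a c)) = 0 \<or>
    c_exp (E_obj x y) (rot p k (E_obj d c)) (rot p k (E_obj a c)) = 0"
proof -
  define x' y' where "x' = x + of_int (- k) * t" and "y' = y + of_int (- k) * t"
  have xy': "x' \<le> y'" "y' \<le> x' + 2 * pi" using xy unfolding x'_def y'_def by auto
  have r: "E_obj x y = rot p k (E_obj x' y')" unfolding rot_E_obj x'_def y'_def by simp
  have X: "E_obj x' y' \<in> Xpi" "E_obj a c \<in> Xpi" "E_obj a b \<in> Xpi" "E_obj d c \<in> Xpi" using xy' o by simp_all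
  have "nonnull (E_obj x' y') (E_obj a c)" using n unfolding r using X by simp
  then obtain j where j: "hits (x', y') (elift j a c)"
    using nonnull_E_iff[of x' y' a c] xy' o unfolding hits_def by auto
  obtain \<alpha> \<beta> where ab: "elift (- j) x' y' = (\<alpha>, \<beta>)" by fastforce
  have e: "elift j \<alpha> \<beta> = (x', y')" using elift_elift[of j "- j" x' y'] ab by simp
  have hh: "hits (\<alpha>, \<beta>) (a, c)" using j hits_elift[of j \<alpha> \<beta> a c] unfolding e by simp
  then have h: "\<alpha> \<le> a" "a < \<beta>" "\<beta> \<le> c" unfolding hits_def by auto
  have f: "fst (elift j a c) < y'" using j unfolding hits_def by simp
  have "\<beta> \<le> b \<or> \<alpha> \<le> d" using l hh elift_olift[of "- j" x "- k" y] ab unfolding x'_def y'_def by metis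
  then have "c_exp (E_obj x' y') (E_obj a b) (E_obj a c) = 0 \<or> c_exp (E_obj x' y') (E_obj d c) (E_obj a c) = 0"
  proof
    assume "\<beta> \<le> b"
    then have "c_exp (E_obj x' y') (E_obj a b) (E_obj a c) = 0"
      by (intro c_exp_E_eq_0I[where i = j and k = j])
        (use o xy' h f e elift_mono[of \<alpha> a \<beta> b j] elift_mono[of a a b c j] in auto)
    then show ?thesis ..
  next
    assume "\<alpha> \<le> d"
    then have "c_exp (E_obj x' y') (E_obj d c) (E_obj a c) = 0"
      by (intro c_exp_E_eq_0I[where i = j and k = j])
        (use o xy' h f e elift_mono[of \<alpha> d \<beta> c j] elift_mono[of d a c c j] in auto)
    then show ?thesis ..
  qed
  then show ?thesis unfolding r using X by simp
qed

text \<open>The two triangles use different squares on one quadrilateral, with the fourth vertex on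
  either side of the diagonal: (a, c) is the minimum of the first square and the maximum of the
  second.\<close>

lemma exchange_triangles:
  assumes L: "cluster p u E L" and T: "T \<in> L"
  obtains T0 where "exchanges p u E L T T0" "\<And>T'. exchanges p u E L T T' \<Longrightarrow> iso_obj DD T' T0"
    "\<And>T'. exchanges p u E L T T' \<Longrightarrow> \<exists>A f g h. left_approximation DD (L - {T}) T A f \<and>
        distinguished Q EQ T A T' (shift_seq Q EQ T) f g h"
    "\<And>T'. exchanges p u E L T T' \<Longrightarrow> \<exists>B f g h V P i d. unshift_seq Q EQ T = (V, P, i, d) \<and>
        right_approximation DD (L - {T}) T B h \<and> distinguished Q EQ V T' B (P, T, i, d) f g h"
proof -
  interpret A: arcs t "arcs_of L" by (rule cluster_arcs[OF L])
  have ar: "almost_rigid p u E X" if "X \<in> L" for X using L that unfolding cluster_def compatible_set_def by blast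
  obtain a c where acL: "(a, c) \<in> arcs_of L" and s: "(a, c) \<in> arc_strip t" and TX: "iso_obj DD T (SEp a c)"
    by (rule almost_rigid_arc[OF ar[OF T] T])
  obtain b S where "A.flip_data a b c S" by (rule A.flip_data_ex[OF acL])
  moreover obtain v w where "S = (v, w)" by (cases S)
  ultimately have fd: "A.flip_data a b c (v, w)" by simp
  note f = A.fdD[OF fd]
  have sv: "(v, w) \<in> arc_strip t" by (rule A.flip_strip[OF fd])
  then have vw: "v \<le> w" "w \<le> v + 2 * pi" using strip_bounds[of v w] unfolding arc_strip_def by auto
  have rem: "arcs_of (L - {T}) = arcs_of L - arc_orbit t (a, c)" by (rule arcs_of_remove[OF L T s TX])
  have obT: "T \<in> Obj Q" using TX unfolding iso_obj_def DD_eq by simp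
  have side: "(a, b) \<in> arcs_of (L - {T})" "(b, c) \<in> arcs_of (L - {T})"
    unfolding rem using f A.side_not_orbit[OF fd] by auto
  have lift: "\<exists>V\<in>L - {T}. iso_obj DS (SO (E_obj x' y')) V" if xy: "(x, y) \<in> arcs_of (L - {T})" "(x', y') \<in> olifts t x y" for x y x' y'
  proof -
    obtain V where V: "V \<in> L - {T}" "iso_obj DD V (SEp x y)" and s: "(x, y) \<in> arc_strip t" using arcs_ofD[OF xy(1)] by blast
    have "iso_obj DD (SEp x' y') (SEp x y)"
      by (rule SE_iso) (use s strip_bounds[of x y] xy(2) in \<open>auto simp: arc_strip_def\<close>)
    then show ?thesis using V DD_sym DD_trans unfolding DD_eq SE_def by blast
  qed
  have arc: "\<exists>x y. x \<le> y \<and> y \<le> x + 2 * pi \<and> (x, y) \<in> arcs_of L - arc_orbit t (a, c) \<and> iso_obj DS (SO (E_obj x y)) V" if V: "V \<in> L - {T}" for V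
  proof -
    have "almost_rigid p u E V" using ar V by blast
    then obtain x y where xy: "(x, y) \<in> arcs_of (L - {T})" "(x, y) \<in> arc_strip t" "iso_obj DD V (SEp x y)"
      by (rule almost_rigid_arc[OF _ V])
    then show ?thesis using DD_sym[OF xy(3)] strip_bounds[of x y] unfolding rem DD_eq SE_def arc_strip_def by blast
  qed
  have TX': "iso_obj DS T (SO (E_obj a c))" using TX unfolding DD_eq SE_def .
  obtain \<alpha> where \<alpha>: "\<alpha> \<in> Hom Q T (SO (E_obj a c))" "iso_mor DS T (SO (E_obj a c)) (cls T (SO (E_obj a c)) \<alpha>)"
    by (rule QF.D_iso_rep[OF TX'])
  have ac: "a \<le> c" "c \<le> a + 2 * pi" "c < a + 2 * pi" using f t_lt t_pos by auto
  show thesis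
  proof (rule that[of "SEp v w"])
    show "exchanges p u E L T (SEp v w)" by (rule exchange_ex[OF L T s TX fd])
    fix T' assume ex: "exchanges p u E L T T'"
    show T': "iso_obj DD T' (SEp v w)" by (rule exchange_unique[OF L T s TX fd ex])
    show "\<exists>A f g h. left_approximation DD (L - {T}) T A f \<and> distinguished Q EQ T A T' (shift_seq Q EQ T) f g h"
    proof -
      obtain d x0 y0 where d: "c \<le> d" "d \<le> a + 2 * pi" "d < b + 2 * pi" "(x0, y0) \<in> arcs_of L - arc_orbit t (a, c)"
        "(a, d) \<in> olifts t x0 y0" "(b, d) \<in> olifts t v w"
        and l: "\<forall>x y \<alpha> \<beta>. (x, y) \<in> arcs_of L - arc_orbit t (a, c) \<longrightarrow> (\<alpha>, \<beta>) \<in> olifts t x y \<longrightarrow> hits (a, c) (\<alpha>, \<beta>) \<longrightarrow> b \<le> \<alpha> \<or> d \<le> \<beta>"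
        by (rule flip_left[OF A.arcs_axioms fd])
      have X: "E_obj a c \<in> Xpi" "E_obj b c \<in> Xpi" "E_obj a d \<in> Xpi" "E_obj b d \<in> Xpi" using f d ac by auto
      have "exact_square (E_obj a c) (E_obj b c) (E_obj a d) (E_obj b d)" by (rule exact_square_E) (use f d ac in auto)
      then obtain A i j q r where bp: "is_biproduct Q (SO (E_obj b c)) (SO (E_obj a d)) A i j q r"
        and cf: "(SO (E_obj a c), A, SO (E_obj b d),
          Pls Q (SO (E_obj a c)) A (Cmp Q (SO (E_obj a c)) (SO (E_obj b c)) A i (circ (dl 0))) (Cmp Q (SO (E_obj a c)) (SO (E_obj a d)) A j (circ (dl 0))),
          Pls Q A (SO (E_obj b d)) (Cmp Q A (SO (E_obj b c)) (SO (E_obj b d)) (circ (dl 0)) q)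
            (QQ.neg A (SO (E_obj b d)) (Cmp Q A (SO (E_obj a d)) (SO (E_obj b d)) (circ (dl 0)) r))) \<in> EQ"
        by (rule S_conflation)
      let ?X = "SO (E_obj a c)"
      let ?f = "Pls Q ?X A (Cmp Q ?X (SO (E_obj b c)) A i (circ (dl 0))) (Cmp Q ?X (SO (E_obj a d)) A j (circ (dl 0)))"
      note [simp] = QQ.is_biproductD[OF bp] SO_props(1)[OF X(1)] \<alpha>(1) obT circ_hom[OF X(1,2)] circ_hom[OF X(1,3)]
      have "iso_obj DD (SEp b d) (SEp v w)" by (rule SE_iso) (use vw d in auto)
      then have "iso_obj DS T' (SO (E_obj b d))" using T' DD_sym DD_trans unfolding DD_eq SE_def by blast
      from QF.triangle_of_conflation[OF cf \<alpha> obT this]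
      obtain G H where tr: "distinguished Q EQ T A T' (shift_seq Q EQ T) (cls T A (Cmp Q T ?X A ?f \<alpha>)) G H" by blast
      obtain V1 V2 where V: "V1 \<in> L - {T}" "iso_obj DS (SO (E_obj b c)) V1" "V2 \<in> L - {T}" "iso_obj DS (SO (E_obj a d)) V2"
        using lift[OF side(2) olifts_self] lift[of x0 y0 a d] d(4,5) unfolding rem by blast
      have "biproduct DS (SO (E_obj b c)) (SO (E_obj a d)) A" using QF.is_biproduct_D[OF bp] unfolding biproduct_iff by blast
      then have cl: "A \<in> add_closure DS (L - {T})" by (rule QF.D.biproduct_add_closure[OF _ V(2,4,1,3)])
      have e: "cls T A (Cmp Q T ?X A ?f \<alpha>) = Cmp DS T ?X A (cls ?X A ?f) (cls T ?X \<alpha>)"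
        by (rule QF.D_cmp[symmetric]) simp_all
      have "left_approximation DS (L - {T}) T A (cls T A (Cmp Q T ?X A ?f \<alpha>))"
      proof (rule QF.D.left_approximationI[OF cl])
        fix V F assume V: "V \<in> L - {T}" and F: "F \<in> Hom DS T V"
        obtain x y where xy: "x \<le> y" "y \<le> x + 2 * pi" "(x, y) \<in> arcs_of L - arc_orbit t (a, c)" "iso_obj DS (SO (E_obj x y)) V"
          using arc[OF V] by blast
        show "\<exists>g\<in>Hom DS A V. Cmp DS T A V g (cls T A (Cmp Q T ?X A ?f \<alpha>)) = F"
          unfolding e
        proof (rule QF.D.left_factor_iso[OF \<alpha>(2) _ _ _ _ xy(4) _ F])
          fix F' assume F': "F' \<in> Hom DS ?X (SO (E_obj x y))"
          show "\<exists>g\<in>Hom DS A (SO (E_obj x y)). Cmp DS ?X A (SO (E_obj x y)) g (cls ?X A ?f) = F'"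
          proof (rule left_factor[OF X(1,2,3) _ bp _ F'])
            show "E_obj x y \<in> Xpi" using xy by simp
            show "c_exp (E_obj a c) (E_obj b c) (rot p k (E_obj x y)) = 0 \<or> c_exp (E_obj a c) (E_obj a d) (rot p k (E_obj x y)) = 0"
              if "nonnull (E_obj a c) (rot p k (E_obj x y))" for k
              by (rule left_c_exp_zero[OF _ _ d(1,2) xy(1,2) that l[rule_format, OF xy(3)]]) (use f in auto)
          qed
        qed simp_all
      qed simp_all
      then show ?thesis unfolding DD_eq using tr by blast
    qed
    show "\<exists>B f g h V P i d. unshift_seq Q EQ T = (V, P, i, d) \<and>
        right_approximation DD (L - {T}) T B h \<and> distinguished Q EQ V T' B (P, T, i, d) f g h"
    proof -
      obtain d x0 y0 where d: "d \<le> a" "c \<le> d + 2 * pi" "d < b" "b < d + 2 * pi" "(x0, y0) \<in> arcs_of L - arc_orbit t (a, c)"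
        "(d, c) \<in> olifts t x0 y0" "(d, b) \<in> olifts t v w"
        and l: "\<forall>x y \<alpha> \<beta>. (x, y) \<in> arcs_of L - arc_orbit t (a, c) \<longrightarrow> (\<alpha>, \<beta>) \<in> olifts t x y \<longrightarrow> hits (\<alpha>, \<beta>) (a, c) \<longrightarrow> \<beta> \<le> b \<or> \<alpha> \<le> d"
        by (rule flip_right[OF A.arcs_axioms fd])
      have X: "E_obj d b \<in> Xpi" "E_obj a b \<in> Xpi" "E_obj d c \<in> Xpi" "E_obj a c \<in> Xpi" using f d ac by auto
      have "exact_square (E_obj d b) (E_obj a b) (E_obj d c) (E_obj a c)" by (rule exact_square_E) (use f d ac in auto)
      then obtain B i j q r where bp: "is_biproduct Q (SO (E_obj a b)) (SO (E_obj d c)) B i j q r"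
        and cf: "(SO (E_obj d b), B, SO (E_obj a c),
          Pls Q (SO (E_obj d b)) B (Cmp Q (SO (E_obj d b)) (SO (E_obj a b)) B i (circ (dl 0))) (Cmp Q (SO (E_obj d b)) (SO (E_obj d c)) B j (circ (dl 0))),
          Pls Q B (SO (E_obj a c)) (Cmp Q B (SO (E_obj a b)) (SO (E_obj a c)) (circ (dl 0)) q)
            (QQ.neg B (SO (E_obj a c)) (Cmp Q B (SO (E_obj d c)) (SO (E_obj a c)) (circ (dl 0)) r))) \<in> EQ"
        by (rule S_conflation)
      let ?X = "SO (E_obj a c)"
      let ?h = "Pls Q B ?X (Cmp Q B (SO (E_obj a b)) ?X (circ (dl 0)) q) (QQ.neg B ?X (Cmp Q B (SO (E_obj d c)) ?X (circ (dl 0)) r))"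
      note [simp] = QQ.is_biproductD[OF bp] SO_props(1)[OF X(4)] \<alpha>(1) obT circ_hom[OF X(2,4)] circ_hom[OF X(3,4)]
      \<comment> \<open>\<alpha> is invertible only stably. With \<beta> representing its inverse,
        \<open>?H\<close> is chosen so that following it by \<alpha> gives the class of
        \<open>?h\<close>.\<close>
      obtain \<beta> where \<beta> [simp]: "\<beta> \<in> Hom Q ?X T"
        and "Cmp DS T ?X T (cls ?X T \<beta>) (cls T ?X \<alpha>) = cls T T (Idn Q T)"
        and \<beta>_inv: "Cmp DS ?X T ?X (cls T ?X \<alpha>) (cls ?X T \<beta>) = cls ?X ?X (Idn Q ?X)"
        by (rule QF.D_iso_inv[OF \<alpha>(2) obT SO_props(1)[OF X(4)]])
      let ?H = "cls B T (Cmp Q B ?X T \<beta> ?h)"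
      have hh: "?h \<in> Hom Q B ?X" by simp
      have H: "?H \<in> Hom DS B T" using hh by simp
      have "Cmp DS B T ?X (cls T ?X \<alpha>) ?H = cls B ?X (Cmp Q B T ?X \<alpha> (Cmp Q B ?X T \<beta> ?h))"
        by (rule QF.D_cmp) (use hh in simp_all)
      also have "\<dots> = cls B ?X (Cmp Q B ?X ?X (Cmp Q ?X T ?X \<alpha> \<beta>) ?h)"
        using QQ.cmp_assoc[of B ?X T ?X ?h \<beta> \<alpha>] hh by simp
      also have "\<dots> = Cmp DS B ?X ?X (cls ?X ?X (Cmp Q ?X T ?X \<alpha> \<beta>)) (cls B ?X ?h)"
        by (rule QF.D_cmp[symmetric]) (use hh in simp_all)
      also have "cls ?X ?X (Cmp Q ?X T ?X \<alpha> \<beta>) = cls ?X ?X (Idn Q ?X)"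
        using \<beta>_inv by (subst (asm) QF.D_cmp) simp_all
      also have "Cmp DS B ?X ?X (cls ?X ?X (Idn Q ?X)) (cls B ?X ?h) = cls B ?X ?h"
        by (subst QF.D_cmp) (use hh in simp_all)
      finally have Hh: "Cmp DS B T ?X (cls T ?X \<alpha>) ?H = cls B ?X ?h" .
      have "iso_obj DD (SEp d b) (SEp v w)" by (rule SE_iso) (use vw d in auto)
      then have "iso_obj DS T' (SO (E_obj d b))" using T' DD_sym DD_trans unfolding DD_eq SE_def by blast
      from QF.triangle_of_conflation_unshift[OF cf \<alpha> obT this H Hh]
      obtain F G V P i' d' where tr: "unshift_seq Q EQ T = (V, P, i', d')" "distinguished Q EQ V T' B (P, T, i', d') F G ?H" by blast
      obtain V1 V2 where V: "V1 \<in> L - {T}" "iso_obj DS (SO (E_obj a b)) V1" "V2 \<in> L - {T}" "iso_obj DS (SO (E_obj d c)) V2"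
        using lift[OF side(1) olifts_self] lift[of x0 y0 d c] d(5,6) unfolding rem by blast
      have "biproduct DS (SO (E_obj a b)) (SO (E_obj d c)) B" using QF.is_biproduct_D[OF bp] unfolding biproduct_iff by blast
      then have cl: "B \<in> add_closure DS (L - {T})" by (rule QF.D.biproduct_add_closure[OF _ V(2,4,1,3)])
      have "right_approximation DS (L - {T}) T B ?H"
      proof (rule QF.D.right_approximationI[OF cl _ _ H])
        fix V F assume V: "V \<in> L - {T}" and F: "F \<in> Hom DS V T"
        obtain x y where xy: "x \<le> y" "y \<le> x + 2 * pi" "(x, y) \<in> arcs_of L - arc_orbit t (a, c)" "iso_obj DS (SO (E_obj x y)) V"
          using arc[OF V] by blast
        show "\<exists>g\<in>Hom DS V B. Cmp DS V B T ?H g = F"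
        proof (rule QF.D.right_factor_iso[OF \<alpha>(2) _ _ _ _ H Hh xy(4) _ F])
          fix F' assume F': "F' \<in> Hom DS (SO (E_obj x y)) ?X"
          show "\<exists>g\<in>Hom DS (SO (E_obj x y)) B. Cmp DS (SO (E_obj x y)) B ?X (cls B ?X ?h) g = F'"
          proof (rule right_factor[OF _ X(2,3,4) bp _ F'])
            show "E_obj x y \<in> Xpi" using xy by simp
            show "c_exp (E_obj x y) (rot p k (E_obj a b)) (rot p k (E_obj a c)) = 0 \<or>
                c_exp (E_obj x y) (rot p k (E_obj d c)) (rot p k (E_obj a c)) = 0"
              if "nonnull (E_obj x y) (rot p k (E_obj a c))" for k
              by (rule right_c_exp_zero[OF d(1) _ _ d(2) xy(1,2) that l[rule_format, OF xy(3)]]) (use f in auto)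
          qed
        qed (use hh in simp_all)
      qed simp_all
      then show ?thesis unfolding DD_eq using tr by blast
    qed
  qed
qed

end

text \<open>A nonunit has an irreducible divisor, which generates a maximal ideal of the principal
  domain; that ideal is (u), as there is only one.\<close>

lemma ground_of_uniformizer:
  fixes u :: "'r::idom"
  assumes dvr: "discrete_valuation_ring (class_ring :: 'r ring)" and un: "uniformizer class_ring u"
  shows "ground u"
proof -
  let ?R = "class_ring :: 'r ring"
  interpret principal_domain ?R using dvr unfolding discrete_valuation_ring_def by blast
  have cr: "cring ?R" using dvr unfolding discrete_valuation_ring_def principal_domain_def domain_def by blast
  have id: "PIdl\<^bsub>?R\<^esub> a = {x. a dvd x}" for a :: 'r
    by (auto simp: cgenideal_def dvd_def mult.commute)
  have mu: "maximalideal (PIdl\<^bsub>?R\<^esub> u) ?R" using un unfolding uniformizer_def by simp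
  show ?thesis
  proof
    show "u \<noteq> 0"
    proof
      assume "u = 0"
      then have "PIdl\<^bsub>?R\<^esub> u = {\<zero>\<^bsub>?R\<^esub>}" unfolding id by auto
      then show False using mu cring.zeromaximalideal_fieldI[OF cr] dvr unfolding discrete_valuation_ring_def by metis
    qed
    show "\<not> u dvd 1"
    proof
      assume "u dvd 1"
      then have "PIdl\<^bsub>?R\<^esub> u = carrier ?R" unfolding id by (auto intro: dvd_trans)
      then show False using maximalideal.I_notcarr[OF mu] by simp
    qed
    fix x assume x: "\<not> u dvd x"
    show "x dvd 1"
    proof (rule ccontr)
      assume "\<not> x dvd 1"
      then have nU: "x \<notin> Units ?R" by (auto simp: Units_def) (metis dvd_triv_left)
      have x0: "x \<in> carrier ?R - {\<zero>\<^bsub>?R\<^esub>}" using x by auto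
      obtain b where b: "b \<in> carrier ?R" "ring_irreducible\<^bsub>?R\<^esub> b" "b divides\<^bsub>?R\<^esub> x"
        by (rule exists_irreducible_divisor[OF x0 nU])
      have "maximalideal (PIdl\<^bsub>?R\<^esub> b) ?R" by (rule irreducible_imp_maximalideal[OF b(1,2)])
      then have "PIdl\<^bsub>?R\<^esub> b = PIdl\<^bsub>?R\<^esub> u" using mu dvr unfolding discrete_valuation_ring_def by blast
      moreover have "x \<in> PIdl\<^bsub>?R\<^esub> b" using b(3) unfolding id factor_def by auto
      ultimately show False using x unfolding id by blast
    qed
  qed
qed

text \<open>Translates the condition on the residue characteristic into divisibility by
  \<open>u\<close>.\<close>

lemma (in ground) residue_of_nat: "[n] \<cdot>\<^bsub>residue_field u\<^esub> \<one>\<^bsub>residue_field u\<^esub> = coset (of_nat n)"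
proof -
  have "rec_nat \<zero>\<^bsub>residue_field u\<^esub> (\<lambda>_ b. b \<oplus>\<^bsub>residue_field u\<^esub> \<one>\<^bsub>residue_field u\<^esub>) n = coset (of_nat n)"
    by (induction n) (simp_all add: coset_hom add.commute)
  then show ?thesis by (simp add: add_pow_def nat_pow_def)
qed

theorem theorem3p5p5:
  fixes p :: nat and u :: "'r::idom"
    and E :: "(pt set list, 'r mat) conflation set"
    and L :: "'r eqobj set" and T :: "'r eqobj"
  assumes "Factorial_Ring.prime p" and "odd p"
    and "discrete_valuation_ring (class_ring :: 'r ring)"
    and "uniformizer class_ring u"
    and "[p] \<cdot>\<^bsub>residue_field u\<^esub> \<one>\<^bsub>residue_field u\<^esub> \<noteq> \<zero>\<^bsub>residue_field u\<^esub>"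
    and "card {z \<in> carrier (residue_field u). z [^]\<^bsub>residue_field u\<^esub> p = \<one>\<^bsub>residue_field u\<^esub>} = p"
    and "F_pi_exact_structure u E"
    and "cluster p u E L" and "T \<in> L"
  shows "(\<exists>T'. exchanges p u E L T T' \<and>
            (\<forall>T''. exchanges p u E L T T'' \<longrightarrow> iso_obj (C_pi_eq p u E) T'' T')) \<and>
         (\<forall>T'. exchanges p u E L T T' \<longrightarrow>
            (\<exists>A f g h. left_approximation (C_pi_eq p u E) (L - {T}) T A f \<and>
               distinguished (F_pi_eq p u) (eq_exact p u E) T A T'
                 (shift_seq (F_pi_eq p u) (eq_exact p u E) T) f g h) \<and>
            (\<exists>B f g h V P i d. unshift_seq (F_pi_eq p u) (eq_exact p u E) T = (V, P, i, d) \<and>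
               right_approximation (C_pi_eq p u E) (L - {T}) T B h \<and>
               distinguished (F_pi_eq p u) (eq_exact p u E) V T' B (P, T, i, d) f g h))"
proof -
  interpret ground u by (rule ground_of_uniformizer[OF assms(3,4)])
  \<comment> \<open>\<open>p\<close> is nonzero in the residue field, hence a unit of the local
    ring.\<close>
  have "coset (of_nat p) \<noteq> coset 0" using assms(5) residue_of_nat[of p] coset_hom(4) by metis
  then have "\<not> u dvd of_nat p" unfolding coset_eq_iff by simp
  then have "\<exists>v. of_nat p * v = (1 :: 'r)" using u_local[of "of_nat p"] unfolding dvd_def by metis
  moreover have "p \<ge> 3" using prime_ge_2_nat[OF assms(1)] assms(2) by (cases "p = 2") auto
  ultimately interpret cluster_category u E p
    by unfold_locales (use assms(2,7) in auto)
  show ?thesis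
  proof (rule exchange_triangles[OF assms(8,9)])
    fix T0 assume 1: "exchanges p u E L T T0" "\<And>T'. exchanges p u E L T T' \<Longrightarrow> iso_obj DD T' T0"
      and 2: "\<And>T'. exchanges p u E L T T' \<Longrightarrow> \<exists>A f g h. left_approximation DD (L - {T}) T A f \<and>
          distinguished Q EQ T A T' (shift_seq Q EQ T) f g h"
        "\<And>T'. exchanges p u E L T T' \<Longrightarrow> \<exists>B f g h V P i d. unshift_seq Q EQ T = (V, P, i, d) \<and>
          right_approximation DD (L - {T}) T B h \<and> distinguished Q EQ V T' B (P, T, i, d) f g h"
    show ?thesis
    proof (intro conjI allI impI)
      show "\<exists>T'. exchanges p u E L T T' \<and> (\<forall>T''. exchanges p u E L T T'' \<longrightarrow> iso_obj DD T'' T')"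
        using 1 by (intro exI[of _ T0] conjI allI impI)
    qed (fact 2)+
  qed
qed

end
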